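(* Let $A$ be a finite abelian group and let $n\geqslant 2$. Let $\mathcal M_n(A)$ consist of $\mathrm{Std}_n$ and one representation $V_\kappa$ from each duality orbit of non-trivial multiplicity vectors. Then $\mathcal M_n(A)$ is gap-determining and minimal. Moreover, every gap-determining family contains $\mathrm{Std}_n$ and at least one of $V_\kappa$ and $V_{\kappa^*}$ for each non-trivial multiplicity vector $\kappa$.
   Context: $W_n(A)=A\wr\mathfrak S_n=A^n\rtimes\mathfrak S_n$ with multiplication $(g;\pi)(h;\sigma)=(g(\pi\cdot h);\pi\sigma)$, $\pi\cdot g=(g_{\pi^{-1}(1)},\dots,g_{\pi^{-1}(n)})$; $A^n$ and $\mathfrak S_n$ are regarded as subgroups. All representations are finite-dimensional, complex and unitary; $\mathrm{Irr}(H)$ is the set of isomorphism classes of irreducible representations of $H$. $\widehat A$ is the character group of $A$. For a finite group $H$ and $w=\sum_h\mathsf c_h h\in\mathbb R[H]$ with $\mathsf c_h=\mathsf c_{h^{-1}}\geqslant 0$, put $\Delta_H(w)=\sum_h\mathsf c_h(1_H-h)$. For a representation $V$ of $H$, $\psi_H(w,V)$ is the smallest eigenvalue of $\Delta_H(w)$ on $(V^H)^\perp$, with $V^H$ the fixed subspace, and $\psi_H(w,V)=+\infty$ if $V=V^H$. Put $\psi_H(w)=\psi_H(w,\mathrm{Reg}_H)$, with $\mathrm{Reg}_H$ the regular representation. An admissible element is $w=\sum_{1\leqslant i<j\leqslant n}\mathsf a_{ij}(ij)+\sum_{x\in A^n}\mathsf c_x x\in\mathbb R[W_n(A)]$ with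 $\mathsf a_{ij}\geqslant 0$ and $\mathsf c_x=\mathsf c_{x^{-1}}\geqslant 0$. A collection $\mathcal E\subseteq\mathrm{Irr}(W_n(A))\setminus\{\mathrm{triv}\}$ is gap-determining if $\psi_{W_n(A)}(w)=\min_{V\in\mathcal E}\psi_{W_n(A)}(w,V)$ for every admissible $w$. It is minimal if no proper subcollection has this property. $\mathrm{Std}_n$ is the irreducible $\mathfrak S_n$-representation of shape $(n-1,1)$, lifted to $W_n(A)$ via the quotient map to $\mathfrak S_n$. A multiplicity vector is a family $\kappa=(\kappa_\chi)_{\chi\in\widehat A}$ of non-negative integers with $\sum_\chi\kappa_\chi=n$; it is non-trivial if $V_\kappa$ is non-trivial, i.e. $\kappa_{\mathrm{triv}}\neq n$. Put $(\kappa^* )_\chi=\kappa_{\chi^{-1}}$; the duality orbit of $\kappa$ is $\{\kappa,\kappa^*\}$. $V_\kappa=\mathrm{Ind}_{\prod_\chi(A\wr\mathfrak S_{\kappa_\chi})}^{A\wr\mathfrak S_n}(\boxtimes_\chi\chi^{\otimes\kappa_\chi})$, where on $\chi^{\otimes m}$ the group $A^m$ acts by $(g_1,\dots,g_m)\mapsto\prod_i\chi(g_i)$ and $\mathfrak S_m$ acts trivially; this is an irreducible representation of $A\wr\mathfrak S_n$. *)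

theory Defs
  imports "HOL-Algebra.Sym_Groups" "HOL-Library.Function_Algebras" "HOL-Library.Extended_Real" "HOL-Library.Disjoint_Sets"
begin

section \<open>Unitary representations of finite groups\<close>

global_interpretation cfun: vector_space "\<lambda>(c::complex) (f :: 'x \<Rightarrow> complex) x. c * f x"
  defines csubspace = cfun.subspace
  by unfold_locales (auto simp: fun_eq_iff algebra_simps)

text \<open>
  A representation space is a complex subspace \<open>vecs R\<close> of the space of functions on the finite set
  \<open>pts R\<close>, extended by zero outside \<open>pts R\<close>, with the inner product inherited from
  \<open>\<complex>\<^sup>p\<^sup>t\<^sup>s\<close>. The values of \<open>act R\<close> outside the group and outside \<open>vecs R\<close> are irrelevant.
\<close>

record ('g, 'x) urep =
  pts  :: "'x set"
  vecs :: "('x \<Rightarrow> complex) set"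
  act  :: "'g \<Rightarrow> ('x \<Rightarrow> complex) \<Rightarrow> 'x \<Rightarrow> complex"

definition functions_on :: "'x set \<Rightarrow> ('x \<Rightarrow> complex) set" where
  "functions_on D = {f. \<forall>x. x \<notin> D \<longrightarrow> f x = 0}"

definition inner_on :: "'x set \<Rightarrow> ('x \<Rightarrow> complex) \<Rightarrow> ('x \<Rightarrow> complex) \<Rightarrow> complex" where
  "inner_on D f f' = (\<Sum>x\<in>D. f x * cnj (f' x))"

definition clinear_on :: "('x \<Rightarrow> complex) set \<Rightarrow> (('x \<Rightarrow> complex) \<Rightarrow> 'y \<Rightarrow> complex) \<Rightarrow> bool" where
  "clinear_on V T \<longleftrightarrow>
     (\<forall>f\<in>V. \<forall>f'\<in>V. T (\<lambda>x. f x + f' x) = (\<lambda>y. T f y + T f' y)) \<and>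
     (\<forall>c. \<forall>f\<in>V. T (\<lambda>x. c * f x) = (\<lambda>y. c * T f y))"

definition unitary_rep :: "('g, 'm) monoid_scheme \<Rightarrow> ('g, 'x) urep \<Rightarrow> bool" where
  "unitary_rep G R \<longleftrightarrow>
     finite (pts R) \<and> csubspace (vecs R) \<and> vecs R \<subseteq> functions_on (pts R) \<and>
     (\<forall>g\<in>carrier G. act R g \<in> vecs R \<rightarrow> vecs R \<and> clinear_on (vecs R) (act R g) \<and>
        (\<forall>f\<in>vecs R. \<forall>f'\<in>vecs R.
           inner_on (pts R) (act R g f) (act R g f') = inner_on (pts R) f f')) \<and>
     (\<forall>f\<in>vecs R. act R \<one>\<^bsub>G\<^esub> f = f) \<and>
     (\<forall>g\<in>carrier G. \<forall>h\<in>carrier G. \<forall>f\<in>vecs R. act R (g \<otimes>\<^bsub>G\<^esub> h) f = act R g (act R h f))"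

definition irreducible_rep :: "('g, 'm) monoid_scheme \<Rightarrow> ('g, 'x) urep \<Rightarrow> bool" where
  "irreducible_rep G R \<longleftrightarrow>
     unitary_rep G R \<and> vecs R \<noteq> {0} \<and>
     (\<forall>U. csubspace U \<longrightarrow> U \<subseteq> vecs R \<longrightarrow> (\<forall>g\<in>carrier G. act R g ` U \<subseteq> U)
        \<longrightarrow> U = {0} \<or> U = vecs R)"

definition rep_iso :: "('g, 'm) monoid_scheme \<Rightarrow> ('g, 'x) urep \<Rightarrow> ('g, 'y) urep \<Rightarrow> bool" where
  "rep_iso G R S \<longleftrightarrow>
     (\<exists>T. clinear_on (vecs R) T \<and> bij_betw T (vecs R) (vecs S) \<and>
        (\<forall>g\<in>carrier G. \<forall>f\<in>vecs R. T (act R g f) = act S g (T f)))"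

text \<open>
  Every finite-dimensional unitary representation is isomorphic to one on functions on a finite set
  of natural numbers, so isomorphism classes are formed within that universe.
\<close>

definition Irr :: "('g, 'm) monoid_scheme \<Rightarrow> ('g, nat) urep set set" where
  "Irr G = {R. irreducible_rep G R} //
     {(R, S). irreducible_rep G R \<and> irreducible_rep G S \<and> rep_iso G R S}"

definition iso_class :: "('g, 'm) monoid_scheme \<Rightarrow> ('g, 'x) urep \<Rightarrow> ('g, nat) urep set" where
  "iso_class G R = {S. irreducible_rep G S \<and> rep_iso G R S}"

definition trivial_rep :: "('g, nat) urep" where
  "trivial_rep = \<lparr>pts = {0}, vecs = functions_on {0}, act = (\<lambda>g f. f)\<rparr>"

definition regular_rep :: "('g, 'm) monoid_scheme \<Rightarrow> ('g, 'g) urep" where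
  "regular_rep G = \<lparr>pts = carrier G, vecs = functions_on (carrier G),
     act = (\<lambda>g f x. if x \<in> carrier G then f (inv\<^bsub>G\<^esub> g \<otimes>\<^bsub>G\<^esub> x) else 0)\<rparr>"

definition character_rep :: "('g \<Rightarrow> complex) \<Rightarrow> ('g, unit) urep" where
  "character_rep \<phi> = \<lparr>pts = UNIV, vecs = UNIV, act = (\<lambda>g f x. \<phi> g * f x)\<rparr>"

definition lift_rep :: "('g \<Rightarrow> 'h) \<Rightarrow> ('h, 'x) urep \<Rightarrow> ('g, 'x) urep" where
  "lift_rep q R = \<lparr>pts = pts R, vecs = vecs R, act = (\<lambda>g. act R (q g))\<rparr>"

text \<open>
  The representation induced from a subgroup \<open>H\<close> is the space of maps \<open>F\<close> from \<open>G\<close> to the space of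
  \<open>R\<close> with \<open>F (g h) = h\<^sup>-\<^sup>1 F g\<close> for \<open>h \<in> H\<close>, on which \<open>G\<close> acts by left translation; \<open>F\<close> is uncurried.
\<close>

definition induced_rep ::
  "('g, 'm) monoid_scheme \<Rightarrow> 'g set \<Rightarrow> ('g, 'x) urep \<Rightarrow> ('g, 'g \<times> 'x) urep" where
  "induced_rep G H R = \<lparr>pts = carrier G \<times> pts R,
     vecs = {F \<in> functions_on (carrier G \<times> pts R).
       (\<forall>g\<in>carrier G. (\<lambda>x. F (g, x)) \<in> vecs R) \<and>
       (\<forall>g\<in>carrier G. \<forall>h\<in>H.
          (\<lambda>x. F (g \<otimes>\<^bsub>G\<^esub> h, x)) = act R (inv\<^bsub>G\<^esub> h) (\<lambda>x. F (g, x)))},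
     act = (\<lambda>g F (y, x). if y \<in> carrier G then F (inv\<^bsub>G\<^esub> g \<otimes>\<^bsub>G\<^esub> y, x) else 0)\<rparr>"


section \<open>Laplacians and spectral gaps\<close>

definition fixed_space :: "('g, 'm) monoid_scheme \<Rightarrow> ('g, 'x) urep \<Rightarrow> ('x \<Rightarrow> complex) set" where
  "fixed_space G R = {f \<in> vecs R. \<forall>g\<in>carrier G. act R g f = f}"

definition fixed_perp :: "('g, 'm) monoid_scheme \<Rightarrow> ('g, 'x) urep \<Rightarrow> ('x \<Rightarrow> complex) set" where
  "fixed_perp G R = {f \<in> vecs R. \<forall>f'\<in>fixed_space G R. inner_on (pts R) f f' = 0}"

definition laplacian ::
  "('g, 'm) monoid_scheme \<Rightarrow> ('g \<Rightarrow> real) \<Rightarrow> ('g, 'x) urep \<Rightarrow> ('x \<Rightarrow> complex) \<Rightarrow> 'x \<Rightarrow> complex" where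
  "laplacian G w R f = (\<lambda>x. \<Sum>h\<in>carrier G. of_real (w h) * (f x - act R h f x))"

text \<open>
  Only real eigenvalues are collected: for symmetric \<open>w\<close> the Laplacian is self-adjoint.
\<close>

definition perp_eigenvalues ::
  "('g, 'm) monoid_scheme \<Rightarrow> ('g \<Rightarrow> real) \<Rightarrow> ('g, 'x) urep \<Rightarrow> real set" where
  "perp_eigenvalues G w R =
     {r. \<exists>f\<in>fixed_perp G R. f \<noteq> 0 \<and> laplacian G w R f = (\<lambda>x. of_real r * f x)}"

definition psi :: "('g, 'm) monoid_scheme \<Rightarrow> ('g \<Rightarrow> real) \<Rightarrow> ('g, 'x) urep \<Rightarrow> ereal" where
  "psi G w R =
     (if vecs R = fixed_space G R then \<infinity> else ereal (Min (perp_eigenvalues G w R)))"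

definition psi_reg :: "('g, 'm) monoid_scheme \<Rightarrow> ('g \<Rightarrow> real) \<Rightarrow> ereal" where
  "psi_reg G w = psi G w (regular_rep G)"

definition psi_class ::
  "('g, 'm) monoid_scheme \<Rightarrow> ('g \<Rightarrow> real) \<Rightarrow> ('g, nat) urep set \<Rightarrow> ereal" where
  "psi_class G w C = psi G w (SOME R. R \<in> C)"


section \<open>Wreath products\<close>

definition base :: "('a, 'b) monoid_scheme \<Rightarrow> nat \<Rightarrow> (nat \<Rightarrow> 'a) set" where
  "base A n = {1..n} \<rightarrow>\<^sub>E carrier A"

definition wreath :: "('a, 'b) monoid_scheme \<Rightarrow> nat \<Rightarrow> ((nat \<Rightarrow> 'a) \<times> (nat \<Rightarrow> nat)) monoid" where
  "wreath A n = \<lparr>carrier = base A n \<times> carrier (sym_group n),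
     mult = (\<lambda>(g, \<pi>) (h, \<sigma>). (\<lambda>i\<in>{1..n}. g i \<otimes>\<^bsub>A\<^esub> h (inv_into UNIV \<pi> i), \<pi> \<circ> \<sigma>)),
     one = (\<lambda>i\<in>{1..n}. \<one>\<^bsub>A\<^esub>, id)\<rparr>"

definition admissible ::
  "('a, 'b) monoid_scheme \<Rightarrow> nat \<Rightarrow> ((nat \<Rightarrow> 'a) \<times> (nat \<Rightarrow> nat) \<Rightarrow> real) \<Rightarrow> bool" where
  "admissible A n w \<longleftrightarrow> (\<exists>a c.
     (\<forall>i j. 1 \<le> i \<and> i < j \<and> j \<le> n \<longrightarrow> 0 \<le> a i j) \<and>
     (\<forall>x\<in>base A n. 0 \<le> c x \<and> c x = c (\<lambda>i\<in>{1..n}. inv\<^bsub>A\<^esub> (x i))) \<and>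
     w = (\<lambda>u. (\<Sum>(i, j)\<in>{(i, j). 1 \<le> i \<and> i < j \<and> j \<le> n}.
                 a i j * of_bool (u = (\<lambda>k\<in>{1..n}. \<one>\<^bsub>A\<^esub>, Transposition.transpose i j))) +
              (\<Sum>x\<in>base A n. c x * of_bool (u = (x, id)))))"

text \<open>
  The minimum is spelled out as an attained lower bound, so the empty family is never gap-determining.
\<close>

definition gap_determining ::
  "('a, 'b) monoid_scheme \<Rightarrow> nat \<Rightarrow> ((nat \<Rightarrow> 'a) \<times> (nat \<Rightarrow> nat), nat) urep set set \<Rightarrow> bool" where
  "gap_determining A n E \<longleftrightarrow>
     E \<subseteq> Irr (wreath A n) - {iso_class (wreath A n) trivial_rep} \<and>
     (\<forall>w. admissible A n w \<longrightarrow>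
        (\<exists>V\<in>E. psi_reg (wreath A n) w = psi_class (wreath A n) w V) \<and>
        (\<forall>V\<in>E. psi_reg (wreath A n) w \<le> psi_class (wreath A n) w V))"

definition minimal_gap_determining ::
  "('a, 'b) monoid_scheme \<Rightarrow> nat \<Rightarrow> ((nat \<Rightarrow> 'a) \<times> (nat \<Rightarrow> nat), nat) urep set set \<Rightarrow> bool" where
  "minimal_gap_determining A n E \<longleftrightarrow>
     gap_determining A n E \<and> (\<forall>E'. E' \<subset> E \<longrightarrow> \<not> gap_determining A n E')"


section \<open>The representations \<open>Std\<close> and \<open>V\<^sub>\<kappa>\<close>\<close>

text \<open>
  In the Specht module of shape \<open>(n - 1, 1)\<close>, a tabloid is determined by the entry of its second row
  and the polytabloids are the differences of two such basis vectors; they span the space of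
  vectors with coordinate sum zero.
\<close>

definition std_rep :: "nat \<Rightarrow> (nat \<Rightarrow> nat, nat) urep" where
  "std_rep n = \<lparr>pts = {1..n}, vecs = {f \<in> functions_on {1..n}. (\<Sum>i\<in>{1..n}. f i) = 0},
     act = (\<lambda>\<pi> f i. f (inv_into UNIV \<pi> i))\<rparr>"

definition Std :: "('a, 'b) monoid_scheme \<Rightarrow> nat \<Rightarrow> ((nat \<Rightarrow> 'a) \<times> (nat \<Rightarrow> nat), nat) urep set" where
  "Std A n = iso_class (wreath A n) (lift_rep snd (std_rep n))"

definition character_group :: "('a, 'b) monoid_scheme \<Rightarrow> ('a \<Rightarrow> complex) monoid" where
  "character_group A =
     \<lparr>carrier = hom A \<lparr>carrier = {z::complex. cmod z = 1}, mult = (*), one = 1\<rparr> \<inter> extensional (carrier A),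
      mult = (\<lambda>\<chi> \<chi>'. \<lambda>x\<in>carrier A. \<chi> x * \<chi>' x),
      one = (\<lambda>x\<in>carrier A. 1)\<rparr>"

definition mult_vectors :: "('a, 'b) monoid_scheme \<Rightarrow> nat \<Rightarrow> (('a \<Rightarrow> complex) \<Rightarrow> nat) set" where
  "mult_vectors A n =
     {\<kappa> \<in> carrier (character_group A) \<rightarrow>\<^sub>E UNIV. (\<Sum>\<chi>\<in>carrier (character_group A). \<kappa> \<chi>) = n}"

definition nontrivial_mult_vectors ::
  "('a, 'b) monoid_scheme \<Rightarrow> nat \<Rightarrow> (('a \<Rightarrow> complex) \<Rightarrow> nat) set" where
  "nontrivial_mult_vectors A n = {\<kappa> \<in> mult_vectors A n. \<kappa> \<one>\<^bsub>character_group A\<^esub> \<noteq> n}"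

definition dual_vector ::
  "('a, 'b) monoid_scheme \<Rightarrow> (('a \<Rightarrow> complex) \<Rightarrow> nat) \<Rightarrow> ('a \<Rightarrow> complex) \<Rightarrow> nat" where
  "dual_vector A \<kappa> = (\<lambda>\<chi>\<in>carrier (character_group A). \<kappa> (inv\<^bsub>character_group A\<^esub> \<chi>))"

text \<open>
  The product of the groups \<open>A \<wr> S\<^sub>\<kappa>\<^sub>\<chi>\<close> sits in the wreath product through a decomposition of
  \<open>{1..n}\<close> into blocks of sizes \<open>\<kappa> \<chi>\<close>. Different decompositions give conjugate subgroups and
  isomorphic induced representations, so an arbitrary one is chosen.
\<close>

definition block_decomposition ::
  "('a, 'b) monoid_scheme \<Rightarrow> nat \<Rightarrow> (('a \<Rightarrow> complex) \<Rightarrow> nat) \<Rightarrow> (('a \<Rightarrow> complex) \<Rightarrow> nat set) \<Rightarrow> bool" where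
  "block_decomposition A n \<kappa> B \<longleftrightarrow>
     disjoint_family_on B (carrier (character_group A)) \<and>
     (\<Union>\<chi>\<in>carrier (character_group A). B \<chi>) = {1..n} \<and>
     (\<forall>\<chi>\<in>carrier (character_group A). card (B \<chi>) = \<kappa> \<chi>)"

definition block_subgroup ::
  "('a, 'b) monoid_scheme \<Rightarrow> nat \<Rightarrow> (('a \<Rightarrow> complex) \<Rightarrow> nat set) \<Rightarrow> ((nat \<Rightarrow> 'a) \<times> (nat \<Rightarrow> nat)) set" where
  "block_subgroup A n B =
     {(g, \<pi>) \<in> carrier (wreath A n). \<forall>\<chi>\<in>carrier (character_group A). \<pi> ` B \<chi> = B \<chi>}"

definition block_character ::
  "('a, 'b) monoid_scheme \<Rightarrow> (('a \<Rightarrow> complex) \<Rightarrow> nat set) \<Rightarrow> (nat \<Rightarrow> 'a) \<times> (nat \<Rightarrow> nat) \<Rightarrow> complex" where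
  "block_character A B = (\<lambda>(g, \<pi>). \<Prod>\<chi>\<in>carrier (character_group A). \<Prod>i\<in>B \<chi>. \<chi> (g i))"

definition V_class ::
  "('a, 'b) monoid_scheme \<Rightarrow> nat \<Rightarrow> (('a \<Rightarrow> complex) \<Rightarrow> nat) \<Rightarrow> ((nat \<Rightarrow> 'a) \<times> (nat \<Rightarrow> nat), nat) urep set" where
  "V_class A n \<kappa> =
     (let B = SOME B. block_decomposition A n \<kappa> B
      in iso_class (wreath A n)
           (induced_rep (wreath A n) (block_subgroup A n B) (character_rep (block_character A B))))"

definition duality_transversal ::
  "('a, 'b) monoid_scheme \<Rightarrow> nat \<Rightarrow> (('a \<Rightarrow> complex) \<Rightarrow> nat) set \<Rightarrow> bool" where
  "duality_transversal A n T \<longleftrightarrow>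
     T \<subseteq> nontrivial_mult_vectors A n \<and>
     (\<forall>\<kappa>\<in>nontrivial_mult_vectors A n. \<exists>!\<kappa>'. \<kappa>' \<in> T \<inter> {\<kappa>, dual_vector A \<kappa>})"

definition M_family ::
  "('a, 'b) monoid_scheme \<Rightarrow> nat \<Rightarrow> (('a \<Rightarrow> complex) \<Rightarrow> nat) set \<Rightarrow>
   ((nat \<Rightarrow> 'a) \<times> (nat \<Rightarrow> nat), nat) urep set set" where
  "M_family A n T = insert (Std A n) (V_class A n ` T)"

end

theory Submission
  imports Defs "HOL-Analysis.Function_Topology" "HOL-Analysis.Topology_Euclidean_Space" "HOL-Algebra.Multiplicative_Group"
begin

text \<open>
  The eigenspaces of the Laplacian on the regular representation are stable under right translation by
  \<open>A\<^sup>n\<close>, so the gap is attained at a function \<open>f\<close> transforming by a character \<open>\<theta>\<close> of \<open>A\<^sup>n\<close>.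
  If \<open>\<theta>\<close> is trivial, then \<open>f\<close> lives on the symmetric group and only the transpositions
  contribute; the Aldous spectral gap theorem, proved along the lines of Caputo, Liggett and Richthammer
  by induction on \<open>n\<close> from the octopus inequality, compares the energy of \<open>f\<close> with the gap of
  \<open>Std\<^sub>n\<close>. If \<open>\<theta>\<close> is non-trivial with multiplicities \<open>\<kappa>\<close>, then a diamagnetic inequality
  produces from the absolute value of \<open>f\<close> a vector of \<open>V\<^sub>\<kappa>\<close> with at most the same Rayleigh
  quotient. Complex conjugation exchanges \<open>\<kappa>\<close> and \<open>\<kappa>\<^sup>*\<close>.

  Conversely, give all transpositions a huge weight and \<open>x \<in> A\<^sup>n\<close> the weight \<open>1 + Re (\<theta> x)\<close>.
  An irreducible representation without vectors invariant under the symmetric group has a huge gap. One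
  with such a vector is determined by any of its weights; unless it is \<open>V\<^sub>\<kappa>\<close> or its dual, the
  weights \<open>\<theta>\<close>, \<open>\<theta>\<^sup>-\<^sup>1\<close> and \<open>1\<close> do not occur in it and its gap is at least \<open>|A|\<^sup>n\<close>,
  whereas the gap of \<open>V\<^sub>\<kappa>\<close> is smaller. Likewise, give \<open>A\<^sup>n\<close> and the transpositions
  fixing \<open>n\<close> a huge weight and the others weight \<open>1\<close>: apart from the trivial representation, only
  \<open>Std\<^sub>n\<close> has a vector fixed by \<open>A\<^sup>n\<close> and the stabilizer of \<open>n\<close>.
\<close>

text \<open>A function on the group that transforms by \<open>\<theta>\<close> under right
  translation by \<open>A^n\<close> can still be of any type under the stabilizer of
  \<open>\<theta>\<close> in the symmetric group. The diamagnetic step shows that the trivial type,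
  which yields \<open>ind \<theta>\<close>, is never more expensive. For trivial
  \<open>\<theta>\<close> this type is the trivial representation, which the gap excludes; hence
  \<open>Std\<close> joins the family, and hence the Aldous theorem.

  For non-trivial \<open>\<theta>\<close> the weights \<open>1 + Re (wt \<theta> x)\<close> have
  Fourier coefficients only at \<open>1\<close>, \<open>\<theta>\<close> and its inverse. They
  contribute exactly the scalar \<open>card (base A n)\<close> to the Laplacian on every other
  weight, less on \<open>\<theta>\<close> and its inverse, and nothing on the trivial weight, which
  therefore has to be ruled out separately.

  The huge constants must be fixed before the representation is known. A displacement bound uniform
  in all unitary representations makes this possible, and the test vectors that bound the competing
  gap from above are not moved by the heavy elements, so that bound survives any choice of the
  constants.\<close>

abbreviation "tr \<equiv> Transposition.transpose"

section \<open>The octopus inequality\<close>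

text \<open>
  A list of pairs \<open>(q, x)\<close> stands for the element \<open>\<Sum> x q\<close> of the integral group ring of the symmetric
  group on five points; \<open>q\<close> lists the images of \<open>0, \<dots>, 4\<close>, and \<open>e\<close> embeds the five points into the
  sites.
\<close>

definition lperm :: "(nat \<Rightarrow> nat) \<Rightarrow> nat list \<Rightarrow> nat \<Rightarrow> nat" where
  "lperm e q x = (if x \<in> e ` {..<5} then e (q ! inv_into {..<5} e x) else x)"

definition lcomp :: "nat list \<Rightarrow> nat list \<Rightarrow> nat list" where
  "lcomp q p = map ((!) q) p"

definition lvalid :: "(nat list \<times> int) list \<Rightarrow> bool" where
  "lvalid L \<longleftrightarrow> (\<forall>(q, x) \<in> set L. length q = 5 \<and> (\<forall>a \<in> set q. a < 5))"

text \<open>In \<open>lapp e L (lapp e M f)\<close> the argument is multiplied on the left first by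
  the permutation from \<open>L\<close>, then by that from \<open>M\<close>, hence the order
  \<open>lcomp r q\<close>.\<close>

definition lconv :: "(nat list \<times> int) list \<Rightarrow> (nat list \<times> int) list \<Rightarrow> (nat list \<times> int) list" where
  "lconv L M = concat (map (\<lambda>(q, x). map (\<lambda>(r, y). (lcomp r q, x * y)) M) L)"

definition lscale :: "int \<Rightarrow> (nat list \<times> int) list \<Rightarrow> (nat list \<times> int) list" where
  "lscale c L = map (\<lambda>(q, x). (q, c * x)) L"

fun ladd :: "nat list \<Rightarrow> int \<Rightarrow> (nat list \<times> int) list \<Rightarrow> (nat list \<times> int) list" where
  "ladd q x [] = [(q, x)]"
| "ladd q x ((r, y) # M) = (if q = r then (r, x + y) # M else (r, y) # ladd q x M)"

fun lnorm :: "(nat list \<times> int) list \<Rightarrow> (nat list \<times> int) list" where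
  "lnorm [] = []"
| "lnorm ((q, x) # L) = ladd q x (lnorm L)"

definition lequal :: "(nat list \<times> int) list \<Rightarrow> (nat list \<times> int) list \<Rightarrow> bool" where
  "lequal L M \<longleftrightarrow> list_all (\<lambda>(q, x). x = 0) (lnorm (L @ lscale (- 1) M))"

definition lapp :: "(nat \<Rightarrow> nat) \<Rightarrow> (nat list \<times> int) list \<Rightarrow> ((nat \<Rightarrow> nat) \<Rightarrow> real) \<Rightarrow> (nat \<Rightarrow> nat) \<Rightarrow> real" where
  "lapp e L f \<sigma> = (\<Sum>(q, x)\<leftarrow>L. of_int x * f (lperm e q \<circ> \<sigma>))"

lemma lperm_comp:
  assumes "inj_on e {..<5}" "length q = 5" "\<forall>a\<in>set q. a < 5"
  shows "lperm e r \<circ> lperm e q = lperm e (lcomp r q)"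
proof
  fix x
  show "(lperm e r \<circ> lperm e q) x = lperm e (lcomp r q) x"
  proof (cases "x \<in> e ` {..<5}")
    case True
    then obtain a where a: "a < 5" "x = e a" by auto
    have i: "inv_into {..<5} e (e b) = b" if "b < 5" for b
      using that assms(1) by (simp add: inv_into_f_f)
    have "q ! a < 5" using assms a by (metis nth_mem)
    then show ?thesis using a assms by (auto simp: lperm_def i lcomp_def)
  qed (auto simp: lperm_def)
qed

lemma lapp_lapp:
  assumes "inj_on e {..<5}" "lvalid L"
  shows "lapp e L (lapp e M f) \<sigma> = lapp e (lconv L M) f \<sigma>"
  using assms(2)
proof (induction L)
  case (Cons a L)
  obtain q x where a: "a = (q, x)" by force
  have v: "length q = 5" "\<forall>b\<in>set q. b < 5" "lvalid L" using Cons.prems by (auto simp: lvalid_def a)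
  have "lapp e M f (lperm e q \<circ> \<sigma>) = (\<Sum>(r, y)\<leftarrow>M. of_int y * f (lperm e (lcomp r q) \<circ> \<sigma>))"
    unfolding lapp_def comp_assoc[symmetric] lperm_comp[OF assms(1) v(1,2)] ..
  then have "of_int x * lapp e M f (lperm e q \<circ> \<sigma>) = (\<Sum>(r, y)\<leftarrow>map (\<lambda>(r, y). (lcomp r q, x * y)) M. of_int y * f (lperm e r \<circ> \<sigma>))"
    by (auto simp: sum_list_const_mult[symmetric] o_def case_prod_unfold mult.assoc intro!: arg_cong[where f=sum_list])
  then show ?case using Cons.IH[OF v(3)] by (simp add: lapp_def lconv_def a)
qed (simp add: lapp_def lconv_def)

lemma lapp_append: "lapp e (L @ M) f \<sigma> = lapp e L f \<sigma> + lapp e M f \<sigma>"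
  by (simp add: lapp_def)

lemma lapp_scale: "lapp e (lscale c L) f \<sigma> = of_int c * lapp e L f \<sigma>"
  by (auto simp: lapp_def lscale_def sum_list_const_mult[symmetric] o_def case_prod_unfold mult.assoc intro!: arg_cong[where f=sum_list])

lemma lapp_ladd: "lapp e (ladd q x M) f \<sigma> = of_int x * f (lperm e q \<circ> \<sigma>) + lapp e M f \<sigma>"
  by (induction q x M rule: ladd.induct) (auto simp: lapp_def algebra_simps o_def)

lemma lapp_lnorm: "lapp e (lnorm L) f \<sigma> = lapp e L f \<sigma>"
proof (induction L rule: lnorm.induct)
  case (2 q x L)
  have "lapp e ((q, x) # L) f \<sigma> = of_int x * f (lperm e q \<circ> \<sigma>) + lapp e L f \<sigma>"
    by (simp add: lapp_def)
  then show ?case using 2 by (simp only: lnorm.simps lapp_ladd)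
qed (simp add: lapp_def)

text \<open>Soundness of the check by evaluation: merging equal permutations does not change the
  action, and a list whose coefficients all vanish acts as zero.\<close>

lemma lapp_eqI:
  assumes "lequal L M"
  shows "lapp e L f \<sigma> = lapp e M f \<sigma>"
proof -
  have "lapp e N f \<sigma> = 0" if "list_all (\<lambda>(q, x). x = 0) N" for N
    using that by (induction N) (auto simp: lapp_def)
  from this[OF assms[unfolded lequal_def]] show ?thesis
    by (simp add: lapp_lnorm lapp_append lapp_scale)
qed

text \<open>
  With \<open>C = \<Sum> c i\<close>, \<open>D = \<Sum> (c i)\<^sup>2\<close> and \<open>Y = \<Sum> c i c j yop s i j\<close>, the sum of
  \<open>c i c j c k c l zop s i j k l\<close> over all indices is \<open>12 (C\<^sup>2 + D) Y - 6 Y\<^sup>2\<close>, so the octopus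
  inequality \<open>Y \<ge> 0\<close> reduces to the positivity of each \<open>zop\<close>. The latter holds because \<open>zop\<close> is
  self-adjoint and squares to \<open>24 zop\<close>.
\<close>

definition yop :: "nat \<Rightarrow> nat \<Rightarrow> nat \<Rightarrow> ((nat \<Rightarrow> nat) \<Rightarrow> real) \<Rightarrow> (nat \<Rightarrow> nat) \<Rightarrow> real" where
  "yop s i j f \<sigma> = f \<sigma> + f (tr i j \<circ> \<sigma>)
     - f (tr s i \<circ> \<sigma>) - f (tr s j \<circ> \<sigma>)"

text \<open>The product of two \<open>yop\<close> is taken in both orders because they need not
  commute. Summed against \<open>c k * c l\<close>, the factor \<open>1 + of_bool (k = l)\<close>
  gives \<open>C^2 + D\<close>.\<close>

definition zop2 :: "nat \<Rightarrow> nat \<Rightarrow> nat \<Rightarrow> nat \<Rightarrow> nat \<Rightarrow> ((nat \<Rightarrow> nat) \<Rightarrow> real) \<Rightarrow> (nat \<Rightarrow> nat) \<Rightarrow> real" where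
  "zop2 s i j k l f \<sigma> = 2 * (1 + of_bool (k = l)) * yop s i j f \<sigma> + 2 * (1 + of_bool (i = j)) * yop s k l f \<sigma>
     - yop s i j (yop s k l f) \<sigma> - yop s k l (yop s i j f) \<sigma>"

definition zop :: "nat \<Rightarrow> nat \<Rightarrow> nat \<Rightarrow> nat \<Rightarrow> nat \<Rightarrow> ((nat \<Rightarrow> nat) \<Rightarrow> real) \<Rightarrow> (nat \<Rightarrow> nat) \<Rightarrow> real" where
  "zop s i j k l f \<sigma> = zop2 s i j k l f \<sigma> + zop2 s i k j l f \<sigma> + zop2 s i l j k f \<sigma>"

definition lswap :: "nat \<Rightarrow> nat \<Rightarrow> nat list" where
  "lswap a b = map (\<lambda>x. if x = a then b else if x = b then a else x) [0, 1, 2, 3, 4]"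

text \<open>Point \<open>0\<close> stands for the hub \<open>s\<close>; the legs are among the
  points \<open>1\<close> to \<open>4\<close> and may coincide.\<close>

definition lY :: "nat \<Rightarrow> nat \<Rightarrow> (nat list \<times> int) list" where
  "lY i j = [([0, 1, 2, 3, 4], 1), (lswap i j, 1), (lswap 0 i, - 1), (lswap 0 j, - 1)]"

definition lZ2 :: "nat \<Rightarrow> nat \<Rightarrow> nat \<Rightarrow> nat \<Rightarrow> (nat list \<times> int) list" where
  "lZ2 i j k l = lscale (2 * (1 + of_bool (k = l))) (lY i j) @ lscale (2 * (1 + of_bool (i = j))) (lY k l)
     @ lscale (- 1) (lconv (lY i j) (lY k l)) @ lscale (- 1) (lconv (lY k l) (lY i j))"

definition lZ :: "nat \<Rightarrow> nat \<Rightarrow> nat \<Rightarrow> nat \<Rightarrow> (nat list \<times> int) list" where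
  "lZ i j k l = lZ2 i j k l @ lZ2 i k j l @ lZ2 i l j k"

lemma lperm_id: "inj_on e {..<5} \<Longrightarrow> lperm e [0, 1, 2, 3, 4] = id"
proof
  fix x assume e: "inj_on e {..<5}"
  have "[0, 1, 2, 3, 4] ! a = a" if "a < 5" for a :: nat
    using that by (auto simp: less_Suc_eq numeral_eq_Suc)
  moreover have "inv_into {..<5} e x < 5" if "x \<in> e ` {..<5}" using inv_into_into[OF that] by simp
  ultimately show "lperm e [0, 1, 2, 3, 4] x = id x"
    by (auto simp: lperm_def f_inv_into_f)
qed

lemma lperm_lswap:
  assumes "inj_on e {..<5}" "a < 5" "b < 5"
  shows "lperm e (lswap a b) = tr (e a) (e b)"
proof
  fix x
  have i: "inv_into {..<5} e (e b) = b" if "b < 5" for b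
    using that assms(1) by (simp add: inv_into_f_f)
  have n: "lswap a b ! c = (if c = a then b else if c = b then a else c)" if "c < 5" for c
  proof -
    have "[0, 1, 2, 3, 4] ! c = c" using that by (auto simp: less_Suc_eq numeral_eq_Suc)
    then show ?thesis using that unfolding lswap_def by (subst nth_map) auto
  qed
  have ei: "e c = e d \<longleftrightarrow> c = d" if "c < 5" "d < 5" for c d
    using assms(1) that by (auto dest: inj_onD)
  show "lperm e (lswap a b) x = tr (e a) (e b) x"
  proof (cases "x \<in> e ` {..<5}")
    case True
    then obtain c where c: "c < 5" "x = e c" by auto
    then show ?thesis using assms(2,3)
      by (auto simp: lperm_def i n ei Transposition.transpose_def)
  next
    case False
    then show ?thesis using assms(2,3) by (auto simp: lperm_def Transposition.transpose_def)
  qed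
qed

lemma lapp_lY:
  assumes "inj_on e {..<5}" "i < 5" "j < 5"
  shows "lapp e (lY i j) f = yop (e 0) (e i) (e j) f"
  using assms by (simp add: fun_eq_iff lapp_def lY_def yop_def lperm_id[simplified] lperm_lswap)

lemma lvalid_lY: "i < 5 \<Longrightarrow> j < 5 \<Longrightarrow> lvalid (lY i j)"
  by (auto simp: lvalid_def lY_def lswap_def)

lemma lapp_lZ:
  assumes e: "inj_on e {..<5}" and "i < 5" "j < 5" "k < 5" "l < 5"
  shows "lapp e (lZ i j k l) f = zop (e 0) (e i) (e j) (e k) (e l) f"
proof
  fix \<sigma>
  have ei: "e c = e d \<longleftrightarrow> c = d" if "c < 5" "d < 5" for c d
    using assms(1) that by (auto dest: inj_onD)
  have 2: "lapp e (lZ2 i j k l) f \<sigma> = zop2 (e 0) (e i) (e j) (e k) (e l) f \<sigma>"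
    if "i < 5" "j < 5" "k < 5" "l < 5" for i j k l
    using that e
    by (simp add: lZ2_def zop2_def lapp_append lapp_scale lapp_lapp[symmetric] lvalid_lY lapp_lY ei)
  show "lapp e (lZ i j k l) f \<sigma> = zop (e 0) (e i) (e j) (e k) (e l) f \<sigma>"
    using assms by (simp add: lZ_def zop_def lapp_append 2)
qed

text \<open>By cycle type: \<open>6\<close> for the identity, \<open>- 2\<close> for the double
  transpositions fixing \<open>0\<close> and for the 3-cycles moving \<open>0\<close>, and
  \<open>2\<close> for the double transpositions moving \<open>0\<close>. Starting from this normal
  form keeps the convolution square small.\<close>

definition lX5 :: "(nat list \<times> int) list" where
  "lX5 = [([0, 1, 2, 3, 4], 6), ([0, 2, 1, 4, 3], - 2), ([0, 3, 4, 1, 2], - 2), ([0, 4, 3, 2, 1], - 2), ([1, 0, 2, 4, 3], 2), ([1, 0, 3, 2, 4], 2), ([1, 0, 4, 3, 2], 2), ([1, 2, 0, 3, 4], - 2), ([1, 3, 2, 0, 4], - 2), ([1, 4, 2, 3, 0], - 2), ([2, 0, 1, 3, 4], - 2), ([2, 1, 0, 4, 3], 2), ([2, 1, 3, 0, 4], - 2), ([2, 1, 4, 3, 0], - 2), ([2, 3, 0, 1, 4], 2), ([2, 4, 0, 3, 1], 2), ([3, 0, 2, 1, 4], - 2), ([3, 1, 0, 2, 4], - 2), ([3, 1, 2, 4, 0], - 2), ([3, 1, 4, 0, 2], 2), ([3, 2, 1, 0, 4], 2), ([3, 4, 2, 0, 1], 2), ([4, 0, 2, 3, 1], - 2), ([4,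 1, 0, 3, 2], - 2), ([4, 1, 2, 0, 3], - 2), ([4, 1, 3, 2, 0], 2), ([4, 2, 1, 3, 0], 2), ([4, 3, 2, 1, 0], 2)]"

text \<open>Four times the sum over the Klein four-group in the alternating group on
  \<open>0, ..., 3\<close>, minus twice the sum of the 3-cycles. This is \<open>24\<close> times the
  projection onto the two non-trivial linear characters of that group.\<close>

definition lX4 :: "(nat list \<times> int) list" where
  "lX4 = [([0, 1, 2, 3, 4], 4), ([0, 2, 3, 1, 4], - 2), ([0, 3, 1, 2, 4], - 2), ([1, 0, 3, 2, 4], 4), ([1, 2, 0, 3, 4], - 2), ([1, 3, 2, 0, 4], - 2), ([2, 0, 1, 3, 4], - 2), ([2, 1, 3, 0, 4], - 2), ([2, 3, 0, 1, 4], 4), ([3, 0, 2, 1, 4], - 2), ([3, 1, 0, 2, 4], - 2), ([3, 2, 1, 0, 4], 4)]"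

text \<open>One instance for each partition type of four indices; since \<open>zop\<close> is
  symmetric in them, these five cover all coincidences.\<close>

lemma lequal_lZ:
  "lequal (lZ 1 2 3 4) lX5" "lequal (lZ 1 1 2 3) lX4" "lequal (lZ 1 1 2 2) []"
  "lequal (lZ 1 1 1 2) []" "lequal (lZ 1 1 1 1) []"
  by code_simp+

lemma lequal_lconv: "lequal (lconv lX5 lX5) (lscale 24 lX5)" "lequal (lconv lX4 lX4) (lscale 24 lX4)"
  by code_simp+

lemma lvalid_lX: "lvalid lX4" "lvalid lX5" "lvalid []"
  by (simp_all add: lvalid_def lX4_def lX5_def)

lemma zop_zop:
  fixes e :: "nat \<Rightarrow> nat"
  assumes e: "inj_on e {..<5}"
    and "(a, b, c, d) \<in> {(1, 2, 3, 4), (1, 1, 2, 3), (1, 1, 2, 2), (1, 1, 1, 2), (1, 1, 1, 1)}"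
  shows "zop (e 0) (e a) (e b) (e c) (e d) (zop (e 0) (e a) (e b) (e c) (e d) f) \<sigma>
    = 24 * zop (e 0) (e a) (e b) (e c) (e d) f \<sigma>"
proof -
  \<comment> \<open>A normal form \<open>L\<close> of the element, certified by evaluation together
    with its convolution square.\<close>
  define P where "P a b c d \<longleftrightarrow> (\<exists>L. lvalid L \<and> (\<forall>f \<sigma>. lapp e (lZ a b c d) f \<sigma> = lapp e L f \<sigma>)
    \<and> (\<forall>f \<sigma>. lapp e (lconv L L) f \<sigma> = lapp e (lscale 24 L) f \<sigma>))" for a b c d
  have 0: "lapp e (lconv [] []) f \<sigma> = lapp e (lscale 24 []) f \<sigma>" for f \<sigma>
    by (simp add: lapp_def lconv_def lscale_def)
  have "P 1 2 3 4" unfolding P_def using lvalid_lX(2) lapp_eqI[OF lequal_lZ(1)] lapp_eqI[OF lequal_lconv(1)] by blast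
  moreover have "P 1 1 2 3" unfolding P_def using lvalid_lX(1) lapp_eqI[OF lequal_lZ(2)] lapp_eqI[OF lequal_lconv(2)] by blast
  moreover have "P 1 1 2 2" unfolding P_def using lvalid_lX(3) lapp_eqI[OF lequal_lZ(3)] 0 by blast
  moreover have "P 1 1 1 2" unfolding P_def using lvalid_lX(3) lapp_eqI[OF lequal_lZ(4)] 0 by blast
  moreover have "P 1 1 1 1" unfolding P_def using lvalid_lX(3) lapp_eqI[OF lequal_lZ(5)] 0 by blast
  ultimately have "P a b c d" using assms(2) by auto
  then obtain L where L: "lvalid L" "\<And>f \<sigma>. lapp e (lZ a b c d) f \<sigma> = lapp e L f \<sigma>"
    "\<And>f \<sigma>. lapp e (lconv L L) f \<sigma> = lapp e (lscale 24 L) f \<sigma>"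
    unfolding P_def by blast
  have z: "zop (e 0) (e a) (e b) (e c) (e d) f = lapp e L f" for f
    using L(2) lapp_lZ[OF e, of a b c d f] assms(2) by (auto simp: fun_eq_iff)
  show ?thesis unfolding z using L(3) lapp_scale[of e 24 L f \<sigma>] by (simp add: lapp_lapp[OF e L(1)])
qed

lemma yop_sym: "yop s i j f = yop s j i f"
  by (simp add: yop_def fun_eq_iff transpose_commute)

lemma zop2_swap: "zop2 s i j k l f = zop2 s k l i j f" "zop2 s i j k l f = zop2 s j i k l f"
    "zop2 s i j k l f = zop2 s i j l k f"
  by (simp_all add: zop2_def fun_eq_iff yop_sym[of s i j] yop_sym[of s k l] eq_commute[of i j] eq_commute[of k l])

text \<open>The summands of \<open>zop\<close> run over the three ways to pair four indices, so
  exchanging neighbours only permutes them.\<close>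

lemma zop_swap: "zop s i j k l f = zop s j i k l f" "zop s i j k l f = zop s i k j l f"
    "zop s i j k l f = zop s i j l k f"
proof -
  show "zop s i j k l f = zop s j i k l f"
    using zop2_swap(2)[of s j i k l f] zop2_swap(1)[of s j k i l f] zop2_swap(1)[of s j l i k f]
    by (simp add: zop_def[abs_def] add_ac)
  show "zop s i j k l f = zop s i k j l f"
    using zop2_swap(3)[of s i l k j f] by (simp add: zop_def[abs_def] add_ac)
  show "zop s i j k l f = zop s i j l k f"
    using zop2_swap(3)[of s i j l k f] by (simp add: zop_def[abs_def] add_ac)
qed

section \<open>Positivity of the octopus form on real functions\<close>

locale site_sum =
  fixes S :: "(nat \<Rightarrow> nat) set" and s :: nat and I :: "nat set"
  assumes fin: "finite S" "finite I" and s: "s \<notin> I"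
    and closed: "\<And>a b \<sigma>. a \<in> insert s I \<Longrightarrow> b \<in> insert s I \<Longrightarrow> \<sigma> \<in> S \<Longrightarrow> tr a b \<circ> \<sigma> \<in> S"
begin

definition ip :: "((nat \<Rightarrow> nat) \<Rightarrow> real) \<Rightarrow> ((nat \<Rightarrow> nat) \<Rightarrow> real) \<Rightarrow> real" where
  "ip f g = (\<Sum>\<sigma>\<in>S. f \<sigma> * g \<sigma>)"

lemma ip_simps:
  "ip (\<lambda>\<sigma>. f \<sigma> + f' \<sigma>) g = ip f g + ip f' g" "ip (\<lambda>\<sigma>. f \<sigma> - f' \<sigma>) g = ip f g - ip f' g"
  "ip (\<lambda>\<sigma>. c * f \<sigma>) g = c * ip f g"
  "ip g (\<lambda>\<sigma>. f \<sigma> + f' \<sigma>) = ip g f + ip g f'" "ip g (\<lambda>\<sigma>. f \<sigma> - f' \<sigma>) = ip g f - ip g f'"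
  "ip g (\<lambda>\<sigma>. c * f \<sigma>) = c * ip g f"
  by (simp_all add: ip_def algebra_simps sum.distrib sum_subtractf sum_distrib_left)

lemma ip_sum: "ip (\<lambda>\<sigma>. \<Sum>x\<in>X. F x \<sigma>) g = (\<Sum>x\<in>X. ip (F x) g)" "ip g (\<lambda>\<sigma>. \<Sum>x\<in>X. F x \<sigma>) = (\<Sum>x\<in>X. ip g (F x))"
  unfolding ip_def sum_distrib_left sum_distrib_right by (rule sum.swap)+

lemma ip_commute: "ip f g = ip g f"
  by (simp add: ip_def mult.commute)

lemma ip_nonneg: "0 \<le> ip f f"
  by (simp add: ip_def sum_nonneg)

text \<open>Left multiplication by a transposition of sites is an involution of \<open>S\<close>, by
  \<open>closed\<close>.\<close>

lemma transpose_adjoint: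
  assumes "a \<in> insert s I" "b \<in> insert s I"
  shows "ip (\<lambda>\<sigma>. f (tr a b \<circ> \<sigma>)) g = ip f (\<lambda>\<sigma>. g (tr a b \<circ> \<sigma>))"
  unfolding ip_def
  by (rule sum.reindex_bij_witness[where i = "\<lambda>\<sigma>. tr a b \<circ> \<sigma>" and j = "\<lambda>\<sigma>. tr a b \<circ> \<sigma>"])
    (use assms closed in \<open>auto simp: comp_assoc[symmetric]\<close>)

lemma yop_adjoint:
  assumes "i \<in> I" "j \<in> I"
  shows "ip (yop s i j f) g = ip f (yop s i j g)"
  using assms unfolding yop_def[abs_def] by (simp add: ip_simps transpose_adjoint)

lemma ip_zop2:
  assumes "i \<in> I" "j \<in> I" "k \<in> I" "l \<in> I"
  shows "ip (zop2 s i j k l f) g = ip f (zop2 s i j k l g)"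
    and "ip f (zop2 s i j k l f) = 2 * (1 + of_bool (k = l)) * ip f (yop s i j f) + 2 * (1 + of_bool (i = j)) * ip f (yop s k l f)
     - 2 * ip (yop s i j f) (yop s k l f)"
  using assms unfolding zop2_def[abs_def] ip_simps
  by (simp_all add: ip_simps yop_adjoint[symmetric] ip_commute[of "yop s k l f" "yop s i j f"]
     del: distrib_left_numeral)

lemma ip_zop:
  assumes "i \<in> I" "j \<in> I" "k \<in> I" "l \<in> I"
  shows "ip (zop s i j k l f) g = ip f (zop s i j k l g)"
  using assms unfolding zop_def[abs_def] by (simp add: ip_simps ip_zop2)

lemma ip_zop_nonneg_pattern:
  fixes e :: "nat \<Rightarrow> nat"
  assumes e: "inj_on e {..<5}"
    and p: "(a, b, c, d) \<in> {(1, 2, 3, 4), (1, 1, 2, 3), (1, 1, 2, 2), (1, 1, 1, 2), (1, 1, 1, 1)}"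
    and "e 0 = s" "e a \<in> I" "e b \<in> I" "e c \<in> I" "e d \<in> I"
  shows "0 \<le> ip f (zop s (e a) (e b) (e c) (e d) f)"
proof -
  let ?Z = "zop s (e a) (e b) (e c) (e d)"
  have "24 * ip f (?Z f) = ip f (?Z (?Z f))"
    using zop_zop[OF e p] assms(3) by (simp add: ip_def sum_distrib_left mult.left_commute)
  also have "\<dots> = ip (?Z f) (?Z f)"
    using assms by (simp add: ip_zop)
  finally show ?thesis using ip_nonneg[of "?Z f"] by linarith
qed

text \<open>The embedding asks for five distinct sites even where fewer indices occur. Only those
  that occur have to lie in \<open>I\<close>, so the remaining places can be filled with fresh
  numbers.\<close>

lemma ip_zop_nonneg_distinct:
  assumes "distinct [i, j, k, l]" "s \<notin> {i, j, k, l}"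
  shows "{i, j, k, l} \<subseteq> I \<Longrightarrow> 0 \<le> ip f (zop s i j k l f)"
    and "{i, j, k} \<subseteq> I \<Longrightarrow> 0 \<le> ip f (zop s i i j k f)"
    and "{i, j} \<subseteq> I \<Longrightarrow> 0 \<le> ip f (zop s i i j j f)"
    and "{i, j} \<subseteq> I \<Longrightarrow> 0 \<le> ip f (zop s i i i j f)"
    and "i \<in> I \<Longrightarrow> 0 \<le> ip f (zop s i i i i f)"
proof -
  define e where "e = (\<lambda>a. [s, i, j, k, l] ! a)"
  have inj: "inj_on e {..<5}"
    using assms unfolding e_def by (intro inj_on_nth) auto
  have ev: "e 0 = s" "e 1 = i" "e 2 = j" "e 3 = k" "e 4 = l"
    by (simp_all add: e_def eval_nat_numeral)
  note * = ip_zop_nonneg_pattern[OF inj _ ev(1), of _ _ _ _ f]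
  show "{i, j, k, l} \<subseteq> I \<Longrightarrow> 0 \<le> ip f (zop s i j k l f)" using *[of 1 2 3 4] ev by simp
  show "{i, j, k} \<subseteq> I \<Longrightarrow> 0 \<le> ip f (zop s i i j k f)" using *[of 1 1 2 3] ev by simp
  show "{i, j} \<subseteq> I \<Longrightarrow> 0 \<le> ip f (zop s i i j j f)" using *[of 1 1 2 2] ev by simp
  show "{i, j} \<subseteq> I \<Longrightarrow> 0 \<le> ip f (zop s i i i j f)" using *[of 1 1 1 2] ev by simp
  show "i \<in> I \<Longrightarrow> 0 \<le> ip f (zop s i i i i f)" using *[of 1 1 1 1] ev by simp
qed

lemma fresh_sites:
  assumes "finite F"
  shows "\<exists>x::nat. x \<notin> F"
  using assms ex_new_if_finite infinite_UNIV_nat by blast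

lemma ip_zop_nonneg:
  assumes I: "i \<in> I" "j \<in> I" "k \<in> I" "l \<in> I"
  shows "0 \<le> ip f (zop s i j k l f)"
proof -
  let ?P = "\<lambda>i j k l. 0 \<le> ip f (zop s i j k l f)"
  obtain x where x: "x \<notin> {s, i, j, k, l}" using fresh_sites[of "{s, i, j, k, l}"] by auto
  obtain y where y: "y \<notin> {s, i, j, k, l, x}" using fresh_sites[of "{s, i, j, k, l, x}"] by auto
  obtain z where z: "z \<notin> {s, i, j, k, l, x, y}" using fresh_sites[of "{s, i, j, k, l, x, y}"] by auto
  have 1: "?P a b c d" if "distinct [a, b, c, d]" "{a, b, c, d} \<subseteq> I" for a b c d
    using that s ip_zop_nonneg_distinct(1)[of a b c d f] by blast
  have 2: "?P a a b c" if "distinct [a, b, c]" "{a, b, c} \<subseteq> {i, j, k, l}" for a b c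
    using that I s x ip_zop_nonneg_distinct(2)[of a b c x f] by auto
  have 3: "?P a a b b" "?P a a a b" if "distinct [a, b]" "{a, b} \<subseteq> {i, j, k, l}" for a b
    using that I s x y ip_zop_nonneg_distinct(3,4)[of a b x y f] by auto
  have 4: "?P a a a a" if "a \<in> {i, j, k, l}" for a
    using that I s x y z ip_zop_nonneg_distinct(5)[of a x y z f] by auto
  have w: "?P a b c d = ?P b a c d" "?P a b c d = ?P a c b d" "?P a b c d = ?P a b d c" for a b c d
    using zop_swap[of s a b c d f] by simp_all
  have t2': "?P a b a c" "?P a b c a" "?P b a a c" "?P b a c a" "?P b c a a"
    if "distinct [a, b, c]" "{a, b, c} \<subseteq> {i, j, k, l}" for a b c
    using 2[OF that] w(2)[of a a b c] w(3)[of a b a c] w(1)[of a b a c] w(3)[of b a a c] w(2)[of b a c a] by blast+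
  have t3': "?P a b a b" "?P a b b a" "?P a a b a" "?P a b a a" "?P b a a a" 
    if "distinct [a, b]" "{a, b} \<subseteq> {i, j, k, l}" for a b
    using 3[OF that] w(2)[of a a b b] w(3)[of a b a b] w(3)[of a a a b] w(2)[of a a b a] w(1)[of a b a a] by blast+
  \<comment> \<open>One case for each set partition of the four indices, fifteen in all.\<close>
  have "i \<noteq> j \<Longrightarrow> i \<noteq> k \<Longrightarrow> i \<noteq> l \<Longrightarrow> j \<noteq> k \<Longrightarrow> j \<noteq> l \<Longrightarrow> k \<noteq> l \<Longrightarrow> ?P i j k l"
    using 1 I by simp
  moreover have "i \<noteq> k \<Longrightarrow> i \<noteq> l \<Longrightarrow> k \<noteq> l \<Longrightarrow> ?P i i k l" using 2[of i k l] by simp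
  moreover have "i \<noteq> j \<Longrightarrow> i \<noteq> l \<Longrightarrow> j \<noteq> l \<Longrightarrow> ?P i j i l" using t2'(1)[of i j l] by simp
  moreover have "i \<noteq> j \<Longrightarrow> i \<noteq> k \<Longrightarrow> j \<noteq> k \<Longrightarrow> ?P i j k i" using t2'(2)[of i j k] by simp
  moreover have "j \<noteq> i \<Longrightarrow> j \<noteq> l \<Longrightarrow> i \<noteq> l \<Longrightarrow> ?P i j j l" using t2'(3)[of j i l] by simp
  moreover have "j \<noteq> i \<Longrightarrow> j \<noteq> k \<Longrightarrow> i \<noteq> k \<Longrightarrow> ?P i j k j" using t2'(4)[of j i k] by simp
  moreover have "k \<noteq> i \<Longrightarrow> k \<noteq> j \<Longrightarrow> i \<noteq> j \<Longrightarrow> ?P i j k k" using t2'(5)[of k i j] by simp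
  moreover have "i \<noteq> k \<Longrightarrow> ?P i i k k" using 3(1)[of i k] by simp
  moreover have "i \<noteq> j \<Longrightarrow> ?P i j i j" "i \<noteq> j \<Longrightarrow> ?P i j j i" using t3'(1,2)[of i j] by simp_all
  moreover have "i \<noteq> l \<Longrightarrow> ?P i i i l" using 3(2)[of i l] by simp
  moreover have "i \<noteq> k \<Longrightarrow> ?P i i k i" using t3'(3)[of i k] by simp
  moreover have "i \<noteq> j \<Longrightarrow> ?P i j i i" using t3'(4)[of i j] by simp
  moreover have "j \<noteq> i \<Longrightarrow> ?P i j j j" using t3'(5)[of j i] by simp
  moreover have "?P i i i i" using 4 by simp
  ultimately show ?thesis
    by (smt (verit, best))
qed

lemma octopus_form:
  assumes c: "\<And>i. i \<in> I \<Longrightarrow> 0 \<le> c i"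
  shows "0 \<le> (\<Sum>i\<in>I. \<Sum>j\<in>I. c i * c j * ip f (yop s i j f))"
proof -
  \<comment> \<open>\<open>SS\<close> is invariant under permuting the index slots of
    \<open>g\<close>, so each of the six terms of \<open>zop\<close> contributes the same
    amount.\<close>
  define SS where "SS g = (\<Sum>i\<in>I. \<Sum>j\<in>I. \<Sum>k\<in>I. \<Sum>l\<in>I. c i * c j * c k * c l * g i j k l)" for g :: "nat \<Rightarrow> nat \<Rightarrow> nat \<Rightarrow> nat \<Rightarrow> real"
  have s12: "SS (\<lambda>i j k l. g j i k l) = SS g" for g
    unfolding SS_def by (subst sum.swap) (simp add: mult_ac)
  have s23: "SS (\<lambda>i j k l. g i k j l) = SS g" for g
    unfolding SS_def by (rule sum.cong[OF refl], subst sum.swap) (simp add: mult_ac)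
  have s34: "SS (\<lambda>i j k l. g i j l k) = SS g" for g
    unfolding SS_def by (rule sum.cong[OF refl], rule sum.cong[OF refl], subst sum.swap) (simp add: mult_ac)
  define u where "u i j = ip f (yop s i j f)" for i j
  define v where "v i j k l = ip (yop s i j f) (yop s k l f)" for i j k l
  define q where "q i j k l = 2 * (1 + of_bool (k = l)) * u i j - v i j k l" for i j k l
  have SSadd: "SS (\<lambda>i j k l. g i j k l + h i j k l) = SS g + SS h" for g h
    by (simp add: SS_def distrib_left sum.distrib)
  have p1: "SS (\<lambda>i j k l. q i k j l) = SS q" by (rule s23)
  have p2: "SS (\<lambda>i j k l. q i l j k) = SS q"
    using s34[of "\<lambda>i j k l. q i k j l"] p1 by simp
  have p3: "SS (\<lambda>i j k l. q j l i k) = SS q"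
    using s12[of "\<lambda>i j k l. q i l j k"] p2 by simp
  have p4: "SS (\<lambda>i j k l. q k l i j) = SS q"
    using s23[of "\<lambda>i j k l. q j l i k"] p3 by simp
  have p5: "SS (\<lambda>i j k l. q j k i l) = SS q"
    using s34[of "\<lambda>i j k l. q j l i k"] p3 by simp
  have v_sym: "v i j k l = v k l i j" for i j k l
    by (simp add: v_def ip_commute)
  have z2: "ip f (zop2 s i j k l f) = q i j k l + q k l i j" if "i \<in> I" "j \<in> I" "k \<in> I" "l \<in> I" for i j k l
    using ip_zop2(2)[OF that, of f] v_sym[of i j k l] by (simp add: q_def u_def v_def)
  have z: "ip f (zop s i j k l f) = q i j k l + q k l i j + q i k j l + q j l i k + q i l j k + q j k i l"
    if "i \<in> I" "j \<in> I" "k \<in> I" "l \<in> I" for i j k l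
    using that by (simp add: zop_def[abs_def] ip_simps z2)
  have "0 \<le> SS (\<lambda>i j k l. ip f (zop s i j k l f))"
    unfolding SS_def using c by (intro sum_nonneg mult_nonneg_nonneg ip_zop_nonneg) auto
  also have "\<dots> = SS (\<lambda>i j k l. q i j k l + q k l i j + q i k j l + q j l i k + q i l j k + q j k i l)"
    unfolding SS_def by (intro sum.cong refl) (simp add: z)
  also have "\<dots> = 6 * SS q"
    by (simp add: SSadd p1 p2 p3 p4 p5)
  finally have SSq: "0 \<le> SS q" by simp
  define Y where "Y = (\<lambda>\<sigma>. \<Sum>i\<in>I. \<Sum>j\<in>I. c i * c j * yop s i j f \<sigma>)"
  \<comment> \<open>\<open>U\<close> is the form to be bounded and \<open>K\<close> is
    \<open>C^2 + D\<close>, so that \<open>SS q = 2 * (U * K) - ip Y Y\<close>. \<open>K\<close> is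
    positive unless \<open>c\<close> vanishes on \<open>I\<close>.\<close>
  define U where "U = (\<Sum>i\<in>I. \<Sum>j\<in>I. c i * c j * u i j)"
  define K where "K = (\<Sum>k\<in>I. \<Sum>l\<in>I. c k * c l * (1 + of_bool (k = l)))"
  have SSq_eq: "SS q = SS (\<lambda>i j k l. 2 * (1 + of_bool (k = l)) * u i j) - SS v"
    unfolding SS_def q_def by (simp add: right_diff_distrib sum_subtractf)
  have "SS v = ip Y Y"
    unfolding Y_def ip_sum ip_simps SS_def v_def by (simp add: sum_distrib_left mult_ac)
  moreover have "SS (\<lambda>i j k l. 2 * (1 + of_bool (k = l)) * u i j) = 2 * (U * K)"
    unfolding U_def sum_distrib_right unfolding K_def SS_def sum_distrib_left
    by (intro sum.cong refl) (simp add: mult_ac)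
  ultimately have UK: "0 \<le> U * K" using SSq SSq_eq ip_nonneg[of Y] by simp
  have K0: "0 \<le> c k * c l * (1 + of_bool (k = l))" if "k \<in> I" "l \<in> I" for k l
    using c that by simp
  have "0 \<le> U"
  proof (cases "\<exists>i\<in>I. c i \<noteq> 0")
    case True
    then obtain i where i: "i \<in> I" "c i > 0" using c by force
    have "0 < (\<Sum>l\<in>I. c i * c l * (1 + of_bool (i = l)))"
      using i K0 fin by (intro sum_pos2[of _ i]) auto
    then have "0 < K" unfolding K_def
      using i K0 fin by (intro sum_pos2[of _ i] sum_nonneg) auto
    then show ?thesis using UK by (simp add: zero_le_mult_iff)
  qed (simp add: U_def)
  then show ?thesis by (simp add: U_def u_def)
qed

text \<open>Each transposition is a self-adjoint isometry, so \<open>E i j\<close> is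
  \<open>2 * ip f f\<close> minus twice a correlation, and \<open>2 * ip f (yop s i j f)\<close>
  equals \<open>E s i + E s j - E i j\<close>. Summation turns positivity of the form into an
  inequality between energies.\<close>

lemma octopus:
  fixes f :: "(nat \<Rightarrow> nat) \<Rightarrow> real"
  assumes c: "\<And>i. i \<in> I \<Longrightarrow> 0 \<le> c i"
  shows "(\<Sum>i\<in>I. \<Sum>j\<in>I. c i * c j * (\<Sum>\<sigma>\<in>S. (f \<sigma> - f (tr i j \<circ> \<sigma>))\<^sup>2))
    \<le> 2 * (\<Sum>i\<in>I. c i) * (\<Sum>i\<in>I. c i * (\<Sum>\<sigma>\<in>S. (f \<sigma> - f (tr s i \<circ> \<sigma>))\<^sup>2))"
proof -
  define E where "E i j = (\<Sum>\<sigma>\<in>S. (f \<sigma> - f (tr i j \<circ> \<sigma>))\<^sup>2)" for i j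
  define F where "F i j = ip f (\<lambda>\<sigma>. f (tr i j \<circ> \<sigma>))" for i j
  have E: "E i j = 2 * ip f f - 2 * F i j" if "i \<in> insert s I" "j \<in> insert s I" for i j
  proof -
    have "(\<Sum>\<sigma>\<in>S. (f (tr i j \<circ> \<sigma>))\<^sup>2) = ip f f"
      using transpose_adjoint[OF that, of f "\<lambda>\<sigma>. f (tr i j \<circ> \<sigma>)"]
      by (simp add: ip_def power2_eq_square comp_assoc[symmetric])
    then show ?thesis
      by (simp add: E_def F_def ip_def power2_diff sum.distrib sum_subtractf sum_distrib_left mult.assoc)
        (simp add: power2_eq_square sum_distrib_left)
  qed
  have y: "2 * ip f (yop s i j f) = E s i + E s j - E i j" if "i \<in> I" "j \<in> I" for i j
    using that by (simp add: yop_def[abs_def] ip_simps E F_def[symmetric])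
  have "0 \<le> 2 * (\<Sum>i\<in>I. \<Sum>j\<in>I. c i * c j * ip f (yop s i j f))"
    using octopus_form[OF c, where f = f] by simp
  also have "\<dots> = (\<Sum>i\<in>I. \<Sum>j\<in>I. c i * c j * (E s i + E s j - E i j))"
    unfolding sum_distrib_left by (intro sum.cong refl) (simp add: y[symmetric])
  also have "\<dots> = (\<Sum>i\<in>I. \<Sum>j\<in>I. c i * E s i * c j) + (\<Sum>i\<in>I. \<Sum>j\<in>I. c i * (c j * E s j)) - (\<Sum>i\<in>I. \<Sum>j\<in>I. c i * c j * E i j)"
    by (simp add: algebra_simps sum.distrib sum_subtractf)
  also have "\<dots> = 2 * (\<Sum>i\<in>I. c i) * (\<Sum>i\<in>I. c i * E s i) - (\<Sum>i\<in>I. \<Sum>j\<in>I. c i * c j * E i j)"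
    by (simp add: sum_product[symmetric] sum_distrib_left[symmetric] sum_distrib_right[symmetric])
  finally show ?thesis by (simp add: E_def)
qed

end

section \<open>Hermitian operators on spaces of functions\<close>

definition norm2_on :: "'x set \<Rightarrow> ('x \<Rightarrow> complex) \<Rightarrow> real" where
  "norm2_on D f = (\<Sum>x\<in>D. (cmod (f x))\<^sup>2)"

lemma sum_fun_apply: "(\<Sum>i\<in>I. F i) x = (\<Sum>i\<in>I. F i x)"
  by (induction I rule: infinite_finite_induct) auto

lemma inner_on_self: "inner_on D f f = complex_of_real (norm2_on D f)"
  by (simp add: inner_on_def norm2_on_def complex_norm_square[symmetric])

lemma inner_on_commute: "inner_on D g f = cnj (inner_on D f g)"
  by (simp add: inner_on_def mult.commute)

lemma inner_on_simps:
  "inner_on D (\<lambda>x. f x + f' x) g = inner_on D f g + inner_on D f' g"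
  "inner_on D (\<lambda>x. f x - f' x) g = inner_on D f g - inner_on D f' g"
  "inner_on D (\<lambda>x. c * f x) g = c * inner_on D f g"
  "inner_on D g (\<lambda>x. f x + f' x) = inner_on D g f + inner_on D g f'"
  "inner_on D g (\<lambda>x. f x - f' x) = inner_on D g f - inner_on D g f'"
  "inner_on D g (\<lambda>x. c * f x) = cnj c * inner_on D g f"
  "inner_on D (\<lambda>x. 0) g = 0" "inner_on D g (\<lambda>x. 0) = 0"
  by (simp_all add: inner_on_def algebra_simps sum.distrib sum_subtractf sum_distrib_left)

lemma inner_on_sum:
  "inner_on D (\<lambda>x. \<Sum>i\<in>I. F i x) g = (\<Sum>i\<in>I. inner_on D (F i) g)"
  "inner_on D g (\<lambda>x. \<Sum>i\<in>I. F i x) = (\<Sum>i\<in>I. inner_on D g (F i))"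
  unfolding inner_on_def sum_distrib_left sum_distrib_right cnj_sum by (rule sum.swap)+

lemma norm2_on_nonneg: "0 \<le> norm2_on D f"
  by (simp add: norm2_on_def sum_nonneg)

lemma norm2_on_eq_0:
  assumes "finite D" "f \<in> functions_on D"
  shows "norm2_on D f = 0 \<longleftrightarrow> f = 0"
proof
  assume "norm2_on D f = 0"
  then have "f x = 0" if "x \<in> D" for x
    using assms(1) that by (simp add: norm2_on_def sum_nonneg_eq_0_iff)
  then show "f = 0" using assms(2) by (fastforce simp: functions_on_def)
qed (simp add: norm2_on_def)

lemma norm2_on_pos:
  assumes "finite D" "f \<in> functions_on D" "f \<noteq> 0"
  shows "0 < norm2_on D f"
  using norm2_on_eq_0[OF assms(1,2)] norm2_on_nonneg[of D f] assms(3) by linarith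

lemma norm2_on_scale: "norm2_on D (\<lambda>x. c * f x) = (cmod c)\<^sup>2 * norm2_on D f"
  by (simp add: norm2_on_def norm_mult power_mult_distrib sum_distrib_left)

lemma csubspace_0: "csubspace V \<Longrightarrow> (\<lambda>x. 0) \<in> V"
  using cfun.subspace_0[of V] by (simp add: zero_fun_def)

lemma csubspace_add: "csubspace V \<Longrightarrow> f \<in> V \<Longrightarrow> g \<in> V \<Longrightarrow> (\<lambda>x. f x + g x) \<in> V"
  using cfun.subspace_add[of V f g] by (simp add: plus_fun_def)

lemma csubspace_diff: "csubspace V \<Longrightarrow> f \<in> V \<Longrightarrow> g \<in> V \<Longrightarrow> (\<lambda>x. f x - g x) \<in> V"
  using cfun.subspace_diff[of V f g] by (simp add: fun_diff_def)

lemma csubspace_scale: "csubspace V \<Longrightarrow> f \<in> V \<Longrightarrow> (\<lambda>x. c * f x) \<in> V"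
  by (rule cfun.subspace_scale)

lemma csubspace_sum:
  assumes "csubspace V" "\<And>i. i \<in> I \<Longrightarrow> F i \<in> V"
  shows "(\<lambda>x. \<Sum>i\<in>I. F i x) \<in> V"
proof -
  have "(\<lambda>x. \<Sum>i\<in>I. F i x) = (\<Sum>i\<in>I. F i)" by (rule ext) (simp add: sum_fun_apply)
  then show ?thesis using cfun.subspace_sum[OF assms, of I "\<lambda>i. i"] cfun.subspace_sum[of V I F] assms by simp
qed

lemma csubspaceI:
  assumes "(\<lambda>x. 0) \<in> V" "\<And>f g. f \<in> V \<Longrightarrow> g \<in> V \<Longrightarrow> (\<lambda>x. f x + g x) \<in> V"
    "\<And>c f. f \<in> V \<Longrightarrow> (\<lambda>x. c * f x) \<in> V"
  shows "csubspace V"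
  using assms by (auto simp: cfun.subspace_def zero_fun_def plus_fun_def)

lemma csubspace_functions_on: "csubspace (functions_on D)"
  by (rule csubspaceI) (auto simp: functions_on_def)

lemma clinear_on_add: "clinear_on V T \<Longrightarrow> f \<in> V \<Longrightarrow> g \<in> V \<Longrightarrow> T (\<lambda>x. f x + g x) = (\<lambda>y. T f y + T g y)"
  by (simp add: clinear_on_def)

lemma clinear_on_scale: "clinear_on V T \<Longrightarrow> f \<in> V \<Longrightarrow> T (\<lambda>x. c * f x) = (\<lambda>y. c * T f y)"
  by (simp add: clinear_on_def)

lemma clinear_on_0: "clinear_on V T \<Longrightarrow> csubspace V \<Longrightarrow> T (\<lambda>x. 0) = (\<lambda>y. 0)"
  using clinear_on_scale[of V T "\<lambda>x. 0" 0] csubspace_0[of V] by simp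

lemma clinear_on_diff:
  assumes "clinear_on V T" "csubspace V" "f \<in> V" "g \<in> V"
  shows "T (\<lambda>x. f x - g x) = (\<lambda>y. T f y - T g y)"
  using clinear_on_add[OF assms(1,3), of "\<lambda>x. - 1 * g x"] clinear_on_scale[OF assms(1,4), of "- 1"]
    csubspace_scale[OF assms(2,4), of "- 1"] by simp

lemma clinear_on_sum:
  assumes "clinear_on V T" "csubspace V" "\<And>i. i \<in> I \<Longrightarrow> F i \<in> V"
  shows "T (\<lambda>x. \<Sum>i\<in>I. F i x) = (\<lambda>y. \<Sum>i\<in>I. T (F i) y)"
  using assms(3)
proof (induction I rule: infinite_finite_induct)
  case (insert i I)
  then show ?case
    using clinear_on_add[OF assms(1), of "F i" "\<lambda>x. \<Sum>i\<in>I. F i x"] csubspace_sum[OF assms(2), of I F] by simp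
qed (use clinear_on_0[OF assms(1,2)] in auto)

lemma functions_on_span:
  assumes "finite D"
  shows "functions_on D \<subseteq> cfun.span ((\<lambda>a x. of_bool (x = a)) ` D)"
proof
  fix f :: "'a \<Rightarrow> complex" assume f: "f \<in> functions_on D"
  have "f = (\<Sum>a\<in>D. (\<lambda>x. f a * of_bool (x = a)))"
  proof
    fix x show "f x = (\<Sum>a\<in>D. (\<lambda>x. f a * of_bool (x = a))) x"
      using f assms by (cases "x \<in> D") (auto simp: sum_fun_apply functions_on_def of_bool_def if_distrib[of "\<lambda>c. _ * c"] cong: if_cong)
  qed
  also have "\<dots> \<in> cfun.span ((\<lambda>a x. of_bool (x = a)) ` D)"
    by (intro cfun.span_sum cfun.span_scale cfun.span_base) auto
  finally show "f \<in> cfun.span ((\<lambda>a x. of_bool (x = a)) ` D)" .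
qed

lemma finite_independent:
  assumes "finite D" "cfun.independent B" "B \<subseteq> functions_on D"
  shows "finite B"
  using cfun.independent_span_bound[of "(\<lambda>a x. of_bool (x = a)) ` D" B] assms functions_on_span[OF assms(1)]
  by blast

text \<open>Compactness is used for coefficient vectors with respect to a basis, where the product
  topology on functions is at hand. The sphere is closed in a product of balls and one-point
  sets.\<close>

lemma compact_coefficient_sphere:
  assumes "finite B"
  shows "compact {u :: 'b \<Rightarrow> complex. (\<forall>b. b \<notin> B \<longrightarrow> u b = 0) \<and> (\<Sum>b\<in>B. (cmod (u b))\<^sup>2) = 1}"
proof -
  define K where "K = (PiE UNIV (\<lambda>b :: 'b. if b \<in> B then cball (0 :: complex) 1 else {0}))"
  have "compactin (product_topology (\<lambda>i. euclidean) UNIV) K"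
    unfolding K_def compactin_PiE by auto
  then have K: "compact K"
    by (simp add: euclidean_product_topology)
  have c: "closed {u :: 'b \<Rightarrow> complex. (\<Sum>b\<in>B. (cmod (u b))\<^sup>2) = 1}"
    by (intro closed_Collect_eq continuous_intros continuous_on_product_coordinates)
  have "cmod (u b) \<le> 1" if "(\<Sum>b\<in>B. (cmod (u b))\<^sup>2) = 1" "b \<in> B" for u :: "'b \<Rightarrow> complex" and b
  proof -
    have "(cmod (u b))\<^sup>2 \<le> (\<Sum>b\<in>B. (cmod (u b))\<^sup>2)"
      using that(2) assms by (intro member_le_sum) auto
    then show ?thesis using that(1) by (simp add: abs_square_le_1)
  qed
  then have "{u :: 'b \<Rightarrow> complex. (\<forall>b. b \<notin> B \<longrightarrow> u b = 0) \<and> (\<Sum>b\<in>B. (cmod (u b))\<^sup>2) = 1}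
      = K \<inter> {u. (\<Sum>b\<in>B. (cmod (u b))\<^sup>2) = 1}"
    by (auto simp: K_def PiE_def Pi_def split: if_splits)
  then show ?thesis using compact_Int_closed[OF K c] by simp
qed

locale hermitian =
  fixes D :: "'x set" and V :: "('x \<Rightarrow> complex) set" and T
  assumes fin: "finite D" and sub: "csubspace V" and VD: "V \<subseteq> functions_on D"
    and lin: "clinear_on V T" and TV: "\<And>f. f \<in> V \<Longrightarrow> T f \<in> V"
    and sym: "\<And>f g. f \<in> V \<Longrightarrow> g \<in> V \<Longrightarrow> inner_on D (T f) g = inner_on D f (T g)"
begin

definition eigen :: "real \<Rightarrow> ('x \<Rightarrow> complex) \<Rightarrow> bool" where
  "eigen r f \<longleftrightarrow> f \<in> V \<and> f \<noteq> 0 \<and> T f = (\<lambda>x. of_real r * f x)"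

text \<open>First variation: moving \<open>f\<close> by \<open>t\<close> times
  \<open>h = T f - r f\<close> changes the form of \<open>T - r\<close> by
  \<open>2 * t * s + t^2 * c\<close>, where \<open>s\<close> is the squared norm of
  \<open>h\<close>. For small negative \<open>t\<close> this would be negative unless
  \<open>s = 0\<close>.\<close>

lemma Re_form_nonneg_null:
  assumes r: "\<And>g. g \<in> V \<Longrightarrow> r * norm2_on D g \<le> Re (inner_on D (T g) g)"
    and f: "f \<in> V" "Re (inner_on D (T f) f) \<le> r * norm2_on D f"
  shows "T f = (\<lambda>x. of_real r * f x)"
proof -
  define T' where "T' g = (\<lambda>x. T g x - of_real r * g x)" for g
  have T'V: "T' g \<in> V" if "g \<in> V" for g
    unfolding T'_def using that by (intro csubspace_diff sub TV csubspace_scale)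
  define h where "h = T' f"
  have hV: "h \<in> V" by (simp add: h_def T'V f)
  define s c where "s = norm2_on D h" and "c = Re (inner_on D (T' h) h)"
  have pos: "0 \<le> Re (inner_on D (T' g) g)" if "g \<in> V" for g
    using r[OF that] by (simp add: T'_def inner_on_simps inner_on_self)
  have f0: "Re (inner_on D (T' f) f) \<le> 0"
    using f(2) by (simp add: T'_def inner_on_simps inner_on_self)
  have hf: "inner_on D (T' h) f = inner_on D h h"
  proof -
    have "inner_on D h h = inner_on D h (T' f)" by (simp add: h_def)
    then show ?thesis using sym[OF hV f(1)] by (simp add: T'_def inner_on_simps)
  qed
  have quad: "0 \<le> 2 * t * s + t\<^sup>2 * c" for t :: real
  proof -
    define g where "g = (\<lambda>x. f x + of_real t * h x)"
    have gV: "g \<in> V" unfolding g_def by (intro csubspace_add sub f csubspace_scale hV)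
    have "T g = (\<lambda>y. T f y + of_real t * T h y)"
      unfolding g_def by (simp add: clinear_on_add[OF lin f(1) csubspace_scale[OF sub hV]] clinear_on_scale[OF lin hV])
    then have "T' g = (\<lambda>x. T' f x + of_real t * T' h x)"
      by (simp add: T'_def g_def algebra_simps)
    then have "inner_on D (T' g) g = inner_on D (T' f) f + of_real t * inner_on D (T' f) h
        + of_real t * inner_on D (T' h) f + of_real t * of_real t * inner_on D (T' h) h"
      by (simp add: g_def inner_on_simps algebra_simps)
    then have "Re (inner_on D (T' g) g) = Re (inner_on D (T' f) f) + 2 * t * s + t\<^sup>2 * c"
      unfolding hf h_def[symmetric] by (simp add: inner_on_self s_def c_def power2_eq_square)
    then show ?thesis using pos[OF gV] f0 by linarith
  qed
  have s0: "0 \<le> s" by (simp add: s_def norm2_on_nonneg)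
  have c0: "0 \<le> c" unfolding c_def by (rule pos[OF hV])
  have "s = 0"
  proof (rule ccontr)
    assume "s \<noteq> 0"
    then have sp: "0 < s" using s0 by simp
    \<comment> \<open>The denominator is positive since \<open>c\<close> is nonnegative, and at this
      \<open>t\<close> the linear term outweighs the quadratic one.\<close>
    define t where "t = - s / (c + 1)"
    have "t * (c + 1) = - s" using c0 by (simp add: t_def)
    have "t < 0" using sp c0 by (simp add: t_def divide_neg_pos)
    have "2 * t * s + t\<^sup>2 * c = t * (2 * s + t * c)" by (simp add: power2_eq_square algebra_simps)
    moreover have "t * c = - s - t" using \<open>t * (c + 1) = - s\<close> by (simp add: algebra_simps)
    moreover have "2 * s + (- s - t) > 0" using sp \<open>t < 0\<close> by simp
    ultimately have "2 * t * s + t\<^sup>2 * c < 0" using \<open>t < 0\<close> by (simp add: mult_neg_pos)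
    then show False using quad[of t] by simp
  qed
  then have "h = 0" using norm2_on_eq_0[OF fin, of h] hV VD by (auto simp: s_def)
  then show ?thesis by (auto simp: h_def T'_def fun_eq_iff)
qed

text \<open>The Rayleigh quotient is invariant under scaling and continuous on the compact sphere of
  coefficients, so it has a minimizer, which \<open>Re_form_nonneg_null\<close> turns into an
  eigenvector. The variational bound is returned too, because \<open>psi\<close> and the induction
  on \<open>n\<close> both rely on it.\<close>

lemma min_eigenvector:
  assumes "V \<noteq> {0}"
  obtains f r where "eigen r f" "\<And>g. g \<in> V \<Longrightarrow> r * norm2_on D g \<le> Re (inner_on D (T g) g)"
proof -
  obtain B where B: "B \<subseteq> V" "cfun.independent B" "V \<subseteq> cfun.span B"
    using cfun.maximal_independent_subset by blast
  have finB: "finite B" using finite_independent[OF fin B(2)] B(1) VD by blast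
  define comb where "comb u = (\<lambda>x. \<Sum>b\<in>B. u b * b x)" for u :: "('x \<Rightarrow> complex) \<Rightarrow> complex"
  have combV: "comb u \<in> V" for u
    unfolding comb_def using B(1) by (intro csubspace_sum sub csubspace_scale) auto
  have T_comb: "T (comb u) = (\<lambda>x. \<Sum>b\<in>B. u b * T b x)" for u
  proof -
    have "T (comb u) = (\<lambda>y. \<Sum>b\<in>B. T (\<lambda>x. u b * b x) y)"
      unfolding comb_def by (rule clinear_on_sum[OF lin sub], rule csubspace_scale[OF sub], use B(1) in blast)
    also have "\<dots> = (\<lambda>x. \<Sum>b\<in>B. u b * T b x)"
      using B(1) clinear_on_scale[OF lin] by (intro ext sum.cong refl) auto
    finally show ?thesis .
  qed
  have comb_ex: "\<exists>u. f = comb u \<and> (\<forall>b. b \<notin> B \<longrightarrow> u b = 0)" if "f \<in> V" for f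
  proof -
    have "f \<in> cfun.span B" using B(3) that by (rule subsetD)
    then obtain u where u: "f = (\<Sum>v\<in>B. (\<lambda>x. u v * v x))"
      unfolding cfun.span_finite[OF finB] by (rule rangeE)
    then have "f = comb (\<lambda>b. if b \<in> B then u b else 0)"
      by (auto simp: comb_def fun_eq_iff sum_fun_apply intro!: sum.cong)
    then show ?thesis by (intro exI[of _ "\<lambda>b. if b \<in> B then u b else 0"]) auto
  qed
  define K where "K = {u :: ('x \<Rightarrow> complex) \<Rightarrow> complex. (\<forall>b. b \<notin> B \<longrightarrow> u b = 0) \<and> (\<Sum>b\<in>B. (cmod (u b))\<^sup>2) = 1}"
  have comb_nz: "comb u \<noteq> 0" if "u \<in> K" for u
  proof
    assume 0: "comb u = 0"
    have "(\<Sum>v\<in>B. (\<lambda>x. u v * v x)) = 0"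
      using fun_cong[OF 0] by (simp add: comb_def fun_eq_iff sum_fun_apply)
    then have "\<forall>v\<in>B. u v = 0"
      using B(2) cfun.dependent_finite[OF finB] by blast
    then have "(\<Sum>b\<in>B. (cmod (u b))\<^sup>2) = 0" by simp
    then show False using that by (simp add: K_def)
  qed
  define \<rho> where "\<rho> u = Re (inner_on D (T (comb u)) (comb u)) / norm2_on D (comb u)" for u
  have npos: "0 < norm2_on D (comb u)" if "u \<in> K" for u
    using norm2_on_pos[OF fin _ comb_nz[OF that]] combV VD by blast
  have "continuous_on K \<rho>"
    unfolding \<rho>_def
  proof (intro continuous_on_divide)
    show "continuous_on K (\<lambda>u. Re (inner_on D (T (comb u)) (comb u)))"
      unfolding T_comb unfolding comb_def inner_on_def
      by (intro continuous_intros continuous_on_subset[OF continuous_on_product_coordinates]) auto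
    show "continuous_on K (\<lambda>u. norm2_on D (comb u))"
      unfolding comb_def norm2_on_def
      by (intro continuous_intros continuous_on_subset[OF continuous_on_product_coordinates]) auto
    show "\<forall>u\<in>K. norm2_on D (comb u) \<noteq> 0" using npos by force
  qed
  have normalise: "\<exists>u\<in>K. \<exists>c. c \<noteq> 0 \<and> g = (\<lambda>x. c * comb u x)" if g: "g \<in> V" "g \<noteq> 0" for g
  proof -
    obtain u where u: "g = comb u" "\<forall>b. b \<notin> B \<longrightarrow> u b = 0" using comb_ex[OF g(1)] by blast
    define S where "S = (\<Sum>b\<in>B. (cmod (u b))\<^sup>2)"
    have "S \<noteq> 0"
    proof
      assume "S = 0"
      then have "\<forall>b\<in>B. u b = 0" using finB by (simp add: S_def sum_nonneg_eq_0_iff)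
      then have "g = 0" by (simp add: u(1) comb_def fun_eq_iff)
      then show False using g(2) by simp
    qed
    moreover have "0 \<le> S" by (simp add: S_def sum_nonneg)
    ultimately have S: "0 < S" by simp
    define c where "c = complex_of_real (sqrt S)"
    have c: "c \<noteq> 0" "(cmod c)\<^sup>2 = S" using S by (simp_all add: c_def)
    have "(\<Sum>b\<in>B. (cmod (u b / c))\<^sup>2) = 1"
      using S c(2) by (simp add: norm_divide power_divide S_def[symmetric] sum_divide_distrib[symmetric])
    then have "(\<lambda>b. u b / c) \<in> K" using u(2) by (simp add: K_def)
    moreover have "g = (\<lambda>x. c * comb (\<lambda>b. u b / c) x)"
      using c(1) by (simp add: u(1) comb_def sum_distrib_left)
    ultimately show ?thesis using c(1) by blast
  qed
  have "K \<noteq> {}"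
    using assms normalise csubspace_0[OF sub] by (force simp: zero_fun_def)
  then obtain u where u: "u \<in> K" "\<And>v. v \<in> K \<Longrightarrow> \<rho> u \<le> \<rho> v"
    using continuous_attains_inf[OF compact_coefficient_sphere[OF finB, folded K_def] _ \<open>continuous_on K \<rho>\<close>] by blast
  have bound: "\<rho> u * norm2_on D g \<le> Re (inner_on D (T g) g)" if g: "g \<in> V" for g
  proof (cases "g = 0")
    case True
    then show ?thesis by (simp add: norm2_on_def inner_on_def)
  next
    case False
    then obtain v c where v: "v \<in> K" "c \<noteq> 0" "g = (\<lambda>x. c * comb v x)" using normalise[OF g] by blast
    have "inner_on D (T g) g = of_real ((cmod c)\<^sup>2) * inner_on D (T (comb v)) (comb v)"
      unfolding v(3) clinear_on_scale[OF lin combV] inner_on_simps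
      by (simp add: mult.assoc[symmetric] complex_norm_square[symmetric])
    then have "Re (inner_on D (T g) g) = (cmod c)\<^sup>2 * Re (inner_on D (T (comb v)) (comb v))"
      by (simp add: Re_complex_of_real)
    also have "Re (inner_on D (T (comb v)) (comb v)) = \<rho> v * norm2_on D (comb v)"
      using npos[OF v(1)] by (simp add: \<rho>_def)
    finally have "Re (inner_on D (T g) g) = \<rho> v * norm2_on D g"
      by (simp add: v(3) norm2_on_scale)
    then show ?thesis using u(2)[OF v(1)] norm2_on_nonneg[of D g] by (simp add: mult_right_mono)
  qed
  have "Re (inner_on D (T (comb u)) (comb u)) \<le> \<rho> u * norm2_on D (comb u)"
    using npos[OF u(1)] by (simp add: \<rho>_def)
  then have "eigen (\<rho> u) (comb u)"
    using Re_form_nonneg_null[OF bound combV] comb_nz[OF u(1)] combV by (simp add: eigen_def)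
  then show ?thesis using that bound by blast
qed

lemma eigen_orthogonal:
  assumes "eigen r f" "eigen r' g" "r \<noteq> r'"
  shows "inner_on D f g = 0"
proof -
  have "of_real r * inner_on D f g = of_real r' * inner_on D f g"
    using sym[of f g] assms(1,2) by (simp add: eigen_def inner_on_simps)
  then show ?thesis using assms(3) by simp
qed

text \<open>Eigenvectors to distinct eigenvalues are orthogonal, hence independent in a
  finite-dimensional space. Finiteness gives \<open>Min\<close> in \<open>psi\<close> its
  meaning.\<close>

lemma finite_eigenvalues: "finite {r. \<exists>f. eigen r f}"
proof -
  define F where "F r = (SOME f. eigen r f)" for r
  let ?E = "{r. \<exists>f. eigen r f}"
  have F: "eigen r (F r)" if "r \<in> ?E" for r
    using that someI_ex[of "eigen r"] by (simp add: F_def)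
  have FV: "F ` ?E \<subseteq> functions_on D" using F VD by (auto simp: eigen_def)
  have np: "norm2_on D (F r) \<noteq> 0" if "r \<in> ?E" for r
    using F[OF that] norm2_on_eq_0[OF fin, of "F r"] VD by (auto simp: eigen_def)
  have inj: "inj_on F ?E"
  proof (rule inj_onI, rule ccontr)
    fix r r' assume *: "r \<in> ?E" "r' \<in> ?E" "F r = F r'" "r \<noteq> r'"
    then have "inner_on D (F r) (F r) = 0" using eigen_orthogonal[of r "F r" r' "F r"] F by metis
    then show False using np[OF *(1)] by (simp add: inner_on_self)
  qed
  have "cfun.independent (F ` ?E)"
    unfolding cfun.independent_explicit_module
  proof (intro allI impI)
    fix t u v assume t: "finite t" "t \<subseteq> F ` ?E" "(\<Sum>v\<in>t. (\<lambda>x. u v * v x)) = 0" "v \<in> t"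
    obtain r where r: "r \<in> ?E" "v = F r" using t by blast
    have "(\<lambda>x. \<Sum>v\<in>t. u v * v x) = (\<lambda>x. 0)"
      using fun_cong[OF t(3)] by (simp add: fun_eq_iff sum_fun_apply)
    then have "0 = inner_on D (\<lambda>x. \<Sum>v\<in>t. u v * v x) v" by (simp add: inner_on_simps)
    also have "\<dots> = (\<Sum>v'\<in>t. u v' * inner_on D v' v)" by (simp add: inner_on_sum inner_on_simps)
    also have "\<dots> = (\<Sum>v'\<in>{v}. u v' * inner_on D v' v)"
    proof (rule sum.mono_neutral_right[OF t(1)])
      show "\<forall>v'\<in>t - {v}. u v' * inner_on D v' v = 0"
      proof
        fix v' assume v': "v' \<in> t - {v}"
        then obtain r' where r': "r' \<in> ?E" "v' = F r'" using t(2) by blast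
        then have "r' \<noteq> r" using v' r(2) by auto
        then show "u v' * inner_on D v' v = 0"
          using eigen_orthogonal[OF F[OF r'(1)] F[OF r(1)]] r r' by simp
      qed
    qed (use t(4) in simp)
    finally show "u v = 0" using np[OF r(1)] by (simp add: r(2) inner_on_self)
  qed
  then have "finite (F ` ?E)" using finite_independent[OF fin _ FV] by blast
  then show ?thesis using finite_imageD inj by blast
qed

end

section \<open>The interchange process\<close>

definition SG :: "nat \<Rightarrow> (nat \<Rightarrow> nat) set" where
  "SG n = {\<sigma>. \<sigma> permutes {1..n}}"

lemma finite_SG: "finite (SG n)"
  by (simp add: SG_def finite_permutations)

lemma SG_transpose: "i \<in> {1..n} \<Longrightarrow> j \<in> {1..n} \<Longrightarrow> \<sigma> \<in> SG n \<Longrightarrow> tr i j \<circ> \<sigma> \<in> SG n"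
  by (simp add: SG_def permutes_compose permutes_swap_id)

lemma transpose_comp_transpose: "tr i j \<circ> (tr i j \<circ> \<sigma>) = \<sigma>"
  by (simp add: fun_eq_iff)

lemma sum_involution_swap:
  assumes "\<And>x. x \<in> D \<Longrightarrow> t x \<in> D" "\<And>x. x \<in> D \<Longrightarrow> t (t x) = x"
  shows "(\<Sum>x\<in>D. f (t x)) = (\<Sum>x\<in>D. f x)"
  by (rule sum.reindex_bij_witness[where i = t and j = t]) (use assms in auto)

lemma involution_energy:
  fixes f :: "'x \<Rightarrow> complex"
  assumes "\<And>x. x \<in> D \<Longrightarrow> t x \<in> D" "\<And>x. x \<in> D \<Longrightarrow> t (t x) = x"
  shows "Re (\<Sum>x\<in>D. (f x - f (t x)) * cnj (f x)) = (\<Sum>x\<in>D. (cmod (f x - f (t x)))\<^sup>2) / 2"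
proof -
  have "(\<Sum>x\<in>D. (cmod (f x - f (t x)))\<^sup>2) = (\<Sum>x\<in>D. 2 * Re ((f x - f (t x)) * cnj (f x)) - (cmod (f x))\<^sup>2 + (cmod (f (t x)))\<^sup>2)"
    by (intro sum.cong refl) (simp only: cmod_power2, simp add: power2_eq_square algebra_simps)
  also have "\<dots> = 2 * Re (\<Sum>x\<in>D. (f x - f (t x)) * cnj (f x)) - (\<Sum>x\<in>D. (cmod (f x))\<^sup>2) + (\<Sum>x\<in>D. (cmod (f (t x)))\<^sup>2)"
    by (simp only: sum.distrib sum_subtractf sum_distrib_left Re_sum)
  also have "(\<Sum>x\<in>D. (cmod (f (t x)))\<^sup>2) = (\<Sum>x\<in>D. (cmod (f x))\<^sup>2)"
    by (rule sum_involution_swap[OF assms])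
  finally show ?thesis by simp
qed

text \<open>Energies run over ordered pairs. In the process, \<open>\<sigma>\<close> and
  \<open>tr i j \<circ> \<sigma>\<close> also count the same difference twice; hence the quadratic
  forms are \<open>walk_energy / 2\<close> and \<open>process_energy / 4\<close>.\<close>

definition walk_energy :: "nat \<Rightarrow> (nat \<Rightarrow> nat \<Rightarrow> real) \<Rightarrow> (nat \<Rightarrow> complex) \<Rightarrow> real" where
  "walk_energy n c \<phi> = (\<Sum>i\<in>{1..n}. \<Sum>j\<in>{1..n}. c i j * (cmod (\<phi> i - \<phi> j))\<^sup>2)"

definition edge_energy :: "nat \<Rightarrow> ((nat \<Rightarrow> nat) \<Rightarrow> complex) \<Rightarrow> nat \<Rightarrow> nat \<Rightarrow> real" where
  "edge_energy n f i j = (\<Sum>\<sigma>\<in>SG n. (cmod (f \<sigma> - f (tr i j \<circ> \<sigma>)))\<^sup>2)"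

definition process_energy :: "nat \<Rightarrow> (nat \<Rightarrow> nat \<Rightarrow> real) \<Rightarrow> ((nat \<Rightarrow> nat) \<Rightarrow> complex) \<Rightarrow> real" where
  "process_energy n c f = (\<Sum>i\<in>{1..n}. \<Sum>j\<in>{1..n}. c i j * edge_energy n f i j)"

lemma edge_energy_nonneg: "0 \<le> edge_energy n f i j"
  by (simp add: edge_energy_def sum_nonneg)

lemma edge_energy_refl: "edge_energy n f i i = 0"
  by (simp add: edge_energy_def)

lemma edge_energy_commute: "edge_energy n f i j = edge_energy n f j i"
  by (simp add: edge_energy_def transpose_commute)

lemma process_energy_nonneg: "(\<And>i j. 0 \<le> c i j) \<Longrightarrow> 0 \<le> process_energy n c f"
  by (simp add: process_energy_def sum_nonneg edge_energy_nonneg)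

lemma octopus_complex:
  assumes "\<And>i. 0 \<le> c i"
  shows "(\<Sum>i\<in>{1..n}. \<Sum>j\<in>{1..n}. c i * c j * edge_energy (Suc n) f i j)
    \<le> 2 * (\<Sum>i\<in>{1..n}. c i) * (\<Sum>i\<in>{1..n}. c i * edge_energy (Suc n) f (Suc n) i)"
proof -
  interpret site_sum "SG (Suc n)" "Suc n" "{1..n}"
    by unfold_locales (auto simp: finite_SG intro!: SG_transpose)
  have e: "edge_energy (Suc n) f i j = (\<Sum>\<sigma>\<in>SG (Suc n). (Re (f \<sigma>) - Re (f (tr i j \<circ> \<sigma>)))\<^sup>2)
      + (\<Sum>\<sigma>\<in>SG (Suc n). (Im (f \<sigma>) - Im (f (tr i j \<circ> \<sigma>)))\<^sup>2)" for i j
    by (simp add: edge_energy_def cmod_power2 sum.distrib)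
  show ?thesis
    unfolding e distrib_left sum.distrib
    using octopus[of c "\<lambda>\<sigma>. Re (f \<sigma>)"] octopus[of c "\<lambda>\<sigma>. Im (f \<sigma>)"] assms by simp
qed

text \<open>The fibres are the right cosets of \<open>SG n\<close>. Left multiplication by
  transpositions of \<open>{1..n}\<close> preserves each of them, so on a fibre the process is an
  interchange process on \<open>n\<close> sites.\<close>

lemma SG_Suc_fibre:
  assumes "k \<in> {1..Suc n}"
  shows "bij_betw (\<lambda>\<rho>. \<rho> \<circ> tr k (Suc n)) (SG n) {\<sigma> \<in> SG (Suc n). \<sigma> k = Suc n}"
proof (rule bij_betwI[where g = "\<lambda>\<sigma>. \<sigma> \<circ> tr k (Suc n)"])
  have t: "tr k (Suc n) permutes {1..Suc n}" using assms by (intro permutes_swap_id) auto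
  show "(\<lambda>\<rho>. \<rho> \<circ> tr k (Suc n)) \<in> SG n \<rightarrow> {\<sigma> \<in> SG (Suc n). \<sigma> k = Suc n}"
  proof
    fix \<rho> assume "\<rho> \<in> SG n"
    then have r: "\<rho> permutes {1..n}" by (simp add: SG_def)
    then have "\<rho> permutes {1..Suc n}" by (rule permutes_subset) auto
    moreover have "\<rho> (Suc n) = Suc n" using r by (intro permutes_not_in) auto
    ultimately show "\<rho> \<circ> tr k (Suc n) \<in> {\<sigma> \<in> SG (Suc n). \<sigma> k = Suc n}"
      using t by (simp add: SG_def permutes_compose)
  qed
  show "(\<lambda>\<sigma>. \<sigma> \<circ> tr k (Suc n)) \<in> {\<sigma> \<in> SG (Suc n). \<sigma> k = Suc n} \<rightarrow> SG n"
  proof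
    fix \<sigma> assume s: "\<sigma> \<in> {\<sigma> \<in> SG (Suc n). \<sigma> k = Suc n}"
    then have "\<sigma> \<circ> tr k (Suc n) permutes {1..Suc n}" using t by (simp add: SG_def permutes_compose)
    then have "\<sigma> \<circ> tr k (Suc n) permutes {1..n}"
      by (rule permutes_superset) (use s in \<open>auto simp: not_le less_Suc_eq_le le_Suc_eq\<close>)
    then show "\<sigma> \<circ> tr k (Suc n) \<in> SG n" by (simp add: SG_def)
  qed
qed (auto simp: fun_eq_iff)

lemma sum_SG_fibres:
  "(\<Sum>\<sigma>\<in>SG (Suc n). h \<sigma>) = (\<Sum>k\<in>{1..Suc n}. \<Sum>\<rho>\<in>SG n. h (\<rho> \<circ> tr k (Suc n)))"
proof -
  have "(\<Sum>k\<in>{1..Suc n}. \<Sum>\<rho>\<in>SG n. h (\<rho> \<circ> tr k (Suc n))) = (\<Sum>k\<in>{1..Suc n}. \<Sum>\<sigma>\<in>{\<sigma> \<in> SG (Suc n). \<sigma> k = Suc n}. h \<sigma>)"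
    by (intro sum.cong refl sum.reindex_bij_betw SG_Suc_fibre)
  also have "\<dots> = (\<Sum>k\<in>{1..Suc n}. \<Sum>\<sigma>\<in>{\<sigma> \<in> SG (Suc n). Hilbert_Choice.inv \<sigma> (Suc n) = k}. h \<sigma>)"
    by (intro sum.cong refl Collect_cong) (auto simp: SG_def permutes_inverses permutes_inv_eq)
  also have "\<dots> = (\<Sum>\<sigma>\<in>SG (Suc n). h \<sigma>)"
  proof (rule sum.group)
    show "(\<lambda>\<sigma>. Hilbert_Choice.inv \<sigma> (Suc n)) ` SG (Suc n) \<subseteq> {1..Suc n}"
    proof safe
      fix \<sigma> assume "\<sigma> \<in> SG (Suc n)"
      then show "Hilbert_Choice.inv \<sigma> (Suc n) \<in> {1..Suc n}"
        using permutes_in_image[OF permutes_inv, of \<sigma> "{1..Suc n}" "Suc n"] by (simp add: SG_def)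
    qed
  qed (auto simp: finite_SG)
  finally show ?thesis ..
qed

text \<open>Star-mesh transformation: a star with edge weights \<open>w\<close> and its centre at
  the weighted mean has the energy of the complete graph with weights \<open>w y * w z / W\<close>;
  the half accounts for ordered pairs.\<close>

lemma variance_identity:
  fixes \<phi> :: "'i \<Rightarrow> complex" and w :: "'i \<Rightarrow> real"
  assumes "(\<Sum>i\<in>I. w i) = W" "W \<noteq> 0"
  shows "(\<Sum>y\<in>I. w y * (cmod (\<phi> y - (\<Sum>z\<in>I. of_real (w z) * \<phi> z) / of_real W))\<^sup>2)
    = (\<Sum>y\<in>I. \<Sum>z\<in>I. w y * w z / W * (cmod (\<phi> y - \<phi> z))\<^sup>2) / 2"
proof -
  define a where "a = (\<Sum>z\<in>I. of_real (w z) * \<phi> z) / of_real W"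
  define p q where "p = Re a" and "q = Im a"
  define P Q R where "P = (\<Sum>z\<in>I. w z * Re (\<phi> z))" and "Q = (\<Sum>z\<in>I. w z * Im (\<phi> z))"
    and "R = (\<Sum>z\<in>I. w z * (cmod (\<phi> z))\<^sup>2)"
  have pq: "p = P / W" "q = Q / W"
    by (simp_all add: p_def q_def a_def P_def Q_def Re_divide_of_real Im_divide_of_real)
  have "(\<Sum>y\<in>I. w y * (cmod (\<phi> y - a))\<^sup>2)
      = (\<Sum>y\<in>I. w y * (cmod (\<phi> y))\<^sup>2 - 2 * p * (w y * Re (\<phi> y)) - 2 * q * (w y * Im (\<phi> y)) + (p\<^sup>2 + q\<^sup>2) * w y)"
    by (intro sum.cong refl) (simp only: cmod_power2, simp add: p_def q_def power2_eq_square algebra_simps)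
  also have "\<dots> = R - 2 * p * P - 2 * q * Q + (p\<^sup>2 + q\<^sup>2) * W"
    by (simp only: sum.distrib sum_subtractf sum_distrib_left[symmetric] P_def Q_def R_def assms(1))
  also have "\<dots> = R - (P\<^sup>2 + Q\<^sup>2) / W"
    using assms(2) by (simp add: pq field_simps power2_eq_square)
  finally have 1: "(\<Sum>y\<in>I. w y * (cmod (\<phi> y - a))\<^sup>2) = R - (P\<^sup>2 + Q\<^sup>2) / W" .
  have "(\<Sum>y\<in>I. \<Sum>z\<in>I. w y * w z * (cmod (\<phi> y - \<phi> z))\<^sup>2)
      = (\<Sum>y\<in>I. \<Sum>z\<in>I. (w y * (cmod (\<phi> y))\<^sup>2) * w z + w y * (w z * (cmod (\<phi> z))\<^sup>2)
          - 2 * ((w y * Re (\<phi> y)) * (w z * Re (\<phi> z))) - 2 * ((w y * Im (\<phi> y)) * (w z * Im (\<phi> z))))"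
    by (intro sum.cong refl) (simp only: cmod_power2, simp add: power2_eq_square algebra_simps)
  also have "\<dots> = R * W + W * R - 2 * (P * P) - 2 * (Q * Q)"
    by (simp only: sum.distrib sum_subtractf sum_distrib_left[symmetric] sum_distrib_right[symmetric] P_def Q_def R_def assms(1)[symmetric])
  finally have 2: "(\<Sum>y\<in>I. \<Sum>z\<in>I. w y * w z * (cmod (\<phi> y - \<phi> z))\<^sup>2) = 2 * (R * W - P\<^sup>2 - Q\<^sup>2)"
    by (simp add: power2_eq_square)
  have "(\<Sum>y\<in>I. \<Sum>z\<in>I. w y * w z / W * (cmod (\<phi> y - \<phi> z))\<^sup>2)
     = (\<Sum>y\<in>I. \<Sum>z\<in>I. w y * w z * (cmod (\<phi> y - \<phi> z))\<^sup>2) / W"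
    by (simp add: sum_divide_distrib)
  then show ?thesis unfolding a_def[symmetric] 1 using 2 assms(2) by (simp add: field_simps)
qed

text \<open>
  The inductive step of Caputo, Liggett and Richthammer: eliminating the site \<open>n + 1\<close> from the network
  does not decrease the gap of the random walk.
\<close>

lemma reduced_network_gap:
  fixes c :: "nat \<Rightarrow> nat \<Rightarrow> real" and \<phi> :: "nat \<Rightarrow> complex"
  assumes c: "\<And>i j. 0 \<le> c i j" "\<And>i j. c i j = c j i" and "0 \<le> r"
    and gap: "\<And>\<phi>. (\<Sum>i\<in>{1..Suc n}. \<phi> i) = 0 \<Longrightarrow> r * norm2_on {1..Suc n} \<phi> \<le> walk_energy (Suc n) c \<phi> / 2"
    and W: "W = (\<Sum>y\<in>{1..n}. c (Suc n) y)" "0 < W"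
    and \<phi>: "(\<Sum>i\<in>{1..n}. \<phi> i) = 0"
  shows "r * norm2_on {1..n} \<phi> \<le> walk_energy n (\<lambda>i j. c i j + c (Suc n) i * c (Suc n) j / W) \<phi> / 2"
proof -
  \<comment> \<open>Extend \<open>\<phi>\<close> to the eliminated site by its weighted mean, the
    value of least energy, then subtract the overall mean \<open>m\<close>. Since
    \<open>\<phi>\<close> sums to zero, \<open>m\<close> is \<open>a\<close> divided by the number
    of sites.\<close>
  define a where "a = (\<Sum>z\<in>{1..n}. of_real (c (Suc n) z) * \<phi> z) / of_real W"
  define m where "m = a / of_nat (Suc n)"
  define \<psi> where "\<psi> i = (if i = Suc n then a else \<phi> i) - m" for i
  have set: "{1..Suc n} = insert (Suc n) {1..n}" by auto
  have old: "\<psi> i = \<phi> i - m" if "i \<in> {1..n}" for i using that by (auto simp: \<psi>_def)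
  have new: "\<psi> (Suc n) = a - m" by (simp add: \<psi>_def)
  have "(\<Sum>i\<in>{1..n}. \<psi> i) = (\<Sum>i\<in>{1..n}. \<phi> i - m)" by (intro sum.cong refl old)
  then have "(\<Sum>i\<in>{1..n}. \<psi> i) = - of_nat n * m" using \<phi> by (simp add: sum_subtractf)
  moreover have "m * of_nat (Suc n) = a" by (simp add: m_def del: of_nat_Suc)
  ultimately have "(\<Sum>i\<in>{1..Suc n}. \<psi> i) = 0"
    unfolding set by (simp add: new algebra_simps)
  note g = gap[OF this]
  \<comment> \<open>The extension only gains norm: shifting the mean-zero \<open>\<phi>\<close> by
    \<open>m\<close> adds \<open>n * (cmod m)^2\<close>, and the new site adds its own
    square.\<close>
  have "norm2_on {1..n} \<phi> \<le> norm2_on {1..Suc n} \<psi>"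
  proof -
    have "norm2_on {1..n} \<psi> = (\<Sum>i\<in>{1..n}. (cmod (\<phi> i))\<^sup>2 - 2 * Re (cnj m * \<phi> i) + (cmod m)\<^sup>2)"
      unfolding norm2_on_def by (intro sum.cong refl) (simp only: cmod_power2, simp add: old power2_eq_square algebra_simps)
    also have "\<dots> = norm2_on {1..n} \<phi> - 2 * Re (cnj m * (\<Sum>i\<in>{1..n}. \<phi> i)) + n * (cmod m)\<^sup>2"
      by (simp only: norm2_on_def sum.distrib sum_subtractf sum_distrib_left Re_sum) simp
    finally have "norm2_on {1..n} \<psi> \<ge> norm2_on {1..n} \<phi>" unfolding \<phi> by simp
    moreover have "norm2_on {1..Suc n} \<psi> = (cmod (\<psi> (Suc n)))\<^sup>2 + norm2_on {1..n} \<psi>"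
      unfolding norm2_on_def set by simp
    ultimately show ?thesis using zero_le_power2[of "cmod (\<psi> (Suc n))"] by linarith
  qed
  moreover have "walk_energy (Suc n) c \<psi> = walk_energy n (\<lambda>i j. c i j + c (Suc n) i * c (Suc n) j / W) \<phi>"
  proof -
    define v where "v = (\<Sum>y\<in>{1..n}. c (Suc n) y * (cmod (\<phi> y - a))\<^sup>2)"
    have oo: "cmod (\<psi> i - \<psi> j) = cmod (\<phi> i - \<phi> j)" if "i \<in> {1..n}" "j \<in> {1..n}" for i j
      using that by (simp add: old)
    have on: "cmod (\<psi> i - \<psi> (Suc n)) = cmod (\<phi> i - a)" "cmod (\<psi> (Suc n) - \<psi> i) = cmod (\<phi> i - a)" if "i \<in> {1..n}" for i
      using that by (simp_all add: old new norm_minus_commute)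
    have "walk_energy (Suc n) c \<psi> = (\<Sum>i\<in>{1..n}. \<Sum>j\<in>{1..n}. c i j * (cmod (\<phi> i - \<phi> j))\<^sup>2)
        + (\<Sum>i\<in>{1..n}. c i (Suc n) * (cmod (\<phi> i - a))\<^sup>2) + (\<Sum>i\<in>{1..n}. c (Suc n) i * (cmod (\<phi> i - a))\<^sup>2)"
      unfolding walk_energy_def set by (simp add: sum.distrib oo on)
    also have "(\<Sum>i\<in>{1..n}. c i (Suc n) * (cmod (\<phi> i - a))\<^sup>2) = v"
      unfolding v_def by (simp add: c(2)[of _ "Suc n"])
    also have "(\<Sum>i\<in>{1..n}. c (Suc n) i * (cmod (\<phi> i - a))\<^sup>2) = v" by (simp add: v_def)
    also have "v = (\<Sum>y\<in>{1..n}. \<Sum>z\<in>{1..n}. c (Suc n) y * c (Suc n) z / W * (cmod (\<phi> y - \<phi> z))\<^sup>2) / 2"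
      unfolding v_def a_def by (rule variance_identity) (use W in auto)
    finally show ?thesis by (simp add: walk_energy_def distrib_right sum.distrib)
  qed
  ultimately show ?thesis
    using g mult_left_mono[of "norm2_on {1..n} \<phi>" "norm2_on {1..Suc n} \<psi>" r] \<open>0 \<le> r\<close> by simp
qed

section \<open>The Laplacian of the interchange process and its marginals\<close>

definition mean0 :: "nat \<Rightarrow> ((nat \<Rightarrow> nat) \<Rightarrow> complex) set" where
  "mean0 n = {f \<in> functions_on (SG n). (\<Sum>\<sigma>\<in>SG n. f \<sigma>) = 0}"

definition process_laplacian :: "nat \<Rightarrow> (nat \<Rightarrow> nat \<Rightarrow> real) \<Rightarrow> ((nat \<Rightarrow> nat) \<Rightarrow> complex) \<Rightarrow> (nat \<Rightarrow> nat) \<Rightarrow> complex" where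
  "process_laplacian n c f \<sigma> = (if \<sigma> \<in> SG n then (\<Sum>i\<in>{1..n}. \<Sum>j\<in>{1..n}. of_real (c i j) * (f \<sigma> - f (tr i j \<circ> \<sigma>))) / 2 else 0)"

lemma sum_SG_transpose:
  assumes "i \<in> {1..n}" "j \<in> {1..n}"
  shows "(\<Sum>\<sigma>\<in>SG n. h (tr i j \<circ> \<sigma>)) = (\<Sum>\<sigma>\<in>SG n. h \<sigma>)"
  using SG_transpose[OF assms] by (intro sum_involution_swap[of "SG n" "\<lambda>\<sigma>. tr i j \<circ> \<sigma>"]) (auto simp: transpose_comp_transpose)

lemma inner_process_laplacian:
  "inner_on (SG n) (process_laplacian n c f) g = (\<Sum>i\<in>{1..n}. \<Sum>j\<in>{1..n}. of_real (c i j) * (\<Sum>\<sigma>\<in>SG n. (f \<sigma> - f (tr i j \<circ> \<sigma>)) * cnj (g \<sigma>))) / 2"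
proof -
  have "inner_on (SG n) (process_laplacian n c f) g = (\<Sum>\<sigma>\<in>SG n. \<Sum>i\<in>{1..n}. \<Sum>j\<in>{1..n}. of_real (c i j) * ((f \<sigma> - f (tr i j \<circ> \<sigma>)) * cnj (g \<sigma>)) / 2)"
    unfolding inner_on_def process_laplacian_def
    by (intro sum.cong refl) (simp add: sum_divide_distrib sum_distrib_left sum_distrib_right mult_ac)
  also have "\<dots> = (\<Sum>i\<in>{1..n}. \<Sum>j\<in>{1..n}. \<Sum>\<sigma>\<in>SG n. of_real (c i j) * ((f \<sigma> - f (tr i j \<circ> \<sigma>)) * cnj (g \<sigma>)) / 2)"
    by (subst sum.swap, rule sum.cong[OF refl], subst sum.swap) simp
  finally show ?thesis by (simp add: sum_divide_distrib sum_distrib_left)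
qed

lemma inner_process_laplacian_self: "Re (inner_on (SG n) (process_laplacian n c f) f) = process_energy n c f / 4"
proof -
  define X where "X i j = (\<Sum>\<sigma>\<in>SG n. (f \<sigma> - f (tr i j \<circ> \<sigma>)) * cnj (f \<sigma>))" for i j
  have X: "Re (X i j) = edge_energy n f i j / 2" if "i \<in> {1..n}" "j \<in> {1..n}" for i j
    unfolding X_def edge_energy_def using SG_transpose[OF that]
    by (intro involution_energy[of "SG n" "\<lambda>\<sigma>. tr i j \<circ> \<sigma>"]) (auto simp: transpose_comp_transpose)
  have "Re (inner_on (SG n) (process_laplacian n c f) f) = (\<Sum>i\<in>{1..n}. \<Sum>j\<in>{1..n}. c i j * Re (X i j)) / 2"
    unfolding inner_process_laplacian X_def[symmetric] by (simp add: Re_divide_numeral)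
  also have "\<dots> = (\<Sum>i\<in>{1..n}. \<Sum>j\<in>{1..n}. c i j * (edge_energy n f i j / 2)) / 2"
    by (simp add: X)
  finally show ?thesis by (simp add: process_energy_def sum_divide_distrib)
qed

lemma hermitian_process_laplacian:
  shows "hermitian (SG n) (mean0 n) (process_laplacian n c)"
proof
  show "finite (SG n)" by (rule finite_SG)
  show "csubspace (mean0 n)"
    by (rule csubspaceI) (auto simp: mean0_def functions_on_def sum.distrib sum_distrib_left[symmetric])
  show "mean0 n \<subseteq> functions_on (SG n)" by (auto simp: mean0_def)
  show "clinear_on (mean0 n) (process_laplacian n c)"
    by (auto simp: clinear_on_def process_laplacian_def fun_eq_iff algebra_simps sum.distrib sum_distrib_left sum_subtractf diff_divide_distrib add_divide_distrib sum_divide_distrib)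
  show "process_laplacian n c f \<in> mean0 n" if "f \<in> mean0 n" for f
  proof -
    have "(\<Sum>\<sigma>\<in>SG n. process_laplacian n c f \<sigma>) = inner_on (SG n) (process_laplacian n c f) (\<lambda>_. 1)" by (simp add: inner_on_def)
    also have "\<dots> = 0" unfolding inner_process_laplacian by (simp add: sum_subtractf sum_SG_transpose)
    finally show ?thesis by (simp add: mean0_def functions_on_def process_laplacian_def)
  qed
  show "inner_on (SG n) (process_laplacian n c f) g = inner_on (SG n) f (process_laplacian n c g)" if "f \<in> mean0 n" "g \<in> mean0 n" for f g
  proof -
    have "(\<Sum>\<sigma>\<in>SG n. (f \<sigma> - f (tr i j \<circ> \<sigma>)) * cnj (g \<sigma>)) = cnj (\<Sum>\<sigma>\<in>SG n. (g \<sigma> - g (tr i j \<circ> \<sigma>)) * cnj (f \<sigma>))"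
      if "i \<in> {1..n}" "j \<in> {1..n}" for i j
      using sum_SG_transpose[OF that, of "\<lambda>\<sigma>. f \<sigma> * cnj (g (tr i j \<circ> \<sigma>))"]
      by (simp add: algebra_simps sum_subtractf transpose_comp_transpose)
    moreover have "inner_on (SG n) f (process_laplacian n c g) = cnj (inner_on (SG n) (process_laplacian n c g) f)"
      by (rule inner_on_commute)
    ultimately show ?thesis unfolding inner_process_laplacian by simp
  qed
qed

lemma marginal_transpose:
  assumes "i \<in> {1..n}" "j \<in> {1..n}"
  shows "(\<Sum>\<sigma>\<in>{\<sigma> \<in> SG n. \<sigma> k = y}. f (tr i j \<circ> \<sigma>)) = (\<Sum>\<sigma>\<in>{\<sigma> \<in> SG n. \<sigma> k = tr i j y}. f \<sigma>)"
  using SG_transpose[OF assms]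
  by (intro sum.reindex_bij_witness[where i = "\<lambda>\<sigma>. tr i j \<circ> \<sigma>" and j = "\<lambda>\<sigma>. tr i j \<circ> \<sigma>"])
    (auto simp: transpose_comp_transpose)

lemma sum_transpose_difference:
  fixes \<phi> :: "nat \<Rightarrow> complex"
  assumes "i \<in> {1..n}" "j \<in> {1..n}"
  shows "(\<Sum>y\<in>{1..n}. (cmod (\<phi> y - \<phi> (tr i j y)))\<^sup>2) = 2 * (cmod (\<phi> i - \<phi> j))\<^sup>2"
proof (cases "i = j")
  case False
  have "(\<Sum>y\<in>{1..n}. (cmod (\<phi> y - \<phi> (tr i j y)))\<^sup>2) = (\<Sum>y\<in>{i, j}. (cmod (\<phi> y - \<phi> (tr i j y)))\<^sup>2)"
    by (rule sum.mono_neutral_right) (use assms in \<open>auto simp: transpose_apply_other\<close>)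
  then show ?thesis using False by (simp add: norm_minus_commute)
qed simp

text \<open>Summing over the permutations with \<open>\<sigma> k = y\<close> maps the process to the
  walk of a single particle, so a non-zero marginal of an eigenfunction is an eigenfunction of the
  walk with the same eigenvalue.\<close>

lemma marginal_eigenvalue:
  assumes gap: "\<And>\<phi>. (\<Sum>i\<in>{1..n}. \<phi> i) = 0 \<Longrightarrow> r * norm2_on {1..n} \<phi> \<le> walk_energy n c \<phi> / 2"
    and f: "f \<in> mean0 n" "process_laplacian n c f = (\<lambda>\<sigma>. of_real \<mu> * f \<sigma>)"
    and k: "k \<in> {1..n}" "y \<in> {1..n}" "(\<Sum>\<sigma>\<in>{\<sigma> \<in> SG n. \<sigma> k = y}. f \<sigma>) \<noteq> 0"
  shows "r \<le> \<mu>"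
proof -
  define \<phi> where "\<phi> y = (\<Sum>\<sigma>\<in>{\<sigma> \<in> SG n. \<sigma> k = y}. f \<sigma>)" for y
  have "(\<Sum>i\<in>{1..n}. \<phi> i) = (\<Sum>\<sigma>\<in>SG n. f \<sigma>)"
    unfolding \<phi>_def
  proof (rule sum.group)
    show "(\<lambda>\<sigma>. \<sigma> k) ` SG n \<subseteq> {1..n}" using k(1) permutes_in_image by (fastforce simp: SG_def)
  qed (auto simp: finite_SG)
  then have sum0: "(\<Sum>i\<in>{1..n}. \<phi> i) = 0" using f(1) by (simp add: mean0_def)
  have ev: "of_real \<mu> * \<phi> y = (\<Sum>i\<in>{1..n}. \<Sum>j\<in>{1..n}. of_real (c i j) * (\<phi> y - \<phi> (tr i j y))) / 2" for y
  proof -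
    have "of_real \<mu> * \<phi> y = (\<Sum>\<sigma>\<in>{\<sigma> \<in> SG n. \<sigma> k = y}. process_laplacian n c f \<sigma>)"
      unfolding \<phi>_def f(2) by (simp add: sum_distrib_left)
    also have "\<dots> = (\<Sum>\<sigma>\<in>{\<sigma> \<in> SG n. \<sigma> k = y}. \<Sum>i\<in>{1..n}. \<Sum>j\<in>{1..n}. of_real (c i j) * (f \<sigma> - f (tr i j \<circ> \<sigma>)) / 2)"
      by (intro sum.cong refl) (simp add: process_laplacian_def sum_divide_distrib)
    also have "\<dots> = (\<Sum>i\<in>{1..n}. \<Sum>j\<in>{1..n}. \<Sum>\<sigma>\<in>{\<sigma> \<in> SG n. \<sigma> k = y}. of_real (c i j) * (f \<sigma> - f (tr i j \<circ> \<sigma>)) / 2)"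
      by (subst sum.swap, rule sum.cong[OF refl], subst sum.swap) simp
    also have "\<dots> = (\<Sum>i\<in>{1..n}. \<Sum>j\<in>{1..n}. of_real (c i j) * (\<phi> y - \<phi> (tr i j y)) / 2)"
      by (intro sum.cong refl)
        (simp add: \<phi>_def marginal_transpose sum_subtractf sum_distrib_left[symmetric] sum_divide_distrib[symmetric])
    finally show ?thesis by (simp add: sum_divide_distrib)
  qed
  define X where "X i j = (\<Sum>y\<in>{1..n}. (\<phi> y - \<phi> (tr i j y)) * cnj (\<phi> y))" for i j
  have X: "Re (X i j) = (cmod (\<phi> i - \<phi> j))\<^sup>2" if "i \<in> {1..n}" "j \<in> {1..n}" for i j
  proof -
    have "tr i j y \<in> {1..n}" if "y \<in> {1..n}" for y
      using permutes_in_image[OF permutes_swap_id[OF \<open>i \<in> {1..n}\<close> \<open>j \<in> {1..n}\<close>]] that by (rule iffD2)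
    then have "Re (X i j) = (\<Sum>y\<in>{1..n}. (cmod (\<phi> y - \<phi> (tr i j y)))\<^sup>2) / 2"
      unfolding X_def by (rule involution_energy) (assumption, rule transpose_involutory)
    then show ?thesis unfolding sum_transpose_difference[OF that] by simp
  qed
  have "of_real (\<mu> * norm2_on {1..n} \<phi>) = (\<Sum>y\<in>{1..n}. of_real \<mu> * \<phi> y * cnj (\<phi> y))"
    using inner_on_self[of "{1..n}" \<phi>] by (simp add: inner_on_def sum_distrib_left[symmetric] mult.assoc)
  also have "\<dots> = (\<Sum>y\<in>{1..n}. \<Sum>i\<in>{1..n}. \<Sum>j\<in>{1..n}. of_real (c i j) * ((\<phi> y - \<phi> (tr i j y)) * cnj (\<phi> y)) / 2)"
    unfolding ev by (intro sum.cong refl) (simp only: sum_divide_distrib sum_distrib_right times_divide_eq_left mult.assoc)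
  also have "\<dots> = (\<Sum>i\<in>{1..n}. \<Sum>j\<in>{1..n}. \<Sum>y\<in>{1..n}. of_real (c i j) * ((\<phi> y - \<phi> (tr i j y)) * cnj (\<phi> y)) / 2)"
    by (subst sum.swap, rule sum.cong[OF refl], subst sum.swap) simp
  also have "\<dots> = (\<Sum>i\<in>{1..n}. \<Sum>j\<in>{1..n}. of_real (c i j) * X i j) / 2"
    by (simp add: X_def sum_divide_distrib sum_distrib_left)
  finally have "Re (of_real (\<mu> * norm2_on {1..n} \<phi>)) = (\<Sum>i\<in>{1..n}. \<Sum>j\<in>{1..n}. c i j * Re (X i j)) / 2"
    by (simp only:) (simp add: Re_divide_numeral)
  then have "\<mu> * norm2_on {1..n} \<phi> = walk_energy n c \<phi> / 2" by (simp add: walk_energy_def X)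
  then have le: "r * norm2_on {1..n} \<phi> \<le> \<mu> * norm2_on {1..n} \<phi>" using gap[OF sum0] by simp
  have "(cmod (\<phi> y))\<^sup>2 \<le> norm2_on {1..n} \<phi>"
    unfolding norm2_on_def using k(2) by (intro member_le_sum) auto
  moreover have "0 < (cmod (\<phi> y))\<^sup>2" using k(3) by (simp add: \<phi>_def)
  ultimately have "0 < norm2_on {1..n} \<phi>" by linarith
  then show ?thesis using le by simp
qed

lemma process_energy_cong: "(\<And>\<sigma>. \<sigma> \<in> SG n \<Longrightarrow> f \<sigma> = g \<sigma>) \<Longrightarrow> process_energy n c f = process_energy n c g"
  using SG_transpose by (auto simp: process_energy_def edge_energy_def intro!: sum.cong)

text \<open>For a minimal eigenvector \<open>g\<close>, either some marginal at the last site is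
  non-zero and \<open>\<mu>\<close> is an eigenvalue of the walk, or \<open>g\<close> has mean zero
  on every fibre \<open>\<sigma> k = Suc n\<close>. In the second case the induction hypothesis
  applies on each fibre, for the network with the last site eliminated, and the octopus inequality
  bounds the reduced energy by the original one. The bound \<open>r\<close> stays fixed in the
  induction; \<open>c\<close> and \<open>f\<close> vary.\<close>

theorem aldous_spectral_gap:
  assumes "\<And>i j. 0 \<le> c i j" "\<And>i j. c i j = c j i"
    and "\<And>\<phi>. (\<Sum>i\<in>{1..n}. \<phi> i) = 0 \<Longrightarrow> r * norm2_on {1..n} \<phi> \<le> walk_energy n c \<phi> / 2"
    and "(\<Sum>\<sigma>\<in>SG n. f \<sigma>) = 0"
  shows "r * norm2_on (SG n) f \<le> process_energy n c f / 4"
  using assms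
proof (induction n arbitrary: c f)
  case 0
  have "SG 0 = {id}" by (auto simp: SG_def)
  then show ?case using 0(4) by (simp add: norm2_on_def process_energy_def id_def)
next
  case (Suc n)
  note c = Suc.prems(1,2) and gap = Suc.prems(3)
  let ?N = "Suc n"
  show ?case
  proof (cases "r \<le> 0")
    case True
    then show ?thesis
      using process_energy_nonneg[OF c(1), where n = ?N and f = f] norm2_on_nonneg[of "SG ?N" f]
      by (meson divide_nonneg_nonneg mult_nonpos_nonneg order_trans zero_le_numeral)
  next
    case False
    then have r: "0 < r" by simp
    interpret H: hermitian "SG ?N" "mean0 ?N" "process_laplacian ?N c" by (rule hermitian_process_laplacian)
    define f' where "f' \<sigma> = (if \<sigma> \<in> SG ?N then f \<sigma> else 0)" for \<sigma>
    have f': "f' \<in> mean0 ?N" using Suc.prems(4) by (simp add: mean0_def functions_on_def f'_def)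
    have eq: "norm2_on (SG ?N) f = norm2_on (SG ?N) f'" "process_energy ?N c f = process_energy ?N c f'"
      by (auto simp: norm2_on_def f'_def intro!: process_energy_cong)
    show ?thesis
    proof (cases "mean0 ?N = {0}")
      case True
      then have "f' = 0" using f' by simp
      then show ?thesis unfolding eq using process_energy_nonneg[OF c(1), where n = ?N and f = f'] by (simp add: norm2_on_def)
    next
      case False
      then obtain g \<mu> where g: "H.eigen \<mu> g"
        and min: "\<And>h. h \<in> mean0 ?N \<Longrightarrow> \<mu> * norm2_on (SG ?N) h \<le> Re (inner_on (SG ?N) (process_laplacian ?N c h) h)"
        using H.min_eigenvector by blast
      have gV: "g \<in> mean0 ?N" and g0: "g \<noteq> 0" and ge: "process_laplacian ?N c g = (\<lambda>\<sigma>. of_real \<mu> * g \<sigma>)"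
        using g by (auto simp: H.eigen_def)
      have gpos: "0 < norm2_on (SG ?N) g"
        using norm2_on_pos[OF finite_SG _ g0] gV by (simp add: mean0_def)
      have "r \<le> \<mu>"
      proof (cases "\<exists>k\<in>{1..?N}. (\<Sum>\<sigma>\<in>{\<sigma> \<in> SG ?N. \<sigma> k = ?N}. g \<sigma>) \<noteq> 0")
        case True
        then obtain k where "k \<in> {1..?N}" "(\<Sum>\<sigma>\<in>{\<sigma> \<in> SG ?N. \<sigma> k = ?N}. g \<sigma>) \<noteq> 0" by blast
        moreover have "?N \<in> {1..?N}" by simp
        ultimately show ?thesis using marginal_eigenvalue[OF gap gV ge, of k ?N] by blast
      next
        case False
        define W where "W = (\<Sum>y\<in>{1..n}. c ?N y)"
        have "n \<noteq> 0"
        proof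
          assume "n = 0"
          then have "{1..?N} = {1}" by simp
          then have SG1: "SG ?N = {id}" unfolding SG_def by simp
          have "(\<Sum>\<sigma>\<in>SG ?N. g \<sigma>) = 0" and "g \<in> functions_on {id}"
            using gV unfolding mean0_def SG1 by blast+
          then have "g \<sigma> = 0" for \<sigma>
            unfolding SG1 functions_on_def by (cases "\<sigma> = id") (auto simp: id_def)
          then have "g = 0" by (simp add: fun_eq_iff)
          then show False using g0 by simp
        qed
        \<comment> \<open>Were the last site isolated, the mean-zero function separating it from the
          others would have no energy, against \<open>0 < r\<close>.\<close>
        have "W \<noteq> 0"
        proof
          assume "W = 0"
          then have c0: "c ?N y = 0" "c y ?N = 0" if "y \<in> {1..n}" for y
            using c that by (auto simp: W_def sum_nonneg_eq_0_iff)
          define \<phi> :: "nat \<Rightarrow> complex" where "\<phi> i = (if i = ?N then of_nat n else - 1)" for i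
          have set: "{1..?N} = insert ?N {1..n}" by auto
          have "(\<Sum>i\<in>{1..n}. \<phi> i) = (\<Sum>i\<in>{1..n}. - 1)" by (intro sum.cong) (auto simp: \<phi>_def)
          then have "(\<Sum>i\<in>{1..?N}. \<phi> i) = 0" unfolding set by (simp add: \<phi>_def)
          moreover have "walk_energy ?N c \<phi> = 0"
            unfolding walk_energy_def
          proof (intro sum.neutral ballI)
            fix i j assume "i \<in> {1..?N}" "j \<in> {1..?N}"
            then show "c i j * (cmod (\<phi> i - \<phi> j))\<^sup>2 = 0"
              using c0[of i] c0[of j] unfolding set by (auto simp: \<phi>_def)
          qed
          ultimately have "r * norm2_on {1..?N} \<phi> \<le> 0" using gap[of \<phi>] by simp
          moreover have "(cmod (\<phi> ?N))\<^sup>2 \<le> norm2_on {1..?N} \<phi>"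
            unfolding norm2_on_def by (intro member_le_sum) auto
          moreover have "0 < (cmod (\<phi> ?N))\<^sup>2" using \<open>n \<noteq> 0\<close> by (simp add: \<phi>_def)
          ultimately show False using r by (meson less_le_trans linorder_not_less mult_pos_pos)
        qed
        moreover have "0 \<le> W" unfolding W_def by (intro sum_nonneg c)
        ultimately have W: "0 < W" by simp
        define c' where "c' i j = c i j + c ?N i * c ?N j / W" for i j
        have c'0: "0 \<le> c' i j" for i j using c W by (simp add: c'_def)
        have c's: "c' i j = c' j i" for i j using c(2)[of i j] by (simp add: c'_def)
        have gap': "r * norm2_on {1..n} \<phi> \<le> walk_energy n c' \<phi> / 2" if "(\<Sum>i\<in>{1..n}. \<phi> i) = 0" for \<phi>
          unfolding c'_def using reduced_network_gap[OF c less_imp_le[OF r] gap W_def W that] by simp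
        define gk where "gk k \<rho> = g (\<rho> \<circ> tr k ?N)" for k \<rho>
        have gk: "r * norm2_on (SG n) (gk k) \<le> process_energy n c' (gk k) / 4" if "k \<in> {1..?N}" for k
        proof (rule Suc.IH[OF c'0 c's gap'])
          show "(\<Sum>\<rho>\<in>SG n. gk k \<rho>) = 0"
            using False that sum.reindex_bij_betw[OF SG_Suc_fibre[OF that], of g] by (simp add: gk_def)
        qed
        have "r * norm2_on (SG ?N) g = (\<Sum>k\<in>{1..?N}. r * norm2_on (SG n) (gk k))"
          unfolding norm2_on_def sum_SG_fibres gk_def by (simp only: sum_distrib_left)
        also have "\<dots> \<le> (\<Sum>k\<in>{1..?N}. process_energy n c' (gk k) / 4)" by (intro sum_mono gk)
        also have "\<dots> = (\<Sum>k\<in>{1..?N}. \<Sum>i\<in>{1..n}. \<Sum>j\<in>{1..n}. c' i j * edge_energy n (gk k) i j) / 4"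
          by (simp only: process_energy_def sum_divide_distrib)
        also have "(\<Sum>k\<in>{1..?N}. \<Sum>i\<in>{1..n}. \<Sum>j\<in>{1..n}. c' i j * edge_energy n (gk k) i j)
            = (\<Sum>i\<in>{1..n}. \<Sum>j\<in>{1..n}. \<Sum>k\<in>{1..?N}. c' i j * edge_energy n (gk k) i j)"
          by (subst sum.swap, rule sum.cong[OF refl], subst sum.swap) simp
        also have "\<dots> = (\<Sum>i\<in>{1..n}. \<Sum>j\<in>{1..n}. c' i j * edge_energy ?N g i j)"
          unfolding edge_energy_def sum_SG_fibres gk_def by (simp only: sum_distrib_left comp_assoc)
        also have "\<dots> = (\<Sum>i\<in>{1..n}. \<Sum>j\<in>{1..n}. c i j * edge_energy ?N g i j)
            + (\<Sum>i\<in>{1..n}. \<Sum>j\<in>{1..n}. c ?N i * c ?N j * edge_energy ?N g i j) / W"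
          by (simp add: c'_def distrib_right sum.distrib sum_divide_distrib)
        \<comment> \<open>The octopus inequality, divided by \<open>W\<close>. Its right side is
          exactly the energy of the edges at the last site, each counted in both orders.\<close>
        also have "\<dots> \<le> (\<Sum>i\<in>{1..n}. \<Sum>j\<in>{1..n}. c i j * edge_energy ?N g i j)
            + 2 * (\<Sum>i\<in>{1..n}. c ?N i * edge_energy ?N g ?N i)"
        proof -
          have "(\<Sum>i\<in>{1..n}. \<Sum>j\<in>{1..n}. c ?N i * c ?N j * edge_energy ?N g i j)
              \<le> 2 * (\<Sum>i\<in>{1..n}. c ?N i * edge_energy ?N g ?N i) * W"
            using octopus_complex[of "c ?N" n g, OF c(1)] unfolding W_def by (simp only: mult_ac)
          then show ?thesis by (simp only: add_le_cancel_left pos_divide_le_eq[OF W])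
        qed
        also have "\<dots> = process_energy ?N c g"
        proof -
          have set: "{1..?N} = insert ?N {1..n}" by auto
          have "(\<Sum>i\<in>{1..n}. c i ?N * edge_energy ?N g i ?N) = (\<Sum>i\<in>{1..n}. c ?N i * edge_energy ?N g ?N i)"
            by (intro sum.cong refl) (simp add: c(2)[of _ ?N] edge_energy_commute[of ?N g _ ?N])
          then show ?thesis unfolding process_energy_def set by (simp add: sum.distrib edge_energy_refl)
        qed
        also have "process_energy ?N c g = 4 * (\<mu> * norm2_on (SG ?N) g)"
          using inner_process_laplacian_self[of ?N c g] by (simp add: ge inner_on_simps inner_on_self)
        finally show ?thesis using gpos by simp
      qed
      then have "r * norm2_on (SG ?N) f' \<le> \<mu> * norm2_on (SG ?N) f'"
        by (intro mult_right_mono norm2_on_nonneg)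
      then show ?thesis unfolding eq using min[OF f'] by (simp add: inner_process_laplacian_self)
    qed
  qed
qed

section \<open>Unitary representations\<close>

lemma norm2_diff:
  "norm2_on D (\<lambda>x. f x - g x) = norm2_on D f + norm2_on D g - 2 * Re (inner_on D f g)"
proof -
  have "complex_of_real (norm2_on D (\<lambda>x. f x - g x)) = inner_on D f f - inner_on D f g - cnj (inner_on D f g) + inner_on D g g"
    unfolding inner_on_self[symmetric] inner_on_simps using inner_on_commute[of D g f] by simp
  then have "Re (complex_of_real (norm2_on D (\<lambda>x. f x - g x))) = Re (inner_on D f f - inner_on D f g - cnj (inner_on D f g) + inner_on D g g)"
    by (simp only:)
  then show ?thesis by (simp add: inner_on_self)
qed

lemma norm2_diff_triangle:
  "norm2_on D (\<lambda>x. f x - h x) \<le> 2 * norm2_on D (\<lambda>x. f x - g x) + 2 * norm2_on D (\<lambda>x. g x - h x)"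
proof -
  have "(cmod (f x - h x))\<^sup>2 \<le> 2 * (cmod (f x - g x))\<^sup>2 + 2 * (cmod (g x - h x))\<^sup>2" for x
  proof -
    have "cmod (f x - h x) \<le> cmod (f x - g x) + cmod (g x - h x)"
      using norm_triangle_ineq[of "f x - g x" "g x - h x"] by simp
    then have "(cmod (f x - h x))\<^sup>2 \<le> (cmod (f x - g x) + cmod (g x - h x))\<^sup>2"
      by (intro power_mono) auto
    also have "\<dots> \<le> 2 * (cmod (f x - g x))\<^sup>2 + 2 * (cmod (g x - h x))\<^sup>2"
      using sum_squares_bound[of "cmod (f x - g x)" "cmod (g x - h x)"] by (simp add: power2_sum)
    finally show ?thesis .
  qed
  then have "norm2_on D (\<lambda>x. f x - h x) \<le> (\<Sum>x\<in>D. 2 * (cmod (f x - g x))\<^sup>2 + 2 * (cmod (g x - h x))\<^sup>2)"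
    unfolding norm2_on_def by (intro sum_mono)
  then show ?thesis by (simp add: norm2_on_def sum.distrib sum_distrib_left)
qed

locale fin_rep = group G for G :: "('g, 'm) monoid_scheme" (structure) +
  fixes R :: "('g, 'x) urep"
  assumes finite_carrier: "finite (carrier G)" and unitary: "unitary_rep G R"
begin

abbreviation "V \<equiv> vecs R"
abbreviation "ip \<equiv> inner_on (pts R)"
abbreviation "nsq \<equiv> norm2_on (pts R)"

lemma
  shows finite_pts: "finite (pts R)" and sub_V: "csubspace V" and V_functions: "V \<subseteq> functions_on (pts R)"
    and act_in: "\<And>g f. g \<in> carrier G \<Longrightarrow> f \<in> V \<Longrightarrow> act R g f \<in> V"
    and act_lin: "\<And>g. g \<in> carrier G \<Longrightarrow> clinear_on V (act R g)"
    and act_unitary: "\<And>g f f'. g \<in> carrier G \<Longrightarrow> f \<in> V \<Longrightarrow> f' \<in> V \<Longrightarrow> ip (act R g f) (act R g f') = ip f f'"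
    and act_one: "\<And>f. f \<in> V \<Longrightarrow> act R \<one> f = f"
    and act_mult: "\<And>g h f. g \<in> carrier G \<Longrightarrow> h \<in> carrier G \<Longrightarrow> f \<in> V \<Longrightarrow> act R (g \<otimes> h) f = act R g (act R h f)"
  using unitary by (auto simp: unitary_rep_def)

lemma norm2_eq_0: "f \<in> V \<Longrightarrow> nsq f = 0 \<longleftrightarrow> f = 0"
  using norm2_on_eq_0[OF finite_pts] V_functions by blast

lemma norm2_pos: "f \<in> V \<Longrightarrow> f \<noteq> 0 \<Longrightarrow> 0 < nsq f"
  using norm2_on_pos[OF finite_pts] V_functions by blast

lemma act_act_inv: "g \<in> carrier G \<Longrightarrow> f \<in> V \<Longrightarrow> act R g (act R (inv g) f) = f"
  using act_mult[of g "inv g" f] act_one by simp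

lemma act_adjoint: "g \<in> carrier G \<Longrightarrow> f \<in> V \<Longrightarrow> f' \<in> V \<Longrightarrow> ip (act R g f) f' = ip f (act R (inv g) f')"
  using act_unitary[of g f "act R (inv g) f'"] act_in act_act_inv by simp

lemma norm2_act: "g \<in> carrier G \<Longrightarrow> f \<in> V \<Longrightarrow> nsq (act R g f) = nsq f"
  using act_unitary[of g f f] by (simp add: inner_on_self)

lemma act_0: "g \<in> carrier G \<Longrightarrow> act R g (\<lambda>x. 0) = (\<lambda>x. 0)"
  by (rule clinear_on_0[OF act_lin sub_V])

lemma V_diff: "f \<in> V \<Longrightarrow> g \<in> V \<Longrightarrow> (\<lambda>x. f x - g x) \<in> V"
  by (rule csubspace_diff[OF sub_V])

lemma V_scale: "f \<in> V \<Longrightarrow> (\<lambda>x. c * f x) \<in> V"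
  by (rule csubspace_scale[OF sub_V])

lemma V_sum: "(\<And>i. i \<in> I \<Longrightarrow> F i \<in> V) \<Longrightarrow> (\<lambda>x. \<Sum>i\<in>I. F i x) \<in> V"
  by (rule csubspace_sum[OF sub_V])

definition sum_over :: "'g set \<Rightarrow> ('x \<Rightarrow> complex) \<Rightarrow> 'x \<Rightarrow> complex" where
  "sum_over H f = (\<lambda>x. \<Sum>h\<in>H. act R h f x)"

lemma sum_over_in: "H \<subseteq> carrier G \<Longrightarrow> f \<in> V \<Longrightarrow> sum_over H f \<in> V"
  unfolding sum_over_def by (intro V_sum act_in) auto

lemma act_sum_over:
  assumes "subgroup H G" "f \<in> V" "h \<in> H"
  shows "act R h (sum_over H f) = sum_over H f"
proof -
  interpret H: subgroup H G by fact
  have h: "h \<in> carrier G" using assms(3) H.subset by blast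
  have "act R h (sum_over H f) = (\<lambda>x. \<Sum>k\<in>H. act R h (act R k f) x)"
    unfolding sum_over_def by (rule clinear_on_sum[OF act_lin[OF h] sub_V]) (use assms(2) H.subset act_in in blast)
  also have "\<dots> = (\<lambda>x. \<Sum>k\<in>H. act R (h \<otimes> k) f x)"
    using h assms(2) H.subset act_mult by (intro ext sum.cong refl) auto
  also have "\<dots> = sum_over H f"
    unfolding sum_over_def
  proof
    fix x show "(\<Sum>k\<in>H. act R (h \<otimes> k) f x) = (\<Sum>k\<in>H. act R k f x)"
      by (rule sum.reindex_bij_witness[where i = "\<lambda>k. inv h \<otimes> k" and j = "\<lambda>k. h \<otimes> k"])
        (use assms(3) h H.subset in \<open>auto simp: m_assoc[symmetric] H.m_closed H.m_inv_closed subset_iff\<close>)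
  qed
  finally show ?thesis .
qed

lemma ip_sum_over_fixed:
  assumes "H \<subseteq> carrier G" "f \<in> V" "u \<in> V" "\<And>h. h \<in> H \<Longrightarrow> act R (inv h) u = u"
  shows "ip (sum_over H f) u = of_nat (card H) * ip f u"
proof -
  have "ip (sum_over H f) u = (\<Sum>h\<in>H. ip (act R h f) u)" by (simp add: sum_over_def inner_on_sum)
  also have "\<dots> = (\<Sum>h\<in>H. ip f u)" using assms act_adjoint by (intro sum.cong refl) (auto simp: subset_iff)
  finally show ?thesis by simp
qed

lemma sum_over_carrier_fixed: "f \<in> V \<Longrightarrow> sum_over (carrier G) f \<in> fixed_space G R"
  using act_sum_over[OF subgroup_self] sum_over_in[of "carrier G"] by (simp add: fixed_space_def)

lemma card_carrier_pos: "0 < card (carrier G)"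
  using finite_carrier one_closed card_gt_0_iff by blast

text \<open>\<open>sum_over (carrier G)\<close> is the order of the group times the orthogonal
  projection onto the fixed vectors.\<close>

lemma fixed_perp_iff: "f \<in> fixed_perp G R \<longleftrightarrow> f \<in> V \<and> sum_over (carrier G) f = 0"
proof
  assume f: "f \<in> fixed_perp G R"
  then have fV: "f \<in> V" by (simp add: fixed_perp_def)
  define u where "u = sum_over (carrier G) f"
  have u: "u \<in> fixed_space G R" "u \<in> V"
    using sum_over_carrier_fixed[OF fV] by (auto simp: u_def fixed_space_def)
  have "ip u u = of_nat (card (carrier G)) * ip f u"
    using ip_sum_over_fixed[of "carrier G" f u] fV u by (simp add: u_def fixed_space_def)
  also have "ip f u = 0" using f u(1) by (simp add: fixed_perp_def)
  finally have "nsq u = 0" by (simp add: inner_on_self)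
  then show "f \<in> V \<and> sum_over (carrier G) f = 0" using fV norm2_eq_0[OF u(2)] by (simp add: u_def)
next
  assume f: "f \<in> V \<and> sum_over (carrier G) f = 0"
  have "ip f u = 0" if "u \<in> fixed_space G R" for u
  proof -
    have "of_nat (card (carrier G)) * ip f u = ip (sum_over (carrier G) f) u"
      using ip_sum_over_fixed[of "carrier G" f u] f that by (simp add: fixed_space_def)
    also have "\<dots> = 0" using f by (simp add: inner_on_def)
    finally show ?thesis using card_carrier_pos by simp
  qed
  then show "f \<in> fixed_perp G R" using f by (simp add: fixed_perp_def)
qed

lemma fixed_perp_subset: "fixed_perp G R \<subseteq> V"
  by (auto simp: fixed_perp_def)

lemma csubspace_fixed_perp: "csubspace (fixed_perp G R)"
  using sub_V by (intro csubspaceI)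
    (auto simp: fixed_perp_def inner_on_simps intro: csubspace_0 csubspace_add V_scale)

lemma fixed_perp_nontrivial:
  assumes "V \<noteq> fixed_space G R"
  shows "fixed_perp G R \<noteq> {0}"
proof -
  obtain f where f: "f \<in> V" "f \<notin> fixed_space G R" using assms by (auto simp: fixed_space_def)
  let ?u = "sum_over (carrier G) f"
  define c where "c = 1 / complex_of_nat (card (carrier G))"
  have c: "c * (of_nat (card (carrier G)) * z) = z" for z
    using card_carrier_pos by (simp add: c_def)
  define g where "g = (\<lambda>x. f x - c * ?u x)"
  have u: "?u \<in> V" "\<And>h. h \<in> carrier G \<Longrightarrow> act R h ?u = ?u"
    using sum_over_carrier_fixed[OF f(1)] by (auto simp: fixed_space_def)
  have gV: "g \<in> V" unfolding g_def by (intro V_diff f V_scale u)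
  have "ip g u' = 0" if "u' \<in> fixed_space G R" for u'
    using ip_sum_over_fixed[of "carrier G" f u'] f(1) that
    by (simp add: g_def inner_on_simps fixed_space_def c)
  then have "g \<in> fixed_perp G R" using gV by (simp add: fixed_perp_def)
  moreover have "g \<noteq> 0"
  proof
    assume "g = 0"
    then have "f = (\<lambda>x. c * ?u x)" by (auto simp: g_def fun_eq_iff)
    moreover have "(\<lambda>x. c * ?u x) \<in> fixed_space G R"
      using u clinear_on_scale[OF act_lin u(1)] V_scale[OF u(1)] by (simp add: fixed_space_def)
    ultimately show False using f(2) by metis
  qed
  ultimately show ?thesis by blast
qed

end

section \<open>Laplacians of symmetric weights and their Rayleigh quotients\<close>

locale laplacian_rep = fin_rep +
  fixes w :: "'a \<Rightarrow> real"
  assumes w_sym: "\<And>h. h \<in> carrier G \<Longrightarrow> w (inv h) = w h"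
begin

abbreviation "L \<equiv> laplacian G w R"

lemma laplacian_in: "f \<in> V \<Longrightarrow> L f \<in> V"
  unfolding laplacian_def by (intro V_sum V_scale V_diff act_in)

lemma laplacian_lin: "clinear_on V L"
  unfolding clinear_on_def laplacian_def
proof (intro conjI ballI allI)
  fix f g assume f: "f \<in> V" "g \<in> V"
  show "(\<lambda>x. \<Sum>h\<in>carrier G. complex_of_real (w h) * (f x + g x - act R h (\<lambda>x. f x + g x) x)) =
       (\<lambda>y. (\<Sum>h\<in>carrier G. complex_of_real (w h) * (f y - act R h f y)) +
            (\<Sum>h\<in>carrier G. complex_of_real (w h) * (g y - act R h g y)))"
    unfolding sum.distrib[symmetric] using f clinear_on_add[OF act_lin]
    by (intro ext sum.cong refl) (simp add: algebra_simps)
next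
  fix c f assume f: "f \<in> V"
  show "(\<lambda>x. \<Sum>h\<in>carrier G. complex_of_real (w h) * (c * f x - act R h (\<lambda>x. c * f x) x)) =
       (\<lambda>y. c * (\<Sum>h\<in>carrier G. complex_of_real (w h) * (f y - act R h f y)))"
    unfolding sum_distrib_left using f clinear_on_scale[OF act_lin]
    by (intro ext sum.cong refl) (simp add: algebra_simps)
qed

lemma ip_laplacian: "ip (L f) g = (\<Sum>h\<in>carrier G. of_real (w h) * (ip f g - ip (act R h f) g))"
  by (simp add: laplacian_def inner_on_sum inner_on_simps)

lemma laplacian_sym:
  assumes "f \<in> V" "g \<in> V"
  shows "ip (L f) g = ip f (L g)"
proof -
  have "ip f (L g) = (\<Sum>h\<in>carrier G. of_real (w h) * (ip f g - ip f (act R h g)))"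
    by (simp add: laplacian_def inner_on_sum inner_on_simps)
  also have "\<dots> = (\<Sum>h\<in>carrier G. of_real (w h) * (ip f g - ip f (act R (inv h) g)))"
    by (rule sum.reindex_bij_witness[where i = "\<lambda>h. inv h" and j = "\<lambda>h. inv h"]) (auto simp: w_sym)
  also have "\<dots> = ip (L f) g"
    unfolding ip_laplacian using assms by (intro sum.cong refl) (simp add: act_adjoint)
  finally show ?thesis ..
qed

text \<open>By unitarity \<open>f\<close> and \<open>act R h f\<close> have the same norm, so the
  form is a sum of squared displacements. Gaps are compared through these displacements from here
  on.\<close>

lemma laplacian_form:
  assumes "f \<in> V"
  shows "Re (ip (L f) f) = (\<Sum>h\<in>carrier G. w h * nsq (\<lambda>x. f x - act R h f x)) / 2"
proof -
  have *: "Re (ip f f - ip (act R h f) f) = nsq (\<lambda>x. f x - act R h f x) / 2" if "h \<in> carrier G" for h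
    using norm2_diff[of "pts R" f "act R h f"] inner_on_commute[of "pts R" f "act R h f"] norm2_act[OF that assms]
    by (simp add: inner_on_self)
  have "Re (ip (L f) f) = (\<Sum>h\<in>carrier G. w h * Re (ip f f - ip (act R h f) f))"
    by (simp add: ip_laplacian)
  also have "\<dots> = (\<Sum>h\<in>carrier G. w h * (nsq (\<lambda>x. f x - act R h f x) / 2))"
    by (intro sum.cong refl) (simp only: *)
  finally show ?thesis by (simp add: sum_divide_distrib)
qed

lemma laplacian_fixed_perp:
  assumes "f \<in> fixed_perp G R"
  shows "L f \<in> fixed_perp G R"
proof -
  have "ip (L f) u = 0" if "u \<in> fixed_space G R" for u
  proof -
    have "L u = (\<lambda>x. 0)" using that by (simp add: laplacian_def fixed_space_def)
    then show ?thesis using laplacian_sym[of f u] assms that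
      by (simp add: fixed_perp_def fixed_space_def inner_on_simps)
  qed
  then show ?thesis using assms laplacian_in by (simp add: fixed_perp_def)
qed

lemma hermitian_laplacian: "hermitian (pts R) (fixed_perp G R) L"
proof
  show "clinear_on (fixed_perp G R) L"
    using laplacian_lin fixed_perp_subset unfolding clinear_on_def by blast
  show "inner_on (pts R) (L f) g = inner_on (pts R) f (L g)" if "f \<in> fixed_perp G R" "g \<in> fixed_perp G R" for f g
    using laplacian_sym fixed_perp_subset that by blast
qed (use finite_pts csubspace_fixed_perp fixed_perp_subset V_functions laplacian_fixed_perp in auto)

lemma perp_eigenvalues_eq: "perp_eigenvalues G w R = {r. \<exists>f. hermitian.eigen (fixed_perp G R) L r f}"
  unfolding perp_eigenvalues_def hermitian.eigen_def[OF hermitian_laplacian] by blast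

text \<open>Identifies the \<open>Min\<close> in \<open>psi\<close> with the minimum of the Rayleigh
  quotient on \<open>fixed_perp\<close>, since every eigenvalue is the quotient of its
  eigenvector.\<close>

lemma psi_attained:
  assumes "V \<noteq> fixed_space G R"
  obtains r f where "psi G w R = ereal r" "f \<in> fixed_perp G R" "f \<noteq> 0" "L f = (\<lambda>x. of_real r * f x)"
    "\<And>g. g \<in> fixed_perp G R \<Longrightarrow> r * nsq g \<le> Re (ip (L g) g)"
proof -
  interpret H: hermitian "pts R" "fixed_perp G R" L by (rule hermitian_laplacian)
  obtain f r where f: "H.eigen r f" and b: "\<And>g. g \<in> fixed_perp G R \<Longrightarrow> r * nsq g \<le> Re (ip (L g) g)"
    using H.min_eigenvector[OF fixed_perp_nontrivial[OF assms]] by blast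
  have "Min (perp_eigenvalues G w R) = r"
  proof (rule Min_eqI)
    show "finite (perp_eigenvalues G w R)" unfolding perp_eigenvalues_eq by (rule H.finite_eigenvalues)
    show "r \<in> perp_eigenvalues G w R" unfolding perp_eigenvalues_eq using f by blast
    fix s assume "s \<in> perp_eigenvalues G w R"
    then obtain g where g: "g \<in> fixed_perp G R" "g \<noteq> 0" "L g = (\<lambda>x. of_real s * g x)"
      by (auto simp: perp_eigenvalues_def)
    have "r * nsq g \<le> s * nsq g" using b[OF g(1)] by (simp add: g(3) inner_on_simps inner_on_self)
    moreover have "0 < nsq g" using norm2_pos g fixed_perp_subset by blast
    ultimately show "r \<le> s" by simp
  qed
  then have "psi G w R = ereal r" using assms by (simp add: psi_def)
  then show ?thesis using that f b by (auto simp: H.eigen_def)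
qed

lemma psi_le_rayleigh:
  assumes "f \<in> fixed_perp G R" "f \<noteq> 0" "Re (ip (L f) f) \<le> r * nsq f"
  shows "psi G w R \<le> ereal r"
proof -
  have fV: "f \<in> V" using assms(1) fixed_perp_subset by blast
  have pos: "0 < nsq f" using norm2_pos[OF fV assms(2)] .
  have ne: "V \<noteq> fixed_space G R"
  proof
    assume "V = fixed_space G R"
    then have "ip f f = 0" using assms(1) fV by (simp add: fixed_perp_def)
    then show False using pos by (simp add: inner_on_self)
  qed
  obtain s where s: "psi G w R = ereal s" "s * nsq f \<le> Re (ip (L f) f)"
    using psi_attained[OF ne] assms(1) by metis
  then have "s * nsq f \<le> r * nsq f" using assms(3) by linarith
  then show ?thesis using s(1) pos by simp
qed

end

section \<open>Irreducible representations and isomorphism classes\<close>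

lemma unitary_of_irreducible: "irreducible_rep G R \<Longrightarrow> unitary_rep G R"
  by (simp add: irreducible_rep_def)

lemma irreducibleD:
  assumes "irreducible_rep G R" "csubspace U" "U \<subseteq> vecs R" "\<And>g f. g \<in> carrier G \<Longrightarrow> f \<in> U \<Longrightarrow> act R g f \<in> U"
    "f \<in> U" "f \<noteq> 0"
  shows "U = vecs R"
  using assms unfolding irreducible_rep_def by blast

lemma rep_iso_trans:
  assumes "rep_iso G R S" "rep_iso G S S'"
  shows "rep_iso G R S'"
proof -
  obtain T T' where T: "clinear_on (vecs R) T" "bij_betw T (vecs R) (vecs S)" "\<And>g f. g \<in> carrier G \<Longrightarrow> f \<in> vecs R \<Longrightarrow> T (act R g f) = act S g (T f)"
    and T': "clinear_on (vecs S) T'" "bij_betw T' (vecs S) (vecs S')" "\<And>g f. g \<in> carrier G \<Longrightarrow> f \<in> vecs S \<Longrightarrow> T' (act S g f) = act S' g (T' f)"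
    using assms unfolding rep_iso_def by blast
  have m: "T f \<in> vecs S" if "f \<in> vecs R" for f using T(2) that by (auto simp: bij_betw_def)
  show ?thesis
    unfolding rep_iso_def
  proof (intro exI[of _ "T' \<circ> T"] conjI ballI)
    show "clinear_on (vecs R) (T' \<circ> T)" using T(1) T'(1) m by (simp add: clinear_on_def)
    show "bij_betw (T' \<circ> T) (vecs R) (vecs S')" using T(2) T'(2) by (rule bij_betw_trans)
  qed (use T(3) T'(3) m in auto)
qed

lemma rep_iso_sym:
  assumes "rep_iso G R S" "unitary_rep G R"
  shows "rep_iso G S R"
proof -
  obtain T where T: "clinear_on (vecs R) T" "bij_betw T (vecs R) (vecs S)" "\<And>g f. g \<in> carrier G \<Longrightarrow> f \<in> vecs R \<Longrightarrow> T (act R g f) = act S g (T f)"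
    using assms unfolding rep_iso_def by blast
  have sub: "csubspace (vecs R)" and a: "\<And>g f. g \<in> carrier G \<Longrightarrow> f \<in> vecs R \<Longrightarrow> act R g f \<in> vecs R"
    using assms(2) by (auto simp: unitary_rep_def)
  define J where "J = inv_into (vecs R) T"
  have J: "J f \<in> vecs R" "T (J f) = f" if "f \<in> vecs S" for f
    using T(2) that unfolding J_def bij_betw_def by (auto simp: inv_into_into f_inv_into_f)
  have JT: "J (T f) = f" if "f \<in> vecs R" for f
    using T(2) that by (simp add: J_def bij_betw_def)
  show ?thesis
    unfolding rep_iso_def
  proof (intro exI[of _ J] conjI ballI)
    show "bij_betw J (vecs S) (vecs R)" unfolding J_def by (rule bij_betw_inv_into[OF T(2)])
    show "clinear_on (vecs S) J"
      unfolding clinear_on_def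
    proof (intro conjI ballI allI)
      fix f g assume f: "f \<in> vecs S" "g \<in> vecs S"
      have "T (\<lambda>y. J f y + J g y) = (\<lambda>x. f x + g x)"
        using clinear_on_add[OF T(1) J(1)[OF f(1)] J(1)[OF f(2)]] J(2) f by simp
      then show "J (\<lambda>x. f x + g x) = (\<lambda>y. J f y + J g y)"
        using JT[OF csubspace_add[OF sub J(1)[OF f(1)] J(1)[OF f(2)]]] by simp
    next
      fix c f assume f: "f \<in> vecs S"
      have "T (\<lambda>y. c * J f y) = (\<lambda>x. c * f x)"
        using clinear_on_scale[OF T(1) J(1)[OF f]] J(2) f by simp
      then show "J (\<lambda>x. c * f x) = (\<lambda>y. c * J f y)"
        using JT[OF csubspace_scale[OF sub J(1)[OF f]]] by metis
    qed
    fix g f assume g: "g \<in> carrier G" "f \<in> vecs S"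
    have "T (act R g (J f)) = act S g f" using T(3)[OF g(1) J(1)[OF g(2)]] J(2)[OF g(2)] by simp
    then show "J (act S g f) = act R g (J f)" using JT[OF a[OF g(1) J(1)[OF g(2)]]] by simp
  qed
qed

text \<open>Schur's lemma: kernel and image are invariant subspaces.\<close>

lemma intertwiner_rep_iso:
  assumes R: "irreducible_rep G R" and S: "irreducible_rep G S"
    and T: "clinear_on (vecs R) T" "\<And>f. f \<in> vecs R \<Longrightarrow> T f \<in> vecs S"
      "\<And>g f. g \<in> carrier G \<Longrightarrow> f \<in> vecs R \<Longrightarrow> T (act R g f) = act S g (T f)"
    and nz: "v \<in> vecs R" "T v \<noteq> 0"
  shows "rep_iso G R S"
proof -
  have subR: "csubspace (vecs R)" and aR: "\<And>g f. g \<in> carrier G \<Longrightarrow> f \<in> vecs R \<Longrightarrow> act R g f \<in> vecs R"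
    and subS: "csubspace (vecs S)" and linS: "\<And>g. g \<in> carrier G \<Longrightarrow> clinear_on (vecs S) (act S g)"
    using R S by (auto simp: irreducible_rep_def unitary_rep_def)
  let ?K = "{f \<in> vecs R. T f = 0}"
  have kerK: "csubspace ?K"
    by (rule csubspaceI) (auto simp: zero_fun_def clinear_on_0[OF T(1) subR] clinear_on_add[OF T(1)] clinear_on_scale[OF T(1)]
        csubspace_0[OF subR] csubspace_add[OF subR] csubspace_scale[OF subR])
  have ker: "f = 0" if "f \<in> vecs R" "T f = 0" for f
  proof (rule ccontr)
    assume "f \<noteq> 0"
    then have "?K = vecs R"
      by (intro irreducibleD[OF R kerK, of f])
        (use that T(3) aR clinear_on_0[OF linS subS] in \<open>auto simp: zero_fun_def\<close>)
    then show False using nz by blast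
  qed
  have inj: "inj_on T (vecs R)"
  proof (rule inj_onI)
    fix f g assume fg: "f \<in> vecs R" "g \<in> vecs R" "T f = T g"
    then have "T (\<lambda>x. f x - g x) = 0"
      by (simp add: clinear_on_diff[OF T(1) subR] zero_fun_def)
    then have "(\<lambda>x. f x - g x) = 0" using ker csubspace_diff[OF subR fg(1,2)] by blast
    then show "f = g" by (simp add: fun_eq_iff)
  qed
  have "T ` vecs R = vecs S"
  proof (rule irreducibleD[OF S])
    show "csubspace (T ` vecs R)"
    proof (rule csubspaceI)
      show "(\<lambda>x. 0) \<in> T ` vecs R" using clinear_on_0[OF T(1) subR] csubspace_0[OF subR] by force
      show "(\<lambda>x. f x + g x) \<in> T ` vecs R" if fg: "f \<in> T ` vecs R" "g \<in> T ` vecs R" for f g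
      proof -
        obtain f' g' where fg': "f' \<in> vecs R" "g' \<in> vecs R" "f = T f'" "g = T g'" using fg by blast
        show ?thesis unfolding fg'(3,4) clinear_on_add[OF T(1) fg'(1,2), symmetric]
          by (intro imageI csubspace_add subR fg')
      qed
      show "(\<lambda>x. c * f x) \<in> T ` vecs R" if f: "f \<in> T ` vecs R" for f c
      proof -
        obtain f' where f': "f' \<in> vecs R" "f = T f'" using f by blast
        show ?thesis unfolding f'(2) clinear_on_scale[OF T(1) f'(1), symmetric]
          by (intro imageI csubspace_scale subR f')
      qed
    qed
    show "act S g f \<in> T ` vecs R" if g: "g \<in> carrier G" and f: "f \<in> T ` vecs R" for g f
    proof -
      obtain f' where f': "f' \<in> vecs R" "f = T f'" using f by blast
      show ?thesis unfolding f'(2) T(3)[OF g f'(1), symmetric] by (intro imageI aR g f')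
    qed
  qed (use T(2) nz in auto)
  then have "bij_betw T (vecs R) (vecs S)" using inj by (simp add: bij_betw_def)
  then show ?thesis unfolding rep_iso_def using T by blast
qed

lemma irreducible_fixed_space:
  assumes R: "irreducible_rep G R"
  shows "fixed_space G R = {0} \<or> fixed_space G R = vecs R"
proof -
  have U: "csubspace (vecs R)" "\<And>g. g \<in> carrier G \<Longrightarrow> clinear_on (vecs R) (act R g)"
    using R by (auto simp: irreducible_rep_def unitary_rep_def)
  have sub: "csubspace (fixed_space G R)"
    by (rule csubspaceI) (auto simp: fixed_space_def clinear_on_0[OF U(2) U(1)] clinear_on_add[OF U(2)] clinear_on_scale[OF U(2)]
        csubspace_0[OF U(1)] csubspace_add[OF U(1)] csubspace_scale[OF U(1)])
  show ?thesis
  proof (cases "fixed_space G R = {0}")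
    case False
    then obtain f where "f \<in> fixed_space G R" "f \<noteq> 0"
      using csubspace_0[OF sub] by (auto simp: zero_fun_def)
    then show ?thesis using irreducibleD[OF R sub] by (auto simp: fixed_space_def)
  qed simp
qed

lemma irreducible_trivial_rep: "irreducible_rep G trivial_rep"
proof -
  have "U = {0} \<or> U = functions_on {0}" if U: "csubspace U" "U \<subseteq> functions_on {0}" for U :: "(nat \<Rightarrow> complex) set"
  proof (cases "U = {0}")
    case False
    then obtain f where f: "f \<in> U" "f \<noteq> 0" using csubspace_0[OF U(1)] by (auto simp: zero_fun_def)
    have f0: "f 0 \<noteq> 0"
    proof
      assume "f 0 = 0"
      then have "f x = 0" for x using f(1) U(2) by (cases "x = 0") (auto simp: functions_on_def)
      then show False using f(2) by (simp add: fun_eq_iff)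
    qed
    have "g \<in> U" if "g \<in> functions_on {0}" for g
    proof -
      have "g x = g 0 / f 0 * f x" for x
        using that f0 f(1) U(2) by (cases "x = 0") (auto simp: functions_on_def)
      then have "g = (\<lambda>x. g 0 / f 0 * f x)" by (rule ext)
      then show ?thesis using csubspace_scale[OF U(1) f(1)] by metis
    qed
    then show ?thesis using U(2) by blast
  qed simp
  moreover have "(\<lambda>x. if x = 0 then 1 else 0) \<in> functions_on {0 :: nat}" "(\<lambda>x :: nat. if x = 0 then 1 else 0 :: complex) \<noteq> 0"
    by (auto simp: functions_on_def fun_eq_iff)
  then have "functions_on {0 :: nat} \<noteq> {0}" by blast
  ultimately show ?thesis
    by (simp add: irreducible_rep_def unitary_rep_def trivial_rep_def csubspace_functions_on clinear_on_def)
qed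

lemma rep_iso_trivial:
  fixes R :: "('g, 'x) urep"
  assumes R: "irreducible_rep G R" and f: "f \<in> fixed_space G R" "f \<noteq> 0"
  shows "rep_iso G R trivial_rep"
proof -
  have fix_all: "fixed_space G R = vecs R" using irreducible_fixed_space[OF R] f by blast
  obtain a where a: "f a \<noteq> 0" using f(2) by (auto simp: fun_eq_iff)
  define T where "T g = (\<lambda>m::nat. if m = 0 then g a else 0)" for g :: "'x \<Rightarrow> complex"
  show ?thesis
  proof (rule intertwiner_rep_iso[OF R irreducible_trivial_rep, of T f])
    show "T (act R g h) = act trivial_rep g (T h)" if "g \<in> carrier G" "h \<in> vecs R" for g h
    proof -
      have "act R g h = h" using that fix_all by (auto simp: fixed_space_def)
      then show ?thesis by (simp add: trivial_rep_def)
    qed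
    show "T f \<noteq> 0" using a by (auto simp: T_def fun_eq_iff)
  qed (use f fix_all in \<open>auto simp: T_def clinear_on_def fun_eq_iff trivial_rep_def functions_on_def\<close>)
qed

lemma fixed_space_iso:
  assumes "rep_iso G R S" "unitary_rep G R" "unitary_rep G S" "fixed_space G R = {0}"
  shows "fixed_space G S = {0}"
proof -
  obtain T where T: "clinear_on (vecs R) T" "bij_betw T (vecs R) (vecs S)" "\<And>g f. g \<in> carrier G \<Longrightarrow> f \<in> vecs R \<Longrightarrow> T (act R g f) = act S g (T f)"
    using assms(1) unfolding rep_iso_def by blast
  have subR: "csubspace (vecs R)" and aR: "\<And>g f. g \<in> carrier G \<Longrightarrow> f \<in> vecs R \<Longrightarrow> act R g f \<in> vecs R"
    and subS: "csubspace (vecs S)" and linS: "\<And>g. g \<in> carrier G \<Longrightarrow> clinear_on (vecs S) (act S g)"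
    using assms(2,3) by (auto simp: unitary_rep_def)
  have "f = 0" if f: "f \<in> fixed_space G S" for f
  proof -
    have "f \<in> vecs S" using f by (simp add: fixed_space_def)
    then obtain g where g: "g \<in> vecs R" "f = T g" using T(2) by (auto simp: bij_betw_def)
    have "act R h g = g" if "h \<in> carrier G" for h
    proof -
      have "T (act R h g) = T g" using f g T(3) that by (simp add: fixed_space_def)
      then show ?thesis using T(2) g(1) aR[OF that g(1)] by (auto simp: bij_betw_def dest: inj_onD)
    qed
    then have "g \<in> fixed_space G R" using g(1) by (simp add: fixed_space_def)
    then have "g = (\<lambda>x. 0)" using assms(4) by (simp add: zero_fun_def)
    then show ?thesis using g(2) clinear_on_0[OF T(1) subR] by (simp add: zero_fun_def)
  qed
  moreover have "(\<lambda>x. 0) \<in> fixed_space G S"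
    using csubspace_0[OF subS] clinear_on_0[OF linS subS] by (simp add: fixed_space_def)
  ultimately show ?thesis unfolding zero_fun_def by blast
qed

text \<open>An isomorphism need not be unitary, so orthogonality to fixed vectors is not visibly
  transported. If no non-zero vector is fixed, \<open>fixed_perp\<close> is the whole space and
  linearity suffices.\<close>

lemma perp_eigenvalues_iso:
  assumes iso: "rep_iso G R S" and R: "unitary_rep G R" and S: "unitary_rep G S" and fx: "fixed_space G R = {0}"
  shows "perp_eigenvalues G w R \<subseteq> perp_eigenvalues G w S"
proof
  obtain T where T: "clinear_on (vecs R) T" "bij_betw T (vecs R) (vecs S)" "\<And>g f. g \<in> carrier G \<Longrightarrow> f \<in> vecs R \<Longrightarrow> T (act R g f) = act S g (T f)"
    using iso unfolding rep_iso_def by blast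
  have subR: "csubspace (vecs R)" and aR: "\<And>g f. g \<in> carrier G \<Longrightarrow> f \<in> vecs R \<Longrightarrow> act R g f \<in> vecs R"
    using R by (auto simp: unitary_rep_def)
  have fixS: "fixed_space G S = {0}" by (rule fixed_space_iso[OF iso R S fx])
  fix r assume "r \<in> perp_eigenvalues G w R"
  then obtain f where f: "f \<in> vecs R" "f \<noteq> 0" "laplacian G w R f = (\<lambda>x. of_real r * f x)"
    by (auto simp: perp_eigenvalues_def fixed_perp_def)
  have TS: "T f \<in> vecs S" using T(2) f(1) by (auto simp: bij_betw_def)
  have T0: "T (\<lambda>x. 0) = (\<lambda>x. 0)" by (rule clinear_on_0[OF T(1) subR])
  have "T f \<noteq> 0"
  proof
    assume "T f = 0"
    then have "T f = T (\<lambda>x. 0)" using T0 by (simp add: zero_fun_def)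
    then have "f = (\<lambda>x. 0)" using T(2) f(1) csubspace_0[OF subR] by (auto simp: bij_betw_def dest: inj_onD)
    then show False using f(2) by (simp add: zero_fun_def)
  qed
  moreover have "T f \<in> fixed_perp G S"
    using TS by (simp add: fixed_perp_def fixS inner_on_def)
  moreover have "laplacian G w S (T f) = (\<lambda>x. of_real r * T f x)"
  proof -
    have d: "(\<lambda>x. f x - act R h f x) \<in> vecs R" if "h \<in> carrier G" for h
      by (intro csubspace_diff subR f aR that)
    have "T (laplacian G w R f) = (\<lambda>y. \<Sum>h\<in>carrier G. T (\<lambda>x. of_real (w h) * (f x - act R h f x)) y)"
      unfolding laplacian_def by (rule clinear_on_sum[OF T(1) subR], rule csubspace_scale[OF subR], rule d)
    also have "\<dots> = laplacian G w S (T f)"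
      unfolding laplacian_def
      using clinear_on_scale[OF T(1) d] clinear_on_diff[OF T(1) subR f(1) aR[OF _ f(1)]] T(3)[OF _ f(1)]
      by (intro ext sum.cong refl) auto
    finally show ?thesis using f(3) clinear_on_scale[OF T(1) f(1)] by simp
  qed
  ultimately show "r \<in> perp_eigenvalues G w S" by (auto simp: perp_eigenvalues_def)
qed

lemma psi_iso:
  assumes iso: "rep_iso G R S" and R: "irreducible_rep G R" and S: "irreducible_rep G S" and fx: "fixed_space G R = {0}"
  shows "psi G w R = psi G w S"
proof -
  note u = unitary_of_irreducible[OF R] unitary_of_irreducible[OF S]
  have fixS: "fixed_space G S = {0}" by (rule fixed_space_iso[OF iso u fx])
  have "perp_eigenvalues G w R = perp_eigenvalues G w S"
    using perp_eigenvalues_iso[OF iso u fx] perp_eigenvalues_iso[OF rep_iso_sym[OF iso u(1)] u(2) u(1) fixS] by blast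
  moreover have "vecs R \<noteq> fixed_space G R" "vecs S \<noteq> fixed_space G S"
    using R S fx fixS by (auto simp: irreducible_rep_def)
  ultimately show ?thesis by (simp add: psi_def)
qed

lemma irreducible_rep_iso_unitary:
  assumes R: "irreducible_rep G R" and S: "unitary_rep G S" and iso: "rep_iso G R S"
  shows "irreducible_rep G S"
proof -
  obtain T where T: "clinear_on (vecs R) T" "bij_betw T (vecs R) (vecs S)" "\<And>g f. g \<in> carrier G \<Longrightarrow> f \<in> vecs R \<Longrightarrow> T (act R g f) = act S g (T f)"
    using iso unfolding rep_iso_def by blast
  have subR: "csubspace (vecs R)" and aR: "\<And>g f. g \<in> carrier G \<Longrightarrow> f \<in> vecs R \<Longrightarrow> act R g f \<in> vecs R"
    using R by (auto simp: irreducible_rep_def unitary_rep_def)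
  have T0: "T (\<lambda>x. 0) = (\<lambda>x. 0)" by (rule clinear_on_0[OF T(1) subR])
  have Tz: "T f = 0 \<longleftrightarrow> f = 0" if "f \<in> vecs R" for f
    using T(2) T0 that csubspace_0[OF subR] unfolding bij_betw_def zero_fun_def by (metis inj_onD)
  have img: "T ` vecs R = vecs S" using T(2) by (simp add: bij_betw_def)
  have "vecs S \<noteq> {0}"
  proof -
    obtain f where "f \<in> vecs R" "f \<noteq> 0"
      using R csubspace_0[OF subR] by (auto simp: irreducible_rep_def zero_fun_def)
    then show ?thesis using Tz img by blast
  qed
  moreover have "U = {0} \<or> U = vecs S"
    if U: "csubspace U" "U \<subseteq> vecs S" "\<forall>g\<in>carrier G. act S g ` U \<subseteq> U" for U
  proof (cases "U = {0}")
    case False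
    then obtain f where f: "f \<in> U" "f \<noteq> 0" using csubspace_0[OF U(1)] by (auto simp: zero_fun_def)
    let ?U = "{f \<in> vecs R. T f \<in> U}"
    obtain f' where f': "f' \<in> vecs R" "f = T f'" using f(1) U(2) img by blast
    have "?U = vecs R"
    proof (rule irreducibleD[OF R])
      show "csubspace ?U"
        by (rule csubspaceI) (auto simp: T0 clinear_on_add[OF T(1)] clinear_on_scale[OF T(1)]
          csubspace_0[OF subR] csubspace_add[OF subR] csubspace_scale[OF subR]
          csubspace_0[OF U(1)] csubspace_add[OF U(1)] csubspace_scale[OF U(1)])
      show "act R g f \<in> ?U" if "g \<in> carrier G" "f \<in> ?U" for g f
        using that U(3) T(3) aR by auto
      show "f' \<in> ?U" "f' \<noteq> 0" using f f' Tz by auto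
    qed auto
    then have "T f \<in> U" if "f \<in> vecs R" for f using that by blast
    then have "vecs S \<subseteq> U" unfolding img[symmetric] by (rule image_subsetI)
    then show ?thesis using U(2) by simp
  qed simp
  ultimately show ?thesis using S by (simp add: irreducible_rep_def)
qed

text \<open>Relabel the points by an injection into the natural numbers. This gives representations
  on other point sets, such as the induced ones, a non-empty class.\<close>

lemma nat_model_exists:
  fixes R :: "('g, 'x) urep"
  assumes R: "irreducible_rep G R"
  shows "\<exists>S :: ('g, nat) urep. irreducible_rep G S \<and> rep_iso G R S"
proof -
  have u: "unitary_rep G R" by (rule unitary_of_irreducible[OF R])
  then have fin: "finite (pts R)" and subR: "csubspace (vecs R)" and VD: "vecs R \<subseteq> functions_on (pts R)"
    and aR: "\<And>g f. g \<in> carrier G \<Longrightarrow> f \<in> vecs R \<Longrightarrow> act R g f \<in> vecs R"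
    and lR: "\<And>g. g \<in> carrier G \<Longrightarrow> clinear_on (vecs R) (act R g)"
    by (auto simp: unitary_rep_def)
  obtain e :: "'x \<Rightarrow> nat" where e: "inj_on e (pts R)" using finite_imp_inj_to_nat_seg[OF fin] by blast
  define push where "push f = (\<lambda>m. if m \<in> e ` pts R then f (inv_into (pts R) e m) else 0)" for f :: "'x \<Rightarrow> complex"
  define pull where "pull F = (\<lambda>x. if x \<in> pts R then F (e x) else 0)" for F :: "nat \<Rightarrow> complex"
  have pp: "pull (push f) = f" if "f \<in> vecs R" for f
    using that VD e by (auto simp: pull_def push_def functions_on_def fun_eq_iff)
  define S where "S = \<lparr>pts = e ` pts R, vecs = push ` vecs R, act = (\<lambda>g F. push (act R g (pull F)))\<rparr>"
  have lin: "clinear_on X push" for X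
    by (auto simp: clinear_on_def push_def)
  have ip: "inner_on (e ` pts R) (push f) (push g) = inner_on (pts R) f g" for f g
    unfolding inner_on_def by (subst sum.reindex[OF e]) (simp add: push_def inv_into_f_f[OF e])
  have bij: "bij_betw push (vecs R) (vecs S)"
    using pp by (intro bij_betwI[where g = pull]) (auto simp: S_def)
  have act: "push (act R g f) = act S g (push f)" if "f \<in> vecs R" for g f
    using pp[OF that] by (simp add: S_def)
  have p0: "push (\<lambda>x. 0) = (\<lambda>x. 0)" by (simp add: push_def)
  have padd: "push (\<lambda>x. f x + g x) = (\<lambda>m. push f m + push g m)" for f g by (auto simp: push_def)
  have pscale: "push (\<lambda>x. c * f x) = (\<lambda>m. c * push f m)" for c f by (auto simp: push_def)
  have vS: "vecs S = push ` vecs R" by (simp add: S_def)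
  have "unitary_rep G S"
    unfolding unitary_rep_def
  proof (intro conjI ballI)
    show "finite (pts S)" using fin by (simp add: S_def)
    show "csubspace (vecs S)"
    proof (rule csubspaceI)
      show "(\<lambda>x. 0) \<in> vecs S" using csubspace_0[OF subR] p0 unfolding vS by force
      show "(\<lambda>x. F x + F' x) \<in> vecs S" if F: "F \<in> vecs S" "F' \<in> vecs S" for F F'
      proof -
        obtain f f' where f: "f \<in> vecs R" "f' \<in> vecs R" "F = push f" "F' = push f'" using F by (auto simp: vS)
        show ?thesis unfolding f(3,4) padd[symmetric] using csubspace_add[OF subR f(1,2)] by (simp add: vS)
      qed
      show "(\<lambda>x. c * F x) \<in> vecs S" if F: "F \<in> vecs S" for F c
      proof -
        obtain f where f: "f \<in> vecs R" "F = push f" using F by (auto simp: vS)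
        show ?thesis unfolding f(2) pscale[symmetric] using csubspace_scale[OF subR f(1)] by (simp add: vS)
      qed
    qed
    show "vecs S \<subseteq> functions_on (pts S)" by (auto simp: S_def push_def functions_on_def)
    show "act S g \<in> vecs S \<rightarrow> vecs S" if g: "g \<in> carrier G" for g
      using aR[OF g] act[symmetric] by (auto simp: vS)
    show "inner_on (pts S) (act S g F) (act S g F') = inner_on (pts S) F F'"
      if g: "g \<in> carrier G" and F: "F \<in> vecs S" "F' \<in> vecs S" for g F F'
    proof -
      obtain f f' where f: "f \<in> vecs R" "f' \<in> vecs R" "F = push f" "F' = push f'" using F by (auto simp: vS)
      have "inner_on (pts S) (push h) (push k) = inner_on (pts R) h k" for h k using ip by (simp add: S_def)
      then show ?thesis unfolding f(3,4) act[OF f(1), symmetric] act[OF f(2), symmetric]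
        using u g f by (simp add: unitary_rep_def)
    qed
    show "act S \<one>\<^bsub>G\<^esub> F = F" if F: "F \<in> vecs S" for F
      using F u act[symmetric] by (auto simp: vS unitary_rep_def)
    show "act S (g \<otimes>\<^bsub>G\<^esub> h) F = act S g (act S h F)" if g: "g \<in> carrier G" "h \<in> carrier G" and F: "F \<in> vecs S" for g h F
    proof -
      obtain f where f: "f \<in> vecs R" "F = push f" using F by (auto simp: vS)
      show ?thesis unfolding f(2) act[OF f(1), symmetric] act[OF aR[OF g(2) f(1)], symmetric]
        using u g f by (simp add: unitary_rep_def)
    qed
    show "clinear_on (vecs S) (act S g)" if g: "g \<in> carrier G" for g
      unfolding clinear_on_def
    proof (intro conjI ballI allI)
      fix F F' assume F: "F \<in> vecs S" "F' \<in> vecs S"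
      then obtain f f' where f: "f \<in> vecs R" "f' \<in> vecs R" "F = push f" "F' = push f'" by (auto simp: vS)
      show "act S g (\<lambda>x. F x + F' x) = (\<lambda>y. act S g F y + act S g F' y)"
        unfolding f(3,4) padd[symmetric] act[OF f(1), symmetric] act[OF f(2), symmetric] act[OF csubspace_add[OF subR f(1,2)], symmetric]
          clinear_on_add[OF lR[OF g] f(1,2)] ..
    next
      fix c F assume F: "F \<in> vecs S"
      then obtain f where f: "f \<in> vecs R" "F = push f" by (auto simp: vS)
      show "act S g (\<lambda>x. c * F x) = (\<lambda>y. c * act S g F y)"
        unfolding f(2) pscale[symmetric] act[OF f(1), symmetric] act[OF csubspace_scale[OF subR f(1)], symmetric]
          clinear_on_scale[OF lR[OF g] f(1)] ..
    qed
  qed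
  moreover have "rep_iso G R S"
    unfolding rep_iso_def using lin bij act by blast
  ultimately show ?thesis using irreducible_rep_iso_unitary[OF R] by blast
qed

lemma iso_class_eq:
  assumes R: "irreducible_rep G R" and S: "irreducible_rep G S" and iso: "rep_iso G R S"
  shows "iso_class G R = iso_class G S"
proof -
  have "rep_iso G R S' \<longleftrightarrow> rep_iso G S S'" for S' :: "('a, nat) urep"
    using rep_iso_trans[OF rep_iso_sym[OF iso unitary_of_irreducible[OF R]], of S'] rep_iso_trans[OF iso, of S'] by blast
  then show ?thesis by (simp add: iso_class_def)
qed

text \<open>Two classes could also agree by being empty; the model over \<open>nat\<close> rules
  this out and serves as the common member.\<close>

lemma iso_class_eqD:
  fixes R :: "('g, 'x) urep" and S :: "('g, 'y) urep"
  assumes R: "irreducible_rep G R" and S: "irreducible_rep G S" and eq: "iso_class G R = iso_class G S"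
  shows "rep_iso G R S"
proof -
  obtain R' :: "('g, nat) urep" where R': "irreducible_rep G R'" "rep_iso G R R'" using nat_model_exists[OF R] by blast
  then have "R' \<in> iso_class G S" using eq by (auto simp: iso_class_def)
  then have "rep_iso G S R'" by (simp add: iso_class_def)
  then show ?thesis using rep_iso_trans[OF R'(2)] rep_iso_sym[OF _ unitary_of_irreducible[OF S]] by blast
qed

lemma iso_class_in_Irr:
  fixes R :: "('g, 'x) urep"
  assumes R: "irreducible_rep G R"
  shows "iso_class G R \<in> Irr G"
proof -
  obtain S :: "('g, nat) urep" where S: "irreducible_rep G S" "rep_iso G R S" using nat_model_exists[OF R] by blast
  have "iso_class G R = iso_class G S" by (rule iso_class_eq[OF R S])
  also have "\<dots> \<in> Irr G"
    unfolding Irr_def iso_class_def quotient_def using S(1) by (intro UN_I[of S]) auto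
  finally show ?thesis .
qed

lemma Irr_cases:
  fixes C :: "('g, nat) urep set"
  assumes "C \<in> Irr G"
  obtains R :: "('g, nat) urep" where "irreducible_rep G R" "C = iso_class G R"
proof -
  obtain R :: "('g, nat) urep" where "irreducible_rep G R" "C = {S. irreducible_rep G S \<and> rep_iso G R S}"
    using assms by (auto simp: Irr_def quotient_def)
  then show ?thesis using that by (simp add: iso_class_def)
qed

text \<open>The arbitrary representative in \<open>psi_class\<close> is isomorphic to
  \<open>R\<close>, and \<open>psi\<close> agrees on isomorphic irreducible representations without
  non-zero fixed vectors.\<close>

lemma psi_class_iso_class:
  assumes R: "irreducible_rep G R" and fx: "fixed_space G R = {0}"
  shows "psi_class G w (iso_class G R) = psi G w R"
proof -
  have "\<exists>S. S \<in> iso_class G R" using nat_model_exists[OF R] by (auto simp: iso_class_def)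
  then have "(SOME S. S \<in> iso_class G R) \<in> iso_class G R" by (rule someI_ex)
  then show ?thesis using psi_iso[OF _ R _ fx, of "SOME S. S \<in> iso_class G R" w]
    by (simp add: psi_class_def iso_class_def)
qed

lemma nontrivial_class_iff:
  assumes R: "irreducible_rep G R"
  shows "iso_class G R \<noteq> iso_class G trivial_rep \<longleftrightarrow> fixed_space G R = {0}"
proof
  assume ne: "iso_class G R \<noteq> iso_class G trivial_rep"
  show "fixed_space G R = {0}"
  proof (rule ccontr)
    assume f0: "fixed_space G R \<noteq> {0}"
    then have "vecs R = fixed_space G R" "vecs R \<noteq> {0}" "csubspace (vecs R)"
      using irreducible_fixed_space[OF R] R by (auto simp: irreducible_rep_def unitary_rep_def)
    then obtain f where "f \<in> fixed_space G R" "f \<noteq> 0" using csubspace_0[of "vecs R"] by (auto simp: zero_fun_def)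
    then show False using ne iso_class_eq[OF R irreducible_trivial_rep rep_iso_trivial[OF R]] by blast
  qed
next
  assume fx: "fixed_space G R = {0}"
  show "iso_class G R \<noteq> iso_class G trivial_rep"
  proof
    assume "iso_class G R = iso_class G trivial_rep"
    then have "rep_iso G R trivial_rep" by (rule iso_class_eqD[OF R irreducible_trivial_rep])
    then have "fixed_space G trivial_rep = {0}"
      by (rule fixed_space_iso[OF _ unitary_of_irreducible[OF R] unitary_of_irreducible[OF irreducible_trivial_rep] fx])
    moreover have "fixed_space G trivial_rep = vecs trivial_rep" by (auto simp: fixed_space_def trivial_rep_def)
    ultimately have "vecs (trivial_rep :: ('a, nat) urep) = {0}" by metis
    then show False using irreducible_trivial_rep[of G] unfolding irreducible_rep_def by blast
  qed
qed

section \<open>The regular representation and displacement bounds\<close>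

lemma regular_unitary:
  assumes "group G" "finite (carrier G)"
  shows "unitary_rep G (regular_rep G)"
proof -
  interpret group G by fact
  have s: "(\<Sum>x\<in>carrier G. h (inv\<^bsub>G\<^esub> g \<otimes>\<^bsub>G\<^esub> x)) = (\<Sum>x\<in>carrier G. h x)" if g: "g \<in> carrier G" for g and h :: "'a \<Rightarrow> complex"
    by (rule sum.reindex_bij_witness[where i = "\<lambda>x. g \<otimes>\<^bsub>G\<^esub> x" and j = "\<lambda>x. inv\<^bsub>G\<^esub> g \<otimes>\<^bsub>G\<^esub> x"])
      (use g in \<open>auto simp: m_assoc[symmetric]\<close>)
  show ?thesis
    unfolding unitary_rep_def
  proof (intro conjI ballI)
    show "inner_on (pts (regular_rep G)) (act (regular_rep G) g f) (act (regular_rep G) g f') = inner_on (pts (regular_rep G)) f f'"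
      if "g \<in> carrier G" for g f f'
      using s[OF that, of "\<lambda>x. f x * cnj (f' x)"] by (simp add: regular_rep_def inner_on_def)
    show "act (regular_rep G) (g \<otimes>\<^bsub>G\<^esub> h) f = act (regular_rep G) g (act (regular_rep G) h f)"
      if "g \<in> carrier G" "h \<in> carrier G" for g h f
      using that by (auto simp: regular_rep_def fun_eq_iff inv_mult_group m_assoc)
  qed (use assms(2) in \<open>auto simp: regular_rep_def csubspace_functions_on[unfolded functions_on_def] clinear_on_def functions_on_def fun_eq_iff\<close>)
qed

lemma regular_fixed_perp:
  assumes "group G" "finite (carrier G)"
  shows "F \<in> fixed_perp G (regular_rep G) \<longleftrightarrow> F \<in> functions_on (carrier G) \<and> (\<Sum>x\<in>carrier G. F x) = 0"
proof -
  interpret group G by fact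
  interpret fin_rep G "regular_rep G"
    by unfold_locales (use assms regular_unitary in auto)
  have "(\<Sum>h\<in>carrier G. F (inv\<^bsub>G\<^esub> h \<otimes>\<^bsub>G\<^esub> x)) = (\<Sum>y\<in>carrier G. F y)" if x: "x \<in> carrier G" for x
    by (rule sum.reindex_bij_witness[where i = "\<lambda>y. x \<otimes>\<^bsub>G\<^esub> inv\<^bsub>G\<^esub> y" and j = "\<lambda>h. inv\<^bsub>G\<^esub> h \<otimes>\<^bsub>G\<^esub> x"])
      (use x in \<open>auto simp: inv_mult_group m_assoc[symmetric]\<close>, auto simp: m_assoc)
  then have "sum_over (carrier G) F x = (if x \<in> carrier G then \<Sum>y\<in>carrier G. F y else 0)" for x
    unfolding sum_over_def by (simp add: regular_rep_def)
  then have "sum_over (carrier G) F = 0 \<longleftrightarrow> (\<Sum>y\<in>carrier G. F y) = 0"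
    using one_closed by (auto simp: fun_eq_iff)
  then show ?thesis unfolding fixed_perp_iff by (simp add: regular_rep_def)
qed

text \<open>The matrix coefficient \<open>F g = ip v (act R g v)\<close> of a minimal eigenvector
  \<open>v\<close> is an eigenfunction of the regular Laplacian with the same eigenvalue. It does
  not vanish at the identity, and it sums to zero because \<open>v\<close> is orthogonal to the
  fixed vectors.\<close>

lemma psi_reg_le:
  assumes "group G" "finite (carrier G)" and R: "irreducible_rep G R" and fixed: "fixed_space G R = {0}"
    and w: "\<And>h. h \<in> carrier G \<Longrightarrow> w (inv\<^bsub>G\<^esub> h) = w h"
  shows "psi_reg G w \<le> psi G w R"
proof -
  interpret group G by fact
  interpret A: laplacian_rep G R w
    by unfold_locales (use assms unitary_of_irreducible in auto)
  interpret B: laplacian_rep G "regular_rep G" w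
    by unfold_locales (use assms regular_unitary in auto)
  have "A.V \<noteq> fixed_space G R" using R fixed by (simp add: irreducible_rep_def)
  then obtain r v where v: "psi G w R = ereal r" "v \<in> fixed_perp G R" "v \<noteq> 0" "A.L v = (\<lambda>x. of_real r * v x)"
    using A.psi_attained by metis
  have vV: "v \<in> A.V" using v(2) A.fixed_perp_subset by blast
  define F where "F g = (if g \<in> carrier G then A.ip v (act R g v) else 0)" for g
  have "(\<Sum>g\<in>carrier G. F g) = A.ip v (A.sum_over (carrier G) v)"
    by (simp add: F_def A.sum_over_def inner_on_sum)
  also have "\<dots> = 0" using v(2) by (simp add: A.fixed_perp_iff inner_on_def)
  finally have perp: "F \<in> fixed_perp G (regular_rep G)"
    by (simp add: regular_fixed_perp[OF assms(1,2)] functions_on_def F_def)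
  have "F \<one>\<^bsub>G\<^esub> \<noteq> 0" using A.norm2_pos[OF vV v(3)] A.act_one[OF vV] by (simp add: F_def inner_on_self)
  then have "F \<noteq> 0" by (metis zero_fun_apply)
  have tr: "F (inv\<^bsub>G\<^esub> h \<otimes>\<^bsub>G\<^esub> x) = A.ip (act R h v) (act R x v)" if "h \<in> carrier G" "x \<in> carrier G" for h x
    using that vV A.act_adjoint[of h v "act R x v"] A.act_in[of x v] A.act_mult[of "inv\<^bsub>G\<^esub> h" x v] by (simp add: F_def)
  have "B.L F x = of_real r * F x" for x
  proof (cases "x \<in> carrier G")
    case True
    have "B.L F x = (\<Sum>h\<in>carrier G. of_real (w h) * (A.ip v (act R x v) - A.ip (act R h v) (act R x v)))"
      unfolding laplacian_def using True tr by (intro sum.cong refl) (auto simp: regular_rep_def F_def)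
    also have "\<dots> = A.ip (A.L v) (act R x v)" by (simp add: A.ip_laplacian)
    also have "\<dots> = of_real r * F x" using True by (simp add: v(4) inner_on_simps F_def)
    finally show ?thesis .
  next
    case False
    then show ?thesis by (simp add: laplacian_def regular_rep_def F_def)
  qed
  then have "B.L F = (\<lambda>x. of_real r * F x)" by (rule ext)
  then have "Re (B.ip (B.L F) F) \<le> r * B.nsq F" by (simp add: inner_on_simps inner_on_self)
  then show ?thesis using B.psi_le_rayleigh[OF perp \<open>F \<noteq> 0\<close>] v(1) by (simp add: psi_reg_def)
qed

text \<open>The constant stems from writing \<open>k\<close> as a word in \<open>X\<close>, so it
  can be chosen before the representation \<open>R\<close>.\<close>

lemma displacement_generate:
  fixes G (structure)
  assumes "group G" "finite (carrier G)" and X: "X \<subseteq> carrier G" and k: "k \<in> generate G X"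
  shows "\<exists>C\<ge>0. \<forall>R :: ('g, 'x) urep. unitary_rep G R \<longrightarrow>
    (\<forall>f\<in>vecs R. norm2_on (pts R) (\<lambda>y. f y - act R k f y) \<le> C * (\<Sum>x\<in>X. norm2_on (pts R) (\<lambda>y. f y - act R x f y)))"
proof -
  interpret group G by fact
  have finX: "finite X" using X assms(2) finite_subset by blast
  define S where "S R f = (\<Sum>x\<in>X. norm2_on (pts R) (\<lambda>y. f y - act R x f y))" for R :: "('g, 'x) urep" and f
  have S0: "0 \<le> S R f" for R f by (simp add: S_def sum_nonneg norm2_on_nonneg)
  have Sx: "norm2_on (pts R) (\<lambda>y. f y - act R x f y) \<le> S R f" if "x \<in> X" for R f x
    unfolding S_def using that finX by (intro member_le_sum) (auto simp: norm2_on_nonneg)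
  have fr: "fin_rep G R" if "unitary_rep G R" for R :: "('g, 'x) urep"
    by unfold_locales (use that assms in auto)
  have "\<exists>C\<ge>0. \<forall>R. unitary_rep G R \<longrightarrow> (\<forall>f\<in>vecs R. norm2_on (pts R) (\<lambda>y. f y - act R k f y) \<le> C * S R f)"
    using k
  proof (induction rule: generate.induct)
    case one
    have "norm2_on (pts R) (\<lambda>y. f y - act R \<one> f y) \<le> 0 * S R f" if "unitary_rep G R" "f \<in> vecs R" for R f
      using fin_rep.act_one[OF fr[OF that(1)] that(2)] by (simp add: norm2_on_def)
    then show ?case by blast
  next
    case (incl h)
    then show ?case using Sx by (intro exI[of _ 1]) simp
  next
    case (inv h)
    have "norm2_on (pts R) (\<lambda>y. f y - act R (inv h) f y) \<le> 1 * S R f" if R: "unitary_rep G R" and f: "f \<in> vecs R" for R f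
    proof -
      interpret fin_rep G R by (rule fr[OF R])
      have h: "h \<in> carrier G" using inv X by blast
      have "act R h (\<lambda>y. f y - act R (inv h) f y) = (\<lambda>y. act R h f y - f y)"
        using h f act_act_inv by (simp add: clinear_on_diff[OF act_lin sub_V] act_in)
      then have "nsq (\<lambda>y. f y - act R (inv h) f y) = nsq (\<lambda>y. act R h f y - f y)"
        using norm2_act[OF h V_diff[OF f act_in[OF inv_closed[OF h] f]]] by simp
      also have "\<dots> = nsq (\<lambda>y. f y - act R h f y)" by (simp add: norm2_on_def norm_minus_commute)
      finally show ?thesis using Sx[OF inv, of R f] by simp
    qed
    then show ?case by (intro exI[of _ 1]) simp
  next
    case (eng h1 h2)
    obtain C1 where C1: "0 \<le> C1" "\<forall>R. unitary_rep G R \<longrightarrow> (\<forall>f\<in>vecs R. norm2_on (pts R) (\<lambda>y. f y - act R h1 f y) \<le> C1 * S R f)"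
      using eng.IH(1) by blast
    obtain C2 where C2: "0 \<le> C2" "\<forall>R. unitary_rep G R \<longrightarrow> (\<forall>f\<in>vecs R. norm2_on (pts R) (\<lambda>y. f y - act R h2 f y) \<le> C2 * S R f)"
      using eng.IH(2) by blast
    have C: "norm2_on (pts R) (\<lambda>y. f y - act R h1 f y) \<le> C1 * S R f" "norm2_on (pts R) (\<lambda>y. f y - act R h2 f y) \<le> C2 * S R f"
      if "unitary_rep G R" "f \<in> vecs R" for R f
      using C1(2) C2(2) that by blast+
    \<comment> \<open>A product moves \<open>f\<close> first by \<open>h2\<close> and then by
      \<open>h1\<close>, and \<open>act R h1\<close> preserves the displacement by
      \<open>h2\<close>. The factors \<open>2\<close> come from squaring the triangle
      inequality.\<close>
    have "norm2_on (pts R) (\<lambda>y. f y - act R (h1 \<otimes> h2) f y) \<le> (2 * C1 + 2 * C2) * S R f" if R: "unitary_rep G R" and f: "f \<in> vecs R" for R f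
    proof -
      interpret fin_rep G R by (rule fr[OF R])
      have h: "h1 \<in> carrier G" "h2 \<in> carrier G" using eng generate_in_carrier[OF X] by blast+
      have "act R h1 (\<lambda>y. f y - act R h2 f y) = (\<lambda>y. act R h1 f y - act R (h1 \<otimes> h2) f y)"
        using h f by (simp add: clinear_on_diff[OF act_lin sub_V] act_in act_mult)
      then have "nsq (\<lambda>y. act R h1 f y - act R (h1 \<otimes> h2) f y) = nsq (\<lambda>y. f y - act R h2 f y)"
        using norm2_act[OF h(1) V_diff[OF f act_in[OF h(2) f]]] by simp
      then show ?thesis
        using norm2_diff_triangle[of "pts R" f "act R (h1 \<otimes> h2) f" "act R h1 f"] C[OF R f] by (simp add: algebra_simps)
    qed
    then show ?case using C1(1) C2(1) by (intro exI[of _ "2 * C1 + 2 * C2"]) auto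
  qed
  then show ?thesis by (simp add: S_def)
qed

text \<open>If the translates of \<open>f\<close> over \<open>K\<close> add up to zero, the average
  squared displacement over \<open>K\<close> is exactly twice the squared norm, so some elements of
  \<open>K\<close>, and hence some generators, must move \<open>f\<close>.\<close>

lemma displacement_gap:
  assumes "group G" "finite (carrier G)" and X: "X \<subseteq> carrier G" and K: "K \<subseteq> generate G X" "K \<noteq> {}"
  shows "\<exists>\<delta>>0. \<forall>R :: ('g, 'x) urep. unitary_rep G R \<longrightarrow> (\<forall>f\<in>vecs R. (\<forall>y. (\<Sum>k\<in>K. act R k f y) = 0) \<longrightarrow>
    \<delta> * norm2_on (pts R) f \<le> (\<Sum>x\<in>X. norm2_on (pts R) (\<lambda>y. f y - act R x f y)))"
proof -
  interpret group G by fact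
  have KG: "K \<subseteq> carrier G" using K(1) generate_in_carrier[OF X] by blast
  then have finK: "finite K" using assms(2) finite_subset by blast
  define S where "S R f = (\<Sum>x\<in>X. norm2_on (pts R) (\<lambda>y. f y - act R x f y))" for R :: "('g, 'x) urep" and f
  have "\<forall>k\<in>K. \<exists>C\<ge>0. \<forall>R. unitary_rep G R \<longrightarrow> (\<forall>f\<in>vecs R. norm2_on (pts R) (\<lambda>y. f y - act R k f y) \<le> C * S R f)"
    unfolding S_def using displacement_generate[OF assms(1,2) X] K(1) by blast
  then obtain C where "\<forall>k\<in>K. 0 \<le> C k \<and> (\<forall>R. unitary_rep G R \<longrightarrow> (\<forall>f\<in>vecs R. norm2_on (pts R) (\<lambda>y. f y - act R k f y) \<le> C k * S R f))"
    using bchoice[of K "\<lambda>k C. 0 \<le> C \<and> (\<forall>R. unitary_rep G R \<longrightarrow> (\<forall>f\<in>vecs R. norm2_on (pts R) (\<lambda>y. f y - act R k f y) \<le> C * S R f))"]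
    by blast
  then have C: "\<And>k. k \<in> K \<Longrightarrow> 0 \<le> C k"
    "\<And>k R f. k \<in> K \<Longrightarrow> unitary_rep G R \<Longrightarrow> f \<in> vecs R \<Longrightarrow> norm2_on (pts R) (\<lambda>y. f y - act R k f y) \<le> C k * S R f"
    by blast+
  \<comment> \<open>Adding \<open>1\<close> keeps the denominator positive when all
    \<open>C k\<close> are zero.\<close>
  define \<delta> where "\<delta> = 2 * real (card K) / (sum C K + 1)"
  have sC: "0 \<le> sum C K" using C(1) by (rule sum_nonneg)
  have cK: "0 < card K" using K(2) finK by (simp add: card_gt_0_iff)
  have "\<delta> * norm2_on (pts R) f \<le> S R f" if R: "unitary_rep G R" and f: "f \<in> vecs R" and z: "\<forall>y. (\<Sum>k\<in>K. act R k f y) = 0" for R f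
  proof -
    interpret fin_rep G R by unfold_locales (use R assms in auto)
    have "(\<Sum>k\<in>K. inner_on (pts R) f (act R k f)) = inner_on (pts R) f (\<lambda>y. \<Sum>k\<in>K. act R k f y)"
      by (simp add: inner_on_sum)
    also have "\<dots> = 0" using z by (simp add: inner_on_simps)
    finally have 0: "(\<Sum>k\<in>K. Re (inner_on (pts R) f (act R k f))) = 0" by (metis Re_sum zero_complex.sel(1))
    \<comment> \<open>The cross terms cancel because the translates of \<open>f\<close> over
      \<open>K\<close> sum to zero.\<close>
    have "(\<Sum>k\<in>K. nsq (\<lambda>y. f y - act R k f y)) = (\<Sum>k\<in>K. 2 * nsq f - 2 * Re (ip f (act R k f)))"
      using KG f by (intro sum.cong refl) (auto simp: norm2_diff norm2_act subset_iff)
    also have "\<dots> = 2 * card K * nsq f"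
      using 0 by (simp add: sum_subtractf sum_distrib_left[symmetric])
    finally have "2 * card K * nsq f = (\<Sum>k\<in>K. nsq (\<lambda>y. f y - act R k f y))" ..
    also have "\<dots> \<le> (\<Sum>k\<in>K. C k * S R f)" by (intro sum_mono C(2) R f)
    also have "\<dots> \<le> (sum C K + 1) * S R f"
      by (simp add: sum_distrib_right[symmetric] distrib_right S_def sum_nonneg norm2_on_nonneg)
    finally show ?thesis using sC by (simp add: \<delta>_def field_simps)
  qed
  moreover have "0 < \<delta>" using sC cK by (simp add: \<delta>_def)
  ultimately show ?thesis unfolding S_def by blast
qed

section \<open>The wreath product\<close>

type_synonym 'a wreath_elt = "(nat \<Rightarrow> 'a) \<times> (nat \<Rightarrow> nat)"

locale wr = comm_group A for A :: "('a, 'b) monoid_scheme" (structure) +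
  fixes n :: nat
  assumes finite_A: "finite (carrier A)"
begin

abbreviation "W \<equiv> wreath A n"

definition bmult :: "(nat \<Rightarrow> 'a) \<Rightarrow> (nat \<Rightarrow> 'a) \<Rightarrow> nat \<Rightarrow> 'a" where
  "bmult x y = (\<lambda>i\<in>{1..n}. x i \<otimes> y i)"

definition binv :: "(nat \<Rightarrow> 'a) \<Rightarrow> nat \<Rightarrow> 'a" where
  "binv x = (\<lambda>i\<in>{1..n}. inv (x i))"

definition bone :: "nat \<Rightarrow> 'a" where
  "bone = (\<lambda>i\<in>{1..n}. \<one>)"

definition permb :: "(nat \<Rightarrow> nat) \<Rightarrow> (nat \<Rightarrow> 'a) \<Rightarrow> nat \<Rightarrow> 'a" where
  "permb \<pi> x = (\<lambda>i\<in>{1..n}. x (inv' \<pi> i))"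

lemma carrier_W: "carrier W = base A n \<times> SG n"
  by (simp add: wreath_def sym_group_def SG_def)

lemma mult_W: "(g, \<pi>) \<otimes>\<^bsub>W\<^esub> (h, \<sigma>) = (bmult g (permb \<pi> h), \<pi> \<circ> \<sigma>)"
  by (auto simp: wreath_def bmult_def permb_def fun_eq_iff restrict_def)

lemma one_W: "\<one>\<^bsub>W\<^esub> = (bone, id)"
  by (simp add: wreath_def bone_def)

lemma SG_D: "\<pi> \<in> SG n \<Longrightarrow> \<pi> permutes {1..n}"
  by (simp add: SG_def)

lemma SG_id: "id \<in> SG n"
  by (simp add: SG_def permutes_id)

lemma SG_inv: "\<pi> \<in> SG n \<Longrightarrow> inv' \<pi> \<in> SG n"
  by (simp add: SG_def permutes_inv)

lemma SG_comp: "\<pi> \<in> SG n \<Longrightarrow> \<sigma> \<in> SG n \<Longrightarrow> \<pi> \<circ> \<sigma> \<in> SG n"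
  by (simp add: SG_def permutes_compose)

lemma SG_in: "\<pi> \<in> SG n \<Longrightarrow> \<pi> i \<in> {1..n} \<longleftrightarrow> i \<in> {1..n}"
  unfolding SG_def mem_Collect_eq by (rule permutes_in_image)

lemma SG_inv_apply: "\<pi> \<in> SG n \<Longrightarrow> inv' \<pi> (\<pi> i) = i" "\<pi> \<in> SG n \<Longrightarrow> \<pi> (inv' \<pi> i) = i"
  by (simp_all add: SG_def permutes_inverses)

lemma SG_inv_comp: "\<pi> \<in> SG n \<Longrightarrow> inv' \<pi> \<circ> \<pi> = id" "\<pi> \<in> SG n \<Longrightarrow> \<pi> \<circ> inv' \<pi> = id"
  by (simp_all add: fun_eq_iff SG_inv_apply)

lemma SG_inv_inv: "\<pi> \<in> SG n \<Longrightarrow> inv' (inv' \<pi>) = \<pi>"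
  by (simp add: SG_def permutes_inv_inv)

lemma inv_comp: "\<pi> \<in> SG n \<Longrightarrow> \<sigma> \<in> SG n \<Longrightarrow> inv' (\<pi> \<circ> \<sigma>) = inv' \<sigma> \<circ> inv' \<pi>"
  by (simp add: SG_def o_inv_distrib permutes_bij)

lemma SG_tr: "i \<in> {1..n} \<Longrightarrow> j \<in> {1..n} \<Longrightarrow> tr i j \<in> SG n"
  by (simp add: SG_def permutes_swap_id)

lemma inv_tr: "inv' (tr i j) = tr i j"
  by (rule inv_unique_comp) (simp_all add: fun_eq_iff)

lemma base_in: "x \<in> base A n \<Longrightarrow> i \<in> {1..n} \<Longrightarrow> x i \<in> carrier A"
  unfolding base_def by (rule PiE_mem)

lemma base_eqI: "x \<in> base A n \<Longrightarrow> y \<in> base A n \<Longrightarrow> (\<And>i. i \<in> {1..n} \<Longrightarrow> x i = y i) \<Longrightarrow> x = y"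
  unfolding base_def by (rule PiE_ext)

lemma base_restrict: "(\<And>i. i \<in> {1..n} \<Longrightarrow> h i \<in> carrier A) \<Longrightarrow> (\<lambda>i\<in>{1..n}. h i) \<in> base A n"
  by (simp add: base_def)

lemma bmult_in: "x \<in> base A n \<Longrightarrow> y \<in> base A n \<Longrightarrow> bmult x y \<in> base A n"
  unfolding bmult_def by (intro base_restrict m_closed base_in)

lemma binv_in: "x \<in> base A n \<Longrightarrow> binv x \<in> base A n"
  unfolding binv_def by (intro base_restrict inv_closed base_in)

lemma bone_in: "bone \<in> base A n"
  unfolding bone_def by (intro base_restrict one_closed)

lemma permb_in: "\<pi> \<in> SG n \<Longrightarrow> x \<in> base A n \<Longrightarrow> permb \<pi> x \<in> base A n"
  unfolding permb_def using SG_in[OF SG_inv] by (intro base_restrict base_in) blast+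

lemma base_apply:
  "i \<in> {1..n} \<Longrightarrow> bmult x y i = x i \<otimes> y i" "i \<in> {1..n} \<Longrightarrow> binv x i = inv (x i)" "i \<in> {1..n} \<Longrightarrow> bone i = \<one>"
  "i \<in> {1..n} \<Longrightarrow> permb \<pi> x i = x (inv' \<pi> i)"
  by (simp_all add: bmult_def binv_def bone_def permb_def)

lemma base_group_laws:
  assumes "x \<in> base A n"
  shows "bmult bone x = x" "bmult x bone = x" "bmult (binv x) x = bone" "bmult x (binv x) = bone" "binv (binv x) = x" "permb id x = x"
  using assms by (auto intro!: base_eqI bmult_in bone_in binv_in permb_in SG_id simp: base_apply base_in)

lemma permb_comp:
  assumes "\<pi> \<in> SG n" "\<sigma> \<in> SG n" "x \<in> base A n"
  shows "permb \<pi> (permb \<sigma> x) = permb (\<pi> \<circ> \<sigma>) x"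
  using assms SG_in[OF SG_inv] by (intro base_eqI permb_in SG_comp) (auto simp: base_apply inv_comp simp del: atLeastAtMost_iff)

lemma permb_bmult:
  assumes "\<pi> \<in> SG n" "x \<in> base A n" "y \<in> base A n"
  shows "permb \<pi> (bmult x y) = bmult (permb \<pi> x) (permb \<pi> y)"
  using assms SG_in[OF SG_inv] by (intro base_eqI permb_in bmult_in) (auto simp: base_apply simp del: atLeastAtMost_iff)

lemma bmult_assoc:
  assumes "x \<in> base A n" "y \<in> base A n" "z \<in> base A n"
  shows "bmult (bmult x y) z = bmult x (bmult y z)"
  using assms by (intro base_eqI bmult_in) (auto simp: base_apply m_assoc base_in)

lemma bmult_commute:
  assumes "x \<in> base A n" "y \<in> base A n"
  shows "bmult x y = bmult y x"
  using assms by (intro base_eqI bmult_in) (auto simp: base_apply m_comm base_in)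

lemma permb_bone: "\<pi> \<in> SG n \<Longrightarrow> permb \<pi> bone = bone"
  using SG_in[OF SG_inv] by (intro base_eqI permb_in bone_in) (auto simp: base_apply simp del: atLeastAtMost_iff)

lemma group_W: "group W"
proof (rule groupI)
  show "u \<otimes>\<^bsub>W\<^esub> v \<in> carrier W" if "u \<in> carrier W" "v \<in> carrier W" for u v
    using that by (auto simp: carrier_W mult_W intro!: bmult_in permb_in SG_comp)
  show "\<one>\<^bsub>W\<^esub> \<in> carrier W" by (simp add: one_W carrier_W bone_in SG_id)
  show "u \<otimes>\<^bsub>W\<^esub> v \<otimes>\<^bsub>W\<^esub> x = u \<otimes>\<^bsub>W\<^esub> (v \<otimes>\<^bsub>W\<^esub> x)" if "u \<in> carrier W" "v \<in> carrier W" "x \<in> carrier W" for u v x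
    using that by (auto simp: carrier_W mult_W bmult_assoc permb_bmult permb_comp permb_in comp_assoc bmult_in SG_comp)
  show "\<one>\<^bsub>W\<^esub> \<otimes>\<^bsub>W\<^esub> u = u" if "u \<in> carrier W" for u
    using that by (auto simp: carrier_W mult_W one_W base_group_laws)
  show "\<exists>v\<in>carrier W. v \<otimes>\<^bsub>W\<^esub> u = \<one>\<^bsub>W\<^esub>" if u: "u \<in> carrier W" for u
  proof -
    obtain g \<pi> where g: "u = (g, \<pi>)" "g \<in> base A n" "\<pi> \<in> SG n" using u by (auto simp: carrier_W)
    have "(binv (permb (inv' \<pi>) g), inv' \<pi>) \<otimes>\<^bsub>W\<^esub> u = \<one>\<^bsub>W\<^esub>"
      using g by (simp add: mult_W one_W base_group_laws permb_in SG_inv SG_inv_comp)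
    then show ?thesis using g by (intro bexI) (auto simp: carrier_W binv_in permb_in SG_inv)
  qed
qed

lemma finite_base: "finite (base A n)"
  unfolding base_def using finite_A by (intro finite_PiE) auto

lemma finite_W: "finite (carrier W)"
  unfolding carrier_W using finite_base finite_SG by (rule finite_cartesian_product)

sublocale W: group W by (rule group_W)

lemma inv_W:
  assumes "g \<in> base A n" "\<pi> \<in> SG n"
  shows "inv\<^bsub>W\<^esub> (g, \<pi>) = (binv (permb (inv' \<pi>) g), inv' \<pi>)"
  by (rule W.inv_equality)
    (use assms in \<open>auto simp: mult_W one_W base_group_laws permb_in SG_inv SG_inv_comp carrier_W binv_in\<close>)

definition bas :: "(nat \<Rightarrow> 'a) \<Rightarrow> 'a wreath_elt" where "bas x = (x, id)"
definition prm :: "(nat \<Rightarrow> nat) \<Rightarrow> 'a wreath_elt" where "prm \<pi> = (bone, \<pi>)"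

lemma bas_in: "x \<in> base A n \<Longrightarrow> bas x \<in> carrier W"
  by (simp add: bas_def carrier_W SG_id)

lemma prm_in: "\<pi> \<in> SG n \<Longrightarrow> prm \<pi> \<in> carrier W"
  by (simp add: prm_def carrier_W bone_in)

lemma bas_prm: "x \<in> base A n \<Longrightarrow> \<pi> \<in> SG n \<Longrightarrow> bas x \<otimes>\<^bsub>W\<^esub> prm \<pi> = (x, \<pi>)"
  by (simp add: bas_def prm_def mult_W base_group_laws bone_in)

lemma bas_bas: "y \<in> base A n \<Longrightarrow> bas x \<otimes>\<^bsub>W\<^esub> bas y = bas (bmult x y)"
  by (simp add: bas_def mult_W base_group_laws)

lemma prm_prm: "\<pi> \<in> SG n \<Longrightarrow> prm \<pi> \<otimes>\<^bsub>W\<^esub> prm \<sigma> = prm (\<pi> \<circ> \<sigma>)"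
  by (simp add: prm_def mult_W permb_bone base_group_laws bone_in)

lemma prm_bas: "\<pi> \<in> SG n \<Longrightarrow> x \<in> base A n \<Longrightarrow> prm \<pi> \<otimes>\<^bsub>W\<^esub> bas x = bas (permb \<pi> x) \<otimes>\<^bsub>W\<^esub> prm \<pi>"
  by (simp add: bas_def prm_def mult_W permb_in base_group_laws bone_in)

lemma inv_bas: "x \<in> base A n \<Longrightarrow> inv\<^bsub>W\<^esub> (bas x) = bas (binv x)"
  using inv_W[OF _ SG_id] by (simp add: bas_def base_group_laws)

lemma binv_bone: "binv bone = bone"
  by (intro base_eqI binv_in bone_in) (simp add: base_apply)

lemma inv_prm: "\<pi> \<in> SG n \<Longrightarrow> inv\<^bsub>W\<^esub> (prm \<pi>) = prm (inv' \<pi>)"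
  using inv_W[OF bone_in] by (simp add: prm_def permb_bone SG_inv binv_bone)

section \<open>Characters\<close>

abbreviation "Ahat \<equiv> carrier (character_group A)"

lemma Ahat_iff: "\<eta> \<in> Ahat \<longleftrightarrow> \<eta> \<in> extensional (carrier A) \<and> (\<forall>x\<in>carrier A. cmod (\<eta> x) = 1) \<and>
    (\<forall>x\<in>carrier A. \<forall>y\<in>carrier A. \<eta> (x \<otimes> y) = \<eta> x * \<eta> y)"
  by (auto simp: character_group_def hom_def)

lemma Ahat_norm: "\<eta> \<in> Ahat \<Longrightarrow> x \<in> carrier A \<Longrightarrow> cmod (\<eta> x) = 1"
  and Ahat_mult: "\<eta> \<in> Ahat \<Longrightarrow> x \<in> carrier A \<Longrightarrow> y \<in> carrier A \<Longrightarrow> \<eta> (x \<otimes> y) = \<eta> x * \<eta> y"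
  and Ahat_ext: "\<eta> \<in> Ahat \<Longrightarrow> \<eta> \<in> extensional (carrier A)"
  by (simp_all add: Ahat_iff)

lemma Ahat_one: "\<eta> \<in> Ahat \<Longrightarrow> \<eta> \<one> = 1"
  using Ahat_mult[of \<eta> \<one> \<one>] Ahat_norm[of \<eta> \<one>] by auto

lemma Ahat_inv: "\<eta> \<in> Ahat \<Longrightarrow> x \<in> carrier A \<Longrightarrow> \<eta> (inv x) = cnj (\<eta> x)"
proof -
  assume *: "\<eta> \<in> Ahat" "x \<in> carrier A"
  have "\<eta> x * cnj (\<eta> x) = 1" using Ahat_norm[OF *] complex_norm_square[of "\<eta> x"] by simp
  moreover have "\<eta> (inv x) * \<eta> x = 1" using Ahat_mult[OF *(1), of "inv x" x] Ahat_one[OF *(1)] * by simp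
  ultimately show ?thesis by (metis mult.assoc mult.commute mult.right_neutral)
qed

lemma Ahat_pow: "\<eta> \<in> Ahat \<Longrightarrow> x \<in> carrier A \<Longrightarrow> \<eta> (x [^] (k::nat)) = \<eta> x ^ k"
  by (induction k) (auto simp: Ahat_one Ahat_mult)

text \<open>Since \<open>x [^] order A\<close> is the identity, the values of a character are roots
  of unity of bounded order.\<close>

lemma finite_Ahat: "finite Ahat"
proof (rule finite_subset)
  let ?N = "order A"
  have N: "?N \<noteq> 0" using finite_A by (simp add: order_def) (metis one_closed empty_iff)
  show "Ahat \<subseteq> carrier A \<rightarrow>\<^sub>E {z. z ^ ?N = 1}"
  proof
    fix \<eta> assume c: "\<eta> \<in> Ahat"
    have "\<eta> x ^ ?N = 1" if "x \<in> carrier A" for x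
      using Ahat_pow[OF c that, of ?N] pow_order_eq_1[OF that] Ahat_one[OF c] by simp
    then show "\<eta> \<in> carrier A \<rightarrow>\<^sub>E {z. z ^ ?N = 1}" using Ahat_ext[OF c] by (auto simp: PiE_def)
  qed
  show "finite (carrier A \<rightarrow>\<^sub>E {z::complex. z ^ ?N = 1})"
    using finite_A N by (intro finite_PiE finite_nth_roots) auto
qed

lemma one_Ahat: "\<one>\<^bsub>character_group A\<^esub> = (\<lambda>x\<in>carrier A. 1)"
  by (simp add: character_group_def)

lemma one_in_Ahat: "(\<lambda>x\<in>carrier A. 1) \<in> Ahat"
  by (simp add: Ahat_iff)

definition cchar :: "('a \<Rightarrow> complex) \<Rightarrow> 'a \<Rightarrow> complex" where
  "cchar \<eta> = (\<lambda>x\<in>carrier A. cnj (\<eta> x))"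

lemma cchar_in: "\<eta> \<in> Ahat \<Longrightarrow> cchar \<eta> \<in> Ahat"
  by (simp add: Ahat_iff cchar_def)

lemma cchar_cchar: "\<eta> \<in> Ahat \<Longrightarrow> cchar (cchar \<eta>) = \<eta>"
  using Ahat_ext[of \<eta>] by (auto simp: cchar_def fun_eq_iff extensional_def)

text \<open>Conjugation inverts numbers of modulus one. This ties \<open>dual_vector\<close> to
  complex conjugation of functions.\<close>

lemma inv_Ahat:
  assumes c: "\<eta> \<in> Ahat"
  shows "inv\<^bsub>character_group A\<^esub> \<eta> = cchar \<eta>"
proof -
  have grp: "group (character_group A)"
  proof (rule groupI)
    show "\<exists>y\<in>Ahat. y \<otimes>\<^bsub>character_group A\<^esub> x = \<one>\<^bsub>character_group A\<^esub>" if x: "x \<in> Ahat" for x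
    proof (rule bexI[OF _ cchar_in[OF x]])
      have "cnj (x a) * x a = 1" if "a \<in> carrier A" for a
        using Ahat_norm[OF x that] complex_norm_square[of "x a"] by (simp add: mult.commute)
      then show "cchar x \<otimes>\<^bsub>character_group A\<^esub> x = \<one>\<^bsub>character_group A\<^esub>"
        by (auto simp: character_group_def cchar_def)
    qed
    show "x \<otimes>\<^bsub>character_group A\<^esub> y \<in> Ahat" if "x \<in> Ahat" "y \<in> Ahat" for x y
    proof -
      have "x \<otimes>\<^bsub>character_group A\<^esub> y = (\<lambda>a\<in>carrier A. x a * y a)" by (simp add: character_group_def)
      then show ?thesis using that by (simp add: Ahat_iff norm_mult)
    qed
    show "\<one>\<^bsub>character_group A\<^esub> \<in> Ahat" by (simp only: one_Ahat one_in_Ahat)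
    show "\<one>\<^bsub>character_group A\<^esub> \<otimes>\<^bsub>character_group A\<^esub> x = x" if "x \<in> Ahat" for x
      using Ahat_ext[OF that] by (auto simp: character_group_def extensional_def fun_eq_iff)
  qed (auto simp: character_group_def fun_eq_iff mult.assoc)
  have "cnj (\<eta> a) * \<eta> a = 1" if "a \<in> carrier A" for a
    using Ahat_norm[OF c that] complex_norm_square[of "\<eta> a"] by (simp add: mult.commute)
  then have "cchar \<eta> \<otimes>\<^bsub>character_group A\<^esub> \<eta> = \<one>\<^bsub>character_group A\<^esub>"
    by (auto simp: character_group_def cchar_def)
  then show ?thesis using group.inv_equality[OF grp] c cchar_in[OF c] by blast
qed

definition wt :: "(nat \<Rightarrow> 'a \<Rightarrow> complex) \<Rightarrow> (nat \<Rightarrow> 'a) \<Rightarrow> complex" where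
  "wt \<theta> x = (\<Prod>i\<in>{1..n}. \<theta> i (x i))"

text \<open>Values outside \<open>{1..n}\<close> are unconstrained, so labellings are compared on
  \<open>{1..n}\<close> only.\<close>

definition chars :: "(nat \<Rightarrow> 'a \<Rightarrow> complex) set" where
  "chars = {1..n} \<rightarrow> Ahat"

lemma chars_in: "\<theta> \<in> chars \<Longrightarrow> i \<in> {1..n} \<Longrightarrow> \<theta> i \<in> Ahat"
  unfolding chars_def by blast

lemma wt_bmult: "\<theta> \<in> chars \<Longrightarrow> x \<in> base A n \<Longrightarrow> y \<in> base A n \<Longrightarrow> wt \<theta> (bmult x y) = wt \<theta> x * wt \<theta> y"
  by (simp add: wt_def prod.distrib[symmetric] base_apply Ahat_mult chars_in base_in)

lemma wt_binv: "\<theta> \<in> chars \<Longrightarrow> x \<in> base A n \<Longrightarrow> wt \<theta> (binv x) = cnj (wt \<theta> x)"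
  by (simp add: wt_def base_apply Ahat_inv chars_in base_in)

lemma wt_norm: "\<theta> \<in> chars \<Longrightarrow> x \<in> base A n \<Longrightarrow> cmod (wt \<theta> x) = 1"
  by (simp add: wt_def prod_norm[symmetric] Ahat_norm chars_in base_in)

lemma wt_bone: "\<theta> \<in> chars \<Longrightarrow> wt \<theta> bone = 1"
  by (simp add: wt_def base_apply Ahat_one chars_in)

lemma wt_cong: "(\<And>i. i \<in> {1..n} \<Longrightarrow> \<theta> i = \<theta>' i) \<Longrightarrow> wt \<theta> x = wt \<theta>' x"
  by (simp add: wt_def)

lemma wt_permb:
  assumes "\<pi> \<in> SG n"
  shows "wt \<theta> (permb \<pi> x) = wt (\<theta> \<circ> \<pi>) x"
proof -
  have "wt \<theta> (permb \<pi> x) = (\<Prod>i\<in>{1..n}. \<theta> i (x (inv' \<pi> i)))" by (simp add: wt_def base_apply)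
  also have "\<dots> = (\<Prod>j\<in>{1..n}. \<theta> (\<pi> j) (x j))"
    by (rule prod.reindex_bij_witness[where i = \<pi> and j = "inv' \<pi>"])
      (use assms SG_in[OF assms] SG_in[OF SG_inv[OF assms]] in \<open>auto simp: SG_inv_apply simp del: atLeastAtMost_iff\<close>)
  finally show ?thesis by (simp add: wt_def)
qed

lemma chars_comp: "\<theta> \<in> chars \<Longrightarrow> \<pi> \<in> SG n \<Longrightarrow> \<theta> \<circ> \<pi> \<in> chars"
  unfolding chars_def using SG_in by auto

definition single :: "nat \<Rightarrow> 'a \<Rightarrow> nat \<Rightarrow> 'a" where
  "single i a = (\<lambda>j\<in>{1..n}. if j = i then a else \<one>)"

lemma single_in: "a \<in> carrier A \<Longrightarrow> single i a \<in> base A n"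
  unfolding single_def by (rule base_restrict) auto

lemma wt_single:
  assumes "\<theta> \<in> chars" "i \<in> {1..n}"
  shows "wt \<theta> (single i a) = \<theta> i a"
proof -
  have "wt \<theta> (single i a) = (\<Prod>j\<in>{1..n}. if j = i then \<theta> i a else 1)"
    unfolding wt_def using assms by (intro prod.cong) (auto simp: single_def Ahat_one chars_in)
  then show ?thesis using assms(2) by (simp add: prod.delta)
qed

lemma wt_eqD:
  assumes "\<theta> \<in> chars" "\<theta>' \<in> chars" "\<And>x. x \<in> base A n \<Longrightarrow> wt \<theta> x = wt \<theta>' x" "i \<in> {1..n}"
  shows "\<theta> i = \<theta>' i"
proof
  fix a show "\<theta> i a = \<theta>' i a"
  proof (cases "a \<in> carrier A")
    case True
    then show ?thesis using assms(3)[OF single_in[OF True, of i]] wt_single assms by simp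
  next
    case False
    then show ?thesis using Ahat_ext[OF chars_in[OF assms(1,4)]] Ahat_ext[OF chars_in[OF assms(2,4)]]
      by (simp add: extensional_def)
  qed
qed

lemma sum_bmult_shift:
  assumes "b \<in> base A n"
  shows "(\<Sum>x\<in>base A n. h (bmult b x)) = (\<Sum>x\<in>base A n. h x)"
  by (rule sum.reindex_bij_witness[where i = "\<lambda>x. bmult (binv b) x" and j = "\<lambda>x. bmult b x"])
    (use assms in \<open>auto simp: bmult_in binv_in bmult_assoc[symmetric] base_group_laws\<close>)

lemma sum_hom_zero:
  assumes "\<And>x y. x \<in> base A n \<Longrightarrow> y \<in> base A n \<Longrightarrow> \<xi> (bmult x y) = \<xi> x * \<xi> y" "b \<in> base A n" "\<xi> b \<noteq> 1"
  shows "(\<Sum>x\<in>base A n. \<xi> x) = (0 :: complex)"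
proof -
  have "(\<Sum>x\<in>base A n. \<xi> x) = (\<Sum>x\<in>base A n. \<xi> (bmult b x))" by (rule sum_bmult_shift[OF assms(2), symmetric])
  also have "\<dots> = \<xi> b * (\<Sum>x\<in>base A n. \<xi> x)" using assms(1,2) by (simp add: sum_distrib_left)
  finally show ?thesis using assms(3) by (metis mult_cancel_right1)
qed

lemma wt_orthogonal:
  assumes "\<theta> \<in> chars" "\<theta>' \<in> chars"
  shows "(\<Sum>x\<in>base A n. cnj (wt \<theta> x) * wt \<theta>' x) = (if \<forall>i\<in>{1..n}. \<theta> i = \<theta>' i then of_nat (card (base A n)) else 0)"
proof (cases "\<forall>i\<in>{1..n}. \<theta> i = \<theta>' i")
  case True
  have "cnj (wt \<theta> x) * wt \<theta>' x = 1" if "x \<in> base A n" for x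
    using wt_cong[of \<theta> \<theta>' x] True wt_norm[OF assms(1) that] complex_norm_square[of "wt \<theta> x"] by (simp add: mult.commute)
  then show ?thesis using True by simp
next
  case False
  then obtain b where b: "b \<in> base A n" "wt \<theta> b \<noteq> wt \<theta>' b" using wt_eqD[OF assms] by blast
  have "cnj (wt \<theta> b) * wt \<theta>' b \<noteq> 1"
  proof
    assume "cnj (wt \<theta> b) * wt \<theta>' b = 1"
    moreover have "wt \<theta> b * cnj (wt \<theta> b) = 1" using wt_norm[OF assms(1) b(1)] complex_norm_square[of "wt \<theta> b"] by simp
    ultimately have "wt \<theta>' b = wt \<theta> b" by (metis mult.assoc mult.left_neutral mult.right_neutral)
    then show False using b(2) by simp
  qed
  then have "(\<Sum>x\<in>base A n. cnj (wt \<theta> x) * wt \<theta>' x) = 0"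
    using b(1) assms by (intro sum_hom_zero[of "\<lambda>x. cnj (wt \<theta> x) * wt \<theta>' x" b]) (auto simp: wt_bmult)
  then show ?thesis by (simp only: if_not_P[OF False])
qed

end

lemma mult_eq_1_unique: "a * b = 1 \<Longrightarrow> a * c = 1 \<Longrightarrow> b = (c :: complex)"
  using mult_left_cancel[of a b c] by (cases "a = 0") auto

lemma nonzero_funI: "f x \<noteq> 0 \<Longrightarrow> f \<noteq> 0"
  by auto

context wr
begin

section \<open>Induced representations of the wreath product\<close>

text \<open>A labelling \<open>\<theta>\<close> of the sites by characters takes the place of a
  block decomposition: the blocks are its fibres, and \<open>stab \<theta>\<close> is the product of
  the wreath products over them.\<close>

definition stab :: "(nat \<Rightarrow> 'a \<Rightarrow> complex) \<Rightarrow> 'a wreath_elt set" where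
  "stab \<theta> = {(g, \<pi>) \<in> carrier W. \<forall>i\<in>{1..n}. \<theta> (\<pi> i) = \<theta> i}"

definition ch :: "(nat \<Rightarrow> 'a \<Rightarrow> complex) \<Rightarrow> 'a wreath_elt \<Rightarrow> complex" where
  "ch \<theta> u = wt \<theta> (fst u)"

definition ind :: "(nat \<Rightarrow> 'a \<Rightarrow> complex) \<Rightarrow> ('a wreath_elt, 'a wreath_elt \<times> unit) urep" where
  "ind \<theta> = induced_rep W (stab \<theta>) (character_rep (ch \<theta>))"

lemma stab_iff: "(g, \<pi>) \<in> stab \<theta> \<longleftrightarrow> g \<in> base A n \<and> \<pi> \<in> SG n \<and> (\<forall>i\<in>{1..n}. \<theta> (\<pi> i) = \<theta> i)"
  by (auto simp: stab_def carrier_W)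

lemma stab_carrier: "h \<in> stab \<theta> \<Longrightarrow> h \<in> carrier W"
  by (auto simp: stab_def)

lemma bas_stab: "x \<in> base A n \<Longrightarrow> bas x \<in> stab \<theta>"
  by (simp add: bas_def stab_iff SG_id)

lemma stab_inv_iff:
  assumes "\<pi> \<in> SG n"
  shows "(\<forall>i\<in>{1..n}. \<theta> (inv' \<pi> i) = \<theta> i) \<longleftrightarrow> (\<forall>i\<in>{1..n}. \<theta> (\<pi> i) = \<theta> i)"
proof
  assume *: "\<forall>i\<in>{1..n}. \<theta> (inv' \<pi> i) = \<theta> i"
  show "\<forall>i\<in>{1..n}. \<theta> (\<pi> i) = \<theta> i"
  proof
    fix i assume "i \<in> {1..n}"
    then have "\<theta> (inv' \<pi> (\<pi> i)) = \<theta> (\<pi> i)" using * SG_in[OF assms, of i] by blast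
    then show "\<theta> (\<pi> i) = \<theta> i" using SG_inv_apply(1)[OF assms] by simp
  qed
next
  assume *: "\<forall>i\<in>{1..n}. \<theta> (\<pi> i) = \<theta> i"
  show "\<forall>i\<in>{1..n}. \<theta> (inv' \<pi> i) = \<theta> i"
  proof
    fix i assume "i \<in> {1..n}"
    then have "\<theta> (\<pi> (inv' \<pi> i)) = \<theta> (inv' \<pi> i)" using * SG_in[OF SG_inv[OF assms], of i] by blast
    then show "\<theta> (inv' \<pi> i) = \<theta> i" using SG_inv_apply(2)[OF assms] by simp
  qed
qed

lemma stab_subgroup: "subgroup (stab \<theta>) W"
proof (rule W.subgroupI)
  show "stab \<theta> \<subseteq> carrier W" using stab_carrier by blast
  show "stab \<theta> \<noteq> {}" using bas_stab[OF bone_in] by blast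
  show "inv\<^bsub>W\<^esub> u \<in> stab \<theta>" if "u \<in> stab \<theta>" for u
  proof -
    obtain g \<pi> where u: "u = (g, \<pi>)" by force
    have *: "g \<in> base A n" "\<pi> \<in> SG n" "\<forall>i\<in>{1..n}. \<theta> (\<pi> i) = \<theta> i" using that by (simp_all add: u stab_iff)
    show ?thesis using * stab_inv_iff[OF *(2), of \<theta>]
      unfolding u inv_W[OF *(1,2)] stab_iff by (simp add: binv_in permb_in SG_inv)
  qed
  show "u \<otimes>\<^bsub>W\<^esub> v \<in> stab \<theta>" if "u \<in> stab \<theta>" "v \<in> stab \<theta>" for u v
  proof -
    obtain g \<pi> h \<sigma> where u: "u = (g, \<pi>)" "v = (h, \<sigma>)" by force
    have *: "g \<in> base A n" "\<pi> \<in> SG n" "\<forall>i\<in>{1..n}. \<theta> (\<pi> i) = \<theta> i" "h \<in> base A n" "\<sigma> \<in> SG n" "\<forall>i\<in>{1..n}. \<theta> (\<sigma> i) = \<theta> i"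
      using that by (simp_all add: u stab_iff)
    have "\<theta> (\<pi> (\<sigma> i)) = \<theta> i" if "i \<in> {1..n}" for i
    proof -
      have "\<sigma> i \<in> {1..n}" using SG_in[OF *(5), of i] that by (rule iffD2)
      then have "\<theta> (\<pi> (\<sigma> i)) = \<theta> (\<sigma> i)" using *(3) by (rule bspec[rotated])
      also have "\<dots> = \<theta> i" using *(6) that by (rule bspec)
      finally show ?thesis .
    qed
    then show ?thesis unfolding u mult_W stab_iff using * by (simp add: bmult_in permb_in SG_comp)
  qed
qed

lemma ch_mult:
  assumes "\<theta> \<in> chars" "u \<in> stab \<theta>" "v \<in> carrier W"
  shows "ch \<theta> (u \<otimes>\<^bsub>W\<^esub> v) = ch \<theta> u * ch \<theta> v"
proof -
  obtain g \<pi> h \<sigma> where u: "u = (g, \<pi>)" "v = (h, \<sigma>)" by force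
  have *: "g \<in> base A n" "\<pi> \<in> SG n" "\<forall>i\<in>{1..n}. \<theta> (\<pi> i) = \<theta> i" "h \<in> base A n"
    using assms by (simp_all add: u stab_iff carrier_W)
  have "wt (\<theta> \<circ> \<pi>) h = wt \<theta> h" using *(3) by (intro wt_cong) auto
  then show ?thesis using * assms(1) by (simp add: u mult_W ch_def wt_bmult permb_in wt_permb)
qed

lemma ch_norm: "\<theta> \<in> chars \<Longrightarrow> u \<in> carrier W \<Longrightarrow> cmod (ch \<theta> u) = 1"
  by (auto simp: ch_def carrier_W wt_norm)

lemma ch_cnj: "\<theta> \<in> chars \<Longrightarrow> u \<in> carrier W \<Longrightarrow> ch \<theta> u * cnj (ch \<theta> u) = 1"
  using ch_norm[of \<theta> u] complex_norm_square[of "ch \<theta> u"] by simp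

lemma ch_one: "\<theta> \<in> chars \<Longrightarrow> ch \<theta> \<one>\<^bsub>W\<^esub> = 1"
  by (simp add: ch_def one_W wt_bone)

lemma ch_inv:
  assumes "\<theta> \<in> chars" "u \<in> stab \<theta>"
  shows "ch \<theta> (inv\<^bsub>W\<^esub> u) = cnj (ch \<theta> u)"
proof -
  have "ch \<theta> u * ch \<theta> (inv\<^bsub>W\<^esub> u) = 1"
    using ch_mult[OF assms, of "inv\<^bsub>W\<^esub> u"] stab_carrier[OF assms(2)] ch_one[OF assms(1)] by simp
  moreover have "ch \<theta> u * cnj (ch \<theta> u) = 1" by (rule ch_cnj[OF assms(1) stab_carrier[OF assms(2)]])
  ultimately show ?thesis by (rule mult_eq_1_unique)
qed

lemma ind_pts: "pts (ind \<theta>) = carrier W \<times> UNIV"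
  by (simp add: ind_def induced_rep_def character_rep_def)

lemma ind_vecs:
  assumes "\<theta> \<in> chars"
  shows "F \<in> vecs (ind \<theta>) \<longleftrightarrow> F \<in> functions_on (carrier W \<times> UNIV) \<and>
    (\<forall>g\<in>carrier W. \<forall>h\<in>stab \<theta>. F (g \<otimes>\<^bsub>W\<^esub> h, ()) = cnj (ch \<theta> h) * F (g, ()))"
proof -
  have "(\<lambda>x. F (g \<otimes>\<^bsub>W\<^esub> h, x)) = act (character_rep (ch \<theta>)) (inv\<^bsub>W\<^esub> h) (\<lambda>x. F (g, x))
      \<longleftrightarrow> F (g \<otimes>\<^bsub>W\<^esub> h, ()) = cnj (ch \<theta> h) * F (g, ())" if "h \<in> stab \<theta>" for g h
    using ch_inv[OF assms that] by (simp add: character_rep_def fun_eq_iff)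
  then show ?thesis by (simp add: ind_def induced_rep_def) (simp add: character_rep_def)
qed

lemma ind_vecs_zero:
  assumes "\<theta> \<in> chars" "F \<in> vecs (ind \<theta>)" "y \<notin> carrier W"
  shows "F (y, x) = 0"
proof -
  have "F \<in> functions_on (carrier W \<times> UNIV)" using assms(2) unfolding ind_vecs[OF assms(1)] by blast
  then show ?thesis using assms(3) unfolding functions_on_def by blast
qed

lemma ind_act: "act (ind \<theta>) g F (y, x) = (if y \<in> carrier W then F (inv\<^bsub>W\<^esub> g \<otimes>\<^bsub>W\<^esub> y, x) else 0)"
  by (simp add: ind_def induced_rep_def)

lemma ind_unitary:
  assumes \<theta>: "\<theta> \<in> chars"
  shows "unitary_rep W (ind \<theta>)"
  unfolding unitary_rep_def
proof (intro conjI ballI)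
  show "finite (pts (ind \<theta>))" by (simp add: ind_pts finite_W)
  show "csubspace (vecs (ind \<theta>))"
    by (rule csubspaceI) (auto simp: ind_vecs[OF \<theta>] functions_on_def algebra_simps)
  show "vecs (ind \<theta>) \<subseteq> functions_on (pts (ind \<theta>))" by (auto simp: ind_vecs[OF \<theta>] ind_pts)
  fix g assume g: "g \<in> carrier W"
  show "act (ind \<theta>) g \<in> vecs (ind \<theta>) \<rightarrow> vecs (ind \<theta>)"
  proof
    fix F assume F: "F \<in> vecs (ind \<theta>)"
    have "act (ind \<theta>) g F \<in> functions_on (carrier W \<times> UNIV)" by (auto simp: functions_on_def ind_act)
    moreover have "act (ind \<theta>) g F (y \<otimes>\<^bsub>W\<^esub> h, ()) = cnj (ch \<theta> h) * act (ind \<theta>) g F (y, ())"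
      if "y \<in> carrier W" "h \<in> stab \<theta>" for y h
      using F that g stab_carrier[OF that(2)] by (simp add: ind_act ind_vecs[OF \<theta>] W.m_assoc[symmetric])
    ultimately show "act (ind \<theta>) g F \<in> vecs (ind \<theta>)" by (simp add: ind_vecs[OF \<theta>])
  qed
  show "clinear_on (vecs (ind \<theta>)) (act (ind \<theta>) g)"
    by (auto simp: clinear_on_def ind_act fun_eq_iff)
  show "inner_on (pts (ind \<theta>)) (act (ind \<theta>) g F) (act (ind \<theta>) g F') = inner_on (pts (ind \<theta>)) F F'" for F F'
    unfolding inner_on_def ind_pts
    by (rule sum.reindex_bij_witness[where i = "\<lambda>(y, x). (g \<otimes>\<^bsub>W\<^esub> y, x)" and j = "\<lambda>(y, x). (inv\<^bsub>W\<^esub> g \<otimes>\<^bsub>W\<^esub> y, x)"])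
      (use g in \<open>auto simp: ind_act W.m_assoc[symmetric]\<close>)
next
  fix F assume F: "F \<in> vecs (ind \<theta>)"
  have "act (ind \<theta>) \<one>\<^bsub>W\<^esub> F (y, x) = F (y, x)" for y x
    using F ind_vecs_zero[OF \<theta> F] by (simp add: ind_act)
  then show "act (ind \<theta>) \<one>\<^bsub>W\<^esub> F = F" by (auto simp: fun_eq_iff)
next
  fix g h F assume *: "g \<in> carrier W" "h \<in> carrier W" "F \<in> vecs (ind \<theta>)"
  have "act (ind \<theta>) (g \<otimes>\<^bsub>W\<^esub> h) F (y, x) = act (ind \<theta>) g (act (ind \<theta>) h F) (y, x)" for y x
    using * by (auto simp: ind_act W.inv_mult_group W.m_assoc)
  then show "act (ind \<theta>) (g \<otimes>\<^bsub>W\<^esub> h) F = act (ind \<theta>) g (act (ind \<theta>) h F)" by (auto simp: fun_eq_iff)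
qed

lemma bas_move:
  assumes "b \<in> base A n" "g \<in> base A n" "\<sigma> \<in> SG n"
  shows "bas b \<otimes>\<^bsub>W\<^esub> (g, \<sigma>) = (g, \<sigma>) \<otimes>\<^bsub>W\<^esub> bas (permb (inv' \<sigma>) b)"
  using assms by (simp add: bas_def mult_W permb_comp SG_inv SG_inv_comp base_group_laws bmult_commute)

text \<open>\<open>bas b\<close> passes through \<open>(g, \<sigma>)\<close> as an element of
  \<open>A^n\<close> on the right, where \<open>F\<close> transforms by the character. So
  \<open>A^n\<close> acts diagonally, with one permuted label per coset.\<close>

lemma ind_bas:
  assumes \<theta>: "\<theta> \<in> chars" and F: "F \<in> vecs (ind \<theta>)" and b: "b \<in> base A n" and y: "g \<in> base A n" "\<sigma> \<in> SG n"
  shows "act (ind \<theta>) (bas b) F ((g, \<sigma>), x) = wt (\<theta> \<circ> inv' \<sigma>) b * F ((g, \<sigma>), x)"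
proof -
  have yW: "(g, \<sigma>) \<in> carrier W" using y by (simp add: carrier_W)
  let ?b = "permb (inv' \<sigma>) (binv b)"
  have bi: "?b \<in> base A n" using b y by (simp add: permb_in binv_in SG_inv)
  have "act (ind \<theta>) (bas b) F ((g, \<sigma>), x) = F ((g, \<sigma>) \<otimes>\<^bsub>W\<^esub> bas ?b, x)"
    using yW b y by (simp add: ind_act inv_bas bas_move binv_in)
  also have "\<dots> = cnj (ch \<theta> (bas ?b)) * F ((g, \<sigma>), x)"
    using F yW bas_stab[OF bi] by (simp add: ind_vecs[OF \<theta>])
  also have "ch \<theta> (bas ?b) = cnj (wt (\<theta> \<circ> inv' \<sigma>) b)"
    using b y chars_comp[OF \<theta> SG_inv[OF y(2)]] by (simp add: ch_def bas_def wt_permb SG_inv wt_binv)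
  finally show ?thesis by simp
qed

lemma ind_spherical_vector:
  assumes \<theta>: "\<theta> \<in> chars"
  shows "(\<lambda>(g, x). if g \<in> stab \<theta> then cnj (ch \<theta> g) else 0) \<in> vecs (ind \<theta>)"
proof -
  interpret H: subgroup "stab \<theta>" W by (rule stab_subgroup)
  have "g \<otimes>\<^bsub>W\<^esub> h \<in> stab \<theta> \<longleftrightarrow> g \<in> stab \<theta>" if "g \<in> carrier W" "h \<in> stab \<theta>" for g h
  proof
    assume "g \<otimes>\<^bsub>W\<^esub> h \<in> stab \<theta>"
    then have "g \<otimes>\<^bsub>W\<^esub> h \<otimes>\<^bsub>W\<^esub> inv\<^bsub>W\<^esub> h \<in> stab \<theta>" by (rule H.m_closed[OF _ H.m_inv_closed[OF that(2)]])
    moreover have "g \<otimes>\<^bsub>W\<^esub> h \<otimes>\<^bsub>W\<^esub> inv\<^bsub>W\<^esub> h = g" using that(1) stab_carrier[OF that(2)] by (simp add: W.m_assoc)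
    ultimately show "g \<in> stab \<theta>" by (simp only:)
  qed (use that in auto)
  then show ?thesis using ch_mult[OF \<theta>] stab_carrier
    by (auto simp: ind_vecs[OF \<theta>] functions_on_def mult.commute)
qed

text \<open>\<open>E\<close>, supported on \<open>stab \<theta>\<close>, generates the space: any
  \<open>F\<close> is, up to the factor \<open>card (stab \<theta>)\<close>, the combination of the
  translates of \<open>E\<close> with coefficients \<open>F (g, ())\<close>. Conversely a non-zero
  invariant subspace contains \<open>E\<close>: translate a vector to be non-zero at the identity
  and project to weight \<open>\<theta>\<close>, which only the coset of the identity
  carries.\<close>

lemma ind_irreducible:
  assumes \<theta>: "\<theta> \<in> chars"
  shows "irreducible_rep W (ind \<theta>)"
proof -
  interpret R: fin_rep W "ind \<theta>" by unfold_locales (use ind_unitary[OF \<theta>] finite_W in auto)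
  interpret H: subgroup "stab \<theta>" W by (rule stab_subgroup)
  define E where "E = (\<lambda>(g, x :: unit). if g \<in> stab \<theta> then cnj (ch \<theta> g) else 0)"
  have E: "E \<in> vecs (ind \<theta>)" unfolding E_def by (rule ind_spherical_vector[OF \<theta>])
  have "E (\<one>\<^bsub>W\<^esub>, ()) \<noteq> 0" by (simp add: E_def ch_one[OF \<theta>])
  then have "E \<noteq> 0" by (rule nonzero_funI)
  have finH: "finite (stab \<theta>)" using finite_W H.subset finite_subset by blast
  have span: "F \<in> U" if U: "csubspace U" "\<And>g f. g \<in> carrier W \<Longrightarrow> f \<in> U \<Longrightarrow> act (ind \<theta>) g f \<in> U" "E \<in> U"
    and F: "F \<in> vecs (ind \<theta>)" for U F
  proof -
    have "(\<lambda>p. \<Sum>g\<in>carrier W. F (g, ()) * act (ind \<theta>) g E p) \<in> U"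
      by (intro csubspace_sum U(1) csubspace_scale[OF U(1)] U(2,3))
    moreover have "(\<Sum>g\<in>carrier W. F (g, ()) * act (ind \<theta>) g E (y, x)) = of_nat (card (stab \<theta>)) * F (y, x)" for y x
    proof (cases "y \<in> carrier W")
      case True
      have "(\<Sum>g\<in>carrier W. F (g, ()) * act (ind \<theta>) g E (y, x)) = (\<Sum>g\<in>carrier W. F (g, ()) * E (inv\<^bsub>W\<^esub> g \<otimes>\<^bsub>W\<^esub> y, x))"
        using True by (simp add: ind_act)
      also have "\<dots> = (\<Sum>k\<in>carrier W. F (y \<otimes>\<^bsub>W\<^esub> inv\<^bsub>W\<^esub> k, ()) * E (k, x))"
        by (rule sum.reindex_bij_witness[where i = "\<lambda>k. y \<otimes>\<^bsub>W\<^esub> inv\<^bsub>W\<^esub> k" and j = "\<lambda>g. inv\<^bsub>W\<^esub> g \<otimes>\<^bsub>W\<^esub> y"])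
          (use True in \<open>auto simp: W.inv_mult_group W.m_assoc[symmetric]\<close>, auto simp: W.m_assoc)
      also have "\<dots> = (\<Sum>k\<in>stab \<theta>. F (y \<otimes>\<^bsub>W\<^esub> inv\<^bsub>W\<^esub> k, ()) * E (k, x))"
        by (rule sum.mono_neutral_right) (use finite_W H.subset in \<open>auto simp: E_def\<close>)
      also have "\<dots> = (\<Sum>k\<in>stab \<theta>. F (y, x))"
      proof (rule sum.cong[OF refl])
        fix k assume k: "k \<in> stab \<theta>"
        have "F (y \<otimes>\<^bsub>W\<^esub> inv\<^bsub>W\<^esub> k, ()) = ch \<theta> k * F (y, x)"
          using F True H.m_inv_closed[OF k] ch_inv[OF \<theta> k] by (simp add: ind_vecs[OF \<theta>])
        then show "F (y \<otimes>\<^bsub>W\<^esub> inv\<^bsub>W\<^esub> k, ()) * E (k, x) = F (y, x)"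
          using ch_cnj[OF \<theta> stab_carrier[OF k]] k by (simp add: E_def mult.commute mult.left_commute)
      qed
      finally show ?thesis by simp
    next
      case False
      then show ?thesis using ind_vecs_zero[OF \<theta> F] by (simp add: ind_act)
    qed
    then have "(\<lambda>p. \<Sum>g\<in>carrier W. F (g, ()) * act (ind \<theta>) g E p) = (\<lambda>p. of_nat (card (stab \<theta>)) * F p)"
      by (auto simp: fun_eq_iff)
    ultimately have "(\<lambda>p. of_nat (card (stab \<theta>)) * F p) \<in> U" by simp
    then have "(\<lambda>p. (1 / of_nat (card (stab \<theta>))) * (of_nat (card (stab \<theta>)) * F p)) \<in> U" by (rule csubspace_scale[OF U(1)])
    moreover have "card (stab \<theta>) \<noteq> 0" using finH bas_stab[OF bone_in, of \<theta>] by (metis card_0_eq empty_iff)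
    ultimately show ?thesis by simp
  qed
  have "U = {0} \<or> U = vecs (ind \<theta>)"
    if U: "csubspace U" "U \<subseteq> vecs (ind \<theta>)" "\<forall>g\<in>carrier W. act (ind \<theta>) g ` U \<subseteq> U" for U
  proof (cases "U = {0}")
    case False
    then obtain F where F: "F \<in> U" "F \<noteq> 0" using csubspace_0[OF U(1)] by (auto simp: zero_fun_def)
    have inv: "act (ind \<theta>) g f \<in> U" if "g \<in> carrier W" "f \<in> U" for g f using U(3) that by blast
    have FV: "F \<in> vecs (ind \<theta>)" using F U(2) by blast
    obtain y where y: "F (y, ()) \<noteq> 0" using F(2) by (auto simp: fun_eq_iff)
    have yW: "y \<in> carrier W"
    proof (rule ccontr)
      assume "y \<notin> carrier W"
      then show False using y ind_vecs_zero[OF \<theta> FV] by blast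
    qed
    define F0 where "F0 = act (ind \<theta>) (inv\<^bsub>W\<^esub> y) F"
    have F0U: "F0 \<in> U" unfolding F0_def using F yW by (intro inv) auto
    have F0V: "F0 \<in> vecs (ind \<theta>)" using F0U U(2) by blast
    have F01: "F0 (\<one>\<^bsub>W\<^esub>, ()) \<noteq> 0" using y yW by (simp add: F0_def ind_act)
    define c where "c = of_nat (card (base A n)) * F0 (\<one>\<^bsub>W\<^esub>, ())"
    have "card (base A n) \<noteq> 0" using finite_base bone_in by (auto simp: card_eq_0_iff)
    then have c: "c \<noteq> 0" using F01 by (simp add: c_def)
    have mem: "(\<lambda>p. \<Sum>b\<in>base A n. cnj (wt \<theta> b) * act (ind \<theta>) (bas b) F0 p) \<in> U"
      by (intro csubspace_sum U(1) csubspace_scale[OF U(1)] inv bas_in F0U)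
    have "(\<Sum>b\<in>base A n. cnj (wt \<theta> b) * act (ind \<theta>) (bas b) F0 (z, x)) = c * E (z, x)" for z x
    proof (cases "z \<in> carrier W")
      case True
      then obtain g \<sigma> where z: "z = (g, \<sigma>)" "g \<in> base A n" "\<sigma> \<in> SG n" by (auto simp: carrier_W)
      have "(\<Sum>b\<in>base A n. cnj (wt \<theta> b) * act (ind \<theta>) (bas b) F0 (z, x)) = (\<Sum>b\<in>base A n. cnj (wt \<theta> b) * wt (\<theta> \<circ> inv' \<sigma>) b) * F0 (z, x)"
        unfolding z(1) using ind_bas[OF \<theta> F0V _ z(2,3)] by (simp add: sum_distrib_right mult.assoc)
      also have "\<dots> = (if \<forall>i\<in>{1..n}. \<theta> i = (\<theta> \<circ> inv' \<sigma>) i then of_nat (card (base A n)) else 0) * F0 (z, x)"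
        by (simp only: wt_orthogonal[OF \<theta> chars_comp[OF \<theta> SG_inv[OF z(3)]]])
      also have "\<dots> = (if z \<in> stab \<theta> then of_nat (card (base A n)) * F0 (z, x) else 0)"
      proof -
        have "(\<forall>i\<in>{1..n}. \<theta> i = (\<theta> \<circ> inv' \<sigma>) i) \<longleftrightarrow> z \<in> stab \<theta>"
        proof -
          have "(\<forall>i\<in>{1..n}. \<theta> i = (\<theta> \<circ> inv' \<sigma>) i) \<longleftrightarrow> (\<forall>i\<in>{1..n}. \<theta> (inv' \<sigma> i) = \<theta> i)"
            unfolding comp_apply by (rule ball_cong[OF refl], rule eq_commute)
          then show ?thesis unfolding stab_inv_iff[OF z(3)] using z by (simp only: z(1) stab_iff simp_thms)
        qed
        then show ?thesis by (simp only: if_distrib[of "\<lambda>c. c * _"] mult_zero_left cong: if_cong)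
      qed
      also have "\<dots> = c * E (z, x)"
      proof (cases "z \<in> stab \<theta>")
        case True
        have "F0 (\<one>\<^bsub>W\<^esub> \<otimes>\<^bsub>W\<^esub> z, ()) = cnj (ch \<theta> z) * F0 (\<one>\<^bsub>W\<^esub>, ())"
          using F0V True W.one_closed unfolding ind_vecs[OF \<theta>] by blast
        then show ?thesis using True \<open>z \<in> carrier W\<close> by (simp add: E_def c_def mult.commute)
      qed (simp add: E_def)
      finally show ?thesis .
    next
      case False
      then show ?thesis using stab_carrier by (auto simp: ind_act E_def)
    qed
    then have "(\<lambda>p. \<Sum>b\<in>base A n. cnj (wt \<theta> b) * act (ind \<theta>) (bas b) F0 p) = (\<lambda>p. c * E p)"
      by (auto simp: fun_eq_iff)
    then have "(\<lambda>p. c * E p) \<in> U" using mem by simp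
    then have "(\<lambda>p. (1 / c) * (c * E p)) \<in> U" by (rule csubspace_scale[OF U(1)])
    then have "E \<in> U" using c by simp
    then show ?thesis using span[OF U(1) inv] U(2) by blast
  qed simp
  then show ?thesis using ind_unitary[OF \<theta>] E \<open>E \<noteq> 0\<close> unfolding irreducible_rep_def by blast
qed

definition has_weight :: "('a wreath_elt, 'x) urep \<Rightarrow> (nat \<Rightarrow> 'a \<Rightarrow> complex) \<Rightarrow> bool" where
  "has_weight R \<theta> \<longleftrightarrow> (\<exists>f\<in>vecs R. f \<noteq> 0 \<and> (\<forall>x\<in>base A n. act R (bas x) f = (\<lambda>p. wt \<theta> x * f p)))"

lemma has_weight_iso:
  assumes "rep_iso W R S" "unitary_rep W R" "has_weight R \<theta>"
  shows "has_weight S \<theta>"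
proof -
  obtain T where T: "clinear_on (vecs R) T" "bij_betw T (vecs R) (vecs S)" "\<And>g f. g \<in> carrier W \<Longrightarrow> f \<in> vecs R \<Longrightarrow> T (act R g f) = act S g (T f)"
    using assms(1) unfolding rep_iso_def by blast
  have subR: "csubspace (vecs R)" using assms(2) by (simp add: unitary_rep_def)
  obtain f where f: "f \<in> vecs R" "f \<noteq> 0" "\<And>x. x \<in> base A n \<Longrightarrow> act R (bas x) f = (\<lambda>p. wt \<theta> x * f p)"
    using assms(3) unfolding has_weight_def by blast
  have "T f \<in> vecs S" using T(2) f(1) by (rule bij_betw_apply)
  moreover have "T f \<noteq> 0"
  proof
    assume "T f = 0"
    then have "T f = T (\<lambda>x. 0)" using clinear_on_0[OF T(1) subR] by (simp add: zero_fun_def)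
    then have "f = (\<lambda>x. 0)" using T(2) f(1) csubspace_0[OF subR] unfolding bij_betw_def by (blast dest: inj_onD)
    then show False using f(2) by (simp add: zero_fun_def)
  qed
  moreover have "act S (bas x) (T f) = (\<lambda>p. wt \<theta> x * T f p)" if "x \<in> base A n" for x
    using T(3)[OF bas_in[OF that] f(1)] f(3)[OF that] clinear_on_scale[OF T(1) f(1)] by simp
  ultimately show ?thesis unfolding has_weight_def by blast
qed

text \<open>At a point where a weight vector does not vanish, \<open>ind_bas\<close> reads off its
  weight.\<close>

lemma ind_weight:
  assumes \<theta>: "\<theta> \<in> chars" "\<theta>' \<in> chars" and w: "has_weight (ind \<theta>) \<theta>'"
  shows "\<exists>\<sigma>\<in>SG n. \<forall>i\<in>{1..n}. \<theta>' i = \<theta> (\<sigma> i)"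
proof -
  obtain F where F: "F \<in> vecs (ind \<theta>)" "F \<noteq> 0" "\<And>x. x \<in> base A n \<Longrightarrow> act (ind \<theta>) (bas x) F = (\<lambda>p. wt \<theta>' x * F p)"
    using w unfolding has_weight_def by blast
  obtain y where y: "F (y, ()) \<noteq> 0" using F(2) by (auto simp: fun_eq_iff)
  have "y \<in> carrier W"
  proof (rule ccontr)
    assume "y \<notin> carrier W"
    then show False using y ind_vecs_zero[OF \<theta>(1) F(1)] by blast
  qed
  then obtain g \<sigma> where g: "y = (g, \<sigma>)" "g \<in> base A n" "\<sigma> \<in> SG n" by (auto simp: carrier_W)
  have "wt \<theta>' b = wt (\<theta> \<circ> inv' \<sigma>) b" if b: "b \<in> base A n" for b
    using ind_bas[OF \<theta>(1) F(1) b g(2,3), of "()"] fun_cong[OF F(3)[OF b], of "(y, ())"] y by (simp add: g(1))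
  then have "\<theta>' i = (\<theta> \<circ> inv' \<sigma>) i" if "i \<in> {1..n}" for i
    using wt_eqD[OF \<theta>(2) chars_comp[OF \<theta>(1) SG_inv[OF g(3)]]] that by blast
  then show ?thesis using SG_inv[OF g(3)] by auto
qed

lemma ind_has_weight:
  assumes \<theta>: "\<theta> \<in> chars"
  shows "has_weight (ind \<theta>) \<theta>"
proof -
  let ?E = "\<lambda>(g, x :: unit). if g \<in> stab \<theta> then cnj (ch \<theta> g) else 0"
  have E: "?E \<in> vecs (ind \<theta>)" by (rule ind_spherical_vector[OF \<theta>])
  interpret H: subgroup "stab \<theta>" W by (rule stab_subgroup)
  have "?E (\<one>\<^bsub>W\<^esub>, ()) \<noteq> 0" by (simp add: ch_one[OF \<theta>])
  then have "?E \<noteq> 0" by (rule nonzero_funI)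
  moreover have "act (ind \<theta>) (bas b) ?E p = wt \<theta> b * ?E p" if b: "b \<in> base A n" for b p
  proof -
    obtain z x where p: "p = (z, x)" by (cases p)
    show ?thesis
    proof (cases "z \<in> stab \<theta>")
      case True
      obtain g \<sigma> where z: "z = (g, \<sigma>)" by force
      have *: "g \<in> base A n" "\<sigma> \<in> SG n" "\<forall>i\<in>{1..n}. \<theta> (\<sigma> i) = \<theta> i" using True by (simp_all add: z stab_iff)
      have "wt (\<theta> \<circ> inv' \<sigma>) b = wt \<theta> b" using *(3) stab_inv_iff[OF *(2), of \<theta>] by (intro wt_cong) auto
      then show ?thesis unfolding p z ind_bas[OF \<theta> E b *(1,2)] by simp
    next
      case False
      have "z \<in> carrier W \<Longrightarrow> \<exists>c. act (ind \<theta>) (bas b) ?E (z, x) = c * ?E (z, x)"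
        using ind_bas[OF \<theta> E b] by (auto simp: carrier_W)
      then show ?thesis unfolding p using False by (cases "z \<in> carrier W") (auto simp: ind_act)
    qed
  qed
  ultimately show ?thesis unfolding has_weight_def using E by blast
qed

text \<open>The component \<open>e\<close> of \<open>u\<close> of weight \<open>\<theta>\<close>
  transforms under \<open>stab \<theta>\<close> by \<open>ch \<theta>\<close>, because
  \<open>u\<close> is fixed by permutations. Frobenius reciprocity then gives a non-zero map to
  \<open>ind \<theta>\<close>, provided that \<open>e\<close> does not vanish.\<close>

lemma spherical_iso:
  fixes R :: "('a wreath_elt, 'x) urep"
  assumes \<theta>: "\<theta> \<in> chars" and R: "irreducible_rep W R" and w: "has_weight R \<theta>"
    and u: "u \<in> vecs R" "u \<noteq> 0" "\<And>\<pi>. \<pi> \<in> SG n \<Longrightarrow> act R (prm \<pi>) u = u"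
  shows "rep_iso W R (ind \<theta>)"
proof -
  interpret R: fin_rep W R by unfold_locales (use unitary_of_irreducible[OF R] finite_W in auto)
  obtain v where v: "v \<in> vecs R" "v \<noteq> 0" "\<And>x. x \<in> base A n \<Longrightarrow> act R (bas x) v = (\<lambda>p. wt \<theta> x * v p)"
    using w unfolding has_weight_def by blast
  \<comment> \<open>Otherwise \<open>u\<close> would be orthogonal to all translates of
    \<open>v\<close>: a group element sends \<open>v\<close> to a multiple of a permuted copy, and
    \<open>u\<close> is fixed by permutations. By irreducibility these translates span.\<close>
  have uv: "R.ip v u \<noteq> 0"
  proof
    assume 0: "R.ip v u = 0"
    define U where "U = {f \<in> vecs R. \<forall>g\<in>carrier W. R.ip (act R g f) u = 0}"
    have "U = vecs R"
    proof (rule irreducibleD[OF R])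
      show "csubspace U"
        by (rule csubspaceI) (auto simp: U_def csubspace_0[OF R.sub_V] csubspace_add[OF R.sub_V] R.V_scale R.act_0
            clinear_on_add[OF R.act_lin] clinear_on_scale[OF R.act_lin] inner_on_simps)
      show "U \<subseteq> vecs R" by (auto simp: U_def)
      show "act R g f \<in> U" if "g \<in> carrier W" "f \<in> U" for g f
        using that by (auto simp: U_def R.act_in R.act_mult[symmetric])
      have "R.ip (act R g v) u = 0" if g: "g \<in> carrier W" for g
      proof -
        obtain x \<pi> where x: "g = (x, \<pi>)" "x \<in> base A n" "\<pi> \<in> SG n" using g by (auto simp: carrier_W)
        let ?x = "permb (inv' \<pi>) x"
        have x': "?x \<in> base A n" using x by (simp add: permb_in SG_inv)
        have "g = prm \<pi> \<otimes>\<^bsub>W\<^esub> bas ?x"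
          using x by (simp add: prm_def bas_def mult_W permb_comp SG_inv SG_inv_comp base_group_laws)
        then have "act R g v = (\<lambda>p. wt \<theta> ?x * act R (prm \<pi>) v p)"
          using v x x' by (simp add: R.act_mult prm_in bas_in clinear_on_scale[OF R.act_lin])
        then have "R.ip (act R g v) u = wt \<theta> ?x * R.ip (act R (prm \<pi>) v) u" by (simp add: inner_on_simps)
        also have "R.ip (act R (prm \<pi>) v) u = R.ip v u"
          using R.act_unitary[OF prm_in[OF x(3)] v(1) u(1)] u(3)[OF x(3)] by simp
        finally show ?thesis using 0 by simp
      qed
      then show "v \<in> U" using v(1) by (simp add: U_def)
    qed (rule v(2))
    then have "R.ip (act R \<one>\<^bsub>W\<^esub> u) u = 0" using u(1) W.one_closed unfolding U_def by blast
    then show False using R.norm2_pos[OF u(1,2)] R.act_one[OF u(1)] by (simp add: inner_on_self)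
  qed
  \<comment> \<open>The projection of \<open>u\<close> to weight \<open>\<theta>\<close>, without
    the normalising factor \<open>1 / card (base A n)\<close>.\<close>
  define e where "e = (\<lambda>p. \<Sum>b\<in>base A n. cnj (wt \<theta> b) * act R (bas b) u p)"
  have eV: "e \<in> vecs R" unfolding e_def by (intro R.V_sum R.V_scale R.act_in bas_in u(1))
  have act_e: "act R g e = (\<lambda>p. \<Sum>b\<in>base A n. cnj (wt \<theta> b) * act R g (act R (bas b) u) p)" if g: "g \<in> carrier W" for g
  proof -
    have "act R g e = (\<lambda>p. \<Sum>b\<in>base A n. act R g (\<lambda>p. cnj (wt \<theta> b) * act R (bas b) u p) p)"
      unfolding e_def by (rule clinear_on_sum[OF R.act_lin[OF g] R.sub_V]) (intro R.V_scale R.act_in bas_in u(1))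
    also have "\<dots> = (\<lambda>p. \<Sum>b\<in>base A n. cnj (wt \<theta> b) * act R g (act R (bas b) u) p)"
      using clinear_on_scale[OF R.act_lin[OF g] R.act_in[OF bas_in u(1)]] by (intro ext sum.cong refl) simp
    finally show ?thesis .
  qed
  have e_bas: "act R (bas x) e = (\<lambda>p. wt \<theta> x * e p)" if x: "x \<in> base A n" for x
  proof
    fix p
    have "act R (bas x) e p = (\<Sum>b\<in>base A n. cnj (wt \<theta> b) * act R (bas (bmult x b)) u p)"
      unfolding act_e[OF bas_in[OF x]] using x u(1) by (intro sum.cong refl) (simp add: R.act_mult[symmetric] bas_in bas_bas)
    also have "\<dots> = (\<Sum>b\<in>base A n. wt \<theta> x * (cnj (wt \<theta> (bmult x b)) * act R (bas (bmult x b)) u p))"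
    proof (intro sum.cong refl)
      fix b assume b: "b \<in> base A n"
      have "wt \<theta> x * cnj (wt \<theta> x) = 1" using wt_norm[OF \<theta> x] complex_norm_square[of "wt \<theta> x"] by simp
      then have "wt \<theta> x * cnj (wt \<theta> (bmult x b)) = cnj (wt \<theta> b)" using b x \<theta> by (simp add: wt_bmult mult.assoc[symmetric])
      then show "cnj (wt \<theta> b) * act R (bas (bmult x b)) u p = wt \<theta> x * (cnj (wt \<theta> (bmult x b)) * act R (bas (bmult x b)) u p)"
        by (simp add: mult.assoc[symmetric])
    qed
    also have "\<dots> = wt \<theta> x * (\<Sum>b\<in>base A n. cnj (wt \<theta> (bmult x b)) * act R (bas (bmult x b)) u p)"
      by (simp add: sum_distrib_left)
    also have "(\<Sum>b\<in>base A n. cnj (wt \<theta> (bmult x b)) * act R (bas (bmult x b)) u p) = e p"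
      unfolding e_def by (rule sum_bmult_shift[OF x])
    finally show "act R (bas x) e p = wt \<theta> x * e p" .
  qed
  have e_prm: "act R (prm \<pi>) e = e" if \<pi>: "\<pi> \<in> SG n" "\<forall>i\<in>{1..n}. \<theta> (\<pi> i) = \<theta> i" for \<pi>
  proof
    fix p
    have c: "wt \<theta> (permb \<pi> b) = wt \<theta> b" for b unfolding wt_permb[OF \<pi>(1)] using \<pi>(2) by (intro wt_cong) auto
    have "act R (prm \<pi>) e p = (\<Sum>b\<in>base A n. cnj (wt \<theta> (permb \<pi> b)) * act R (bas (permb \<pi> b)) u p)"
      unfolding act_e[OF prm_in[OF \<pi>(1)]] c
    proof (intro sum.cong refl)
      fix b assume b: "b \<in> base A n"
      have "act R (prm \<pi>) (act R (bas b) u) = act R (prm \<pi> \<otimes>\<^bsub>W\<^esub> bas b) u" using b \<pi> u(1) by (simp add: R.act_mult prm_in bas_in)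
      also have "\<dots> = act R (bas (permb \<pi> b)) u" unfolding prm_bas[OF \<pi>(1) b]
        using b \<pi> u by (simp add: R.act_mult prm_in bas_in permb_in)
      finally show "cnj (wt \<theta> b) * act R (prm \<pi>) (act R (bas b) u) p = cnj (wt \<theta> b) * act R (bas (permb \<pi> b)) u p" by simp
    qed
    also have "\<dots> = e p"
      unfolding e_def
      by (rule sum.reindex_bij_witness[where i = "permb (inv' \<pi>)" and j = "permb \<pi>"])
        (use \<pi> in \<open>auto simp: permb_in permb_comp SG_inv SG_inv_comp base_group_laws\<close>)
    finally show "act R (prm \<pi>) e p = e p" .
  qed
  have e_stab: "act R h e = (\<lambda>p. ch \<theta> h * e p)" if h: "h \<in> stab \<theta>" for h
  proof -
    obtain g \<pi> where g: "h = (g, \<pi>)" by force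
    have *: "g \<in> base A n" "\<pi> \<in> SG n" "\<forall>i\<in>{1..n}. \<theta> (\<pi> i) = \<theta> i" using h by (simp_all add: g stab_iff)
    have "h = bas g \<otimes>\<^bsub>W\<^esub> prm \<pi>" using * by (simp add: g bas_prm)
    then have "act R h e = act R (bas g) e" using * eV by (simp add: R.act_mult bas_in prm_in e_prm)
    then show ?thesis using e_bas[OF *(1)] by (simp add: ch_def g)
  qed
  have "R.ip e v = (\<Sum>b\<in>base A n. cnj (wt \<theta> b) * R.ip (act R (bas b) u) v)"
    unfolding e_def by (simp add: inner_on_sum inner_on_simps)
  also have "\<dots> = (\<Sum>b\<in>base A n. R.ip u v)"
  proof (intro sum.cong refl)
    fix b assume b: "b \<in> base A n"
    have "R.ip (act R (bas b) u) v = R.ip u (act R (bas (binv b)) v)"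
      using b u v by (simp add: R.act_adjoint bas_in inv_bas)
    also have "\<dots> = wt \<theta> b * R.ip u v" using b \<theta> v(3) by (simp add: binv_in inner_on_simps wt_binv)
    finally show "cnj (wt \<theta> b) * R.ip (act R (bas b) u) v = R.ip u v"
      using wt_norm[OF \<theta> b] complex_norm_square[of "wt \<theta> b"] by (simp add: mult.assoc[symmetric] mult.commute)
  qed
  finally have "R.ip e v = of_nat (card (base A n)) * R.ip u v" by simp
  moreover have "card (base A n) \<noteq> 0" using finite_base bone_in by (auto simp: card_eq_0_iff)
  moreover have "R.ip u v \<noteq> 0" using uv inner_on_commute[of "pts R" u v] by simp
  ultimately have "R.ip e v \<noteq> 0" by simp
  then have "e \<noteq> 0" by (auto simp: inner_on_def)
  \<comment> \<open>Frobenius reciprocity: pair \<open>f\<close> with the translates of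
    \<open>e\<close>.\<close>
  define T where "T f = (\<lambda>(g, x :: unit). if g \<in> carrier W then R.ip f (act R g e) else 0)" for f
  show ?thesis
  proof (rule intertwiner_rep_iso[OF R ind_irreducible[OF \<theta>], of T e])
    show "clinear_on (vecs R) T" by (auto simp: clinear_on_def T_def inner_on_simps fun_eq_iff)
    show "T f \<in> vecs (ind \<theta>)" if "f \<in> vecs R" for f
      unfolding ind_vecs[OF \<theta>]
    proof (intro conjI ballI)
      show "T f \<in> functions_on (carrier W \<times> UNIV)" by (auto simp: T_def functions_on_def)
      fix g h assume g: "g \<in> carrier W" "h \<in> stab \<theta>"
      have "act R (g \<otimes>\<^bsub>W\<^esub> h) e = (\<lambda>p. ch \<theta> h * act R g e p)"
        using g eV stab_carrier[OF g(2)] by (simp add: R.act_mult e_stab clinear_on_scale[OF R.act_lin])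
      then show "T f (g \<otimes>\<^bsub>W\<^esub> h, ()) = cnj (ch \<theta> h) * T f (g, ())"
        using g stab_carrier[OF g(2)] by (simp add: T_def inner_on_simps)
    qed
    show "T (act R g f) = act (ind \<theta>) g (T f)" if g: "g \<in> carrier W" and f: "f \<in> vecs R" for g f
    proof -
      have "T (act R g f) (y, x) = act (ind \<theta>) g (T f) (y, x)" for y x
        using g f eV by (simp add: T_def ind_act R.act_adjoint R.act_in R.act_mult)
      then show ?thesis by (auto simp: fun_eq_iff)
    qed
    show "e \<in> vecs R" by (rule eV)
    have "T e (\<one>\<^bsub>W\<^esub>, ()) \<noteq> 0"
      using R.norm2_pos[OF eV \<open>e \<noteq> 0\<close>] by (simp add: T_def R.act_one[OF eV] inner_on_self)
    then show "T e \<noteq> 0" by (rule nonzero_funI)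
  qed
qed

lemma has_weight_comp:
  assumes R: "unitary_rep W R" and \<theta>: "\<theta> \<in> chars" and \<sigma>: "\<sigma> \<in> SG n" and w: "has_weight R \<theta>"
  shows "has_weight R (\<theta> \<circ> \<sigma>)"
proof -
  interpret R: fin_rep W R by unfold_locales (use R finite_W in auto)
  obtain v where v: "v \<in> vecs R" "v \<noteq> 0" "\<And>x. x \<in> base A n \<Longrightarrow> act R (bas x) v = (\<lambda>p. wt \<theta> x * v p)"
    using w unfolding has_weight_def by blast
  let ?p = "prm (inv' \<sigma>)"
  have p: "?p \<in> carrier W" by (intro prm_in SG_inv \<sigma>)
  have "act R (bas x) (act R ?p v) = (\<lambda>q. wt (\<theta> \<circ> \<sigma>) x * act R ?p v q)" if x: "x \<in> base A n" for x
  proof -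
    have s: "permb \<sigma> x \<in> base A n" using x \<sigma> by (simp add: permb_in)
    have "bas x \<otimes>\<^bsub>W\<^esub> ?p = ?p \<otimes>\<^bsub>W\<^esub> bas (permb \<sigma> x)"
      using x \<sigma> s by (simp add: prm_bas SG_inv permb_comp SG_inv_comp base_group_laws)
    then have "act R (bas x) (act R ?p v) = act R ?p (act R (bas (permb \<sigma> x)) v)"
      using x s p v(1) by (simp add: R.act_mult[symmetric] bas_in)
    also have "\<dots> = (\<lambda>q. wt \<theta> (permb \<sigma> x) * act R ?p v q)"
      using v(3)[OF s] clinear_on_scale[OF R.act_lin[OF p] v(1)] by simp
    finally show ?thesis by (simp add: wt_permb[OF \<sigma>])
  qed
  moreover have "act R ?p v \<noteq> 0"
    using R.norm2_act[OF p v(1)] R.norm2_pos[OF v(1,2)] R.norm2_eq_0[OF R.act_in[OF p v(1)]] by simp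
  ultimately show ?thesis unfolding has_weight_def using R.act_in[OF p v(1)] by blast
qed

section \<open>The standard representation\<close>

abbreviation "Rstd \<equiv> lift_rep snd (std_rep n) :: ('a wreath_elt, nat) urep"

lemma std_pts: "pts Rstd = {1..n}"
  and std_vecs: "vecs Rstd = {f \<in> functions_on {1..n}. (\<Sum>i\<in>{1..n}. f i) = 0}"
  and std_act: "act Rstd (g, \<pi>) f i = f (inv' \<pi> i)"
  by (simp_all add: lift_rep_def std_rep_def)

lemma sum_inv_perm: "\<pi> \<in> SG n \<Longrightarrow> (\<Sum>i\<in>{1..n}. h (inv' \<pi> i)) = (\<Sum>i\<in>{1..n}. h i)"
  using SG_in[OF SG_inv] SG_in
  by (intro sum.reindex_bij_witness[where i = \<pi> and j = "inv' \<pi>"]) (auto simp: SG_inv_apply simp del: atLeastAtMost_iff)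

lemma std_unitary: "unitary_rep W Rstd"
  unfolding unitary_rep_def
proof (intro conjI ballI)
  show "finite (pts Rstd)" unfolding std_pts by simp
  show "csubspace (vecs Rstd)" unfolding std_vecs
    by (rule csubspaceI) (auto simp: functions_on_def sum.distrib sum_distrib_left[symmetric])
  show "vecs Rstd \<subseteq> functions_on (pts Rstd)" unfolding std_vecs std_pts by auto
  fix u assume "u \<in> carrier W"
  then obtain g \<pi> where u: "u = (g, \<pi>)" "g \<in> base A n" "\<pi> \<in> SG n" by (auto simp: carrier_W)
  show "act Rstd u \<in> vecs Rstd \<rightarrow> vecs Rstd"
  proof
    fix f assume f: "f \<in> vecs Rstd"
    have "act Rstd u f i = 0" if "i \<notin> {1..n}" for i
      using f SG_in[OF SG_inv[OF u(3)], of i] that by (auto simp: u(1) std_act std_vecs functions_on_def simp del: atLeastAtMost_iff)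
    then show "act Rstd u f \<in> vecs Rstd"
      using f sum_inv_perm[OF u(3), of f] unfolding std_vecs functions_on_def by (simp add: u(1) std_act)
  qed
  show "clinear_on (vecs Rstd) (act Rstd u)" by (simp add: clinear_on_def u(1) fun_eq_iff std_act)
  show "inner_on (pts Rstd) (act Rstd u f) (act Rstd u f') = inner_on (pts Rstd) f f'" for f f'
    using sum_inv_perm[OF u(3), of "\<lambda>i. f i * cnj (f' i)"] unfolding inner_on_def std_pts by (simp add: u(1) std_act)
next
  fix f assume "f \<in> vecs Rstd"
  show "act Rstd \<one>\<^bsub>W\<^esub> f = f" by (simp add: one_W std_act fun_eq_iff inv_id)
next
  fix u v f assume "u \<in> carrier W" "v \<in> carrier W"
  then obtain g \<pi> h \<sigma> where u: "u = (g, \<pi>)" "\<pi> \<in> SG n" "v = (h, \<sigma>)" "\<sigma> \<in> SG n" by (auto simp: carrier_W)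
  show "act Rstd (u \<otimes>\<^bsub>W\<^esub> v) f = act Rstd u (act Rstd v f)"
    by (simp add: u(1,3) mult_W std_act fun_eq_iff inv_comp[OF u(2,4)])
qed

text \<open>A transposition extracts from a non-constant vector the difference of two unit vectors;
  permuting it gives a spanning set of differences.\<close>

lemma std_irreducible:
  assumes n: "2 \<le> n"
  shows "irreducible_rep W Rstd"
proof -
  define d where "d i j = (\<lambda>k. of_bool (k = i) - of_bool (k = j) :: complex)" for i j :: nat
  have dV: "d i j \<in> vecs Rstd" if "i \<in> {1..n}" "j \<in> {1..n}" for i j
    unfolding std_vecs using that by (auto simp: d_def functions_on_def sum_subtractf of_bool_def)
  have "d 1 2 1 \<noteq> 0" by (simp add: d_def)
  then have "d 1 2 \<noteq> 0" by (rule nonzero_funI)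
  moreover have "d 1 2 \<in> vecs Rstd" using n by (intro dV) auto
  ultimately have "vecs Rstd \<noteq> {0}" by blast
  moreover have "U = {0} \<or> U = vecs Rstd"
    if U: "csubspace U" "U \<subseteq> vecs Rstd" "\<forall>u\<in>carrier W. act Rstd u ` U \<subseteq> U" for U
  proof (cases "U = {0}")
    case False
    then obtain f where f: "f \<in> U" "f \<noteq> 0" using csubspace_0[OF U(1)] by (auto simp: zero_fun_def)
    have fV: "f \<in> functions_on {1..n}" "(\<Sum>i\<in>{1..n}. f i) = 0" using f(1) U(2) by (auto simp: std_vecs)
    have inv: "act Rstd (prm \<pi>) h \<in> U" if "\<pi> \<in> SG n" "h \<in> U" for \<pi> h using U(3) prm_in[OF that(1)] that(2) by blast
    have "\<exists>i\<in>{1..n}. \<exists>j\<in>{1..n}. f i \<noteq> f j"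
    proof (rule ccontr)
      assume "\<not> (\<exists>i\<in>{1..n}. \<exists>j\<in>{1..n}. f i \<noteq> f j)"
      moreover have "1 \<in> {1..n}" using n by simp
      ultimately have c: "f i = f 1" if "i \<in> {1..n}" for i using that by blast
      then have "(\<Sum>i\<in>{1..n}. f i) = (\<Sum>i\<in>{1..n}. f 1)" by (intro sum.cong refl c)
      then have f1: "f 1 = 0" using fV(2) n by simp
      have "f i = 0" for i using c[of i] f1 fV(1) unfolding functions_on_def by (cases "i \<in> {1..n}") (simp, blast)
      then show False using f(2) by (simp add: fun_eq_iff)
    qed
    then obtain i j where ij: "i \<in> {1..n}" "j \<in> {1..n}" "f i \<noteq> f j" by blast
    have "(\<lambda>k. (1 / (f i - f j)) * (f k - act Rstd (prm (tr i j)) f k)) \<in> U"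
      by (intro csubspace_scale[OF U(1)] csubspace_diff[OF U(1) f(1)] inv SG_tr ij f(1))
    moreover have "(1 / (f i - f j)) * (f k - act Rstd (prm (tr i j)) f k) = d i j k" for k
      using ij(3) by (auto simp: prm_def std_act inv_tr d_def Transposition.transpose_def divide_simps)
    ultimately have dij: "d i j \<in> U" by simp
    have ijne: "i \<noteq> j" using ij(3) by auto
    have da: "d i a \<in> U" if a: "a \<in> {1..n}" for a
    proof (cases "a = i")
      case True
      then show ?thesis using csubspace_0[OF U(1)] by (simp add: d_def)
    next
      case False
      have "act Rstd (prm (tr j a)) (d i j) = d i a"
        using False ijne by (auto simp: prm_def std_act inv_tr d_def Transposition.transpose_def fun_eq_iff)
      then show ?thesis using inv[OF SG_tr[OF ij(2) a] dij] by simp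
    qed
    have "h \<in> U" if h: "h \<in> vecs Rstd" for h
    proof -
      have hV: "h \<in> functions_on {1..n}" "(\<Sum>i\<in>{1..n}. h i) = 0" using h by (auto simp: std_vecs)
      have "(\<lambda>k. \<Sum>a\<in>{1..n}. (- h a) * d i a k) \<in> U"
        by (intro csubspace_sum[OF U(1)] csubspace_scale[OF U(1)] da)
      moreover have "(\<Sum>a\<in>{1..n}. (- h a) * d i a k) = h k" for k
      proof -
        have "(\<Sum>a\<in>{1..n}. (- h a) * d i a k) = (\<Sum>a\<in>{1..n}. h a * of_bool (k = a)) - (\<Sum>a\<in>{1..n}. h a) * of_bool (k = i)"
          by (simp add: d_def algebra_simps sum_subtractf sum_distrib_left)
        also have "(\<Sum>a\<in>{1..n}. h a * of_bool (k = a)) = h k"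
          using hV(1) by (auto simp: functions_on_def of_bool_def if_distrib[of "\<lambda>c. _ * c"] cong: if_cong)
        finally show ?thesis unfolding hV(2) by simp
      qed
      ultimately show ?thesis by simp
    qed
    then show ?thesis using U(2) by blast
  qed simp
  ultimately show ?thesis using std_unitary unfolding irreducible_rep_def by blast
qed

lemma std_bas: "act Rstd (bas x) f = f"
  by (simp add: bas_def std_act fun_eq_iff inv_id)

lemma std_fixed:
  assumes n: "2 \<le> n"
  shows "fixed_space W Rstd = {0}"
proof -
  have "fixed_space W Rstd \<noteq> vecs Rstd"
  proof
    assume *: "fixed_space W Rstd = vecs Rstd"
    define d where "d = (\<lambda>k. of_bool (k = (1::nat)) - of_bool (k = (2::nat)) :: complex)"
    have "d \<in> vecs Rstd"
      unfolding std_vecs using n by (auto simp: d_def functions_on_def sum_subtractf of_bool_def)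
    then have "act Rstd (prm (tr 1 2)) d = d"
      using * prm_in[OF SG_tr, of 1 2] n by (auto simp: fixed_space_def)
    then have "act Rstd (prm (tr 1 2)) d 1 = d 1" by simp
    then show False by (simp add: prm_def std_act inv_tr d_def)
  qed
  then show ?thesis using irreducible_fixed_space[OF std_irreducible[OF n]] by blast
qed

text \<open>The translates \<open>v i\<close> of \<open>u\<close> are permuted like the sites and
  fixed by \<open>A^n\<close>, so pairing with them maps \<open>R\<close> to functions on the sites.
  Their sum is fixed by the whole group, hence zero, which forces coordinate sum zero.\<close>

lemma std_iso:
  fixes R :: "('a wreath_elt, 'x) urep"
  assumes n: "2 \<le> n" and R: "irreducible_rep W R" and fx: "fixed_space W R = {0}"
    and u: "u \<in> vecs R" "u \<noteq> 0" "\<And>x. x \<in> base A n \<Longrightarrow> act R (bas x) u = u"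
      "\<And>\<pi>. \<pi> \<in> SG n \<Longrightarrow> \<pi> n = n \<Longrightarrow> act R (prm \<pi>) u = u"
  shows "rep_iso W R Rstd"
proof -
  interpret R: fin_rep W R by unfold_locales (use unitary_of_irreducible[OF R] finite_W in auto)
  have nn: "n \<in> {1..n}" using n by simp
  define v where "v i = act R (prm (tr i n)) u" for i
  have vV: "v i \<in> vecs R" if "i \<in> {1..n}" for i
    unfolding v_def by (intro R.act_in prm_in SG_tr that nn u(1))
  have pu: "act R (prm \<sigma>) u = v (\<sigma> n)" if s: "\<sigma> \<in> SG n" for \<sigma>
  proof -
    have sn: "\<sigma> n \<in> {1..n}" using SG_in[OF s, of n] nn by blast
    have t: "tr (\<sigma> n) n \<in> SG n" by (rule SG_tr[OF sn nn])
    have "prm \<sigma> = prm (tr (\<sigma> n) n) \<otimes>\<^bsub>W\<^esub> prm (tr (\<sigma> n) n \<circ> \<sigma>)"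
      using t by (simp add: prm_prm transpose_comp_transpose)
    then have "act R (prm \<sigma>) u = act R (prm (tr (\<sigma> n) n)) (act R (prm (tr (\<sigma> n) n \<circ> \<sigma>)) u)"
      using t s u(1) by (simp add: R.act_mult prm_in SG_comp)
    also have "act R (prm (tr (\<sigma> n) n \<circ> \<sigma>)) u = u"
      using t s by (intro u(4) SG_comp) auto
    finally show ?thesis by (simp add: v_def)
  qed
  have pv: "act R (prm \<pi>) (v i) = v (\<pi> i)" if "\<pi> \<in> SG n" "i \<in> {1..n}" for \<pi> i
  proof -
    have "act R (prm \<pi>) (v i) = act R (prm (\<pi> \<circ> tr i n)) u"
      unfolding v_def using that u(1) SG_tr[OF that(2) nn] by (simp add: R.act_mult[symmetric] prm_in prm_prm)
    also have "\<dots> = v (\<pi> i)" using that SG_tr[OF that(2) nn] by (simp add: pu SG_comp)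
    finally show ?thesis .
  qed
  have bv: "act R (bas x) (v i) = v i" if "x \<in> base A n" "i \<in> {1..n}" for x i
  proof -
    have t: "tr i n \<in> SG n" by (rule SG_tr[OF that(2) nn])
    let ?x = "permb (tr i n) x"
    have x': "?x \<in> base A n" using t that by (simp add: permb_in)
    have "bas x \<otimes>\<^bsub>W\<^esub> prm (tr i n) = prm (tr i n) \<otimes>\<^bsub>W\<^esub> bas ?x"
      using t that x' by (simp add: prm_bas permb_comp base_group_laws)
    then have "act R (bas x) (v i) = act R (prm (tr i n)) (act R (bas ?x) u)"
      unfolding v_def using t that u(1) x' by (simp add: R.act_mult[symmetric] prm_in bas_in)
    then show ?thesis using u(3)[OF x'] by (simp add: v_def)
  qed
  have gv: "act R (g, \<pi>) (v i) = v (\<pi> i)" if "g \<in> base A n" "\<pi> \<in> SG n" "i \<in> {1..n}" for g \<pi> i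
  proof -
    have i: "\<pi> i \<in> {1..n}" using SG_in[OF that(2), of i] that(3) by blast
    show ?thesis using that i vV[OF that(3)]
      by (simp add: bas_prm[symmetric] R.act_mult bas_in prm_in pv bv del: atLeastAtMost_iff)
  qed
  define s where "s = (\<lambda>x. \<Sum>i\<in>{1..n}. v i x)"
  have sV: "s \<in> vecs R" unfolding s_def by (intro R.V_sum vV)
  have "act R w s = s" if wW: "w \<in> carrier W" for w
  proof -
    obtain g \<pi> where w: "w = (g, \<pi>)" "g \<in> base A n" "\<pi> \<in> SG n" using wW by (auto simp: carrier_W)
    have "act R w s = (\<lambda>x. \<Sum>i\<in>{1..n}. act R w (v i) x)"
      unfolding s_def by (rule clinear_on_sum[OF R.act_lin[OF wW] R.sub_V vV])
    also have "\<dots> = (\<lambda>x. \<Sum>i\<in>{1..n}. v (\<pi> i) x)" using w gv by simp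
    also have "\<dots> = s"
    proof
      fix x show "(\<Sum>i\<in>{1..n}. v (\<pi> i) x) = s x"
        using sum_inv_perm[OF SG_inv[OF w(3)], of "\<lambda>i. v i x"] by (simp add: SG_inv_inv[OF w(3)] s_def)
    qed
    finally show ?thesis .
  qed
  then have "s \<in> fixed_space W R" using sV by (simp add: fixed_space_def)
  then have s0: "s = 0" using fx by blast
  define T where "T f = (\<lambda>i. if i \<in> {1..n} then R.ip f (v i) else 0)" for f
  show ?thesis
  proof (rule intertwiner_rep_iso[OF R std_irreducible[OF n], of T u])
    show "clinear_on (vecs R) T" by (auto simp: clinear_on_def T_def inner_on_simps fun_eq_iff)
    show "T f \<in> vecs Rstd" if "f \<in> vecs R" for f
    proof -
      have "(\<Sum>i\<in>{1..n}. T f i) = R.ip f s" by (simp add: T_def s_def inner_on_sum)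
      then show ?thesis unfolding std_vecs by (simp add: s0 inner_on_def) (simp add: T_def functions_on_def)
    qed
    show "T (act R w f) = act Rstd w (T f)" if w: "w \<in> carrier W" and f: "f \<in> vecs R" for w f
    proof
      fix i
      obtain g \<pi> where g: "w = (g, \<pi>)" "g \<in> base A n" "\<pi> \<in> SG n" using w by (auto simp: carrier_W)
      have i': "inv' \<pi> i \<in> {1..n} \<longleftrightarrow> i \<in> {1..n}" by (rule SG_in[OF SG_inv[OF g(3)]])
      show "T (act R w f) i = act Rstd w (T f) i"
      proof (cases "i \<in> {1..n}")
        case True
        have "act R (inv\<^bsub>W\<^esub> w) (v i) = v (inv' \<pi> i)"
          unfolding g(1) inv_W[OF g(2,3)] using g True by (intro gv binv_in permb_in SG_inv) auto
        then show ?thesis using True i' w f vV[OF True] by (simp add: T_def g(1) std_act R.act_adjoint del: atLeastAtMost_iff)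
      next
        case False
        then show ?thesis using i' by (simp add: T_def g(1) std_act del: atLeastAtMost_iff)
      qed
    qed
    show "u \<in> vecs R" by (rule u(1))
    have "v n = u" using u(4)[OF SG_id] by (simp add: v_def)
    then have "T u n \<noteq> 0" using nn R.norm2_pos[OF u(1,2)] by (simp add: T_def inner_on_self)
    then show "T u \<noteq> 0" by (rule nonzero_funI)
  qed
qed

section \<open>Multiplicity vectors\<close>

definition cnt :: "(nat \<Rightarrow> 'a \<Rightarrow> complex) \<Rightarrow> ('a \<Rightarrow> complex) \<Rightarrow> nat" where
  "cnt \<theta> c = card {i \<in> {1..n}. \<theta> i = c}"

lemma cnt_perm:
  assumes "\<sigma> \<in> SG n" "\<And>i. i \<in> {1..n} \<Longrightarrow> \<theta>' i = \<theta> (\<sigma> i)"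
  shows "cnt \<theta>' c = cnt \<theta> c"
  unfolding cnt_def
proof (rule bij_betw_same_card[of \<sigma>], rule bij_betwI[where g = "inv' \<sigma>"])
  show "\<sigma> \<in> {i \<in> {1..n}. \<theta>' i = c} \<rightarrow> {i \<in> {1..n}. \<theta> i = c}"
  proof
    fix i assume i: "i \<in> {i \<in> {1..n}. \<theta>' i = c}"
    then have "\<sigma> i \<in> {1..n}" using SG_in[OF assms(1), of i] by blast
    then show "\<sigma> i \<in> {i \<in> {1..n}. \<theta> i = c}" using i assms(2)[of i] by simp
  qed
  show "inv' \<sigma> \<in> {i \<in> {1..n}. \<theta> i = c} \<rightarrow> {i \<in> {1..n}. \<theta>' i = c}"
  proof
    fix i assume i: "i \<in> {i \<in> {1..n}. \<theta> i = c}"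
    then have "inv' \<sigma> i \<in> {1..n}" using SG_in[OF SG_inv[OF assms(1)], of i] by blast
    then show "inv' \<sigma> i \<in> {i \<in> {1..n}. \<theta>' i = c}"
      using i assms(2)[of "inv' \<sigma> i"] SG_inv_apply(2)[OF assms(1), of i] by simp
  qed
qed (simp_all add: SG_inv_apply[OF assms(1)])

text \<open>Equal counts mean equal multisets of labels.\<close>

lemma cnt_eq_perm:
  assumes \<theta>: "\<theta> \<in> chars" "\<theta>' \<in> chars" and eq: "\<And>c. c \<in> Ahat \<Longrightarrow> cnt \<theta> c = cnt \<theta>' c"
  shows "\<exists>\<sigma>\<in>SG n. \<forall>i\<in>{1..n}. \<theta>' i = \<theta> (\<sigma> i)"
proof -
  have "image_mset \<theta>' (mset_set {1..n}) = image_mset \<theta> (mset_set {1..n})"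
  proof (rule multiset_eqI)
    fix c
    have k: "count (image_mset t (mset_set {1..n})) c = cnt t c" for t
      by (simp add: count_image_mset' cnt_def) (auto simp: sum.If_cases Int_def conj_commute intro!: arg_cong[where f = card])
    show "count (image_mset \<theta>' (mset_set {1..n})) c = count (image_mset \<theta> (mset_set {1..n})) c"
    proof (cases "c \<in> Ahat")
      case True
      then show ?thesis unfolding k using eq by simp
    next
      case False
      then have "{i \<in> {1..n}. \<theta> i = c} = {}" "{i \<in> {1..n}. \<theta>' i = c} = {}" using \<theta> chars_in by blast+
      then show ?thesis unfolding k cnt_def by (simp only:)
    qed
  qed
  then obtain p where "p permutes {1..n}" "\<forall>i\<in>{1..n}. \<theta>' i = \<theta> (p i)"
    using image_mset_eq_implies_permutes[of "{1..n}" \<theta>' \<theta>] by auto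
  then show ?thesis by (auto simp: SG_def)
qed

lemma ind_cong:
  assumes "\<And>u. u \<in> carrier W \<Longrightarrow> \<phi> u = ch \<theta> u"
  shows "induced_rep W (stab \<theta>) (character_rep \<phi>) = ind \<theta>"
proof -
  have "act (character_rep \<phi>) (inv\<^bsub>W\<^esub> h) f = act (character_rep (ch \<theta>)) (inv\<^bsub>W\<^esub> h) f" if "h \<in> stab \<theta>" for h f
    using assms[of "inv\<^bsub>W\<^esub> h"] stab_carrier[OF that] by (simp add: character_rep_def)
  then have "(\<forall>g\<in>carrier W. \<forall>h\<in>stab \<theta>. (\<lambda>x. F (g \<otimes>\<^bsub>W\<^esub> h, x)) = act (character_rep \<phi>) (inv\<^bsub>W\<^esub> h) (\<lambda>x. F (g, x)))
      \<longleftrightarrow> (\<forall>g\<in>carrier W. \<forall>h\<in>stab \<theta>. (\<lambda>x. F (g \<otimes>\<^bsub>W\<^esub> h, x)) = act (character_rep (ch \<theta>)) (inv\<^bsub>W\<^esub> h) (\<lambda>x. F (g, x)))" for F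
    by simp
  moreover have "pts (character_rep \<phi>) = pts (character_rep (ch \<theta>))" "vecs (character_rep \<phi>) = vecs (character_rep (ch \<theta>))"
    by (simp_all add: character_rep_def)
  ultimately show ?thesis unfolding ind_def induced_rep_def by simp
qed

lemma block_decomposition_exists:
  assumes "\<kappa> \<in> mult_vectors A n"
  shows "\<exists>B. block_decomposition A n \<kappa> B"
proof -
  let ?S = "SIGMA c:Ahat. {..<\<kappa> c}"
  have "card ?S = n" using assms finite_Ahat by (simp add: mult_vectors_def)
  moreover have "finite ?S" using finite_Ahat by auto
  ultimately obtain h where h: "bij_betw h {1..n} ?S"
    using finite_same_card_bij[of "{1..n}" ?S] by auto
  define B where "B c = {i \<in> {1..n}. fst (h i) = c}" for c
  have "card (B c) = \<kappa> c" if c: "c \<in> Ahat" for c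
  proof -
    have "h ` B c = {c} \<times> {..<\<kappa> c}"
    proof
      show "h ` B c \<subseteq> {c} \<times> {..<\<kappa> c}"
      proof
        fix p assume "p \<in> h ` B c"
        then obtain i where i: "i \<in> {1..n}" "fst (h i) = c" "p = h i" unfolding B_def by blast
        then show "p \<in> {c} \<times> {..<\<kappa> c}" using bij_betw_apply[OF h i(1)] by (cases "h i") simp
      qed
      show "{c} \<times> {..<\<kappa> c} \<subseteq> h ` B c"
      proof
        fix p assume p: "p \<in> {c} \<times> {..<\<kappa> c}"
        then have "p \<in> ?S" using c by auto
        then have "p \<in> h ` {1..n}" using bij_betw_imp_surj_on[OF h] by simp
        then obtain i where i: "i \<in> {1..n}" "p = h i" by blast
        then have "i \<in> B c" unfolding B_def using p by auto
        then show "p \<in> h ` B c" using i(2) by blast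
      qed
    qed
    then have "bij_betw h (B c) ({c} \<times> {..<\<kappa> c})"
      by (rule bij_betw_subset[OF h, rotated]) (auto simp: B_def)
    then have "card (B c) = card ({c} \<times> {..<\<kappa> c})" by (rule bij_betw_same_card)
    then show ?thesis by simp
  qed
  moreover have "fst (h i) \<in> Ahat" if "i \<in> {1..n}" for i
    using bij_betw_apply[OF h that] by auto
  ultimately show ?thesis
    unfolding block_decomposition_def disjoint_family_on_def by (intro exI[of _ B]) (auto simp: B_def)
qed

text \<open>Passes from the chosen block decomposition to the labelling that sends a site to the
  character of its block; the later arguments work with \<open>ind \<theta>\<close>.\<close>

lemma V_class_ind:
  assumes k: "\<kappa> \<in> mult_vectors A n"
  shows "\<exists>\<theta>\<in>chars. (\<forall>c\<in>Ahat. cnt \<theta> c = \<kappa> c) \<and> V_class A n \<kappa> = iso_class W (ind \<theta>)"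
proof -
  define B where "B = (SOME B. block_decomposition A n \<kappa> B)"
  have B: "block_decomposition A n \<kappa> B"
    unfolding B_def by (rule someI_ex[OF block_decomposition_exists[OF k]])
  then have dis: "i \<in> B c \<Longrightarrow> i \<in> B c' \<Longrightarrow> c \<in> Ahat \<Longrightarrow> c' \<in> Ahat \<Longrightarrow> c = c'"
    and un: "(\<Union>c\<in>Ahat. B c) = {1..n}" and crd: "\<And>c. c \<in> Ahat \<Longrightarrow> card (B c) = \<kappa> c" for i c c'
    unfolding block_decomposition_def disjoint_family_on_def by blast+
  define \<theta> where "\<theta> i = (THE c. c \<in> Ahat \<and> i \<in> B c)" for i
  have the: "\<theta> i = c" if "c \<in> Ahat" "i \<in> B c" for i c
    unfolding \<theta>_def using that dis by (intro the_equality) blast+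
  have ex: "\<exists>c\<in>Ahat. i \<in> B c" if "i \<in> {1..n}" for i using un that by blast
  have \<theta>: "\<theta> \<in> chars" unfolding chars_def using ex the by force
  have Bc: "B c = {i \<in> {1..n}. \<theta> i = c}" if c: "c \<in> Ahat" for c
  proof
    show "B c \<subseteq> {i \<in> {1..n}. \<theta> i = c}" using the[OF c] un c by blast
    show "{i \<in> {1..n}. \<theta> i = c} \<subseteq> B c"
    proof
      fix i assume i: "i \<in> {i \<in> {1..n}. \<theta> i = c}"
      then obtain c' where "c' \<in> Ahat" "i \<in> B c'" using ex by blast
      then show "i \<in> B c" using the[of c' i] i by simp
    qed
  qed
  have "block_subgroup A n B = stab \<theta>"
  proof -
    have "(\<forall>c\<in>Ahat. \<pi> ` B c = B c) \<longleftrightarrow> (\<forall>i\<in>{1..n}. \<theta> (\<pi> i) = \<theta> i)" if p: "\<pi> \<in> SG n" for \<pi>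
    proof
      assume l: "\<forall>c\<in>Ahat. \<pi> ` B c = B c"
      show "\<forall>i\<in>{1..n}. \<theta> (\<pi> i) = \<theta> i"
      proof
        fix i assume "i \<in> {1..n}"
        then obtain c where "c \<in> Ahat" "i \<in> B c" using ex by blast
        moreover then have "\<pi> i \<in> B c" using l by blast
        ultimately show "\<theta> (\<pi> i) = \<theta> i" using the by simp
      qed
    next
      assume r: "\<forall>i\<in>{1..n}. \<theta> (\<pi> i) = \<theta> i"
      show "\<forall>c\<in>Ahat. \<pi> ` B c = B c"
      proof
        fix c assume c: "c \<in> Ahat"
        have "finite (B c)" unfolding Bc[OF c] by simp
        moreover have "\<pi> ` B c \<subseteq> B c" unfolding Bc[OF c] using r SG_in[OF p] by auto
        moreover have "inj_on \<pi> (B c)" using permutes_inj_on[OF SG_D[OF p]] by blast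
        ultimately show "\<pi> ` B c = B c" by (rule endo_inj_surj)
      qed
    qed
    then show ?thesis unfolding block_subgroup_def stab_def by (auto simp: carrier_W)
  qed
  moreover have "block_character A B u = ch \<theta> u" if "u \<in> carrier W" for u
  proof -
    obtain g \<pi> where u: "u = (g, \<pi>)" by force
    have "block_character A B u = (\<Prod>c\<in>Ahat. \<Prod>i\<in>{i \<in> {1..n}. \<theta> i = c}. \<theta> i (g i))"
      unfolding block_character_def u by (simp add: Bc)
    also have "\<dots> = (\<Prod>i\<in>{1..n}. \<theta> i (g i))"
      by (rule prod.group) (use finite_Ahat chars_in[OF \<theta>] in auto)
    finally show ?thesis by (simp add: ch_def wt_def u)
  qed
  ultimately have "V_class A n \<kappa> = iso_class W (ind \<theta>)"
    unfolding V_class_def B_def[symmetric] Let_def using ind_cong by simp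
  moreover have "cnt \<theta> c = \<kappa> c" if "c \<in> Ahat" for c using crd[OF that] by (simp add: cnt_def Bc[OF that])
  ultimately show ?thesis using \<theta> by blast
qed

end

section \<open>Joint eigenvectors of commuting operators of finite order\<close>

text \<open>The \<open>g j\<close> are discrete Fourier components of the orbit of \<open>f\<close>:
  each is zero or an eigenvector with eigenvalue \<open>1 / z j\<close>. They add up to
  \<open>m\<close> times \<open>f\<close>, so they cannot all vanish.\<close>

lemma finite_order_eigenvector:
  assumes U: "csubspace U" and lin: "clinear_on U T" and TU: "\<And>f. f \<in> U \<Longrightarrow> T f \<in> U"
    and m: "0 < m" "\<And>f. f \<in> U \<Longrightarrow> (T ^^ m) f = f" and f: "f \<in> U" "f \<noteq> 0"
  shows "\<exists>g\<in>U. g \<noteq> 0 \<and> (\<exists>c. T g = (\<lambda>x. c * g x))"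
proof -
  define z where "z k = cis (2 * pi * real k / real m)" for k :: nat
  have z_pow: "z j ^ k = z k ^ j" for j k by (simp add: z_def DeMoivre mult_ac)
  have z_m: "z j ^ m = 1" for j
    using m(1) by (simp add: z_def DeMoivre cis_multiple_2pi)
  have z_nz: "z j \<noteq> 0" for j by (simp add: z_def)
  have z_inj: "inj_on z {..<m}" using bij_betw_imp_inj_on[OF bij_betw_roots_unity[OF m(1)]] unfolding z_def[abs_def] .
  have z_ne: "z k \<noteq> 1" if k: "0 < k" "k < m" for k
  proof
    assume "z k = 1"
    then have "z k = z 0" by (simp add: z_def)
    then show False using inj_onD[OF z_inj, of k 0] k by simp
  qed
  have TkU: "(T ^^ k) f \<in> U" for k by (induction k) (auto intro: TU f)
  define g where "g j = (\<lambda>x. \<Sum>k<m. z j ^ k * (T ^^ k) f x)" for j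
  have gU: "g j \<in> U" for j unfolding g_def by (intro csubspace_sum[OF U] csubspace_scale[OF U] TkU)
  have Tg: "T (g j) = (\<lambda>x. (1 / z j) * g j x)" for j
  proof
    fix x
    define h where "h k = z j ^ k * (T ^^ k) f x" for k
    have "T (g j) = (\<lambda>x. \<Sum>k<m. T (\<lambda>x. z j ^ k * (T ^^ k) f x) x)"
      unfolding g_def by (rule clinear_on_sum[OF lin U], rule csubspace_scale[OF U TkU])
    then have "T (g j) x = (\<Sum>k<m. z j ^ k * (T ^^ Suc k) f x)"
      by (simp add: clinear_on_scale[OF lin TkU])
    then have "z j * T (g j) x = (\<Sum>k<m. h (Suc k))" by (simp add: h_def sum_distrib_left mult.assoc)
    also have "\<dots> = (\<Sum>k<m. h k)"
    proof -
      have "h 0 + (\<Sum>k<m. h (Suc k)) = (\<Sum>k<m. h k) + h m"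
        using sum.lessThan_Suc_shift[of h m] sum.lessThan_Suc[of h m] by simp
      moreover have "h m = h 0" using m(2)[OF f(1)] z_m by (simp add: h_def)
      ultimately show ?thesis by simp
    qed
    finally show "T (g j) x = (1 / z j) * g j x" using z_nz[of j] by (simp add: g_def h_def field_simps)
  qed
  have "\<exists>j. g j \<noteq> 0"
  proof (rule ccontr)
    assume "\<not> (\<exists>j. g j \<noteq> 0)"
    then have g0: "g j x = 0" for j x by simp
    have "f x = 0" for x
    proof -
      have "0 = (\<Sum>j<m. g j x)" by (simp add: g0)
      also have "\<dots> = (\<Sum>k<m. \<Sum>j<m. z j ^ k * (T ^^ k) f x)" unfolding g_def by (rule sum.swap)
      also have "\<dots> = (\<Sum>k<m. (\<Sum>j<m. z k ^ j) * (T ^^ k) f x)"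
        unfolding sum_distrib_right by (intro sum.cong refl) (simp only: z_pow)
      also have "\<dots> = (\<Sum>k<m. if k = 0 then of_nat m * f x else 0)"
      proof (rule sum.cong[OF refl])
        fix k assume "k \<in> {..<m}"
        then have k: "k < m" by simp
        show "(\<Sum>j<m. z k ^ j) * (T ^^ k) f x = (if k = 0 then of_nat m * f x else 0)"
        proof (cases "k = 0")
          case True
          then show ?thesis by (simp add: z_def)
        next
          case False
          then have "(\<Sum>j<m. z k ^ j) = (z k ^ m - 1) / (z k - 1)" using z_ne k by (intro geometric_sum) auto
          then show ?thesis using False by (simp add: z_m)
        qed
      qed
      also have "\<dots> = of_nat m * f x" using m(1) by simp
      finally show ?thesis using m(1) by simp
    qed
    then show False using f(2) by (simp add: fun_eq_iff)
  qed
  then show ?thesis using gU Tg by blast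
qed

text \<open>The next operator is restricted to a joint eigenspace of the previous ones, which
  commutation keeps invariant.\<close>

lemma joint_eigenvector:
  assumes "finite X" and U: "csubspace U" and lin: "\<And>k. k \<in> X \<Longrightarrow> clinear_on U (T k)"
    and TU: "\<And>k f. k \<in> X \<Longrightarrow> f \<in> U \<Longrightarrow> T k f \<in> U"
    and comm: "\<And>k l f. k \<in> X \<Longrightarrow> l \<in> X \<Longrightarrow> f \<in> U \<Longrightarrow> T k (T l f) = T l (T k f)"
    and m: "0 < m" "\<And>k f. k \<in> X \<Longrightarrow> f \<in> U \<Longrightarrow> (T k ^^ m) f = f" and f: "f \<in> U" "f \<noteq> 0"
  shows "\<exists>g\<in>U. g \<noteq> 0 \<and> (\<forall>k\<in>X. \<exists>c. T k g = (\<lambda>x. c * g x))"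
  using assms(1) lin TU comm m(2)
proof (induction X rule: finite_induct)
  case empty
  then show ?case using f by blast
next
  case (insert l X)
  have "\<exists>g\<in>U. g \<noteq> 0 \<and> (\<forall>k\<in>X. \<exists>c. T k g = (\<lambda>x. c * g x))"
    by (rule insert.IH) (use insert.prems in simp_all)
  then obtain g where g: "g \<in> U" "g \<noteq> 0" "\<forall>k\<in>X. \<exists>c. T k g = (\<lambda>x. c * g x)" by blast
  obtain c where c: "\<And>k. k \<in> X \<Longrightarrow> T k g = (\<lambda>x. c k * g x)" using bchoice[OF g(3)] by blast
  define U' where "U' = {h \<in> U. \<forall>k\<in>X. T k h = (\<lambda>x. c k * h x)}"
  have linX: "clinear_on U (T k)" if "k \<in> X" for k using insert.prems(1)[of k] that by simp
  have U': "csubspace U'"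
    by (rule csubspaceI)
      (auto simp: U'_def csubspace_0[OF U] csubspace_add[OF U] csubspace_scale[OF U] clinear_on_0[OF linX U]
        clinear_on_add[OF linX] clinear_on_scale[OF linX] algebra_simps)
  have linl: "clinear_on U (T l)" using insert.prems(1) by simp
  have U'U: "h \<in> U" if "h \<in> U'" for h using that by (simp add: U'_def)
  have lin': "clinear_on U' (T l)" using linl U'U unfolding clinear_on_def by blast
  have TU': "T l h \<in> U'" if h: "h \<in> U'" for h
  proof -
    have hU: "h \<in> U" by (rule U'U[OF h])
    have "T k (T l h) = (\<lambda>x. c k * T l h x)" if k: "k \<in> X" for k
    proof -
      have "T k (T l h) = T l (T k h)" using insert.prems(3)[of k l h] k hU by simp
      also have "T k h = (\<lambda>x. c k * h x)" using h k by (simp add: U'_def)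
      finally show ?thesis by (simp only: clinear_on_scale[OF linl hU])
    qed
    then show ?thesis using insert.prems(2)[of l h] hU by (simp add: U'_def)
  qed
  have mU': "(T l ^^ m) h = h" if "h \<in> U'" for h using insert.prems(4)[of l h] U'U[OF that] by simp
  have gU': "g \<in> U'" using g(1) c by (simp add: U'_def)
  obtain h where h: "h \<in> U'" "h \<noteq> 0" "\<exists>c. T l h = (\<lambda>x. c * h x)"
    using finite_order_eigenvector[OF U' lin' TU' m(1) mU' gU' g(2)] by blast
  have "\<exists>c. T k h = (\<lambda>x. c * h x)" if "k \<in> X" for k using h(1) that by (auto simp: U'_def)
  then show ?case using h U'U by blast
qed

context wr
begin

section \<open>Admissible elements\<close>

definition pairs :: "(nat \<times> nat) set" where
  "pairs = {(i, j). 1 \<le> i \<and> i < j \<and> j \<le> n}"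

definition adm :: "(nat \<Rightarrow> nat \<Rightarrow> real) \<Rightarrow> ((nat \<Rightarrow> 'a) \<Rightarrow> real) \<Rightarrow> 'a wreath_elt \<Rightarrow> real" where
  "adm a c u = (\<Sum>(i, j)\<in>pairs. a i j * of_bool (u = prm (tr i j))) + (\<Sum>x\<in>base A n. c x * of_bool (u = bas x))"

definition weights :: "(nat \<Rightarrow> nat \<Rightarrow> real) \<Rightarrow> ((nat \<Rightarrow> 'a) \<Rightarrow> real) \<Rightarrow> bool" where
  "weights a c \<longleftrightarrow> (\<forall>i j. 1 \<le> i \<and> i < j \<and> j \<le> n \<longrightarrow> 0 \<le> a i j) \<and> (\<forall>x\<in>base A n. 0 \<le> c x \<and> c x = c (binv x))"

lemma admissible_iff: "admissible A n w \<longleftrightarrow> (\<exists>a c. weights a c \<and> w = adm a c)"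
  by (simp add: admissible_def weights_def adm_def[abs_def] pairs_def prm_def bas_def bone_def binv_def conj_assoc)

lemma finite_pairs: "finite pairs"
  by (rule finite_subset[of _ "{..n} \<times> {..n}"]) (auto simp: pairs_def)

lemma pairs_tr: "(i, j) \<in> pairs \<Longrightarrow> tr i j \<in> SG n"
  by (rule SG_tr) (auto simp: pairs_def)

lemma pairs_prm: "(i, j) \<in> pairs \<Longrightarrow> prm (tr i j) \<in> carrier W"
  by (intro prm_in pairs_tr)

lemma adm_sum:
  "(\<Sum>h\<in>carrier W. adm a c h * \<Phi> h) = (\<Sum>(i, j)\<in>pairs. a i j * \<Phi> (prm (tr i j))) + (\<Sum>x\<in>base A n. c x * \<Phi> (bas x))"
proof -
  have d: "(\<Sum>h\<in>carrier W. of_bool (h = k) * \<Phi> h) = \<Phi> k" if "k \<in> carrier W" for k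
    using finite_W that by (simp add: of_bool_def if_distrib[of "\<lambda>c. c * _"] cong: if_cong)
  have "(\<Sum>h\<in>carrier W. adm a c h * \<Phi> h) = (\<Sum>h\<in>carrier W. \<Sum>p\<in>pairs. (case p of (i, j) \<Rightarrow> a i j * (of_bool (h = prm (tr i j)) * \<Phi> h)))
      + (\<Sum>h\<in>carrier W. \<Sum>x\<in>base A n. c x * (of_bool (h = bas x) * \<Phi> h))"
    unfolding adm_def by (simp add: distrib_right sum_distrib_right sum.distrib case_prod_unfold mult.assoc)
  also have "(\<Sum>h\<in>carrier W. \<Sum>p\<in>pairs. (case p of (i, j) \<Rightarrow> a i j * (of_bool (h = prm (tr i j)) * \<Phi> h)))
      = (\<Sum>p\<in>pairs. \<Sum>h\<in>carrier W. (case p of (i, j) \<Rightarrow> a i j * (of_bool (h = prm (tr i j)) * \<Phi> h)))" by (rule sum.swap)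
  also have "\<dots> = (\<Sum>(i, j)\<in>pairs. a i j * \<Phi> (prm (tr i j)))"
  proof (rule sum.cong[OF refl])
    fix p assume p: "p \<in> pairs"
    obtain i j where ij: "p = (i, j)" by (cases p)
    show "(\<Sum>h\<in>carrier W. (case p of (i, j) \<Rightarrow> a i j * (of_bool (h = prm (tr i j)) * \<Phi> h))) = (case p of (i, j) \<Rightarrow> a i j * \<Phi> (prm (tr i j)))"
      unfolding ij case_prod_conv sum_distrib_left[symmetric] d[OF pairs_prm[OF p[unfolded ij]]] ..
  qed
  also have "(\<Sum>h\<in>carrier W. \<Sum>x\<in>base A n. c x * (of_bool (h = bas x) * \<Phi> h))
      = (\<Sum>x\<in>base A n. \<Sum>h\<in>carrier W. c x * (of_bool (h = bas x) * \<Phi> h))" by (rule sum.swap)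
  also have "\<dots> = (\<Sum>x\<in>base A n. c x * \<Phi> (bas x))"
    by (intro sum.cong refl) (simp only: sum_distrib_left[symmetric] d[OF bas_in])
  finally show ?thesis .
qed

lemma inv_eq_iff: "h \<in> carrier W \<Longrightarrow> k \<in> carrier W \<Longrightarrow> inv\<^bsub>W\<^esub> h = k \<longleftrightarrow> h = inv\<^bsub>W\<^esub> k"
  by auto

lemma adm_sym:
  assumes w: "weights a c" and h: "h \<in> carrier W"
  shows "adm a c (inv\<^bsub>W\<^esub> h) = adm a c h"
proof -
  have "(\<Sum>(i, j)\<in>pairs. a i j * of_bool (inv\<^bsub>W\<^esub> h = prm (tr i j))) = (\<Sum>(i, j)\<in>pairs. a i j * of_bool (h = prm (tr i j)))"
    using inv_eq_iff[OF h pairs_prm] by (intro sum.cong refl) (auto simp: inv_prm pairs_tr inv_tr)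
  moreover have "(\<Sum>x\<in>base A n. c x * of_bool (inv\<^bsub>W\<^esub> h = bas x)) = (\<Sum>x\<in>base A n. c x * of_bool (h = bas x))"
  proof (rule sum.reindex_bij_witness[where i = binv and j = binv])
    fix x assume x: "x \<in> base A n"
    have "inv\<^bsub>W\<^esub> h = bas x \<longleftrightarrow> h = bas (binv x)" using inv_eq_iff[OF h bas_in[OF x]] x by (simp add: inv_bas)
    then show "c (binv x) * of_bool (h = bas (binv x)) = c x * of_bool (inv\<^bsub>W\<^esub> h = bas x)"
      using w x unfolding weights_def by simp
  qed (auto simp: base_group_laws binv_in)
  ultimately show ?thesis by (simp add: adm_def)
qed

lemma adm_nonneg: "weights a c \<Longrightarrow> 0 \<le> adm a c h"
  unfolding adm_def weights_def pairs_def by (intro add_nonneg_nonneg sum_nonneg) auto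

lemma adm_support:
  assumes "adm a c h \<noteq> 0"
  obtains i j where "(i, j) \<in> pairs" "h = prm (tr i j)" | x where "x \<in> base A n" "h = bas x"
proof (cases "(\<exists>(i, j)\<in>pairs. h = prm (tr i j)) \<or> (\<exists>x\<in>base A n. h = bas x)")
  case True
  then show ?thesis using that by blast
next
  case False
  then have "(\<Sum>(i, j)\<in>pairs. a i j * of_bool (h = prm (tr i j))) = 0" "(\<Sum>x\<in>base A n. c x * of_bool (h = bas x)) = 0"
    by (auto intro!: sum.neutral)
  then show ?thesis using assms by (simp add: adm_def)
qed

lemma laplacian_rep_adm:
  assumes "unitary_rep W R" "weights a c"
  shows "laplacian_rep W R (adm a c)"
  by unfold_locales (use assms finite_W adm_sym in auto)

lemma adm_form:
  assumes R: "unitary_rep W R" and w: "weights a c" and f: "f \<in> vecs R"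
  shows "Re (inner_on (pts R) (laplacian W (adm a c) R f) f) =
    ((\<Sum>(i, j)\<in>pairs. a i j * norm2_on (pts R) (\<lambda>y. f y - act R (prm (tr i j)) f y))
      + (\<Sum>x\<in>base A n. c x * norm2_on (pts R) (\<lambda>y. f y - act R (bas x) f y))) / 2"
proof -
  interpret laplacian_rep W R "adm a c" by (rule laplacian_rep_adm[OF R w])
  show ?thesis unfolding laplacian_form[OF f] adm_sum[of a c "\<lambda>h. norm2_on (pts R) (\<lambda>y. f y - act R h f y)"] ..
qed

lemma sum_pairs:
  fixes h :: "nat \<Rightarrow> nat \<Rightarrow> real"
  assumes "\<And>i j. h i j = h j i" "\<And>i. h i i = 0"
  shows "(\<Sum>i\<in>{1..n}. \<Sum>j\<in>{1..n}. h i j) = 2 * (\<Sum>(i, j)\<in>pairs. h i j)"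
proof -
  let ?D = "{1..n} \<times> {1..n}"
  have "(\<Sum>i\<in>{1..n}. \<Sum>j\<in>{1..n}. h i j) = (\<Sum>(i, j)\<in>?D. h i j)" by (rule sum.cartesian_product)
  also have "\<dots> = (\<Sum>(i, j)\<in>pairs \<union> prod.swap ` pairs. h i j)"
  proof (rule sum.mono_neutral_right)
    show "pairs \<union> prod.swap ` pairs \<subseteq> ?D" by (auto simp: pairs_def)
    show "\<forall>p\<in>?D - (pairs \<union> prod.swap ` pairs). (case p of (i, j) \<Rightarrow> h i j) = 0"
    proof
      fix p assume p: "p \<in> ?D - (pairs \<union> prod.swap ` pairs)"
      obtain i j where ij: "p = (i, j)" by (cases p)
      have "\<not> i < j" using p by (auto simp: ij pairs_def)
      moreover have "\<not> j < i"
      proof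
        assume "j < i"
        then have "prod.swap (j, i) \<in> prod.swap ` pairs" using p by (intro imageI) (auto simp: ij pairs_def)
        then show False using p by (simp add: ij)
      qed
      ultimately have "i = j" by simp
      then show "(case p of (i, j) \<Rightarrow> h i j) = 0" by (simp add: ij assms(2))
    qed
  qed simp
  also have "\<dots> = (\<Sum>(i, j)\<in>pairs. h i j) + (\<Sum>(i, j)\<in>prod.swap ` pairs. h i j)"
    by (rule sum.union_disjoint[OF finite_pairs finite_imageI[OF finite_pairs]]) (auto simp: pairs_def)
  also have "(\<Sum>(i, j)\<in>prod.swap ` pairs. h i j) = (\<Sum>(i, j)\<in>pairs. h i j)"
    by (subst sum.reindex) (auto simp: case_prod_unfold assms(1)[of "snd _"] intro!: sum.cong)
  finally show ?thesis by simp
qed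

end

text \<open>The reverse triangle inequality, squared. Through it, passing to root sums of squares
  does not increase distances in the diamagnetic step.\<close>

lemma L2_set_diff_le: "(L2_set a S - L2_set b S)\<^sup>2 \<le> (\<Sum>i\<in>S. (a i - b i)\<^sup>2)"
proof -
  have 1: "L2_set a S \<le> L2_set (\<lambda>i. a i - b i) S + L2_set b S"
    using L2_set_triangle_ineq[of "\<lambda>i. a i - b i" b S] by simp
  have "L2_set (\<lambda>i. b i - a i) S = L2_set (\<lambda>i. a i - b i) S"
    by (simp add: L2_set_def power2_commute)
  then have 2: "L2_set b S \<le> L2_set (\<lambda>i. a i - b i) S + L2_set a S"
    using L2_set_triangle_ineq[of "\<lambda>i. b i - a i" a S] by simp
  have "\<bar>L2_set a S - L2_set b S\<bar> \<le> L2_set (\<lambda>i. a i - b i) S" using 1 2 by linarith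
  then have "\<bar>L2_set a S - L2_set b S\<bar>\<^sup>2 \<le> (L2_set (\<lambda>i. a i - b i) S)\<^sup>2" by (rule power_mono) simp
  then show ?thesis by (simp add: L2_set_def sum_nonneg)
qed

context wr
begin

section \<open>Weight functions on the group\<close>

text \<open>The conjugate matches the transformation rule of \<open>ind \<theta>\<close>. Such
  functions share the covariance of its vectors under \<open>A^n\<close>, but no rule is imposed
  under the permutations in \<open>stab \<theta>\<close>.\<close>

definition cov :: "(nat \<Rightarrow> 'a \<Rightarrow> complex) \<Rightarrow> ('a wreath_elt \<Rightarrow> complex) \<Rightarrow> bool" where
  "cov \<theta> f \<longleftrightarrow> (\<forall>x\<in>carrier W. \<forall>b\<in>base A n. f (x \<otimes>\<^bsub>W\<^esub> bas b) = cnj (wt \<theta> b) * f x)"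

lemma covD: "cov \<theta> f \<Longrightarrow> x \<in> carrier W \<Longrightarrow> b \<in> base A n \<Longrightarrow> f (x \<otimes>\<^bsub>W\<^esub> bas b) = cnj (wt \<theta> b) * f x"
  by (simp add: cov_def)

lemma cov_left:
  assumes "cov \<theta> f" "g \<in> base A n" "\<sigma> \<in> SG n" "y \<in> base A n"
  shows "f (bas y \<otimes>\<^bsub>W\<^esub> (g, \<sigma>)) = cnj (wt (\<theta> \<circ> inv' \<sigma>) y) * f (g, \<sigma>)"
proof -
  have "(g, \<sigma>) \<in> carrier W" "permb (inv' \<sigma>) y \<in> base A n" using assms by (simp_all add: carrier_W permb_in SG_inv)
  from covD[OF assms(1) this] show ?thesis
    unfolding bas_move[OF assms(4,2,3)] wt_permb[OF SG_inv[OF assms(3)]] .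
qed

lemma sum_right_shift:
  assumes "k \<in> carrier W"
  shows "(\<Sum>g\<in>carrier W. h (g \<otimes>\<^bsub>W\<^esub> k)) = (\<Sum>g\<in>carrier W. h g)"
  by (rule sum.reindex_bij_witness[where i = "\<lambda>g. g \<otimes>\<^bsub>W\<^esub> inv\<^bsub>W\<^esub> k" and j = "\<lambda>g. g \<otimes>\<^bsub>W\<^esub> k"])
    (use assms in \<open>auto simp: W.m_assoc\<close>)

abbreviation "Reg \<equiv> regular_rep W"

lemma reg_pts: "pts Reg = carrier W" and reg_vecs: "vecs Reg = functions_on (carrier W)"
  and reg_act: "x \<in> carrier W \<Longrightarrow> act Reg h f x = f (inv\<^bsub>W\<^esub> h \<otimes>\<^bsub>W\<^esub> x)"
  by (simp_all add: regular_rep_def)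

lemma reg_unitary: "unitary_rep W Reg"
  by (rule regular_unitary[OF group_W finite_W])

lemma reg_norm2: "norm2_on (pts Reg) f = (\<Sum>g\<in>carrier W. (cmod (f g))\<^sup>2)"
  by (simp add: norm2_on_def reg_pts)

lemma reg_displacement:
  "norm2_on (pts Reg) (\<lambda>y. f y - act Reg h f y) = (\<Sum>g\<in>carrier W. (cmod (f g - f (inv\<^bsub>W\<^esub> h \<otimes>\<^bsub>W\<^esub> g)))\<^sup>2)"
  unfolding norm2_on_def reg_pts by (intro sum.cong refl) (simp add: reg_act)

lemma fixed_perp_all: "fixed_space W R = {0} \<Longrightarrow> fixed_perp W R = vecs R"
  by (auto simp: fixed_perp_def inner_on_def)

text \<open>If anything non-zero were fixed, everything would be, and a vector of weight
  \<open>\<theta>\<close> would make that weight trivial.\<close>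

lemma ind_fixed:
  assumes \<theta>: "\<theta> \<in> chars" and i: "i \<in> {1..n}" "\<theta> i \<noteq> (\<lambda>x\<in>carrier A. 1)"
  shows "fixed_space W (ind \<theta>) = {0}"
proof (rule ccontr)
  assume "fixed_space W (ind \<theta>) \<noteq> {0}"
  then have all: "fixed_space W (ind \<theta>) = vecs (ind \<theta>)"
    using irreducible_fixed_space[OF ind_irreducible[OF \<theta>]] by blast
  obtain f where f: "f \<in> vecs (ind \<theta>)" "f \<noteq> 0" "\<forall>x\<in>base A n. act (ind \<theta>) (bas x) f = (\<lambda>p. wt \<theta> x * f p)"
    using ind_has_weight[OF \<theta>] unfolding has_weight_def by blast
  obtain p where p: "f p \<noteq> 0" using f(2) by (auto simp: fun_eq_iff)
  let ?one = "\<lambda>i :: nat. \<lambda>x\<in>carrier A. 1 :: complex"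
  have one: "?one \<in> chars" using one_in_Ahat by (simp add: chars_def)
  have "wt \<theta> x = wt ?one x" if x: "x \<in> base A n" for x
  proof -
    have "act (ind \<theta>) (bas x) f = f" using all f(1) bas_in[OF x] by (auto simp: fixed_space_def)
    then have "wt \<theta> x * f p = f p" using f(3) x by (metis (no_types))
    then have "wt \<theta> x = 1" using p by simp
    moreover have "wt ?one x = 1" unfolding wt_def using base_in[OF x] by (intro prod.neutral) auto
    ultimately show ?thesis by simp
  qed
  then have "\<theta> i = ?one i" by (rule wt_eqD[OF \<theta> one _ i(1)])
  then show False using i(2) by simp
qed

text \<open>An element \<open>(b, \<sigma>)\<close> is \<open>prm \<sigma>\<close> times
  \<open>bas (permb (inv' \<sigma>) b)\<close>. The value \<open>1\<close> on permutations and
  covariance on the right therefore force this formula: it is the vector of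
  \<open>ind \<theta>\<close> invariant under the symmetric group.\<close>

definition phase :: "(nat \<Rightarrow> 'a \<Rightarrow> complex) \<Rightarrow> 'a wreath_elt \<Rightarrow> complex" where
  "phase \<theta> g = cnj (wt \<theta> (permb (inv' (snd g)) (fst g)))"

lemma phase_norm:
  assumes "\<theta> \<in> chars" "g \<in> carrier W"
  shows "cmod (phase \<theta> g) = 1"
  using assms by (auto simp: phase_def carrier_W intro!: wt_norm permb_in SG_inv)

lemma phase_right:
  assumes \<theta>: "\<theta> \<in> chars" and g: "g \<in> carrier W" and h: "h \<in> stab \<theta>"
  shows "phase \<theta> (g \<otimes>\<^bsub>W\<^esub> h) = cnj (ch \<theta> h) * phase \<theta> g"
proof -
  obtain b \<sigma> c \<tau> where gh: "g = (b, \<sigma>)" "h = (c, \<tau>)" by (cases g, cases h) blast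
  have *: "b \<in> base A n" "\<sigma> \<in> SG n" using g by (simp_all add: gh carrier_W)
  have **: "c \<in> base A n" "\<tau> \<in> SG n" "\<forall>i\<in>{1..n}. \<theta> (\<tau> i) = \<theta> i" using h by (simp_all add: gh stab_iff)
  let ?y = "bmult b (permb \<sigma> c)"
  have y: "?y \<in> base A n" using * ** by (intro bmult_in permb_in)
  have "wt (\<theta> \<circ> inv' \<tau>) z = wt \<theta> z" for z using **(3) stab_inv_iff[OF **(2), of \<theta>] by (intro wt_cong) auto
  then have "wt \<theta> (permb (inv' (\<sigma> \<circ> \<tau>)) ?y) = wt \<theta> (permb (inv' \<sigma>) ?y)"
    using * ** y by (simp add: inv_comp permb_comp[symmetric] SG_inv wt_permb[OF SG_inv])
  also have "permb (inv' \<sigma>) ?y = bmult (permb (inv' \<sigma>) b) c"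
    using * ** by (simp add: permb_bmult SG_inv permb_in permb_comp SG_inv_comp base_group_laws)
  also have "wt \<theta> \<dots> = wt \<theta> (permb (inv' \<sigma>) b) * wt \<theta> c" using * ** \<theta> by (simp add: wt_bmult permb_in SG_inv)
  finally have E: "wt \<theta> (permb (inv' (\<sigma> \<circ> \<tau>)) ?y) = wt \<theta> (permb (inv' \<sigma>) b) * wt \<theta> c" .
  show ?thesis unfolding phase_def gh mult_W fst_conv snd_conv ch_def E by simp
qed

lemma phase_prm:
  assumes "g \<in> carrier W" "\<tau> \<in> SG n"
  shows "phase \<theta> (prm \<tau> \<otimes>\<^bsub>W\<^esub> g) = phase \<theta> g"
proof -
  obtain b \<sigma> where g: "g = (b, \<sigma>)" by (cases g)
  have *: "b \<in> base A n" "\<sigma> \<in> SG n" using assms by (simp_all add: g carrier_W)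
  have "permb (inv' (\<tau> \<circ> \<sigma>)) (permb \<tau> b) = permb (inv' \<sigma>) b"
    using * assms(2) by (simp add: inv_comp permb_comp[symmetric] SG_inv permb_in)
      (simp add: permb_comp SG_inv SG_inv_comp base_group_laws comp_assoc SG_comp)
  then show ?thesis using * assms(2) by (simp add: phase_def g prm_def mult_W base_group_laws permb_in)
qed

lemma phase_bas:
  assumes \<theta>: "\<theta> \<in> chars" and g: "b \<in> base A n" "\<sigma> \<in> SG n" and y: "y \<in> base A n"
  shows "phase \<theta> (bas y \<otimes>\<^bsub>W\<^esub> (b, \<sigma>)) = cnj (wt (\<theta> \<circ> inv' \<sigma>) y) * phase \<theta> (b, \<sigma>)"
  using assms chars_comp[OF \<theta> SG_inv[OF g(2)]]
  by (simp add: phase_def bas_def mult_W base_group_laws wt_permb SG_inv wt_bmult)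

lemma ind_norm2: "norm2_on (pts (ind \<theta>)) F = (\<Sum>g\<in>carrier W. (cmod (F (g, ())))\<^sup>2)"
  unfolding norm2_on_def ind_pts
  by (rule sum.reindex_bij_witness[where i = "\<lambda>g. (g, ())" and j = fst]) auto

lemma ind_displacement:
  "norm2_on (pts (ind \<theta>)) (\<lambda>y. F y - act (ind \<theta>) h F y) = (\<Sum>g\<in>carrier W. (cmod (F (g, ()) - F (inv\<^bsub>W\<^esub> h \<otimes>\<^bsub>W\<^esub> g, ())))\<^sup>2)"
  unfolding ind_norm2 by (intro sum.cong refl) (simp add: ind_act)

text \<open>
  A diamagnetic inequality: replacing \<open>f\<close> by its root mean square over the cosets of the stabilizer
  of \<open>\<theta>\<close> in the symmetric group, times the phase of the spherical vector of \<open>V\<^sub>\<kappa>\<close>, does not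
  increase the energy of a transposition and preserves that of an element of \<open>A\<^sup>n\<close>.
\<close>

lemma weight_function_bound:
  assumes \<theta>: "\<theta> \<in> chars" and fx: "fixed_space W (ind \<theta>) = {0}" and w: "weights a c"
    and f: "f \<in> functions_on (carrier W)" "f \<noteq> 0" "cov \<theta> f"
    and r: "Re (inner_on (pts Reg) (laplacian W (adm a c) Reg f) f) \<le> r * norm2_on (pts Reg) f"
  shows "psi W (adm a c) (ind \<theta>) \<le> ereal r"
proof -
  interpret I: laplacian_rep W "ind \<theta>" "adm a c" by (rule laplacian_rep_adm[OF ind_unitary[OF \<theta>] w])
  interpret J: laplacian_rep W Reg "adm a c" by (rule laplacian_rep_adm[OF reg_unitary w])
  define S where "S = {s \<in> SG n. \<forall>i\<in>{1..n}. \<theta> (s i) = \<theta> i}"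
  have S: "s \<in> SG n" "\<forall>i\<in>{1..n}. \<theta> (s i) = \<theta> i" if "s \<in> S" for s using that by (simp_all add: S_def)
  have prmS: "prm s \<in> carrier W" if "s \<in> S" for s by (rule prm_in[OF S(1)[OF that]])
  have S_stab: "prm s \<in> stab \<theta> \<longleftrightarrow> s \<in> S" for s by (auto simp: prm_def stab_iff S_def bone_in)
  interpret H: subgroup "stab \<theta>" W by (rule stab_subgroup)
  have S_comp: "s \<circ> t \<in> S" if "s \<in> S" "t \<in> S" for s t
    using H.m_closed[of "prm s" "prm t"] that S by (simp add: S_stab prm_prm)
  have S_inv: "inv' s \<in> S" if "s \<in> S" for s
    using H.m_inv_closed[of "prm s"] that S by (simp add: S_stab inv_prm)
  have S_id: "id \<in> S" by (simp add: S_def SG_id)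
  have finS: "finite S" using finite_SG by (simp add: S_def)
  have wtS: "wt (\<theta> \<circ> inv' (\<sigma> \<circ> s)) y = wt (\<theta> \<circ> inv' \<sigma>) y" if "s \<in> S" "\<sigma> \<in> SG n" for s \<sigma> y
  proof (rule wt_cong)
    fix i assume "i \<in> {1..n}"
    then have "inv' \<sigma> i \<in> {1..n}" using SG_in[OF SG_inv[OF that(2)], of i] by blast
    then have "\<theta> (inv' s (inv' \<sigma> i)) = \<theta> (inv' \<sigma> i)" using S(2)[OF S_inv[OF that(1)]] by blast
    then show "(\<theta> \<circ> inv' (\<sigma> \<circ> s)) i = (\<theta> \<circ> inv' \<sigma>) i" by (simp add: inv_comp[OF that(2) S(1)[OF that(1)]])
  qed
  define v where "v g s = cmod (f (g \<otimes>\<^bsub>W\<^esub> prm s))" for g s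
  \<comment> \<open>A sum of squares without division by \<open>card S\<close>; this factor cancels
    in the Rayleigh quotient.\<close>
  define G where "G g = L2_set (v g) S" for g
  have G2: "(G g)\<^sup>2 = (\<Sum>s\<in>S. (v g s)\<^sup>2)" for g by (simp add: G_def L2_set_def sum_nonneg)
  have G_right: "G (g \<otimes>\<^bsub>W\<^esub> h) = G g" if g: "g \<in> carrier W" and h: "h \<in> stab \<theta>" for g h
  proof -
    obtain c \<tau> where hc: "h = (c, \<tau>)" by (cases h)
    have c: "c \<in> base A n" "\<tau> \<in> SG n" "\<tau> \<in> S" using h by (simp_all add: hc stab_iff S_def)
    have "v (g \<otimes>\<^bsub>W\<^esub> h) s = v g (\<tau> \<circ> s)" if s: "s \<in> S" for s
    proof -
      have ts: "\<tau> \<circ> s \<in> SG n" using c S[OF s] by (simp add: SG_comp)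
      let ?c = "permb (inv' (\<tau> \<circ> s)) c"
      have c': "?c \<in> base A n" using c ts by (simp add: permb_in SG_inv)
      have "h \<otimes>\<^bsub>W\<^esub> prm s = bas c \<otimes>\<^bsub>W\<^esub> prm (\<tau> \<circ> s)"
        using c ts S(1)[OF s] by (simp add: hc bas_prm[symmetric] W.m_assoc bas_in prm_in prm_prm)
      also have "\<dots> = prm (\<tau> \<circ> s) \<otimes>\<^bsub>W\<^esub> bas ?c"
        using c ts c' by (simp add: prm_bas permb_comp SG_inv SG_inv_comp base_group_laws)
      finally have "g \<otimes>\<^bsub>W\<^esub> h \<otimes>\<^bsub>W\<^esub> prm s = g \<otimes>\<^bsub>W\<^esub> prm (\<tau> \<circ> s) \<otimes>\<^bsub>W\<^esub> bas ?c"
        using g ts c' stab_carrier[OF h] prmS[OF s] by (simp add: W.m_assoc prm_in bas_in)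
      then show ?thesis
        using covD[OF f(3) _ c', of "g \<otimes>\<^bsub>W\<^esub> prm (\<tau> \<circ> s)"] g ts wt_norm[OF \<theta> c'] by (simp add: v_def norm_mult prm_in)
    qed
    then have "(G (g \<otimes>\<^bsub>W\<^esub> h))\<^sup>2 = (\<Sum>s\<in>S. (v g (\<tau> \<circ> s))\<^sup>2)" by (simp add: G2)
    also have "\<dots> = (\<Sum>s\<in>S. (v g s)\<^sup>2)"
      by (rule sum.reindex_bij_witness[where i = "\<lambda>s. inv' \<tau> \<circ> s" and j = "\<lambda>s. \<tau> \<circ> s"])
        (use c in \<open>auto simp: S_comp S_inv comp_assoc[symmetric] SG_inv_comp\<close>)
    finally show ?thesis by (simp add: G2[symmetric] G_def)
  qed
  define F where "F = (\<lambda>(g, u :: unit). if g \<in> carrier W then phase \<theta> g * of_real (G g) else 0)"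
  have FV: "F \<in> vecs (ind \<theta>)"
    unfolding ind_vecs[OF \<theta>]
    using phase_right[OF \<theta>] G_right stab_carrier by (auto simp: F_def functions_on_def)
  have cmF: "(cmod (F (g, ())))\<^sup>2 = (\<Sum>s\<in>S. (v g s)\<^sup>2)" if "g \<in> carrier W" for g
    using that phase_norm[OF \<theta> that] by (simp add: F_def norm_mult power_mult_distrib G2)
  have "norm2_on (pts (ind \<theta>)) F = (\<Sum>g\<in>carrier W. \<Sum>s\<in>S. (v g s)\<^sup>2)"
    unfolding ind_norm2 by (intro sum.cong refl cmF)
  also have "\<dots> = (\<Sum>s\<in>S. \<Sum>g\<in>carrier W. (v g s)\<^sup>2)" by (rule sum.swap)
  also have "\<dots> = (\<Sum>s\<in>S. norm2_on (pts Reg) f)"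
    unfolding v_def reg_norm2 by (intro sum.cong refl sum_right_shift[of _ "\<lambda>g. (cmod (f g))\<^sup>2"] prmS)
  finally have nF: "norm2_on (pts (ind \<theta>)) F = real (card S) * norm2_on (pts Reg) f" by simp
  \<comment> \<open>A permutation leaves the phase alone and changes only \<open>G\<close>: use the
    reverse triangle inequality over \<open>S\<close>, then for each modulus. An element of
    \<open>A^n\<close> multiplies all values of \<open>f\<close> on the coset by one number
    \<open>z\<close>, since \<open>S\<close> fixes \<open>\<theta>\<close>, and \<open>F\<close> by
    the same \<open>z\<close>, so equality holds.\<close>
  have step: "(cmod (F (g, ()) - F (k \<otimes>\<^bsub>W\<^esub> g, ())))\<^sup>2 \<le> (\<Sum>s\<in>S. (cmod (f (g \<otimes>\<^bsub>W\<^esub> prm s) - f (k \<otimes>\<^bsub>W\<^esub> (g \<otimes>\<^bsub>W\<^esub> prm s))))\<^sup>2)"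
    if g: "g \<in> carrier W" and k: "(\<exists>\<tau>\<in>SG n. k = prm \<tau>) \<or> (\<exists>y\<in>base A n. k = bas y)" for g k
    using k
  proof
    assume "\<exists>\<tau>\<in>SG n. k = prm \<tau>"
    then obtain \<tau> where t: "\<tau> \<in> SG n" "k = prm \<tau>" by blast
    have kW: "k \<in> carrier W" using t by (simp add: prm_in)
    have "F (g, ()) - F (k \<otimes>\<^bsub>W\<^esub> g, ()) = phase \<theta> g * of_real (G g - G (k \<otimes>\<^bsub>W\<^esub> g))"
      using g kW phase_prm[OF g t(1)] by (simp add: F_def t(2) algebra_simps)
    then have "(cmod (F (g, ()) - F (k \<otimes>\<^bsub>W\<^esub> g, ())))\<^sup>2 = (G g - G (k \<otimes>\<^bsub>W\<^esub> g))\<^sup>2"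
      using phase_norm[OF \<theta> g] by (simp add: norm_mult del: of_real_diff)
    also have "\<dots> \<le> (\<Sum>s\<in>S. (v g s - v (k \<otimes>\<^bsub>W\<^esub> g) s)\<^sup>2)" unfolding G_def by (rule L2_set_diff_le)
    also have "\<dots> \<le> (\<Sum>s\<in>S. (cmod (f (g \<otimes>\<^bsub>W\<^esub> prm s) - f (k \<otimes>\<^bsub>W\<^esub> (g \<otimes>\<^bsub>W\<^esub> prm s))))\<^sup>2)"
    proof (rule sum_mono)
      fix s assume s: "s \<in> S"
      have "k \<otimes>\<^bsub>W\<^esub> g \<otimes>\<^bsub>W\<^esub> prm s = k \<otimes>\<^bsub>W\<^esub> (g \<otimes>\<^bsub>W\<^esub> prm s)" by (rule W.m_assoc[OF kW g prmS[OF s]])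
      then have "\<bar>v g s - v (k \<otimes>\<^bsub>W\<^esub> g) s\<bar> \<le> cmod (f (g \<otimes>\<^bsub>W\<^esub> prm s) - f (k \<otimes>\<^bsub>W\<^esub> (g \<otimes>\<^bsub>W\<^esub> prm s)))"
        unfolding v_def by (simp add: norm_triangle_ineq3)
      then have "\<bar>v g s - v (k \<otimes>\<^bsub>W\<^esub> g) s\<bar>\<^sup>2 \<le> (cmod (f (g \<otimes>\<^bsub>W\<^esub> prm s) - f (k \<otimes>\<^bsub>W\<^esub> (g \<otimes>\<^bsub>W\<^esub> prm s))))\<^sup>2"
        by (rule power_mono) simp
      then show "(v g s - v (k \<otimes>\<^bsub>W\<^esub> g) s)\<^sup>2 \<le> (cmod (f (g \<otimes>\<^bsub>W\<^esub> prm s) - f (k \<otimes>\<^bsub>W\<^esub> (g \<otimes>\<^bsub>W\<^esub> prm s))))\<^sup>2" by simp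
    qed
    finally show ?thesis .
  next
    assume "\<exists>y\<in>base A n. k = bas y"
    then obtain y where y: "y \<in> base A n" "k = bas y" by blast
    have kW: "k \<in> carrier W" using y by (simp add: bas_in)
    obtain b \<sigma> where gb: "g = (b, \<sigma>)" by (cases g)
    have b: "b \<in> base A n" "\<sigma> \<in> SG n" using g by (simp_all add: gb carrier_W)
    define z where "z = cnj (wt (\<theta> \<circ> inv' \<sigma>) y)"
    have z1: "cmod z = 1" unfolding z_def using wt_norm[OF chars_comp[OF \<theta> SG_inv[OF b(2)]] y(1)] by simp
    have fz: "f (k \<otimes>\<^bsub>W\<^esub> (g \<otimes>\<^bsub>W\<^esub> prm s)) = z * f (g \<otimes>\<^bsub>W\<^esub> prm s)" if s: "s \<in> S" for s
    proof -
      have e: "g \<otimes>\<^bsub>W\<^esub> prm s = (b, \<sigma> \<circ> s)" using b by (simp add: gb prm_def mult_W permb_bone base_group_laws)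
      show ?thesis unfolding e y(2) z_def
        using cov_left[OF f(3) b(1) SG_comp[OF b(2) S(1)[OF s]] y(1)] wtS[OF s b(2)] by simp
    qed
    have "v (k \<otimes>\<^bsub>W\<^esub> g) s = v g s" if s: "s \<in> S" for s
    proof -
      have "k \<otimes>\<^bsub>W\<^esub> g \<otimes>\<^bsub>W\<^esub> prm s = k \<otimes>\<^bsub>W\<^esub> (g \<otimes>\<^bsub>W\<^esub> prm s)" by (rule W.m_assoc[OF kW g prmS[OF s]])
      then show ?thesis unfolding v_def using fz[OF s] z1 by (simp add: norm_mult)
    qed
    then have "G (k \<otimes>\<^bsub>W\<^esub> g) = G g" unfolding G_def L2_set_def by simp
    then have "F (k \<otimes>\<^bsub>W\<^esub> g, ()) = z * F (g, ())"
      using g kW phase_bas[OF \<theta> b y(1)] by (simp add: F_def z_def y(2)[symmetric] gb[symmetric])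
    then have "F (g, ()) - F (k \<otimes>\<^bsub>W\<^esub> g, ()) = (1 - z) * F (g, ())" by (simp add: algebra_simps)
    then have "(cmod (F (g, ()) - F (k \<otimes>\<^bsub>W\<^esub> g, ())))\<^sup>2 = (cmod (1 - z))\<^sup>2 * (\<Sum>s\<in>S. (v g s)\<^sup>2)"
      by (simp add: norm_mult power_mult_distrib cmF[OF g])
    also have "\<dots> = (\<Sum>s\<in>S. (cmod (f (g \<otimes>\<^bsub>W\<^esub> prm s) - f (k \<otimes>\<^bsub>W\<^esub> (g \<otimes>\<^bsub>W\<^esub> prm s))))\<^sup>2)"
      unfolding sum_distrib_left
    proof (rule sum.cong[OF refl])
      fix s assume s: "s \<in> S"
      have "f (g \<otimes>\<^bsub>W\<^esub> prm s) - f (k \<otimes>\<^bsub>W\<^esub> (g \<otimes>\<^bsub>W\<^esub> prm s)) = (1 - z) * f (g \<otimes>\<^bsub>W\<^esub> prm s)"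
        unfolding fz[OF s] by (simp add: algebra_simps)
      then show "(cmod (1 - z))\<^sup>2 * (v g s)\<^sup>2 = (cmod (f (g \<otimes>\<^bsub>W\<^esub> prm s) - f (k \<otimes>\<^bsub>W\<^esub> (g \<otimes>\<^bsub>W\<^esub> prm s))))\<^sup>2"
        by (simp add: norm_mult power_mult_distrib v_def)
    qed
    finally show ?thesis by simp
  qed
  \<comment> \<open>The action translates by the inverse, and inverses of elements in the support of
    \<open>adm a c\<close> are again of the two kinds treated in \<open>step\<close>.\<close>
  have disp: "adm a c h * norm2_on (pts (ind \<theta>)) (\<lambda>y. F y - act (ind \<theta>) h F y)
      \<le> adm a c h * (real (card S) * norm2_on (pts Reg) (\<lambda>y. f y - act Reg h f y))" if h: "h \<in> carrier W" for h
  proof (cases "adm a c h = 0")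
    case False
    let ?k = "inv\<^bsub>W\<^esub> h"
    have k: "(\<exists>\<tau>\<in>SG n. ?k = prm \<tau>) \<or> (\<exists>y\<in>base A n. ?k = bas y)"
      using False
    proof (cases rule: adm_support)
      case (1 i j)
      then have "?k = prm (tr i j)" by (simp add: inv_prm pairs_tr inv_tr)
      then show ?thesis using pairs_tr[OF 1(1)] by blast
    next
      case (2 x)
      then have "?k = bas (binv x)" by (simp add: inv_bas)
      then show ?thesis using binv_in[OF 2(1)] by blast
    qed
    have kW: "?k \<in> carrier W" using h by simp
    have "norm2_on (pts (ind \<theta>)) (\<lambda>y. F y - act (ind \<theta>) h F y)
        \<le> (\<Sum>g\<in>carrier W. \<Sum>s\<in>S. (cmod (f (g \<otimes>\<^bsub>W\<^esub> prm s) - f (?k \<otimes>\<^bsub>W\<^esub> (g \<otimes>\<^bsub>W\<^esub> prm s))))\<^sup>2)"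
      unfolding ind_displacement by (intro sum_mono step k)
    also have "\<dots> = (\<Sum>s\<in>S. \<Sum>g\<in>carrier W. (cmod (f (g \<otimes>\<^bsub>W\<^esub> prm s) - f (?k \<otimes>\<^bsub>W\<^esub> (g \<otimes>\<^bsub>W\<^esub> prm s))))\<^sup>2)"
      by (rule sum.swap)
    also have "\<dots> = (\<Sum>s\<in>S. norm2_on (pts Reg) (\<lambda>y. f y - act Reg h f y))"
      unfolding reg_displacement
      by (intro sum.cong refl sum_right_shift[of _ "\<lambda>g. (cmod (f g - f (?k \<otimes>\<^bsub>W\<^esub> g)))\<^sup>2"] prmS)
    finally have "norm2_on (pts (ind \<theta>)) (\<lambda>y. F y - act (ind \<theta>) h F y) \<le> real (card S) * norm2_on (pts Reg) (\<lambda>y. f y - act Reg h f y)"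
      by simp
    then show ?thesis by (rule mult_left_mono) (rule adm_nonneg[OF w])
  qed simp
  have fR: "f \<in> vecs Reg" using f(1) by (simp add: reg_vecs)
  have "Re (inner_on (pts (ind \<theta>)) (laplacian W (adm a c) (ind \<theta>) F) F)
      \<le> (\<Sum>h\<in>carrier W. adm a c h * (real (card S) * norm2_on (pts Reg) (\<lambda>y. f y - act Reg h f y))) / 2"
    unfolding I.laplacian_form[OF FV] by (intro divide_right_mono sum_mono disp) simp_all
  also have "\<dots> = real (card S) * Re (inner_on (pts Reg) (laplacian W (adm a c) Reg f) f)"
    unfolding J.laplacian_form[OF fR] by (simp add: sum_distrib_left mult_ac)
  also have "\<dots> \<le> real (card S) * (r * norm2_on (pts Reg) f)" by (rule mult_left_mono[OF r]) simp
  also have "\<dots> = r * norm2_on (pts (ind \<theta>)) F" by (simp add: nF)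
  finally have ray: "Re (inner_on (pts (ind \<theta>)) (laplacian W (adm a c) (ind \<theta>) F) F) \<le> r * norm2_on (pts (ind \<theta>)) F" .
  have "0 < card S" using finS S_id card_gt_0_iff by blast
  then have "norm2_on (pts (ind \<theta>)) F \<noteq> 0" using J.norm2_pos[OF fR f(2)] by (simp add: nF)
  then have "F \<noteq> 0" by (auto simp: norm2_on_def)
  moreover have "F \<in> fixed_perp W (ind \<theta>)" using FV by (simp add: fixed_perp_all[OF fx])
  ultimately show ?thesis using I.psi_le_rayleigh ray by blast
qed

section \<open>Right translations and the existence of weight functions\<close>

definition right_translate :: "(nat \<Rightarrow> 'a) \<Rightarrow> ('a wreath_elt \<Rightarrow> complex) \<Rightarrow> 'a wreath_elt \<Rightarrow> complex" where
  "right_translate b f = (\<lambda>x. if x \<in> carrier W then f (x \<otimes>\<^bsub>W\<^esub> bas b) else 0)"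

lemma right_translate_functions: "right_translate b f \<in> functions_on (carrier W)"
  by (simp add: right_translate_def functions_on_def)

lemma right_translate_comp: "b \<in> base A n \<Longrightarrow> b' \<in> base A n \<Longrightarrow> right_translate b (right_translate b' f) = right_translate (bmult b b') f"
  by (auto simp: right_translate_def bas_in W.m_assoc bas_bas)

lemma right_translate_bone: "f \<in> functions_on (carrier W) \<Longrightarrow> right_translate bone f = f"
  using W.r_one by (auto simp: right_translate_def bas_def one_W functions_on_def)

lemma right_translate_power:
  assumes f: "f \<in> functions_on (carrier W)" and b: "b \<in> base A n"
  shows "(right_translate b ^^ k) f = right_translate (\<lambda>i\<in>{1..n}. b i [^] k) f"
proof (induction k)
  case 0
  have "(\<lambda>i\<in>{1..n}. b i [^] (0::nat)) = bone" by (simp add: bone_def)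
  then show ?case using right_translate_bone[OF f] by simp
next
  case (Suc k)
  have p: "(\<lambda>i\<in>{1..n}. b i [^] k) \<in> base A n" by (intro base_restrict nat_pow_closed base_in[OF b])
  have "bmult b (\<lambda>i\<in>{1..n}. b i [^] k) = (\<lambda>i\<in>{1..n}. b i [^] Suc k)"
    unfolding bmult_def by (rule restrict_ext) (simp add: m_comm[OF base_in[OF b] nat_pow_closed[OF base_in[OF b]]])
  moreover have "(right_translate b ^^ Suc k) f = right_translate b (right_translate (\<lambda>i\<in>{1..n}. b i [^] k) f)" unfolding Suc[symmetric] by simp
  ultimately show ?case unfolding right_translate_comp[OF b p, of f] by (simp only:)
qed

lemma right_translate_order:
  assumes "f \<in> functions_on (carrier W)" "b \<in> base A n"
  shows "(right_translate b ^^ order A) f = f"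
proof -
  have "(\<lambda>i\<in>{1..n}. b i [^] order A) = bone"
    unfolding bone_def by (rule restrict_ext) (simp add: pow_order_eq_1[OF base_in[OF assms(2)]])
  then show ?thesis using right_translate_power[OF assms] right_translate_bone[OF assms(1)] by simp
qed

lemma right_translate_norm2: "b \<in> base A n \<Longrightarrow> norm2_on (carrier W) (right_translate b f) = norm2_on (carrier W) f"
  using sum_right_shift[OF bas_in, of b "\<lambda>g. (cmod (f g))\<^sup>2"] by (simp add: norm2_on_def right_translate_def)

text \<open>Induction over sets \<open>J\<close> of coordinates: \<open>r J\<close> keeps the
  coordinates of \<open>b\<close> in \<open>J\<close> and is trivial elsewhere.\<close>

lemma hom_product:
  assumes c: "\<And>b b'. b \<in> base A n \<Longrightarrow> b' \<in> base A n \<Longrightarrow> c (bmult b b') = c b * (c b' :: complex)"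
    and c1: "c bone = 1" and b: "b \<in> base A n"
  shows "c b = (\<Prod>i\<in>{1..n}. c (single i (b i)))"
proof -
  define r where "r J = (\<lambda>i\<in>{1..n}. if i \<in> J then b i else \<one>)" for J
  have rin: "r J \<in> base A n" for J unfolding r_def using base_in[OF b] by (intro base_restrict) auto
  have "c (r J) = (\<Prod>i\<in>J. c (single i (b i)))" if "finite J" "J \<subseteq> {1..n}" for J
    using that
  proof (induction J rule: finite_induct)
    case empty
    have "r {} = bone" by (simp add: r_def bone_def)
    then show ?case by (simp add: c1)
  next
    case (insert j J)
    have s: "single j (b j) \<in> base A n" using insert.prems by (intro single_in base_in[OF b]) auto
    have "r (insert j J) = bmult (single j (b j)) (r J)"
    proof (rule base_eqI[OF rin bmult_in[OF s rin]])
      fix i assume i: "i \<in> {1..n}"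
      then show "r (insert j J) i = bmult (single j (b j)) (r J) i"
        using insert.hyps(2) base_in[OF b i] by (auto simp: base_apply r_def single_def)
    qed
    then show ?case using insert c[OF s rin] by simp
  qed
  from this[of "{1..n}"] have "c (r {1..n}) = (\<Prod>i\<in>{1..n}. c (single i (b i)))" by simp
  moreover have "r {1..n} = b" by (rule base_eqI[OF rin b]) (simp add: r_def)
  ultimately show ?thesis by simp
qed

text \<open>Right translations by \<open>A^n\<close> commute and become the identity at the power
  \<open>order A\<close>, so some vector of \<open>U\<close> is an eigenvector of them all. Its
  eigenvalues form a homomorphism of modulus one, which splits into characters of the
  coordinates.\<close>

lemma weight_function_exists:
  assumes U: "csubspace U" "U \<subseteq> functions_on (carrier W)" and rightU: "\<And>b f. b \<in> base A n \<Longrightarrow> f \<in> U \<Longrightarrow> right_translate b f \<in> U"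
    and f0: "f0 \<in> U" "f0 \<noteq> 0"
  shows "\<exists>\<theta>\<in>chars. \<exists>f\<in>U. f \<noteq> 0 \<and> cov \<theta> f"
proof -
  have m: "0 < order A" using finite_A one_closed by (auto simp: order_def card_gt_0_iff)
  have fU: "f \<in> functions_on (carrier W)" if "f \<in> U" for f using U(2) that by blast
  have "\<exists>g\<in>U. g \<noteq> 0 \<and> (\<forall>b\<in>base A n. \<exists>c. right_translate b g = (\<lambda>x. c * g x))"
  proof (rule joint_eigenvector[OF finite_base U(1) _ rightU _ m _ f0])
    show "clinear_on U (right_translate b)" for b by (auto simp: clinear_on_def right_translate_def)
    show "right_translate k (right_translate l f) = right_translate l (right_translate k f)" if "k \<in> base A n" "l \<in> base A n" for k l f
      unfolding right_translate_comp[OF that] right_translate_comp[OF that(2,1)] bmult_commute[OF that] ..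
    show "(right_translate k ^^ order A) f = f" if "k \<in> base A n" "f \<in> U" for k f by (rule right_translate_order[OF fU[OF that(2)] that(1)])
  qed
  then obtain g where g: "g \<in> U" "g \<noteq> 0" "\<forall>b\<in>base A n. \<exists>c. right_translate b g = (\<lambda>x. c * g x)" by blast
  obtain c where c: "\<forall>b\<in>base A n. right_translate b g = (\<lambda>x. c b * g x)" using bchoice[OF g(3)] by blast
  have cb: "right_translate b g = (\<lambda>x. c b * g x)" if "b \<in> base A n" for b using c that by (rule bspec)
  obtain p where p: "g p \<noteq> 0" using g(2) by (auto simp: fun_eq_iff)
  have cm: "c (bmult b b') = c b * c b'" if b: "b \<in> base A n" "b' \<in> base A n" for b b'
  proof -
    have "right_translate (bmult b b') g = right_translate b (\<lambda>x. c b' * g x)" by (simp only: right_translate_comp[OF b, symmetric] cb[OF b(2)])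
    also have "\<dots> = (\<lambda>x. c b' * right_translate b g x)" by (auto simp: right_translate_def)
    finally have "right_translate (bmult b b') g p = c b' * right_translate b g p" by (rule fun_cong)
    then have "c (bmult b b') * g p = c b' * (c b * g p)" by (simp only: cb[OF bmult_in[OF b]] cb[OF b(1)])
    then show ?thesis using p by simp
  qed
  have cn: "cmod (c b) = 1" if b: "b \<in> base A n" for b
  proof -
    have "norm2_on (carrier W) (\<lambda>x. c b * g x) = norm2_on (carrier W) g" using right_translate_norm2[OF b, of g] by (simp only: cb[OF b])
    then have "(cmod (c b))\<^sup>2 * norm2_on (carrier W) g = norm2_on (carrier W) g" by (simp only: norm2_on_scale)
    moreover have "norm2_on (carrier W) g \<noteq> 0" using norm2_on_pos[OF finite_W fU[OF g(1)] g(2)] by simp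
    ultimately have "(cmod (c b))\<^sup>2 = 1\<^sup>2" by simp
    then show ?thesis by (rule power2_eq_imp_eq) simp_all
  qed
  have c1: "c bone = 1"
  proof -
    have "c bone = c bone * c bone" using cm[OF bone_in bone_in] by (simp add: base_group_laws bone_in)
    moreover have "c bone \<noteq> 0" using cn[OF bone_in] by auto
    ultimately show ?thesis by simp
  qed
  \<comment> \<open>The conjugate makes \<open>wt \<theta>\<close> the conjugate of the eigenvalue,
    as \<open>cov\<close> expects.\<close>
  define \<theta> where "\<theta> i = (\<lambda>a\<in>carrier A. cnj (c (single i a)))" for i
  have "\<theta> i \<in> Ahat" if i: "i \<in> {1..n}" for i
  proof -
    have "single i (a \<otimes> b) = bmult (single i a) (single i b)" if "a \<in> carrier A" "b \<in> carrier A" for a b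
      using that by (intro base_eqI single_in bmult_in m_closed) (auto simp: base_apply single_def)
    then show ?thesis by (simp add: Ahat_iff \<theta>_def cn single_in cm)
  qed
  then have \<theta>: "\<theta> \<in> chars" by (simp add: chars_def)
  have wt: "wt \<theta> b = cnj (c b)" if b: "b \<in> base A n" for b
  proof -
    have "c b = (\<Prod>i\<in>{1..n}. c (single i (b i)))" by (rule hom_product[OF cm c1 b])
    then have "cnj (c b) = (\<Prod>i\<in>{1..n}. cnj (c (single i (b i))))" by (simp only: cnj_prod)
    also have "\<dots> = wt \<theta> b" unfolding wt_def using base_in[OF b] by (intro prod.cong refl) (simp add: \<theta>_def)
    finally show ?thesis ..
  qed
  have "cov \<theta> g"
    unfolding cov_def
  proof (intro ballI)
    fix x b assume x: "x \<in> carrier W" "b \<in> base A n"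
    have "right_translate b g x = c b * g x" by (simp only: cb[OF x(2)])
    then show "g (x \<otimes>\<^bsub>W\<^esub> bas b) = cnj (wt \<theta> b) * g x" using x by (simp add: right_translate_def wt)
  qed
  then show ?thesis using \<theta> g by blast
qed

lemma gap_weight_function:
  assumes n: "2 \<le> n" and w: "weights a c"
  obtains r \<theta> f where "psi_reg W (adm a c) = ereal r" "\<theta> \<in> chars" "f \<in> functions_on (carrier W)" "f \<noteq> 0"
    "(\<Sum>x\<in>carrier W. f x) = 0" "cov \<theta> f"
    "Re (inner_on (pts Reg) (laplacian W (adm a c) Reg f) f) = r * norm2_on (pts Reg) f"
proof -
  interpret J: laplacian_rep W Reg "adm a c" by (rule laplacian_rep_adm[OF reg_unitary w])
  have "vecs Reg \<noteq> fixed_space W Reg"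
  proof
    assume eq: "vecs Reg = fixed_space W Reg"
    define e where "e x = (if x = \<one>\<^bsub>W\<^esub> then 1 else 0 :: complex)" for x
    have t: "prm (tr 1 2) \<in> carrier W" using n by (intro prm_in SG_tr) auto
    have "e \<in> vecs Reg" by (simp add: reg_vecs functions_on_def e_def)
    then have "e \<in> fixed_space W Reg" unfolding eq .
    then have "\<forall>g\<in>carrier W. act Reg g e = e" unfolding fixed_space_def mem_Collect_eq by (rule conjunct2)
    then have "act Reg (prm (tr 1 2)) e = e" using t by (rule bspec)
    then have "act Reg (prm (tr 1 2)) e (prm (tr 1 2)) = e (prm (tr 1 2))" by simp
    then have "prm (tr 1 2) = \<one>\<^bsub>W\<^esub>" using t by (simp add: reg_act e_def split: if_splits)
    then have "tr 1 2 = (id :: nat \<Rightarrow> nat)" by (simp add: prm_def one_W)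
    then have "tr 1 2 1 = (1 :: nat)" by (simp only: id_apply)
    then show False by simp
  qed
  then obtain r f0 where r: "psi W (adm a c) Reg = ereal r" "f0 \<in> fixed_perp W Reg" "f0 \<noteq> 0"
      "J.L f0 = (\<lambda>x. of_real r * f0 x)"
    by (rule J.psi_attained)
  define U where "U = {f \<in> functions_on (carrier W). (\<Sum>x\<in>carrier W. f x) = 0 \<and> J.L f = (\<lambda>x. of_real r * f x)}"
  have sub: "csubspace U"
  proof (rule csubspaceI)
    show "(\<lambda>x. 0) \<in> U" using clinear_on_0[OF J.laplacian_lin J.sub_V] by (simp add: U_def functions_on_def)
    show "(\<lambda>x. f x + g x) \<in> U" if "f \<in> U" "g \<in> U" for f g
      using that clinear_on_add[OF J.laplacian_lin, of f g] by (simp add: U_def reg_vecs) (simp add: functions_on_def sum.distrib algebra_simps)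
    show "(\<lambda>x. k * f x) \<in> U" if f: "f \<in> U" for k f
    proof -
      have fF: "f \<in> functions_on (carrier W)" and f0: "(\<Sum>x\<in>carrier W. f x) = 0" and fL: "J.L f = (\<lambda>x. of_real r * f x)"
        using f by (simp_all add: U_def)
      have "(\<Sum>x\<in>carrier W. k * f x) = 0" by (simp only: sum_distrib_left[symmetric] f0 mult_zero_right)
      moreover have "J.L (\<lambda>x. k * f x) = (\<lambda>x. of_real r * (k * f x))"
        unfolding clinear_on_scale[OF J.laplacian_lin fF[folded reg_vecs]] fL by (simp only: mult.left_commute)
      moreover have "(\<lambda>x. k * f x) \<in> functions_on (carrier W)" using fF by (simp add: functions_on_def)
      ultimately show ?thesis unfolding U_def by simp
    qed
  qed
  \<comment> \<open>Left and right translations commute, so \<open>right_translate b\<close>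
    commutes with the Laplacian.\<close>
  have rightU: "right_translate b f \<in> U" if b: "b \<in> base A n" and f: "f \<in> U" for b f
  proof -
    have "(\<Sum>x\<in>carrier W. right_translate b f x) = (\<Sum>x\<in>carrier W. f x)"
      using sum_right_shift[OF bas_in[OF b], of f] by (simp add: right_translate_def)
    moreover have "J.L (right_translate b f) x = of_real r * right_translate b f x" for x
    proof (cases "x \<in> carrier W")
      case True
      have xb: "x \<otimes>\<^bsub>W\<^esub> bas b \<in> carrier W" using True bas_in[OF b] by simp
      have "J.L (right_translate b f) x = J.L f (x \<otimes>\<^bsub>W\<^esub> bas b)"
        unfolding laplacian_def using True xb bas_in[OF b]
        by (intro sum.cong refl) (simp add: reg_act right_translate_def W.m_assoc)
      then show ?thesis using f True by (simp add: U_def right_translate_def)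
    next
      case False
      then show ?thesis by (simp add: laplacian_def regular_rep_def right_translate_def)
    qed
    ultimately show ?thesis using f right_translate_functions by (auto simp: U_def)
  qed
  have f0U: "f0 \<in> U" using r regular_fixed_perp[OF group_W finite_W] by (simp add: U_def)
  obtain \<theta> f where f: "\<theta> \<in> chars" "f \<in> U" "f \<noteq> 0" "cov \<theta> f"
    using weight_function_exists[OF sub _ rightU f0U r(3)] by (auto simp: U_def)
  have "Re (inner_on (pts Reg) (J.L f) f) = r * norm2_on (pts Reg) f"
    using f(2) by (simp add: U_def inner_on_simps inner_on_self)
  then show ?thesis using that[of r \<theta> f] f r(1) by (simp add: psi_reg_def U_def)
qed

lemma trivial_weight_bound:
  assumes n: "2 \<le> n" and w: "weights a c" and triv: "\<And>i. i \<in> {1..n} \<Longrightarrow> \<theta> i = (\<lambda>x\<in>carrier A. 1)"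
    and f: "f \<in> functions_on (carrier W)" "f \<noteq> 0" "(\<Sum>x\<in>carrier W. f x) = 0" "cov \<theta> f"
    and r: "Re (inner_on (pts Reg) (laplacian W (adm a c) Reg f) f) = r * norm2_on (pts Reg) f"
  shows "psi W (adm a c) Rstd \<le> ereal r"
proof -
  interpret S: laplacian_rep W Rstd "adm a c" by (rule laplacian_rep_adm[OF std_unitary w])
  have "vecs Rstd \<noteq> fixed_space W Rstd"
    using std_fixed[OF n] std_irreducible[OF n] by (simp add: irreducible_rep_def)
  then obtain q where q: "psi W (adm a c) Rstd = ereal q"
    "\<And>g. g \<in> fixed_perp W Rstd \<Longrightarrow> q * norm2_on (pts Rstd) g \<le> Re (inner_on (pts Rstd) (S.L g) g)"
    by (rule S.psi_attained) blast
  \<comment> \<open>\<open>a\<close> is constrained only at pairs with \<open>i < j\<close>; the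
    Aldous theorem takes rates that are symmetric and nonnegative everywhere.\<close>
  define cc where "cc i j = (if (i, j) \<in> pairs then a i j else if (j, i) \<in> pairs then a j i else 0)" for i j
  have cc0: "0 \<le> cc i j" for i j using w unfolding weights_def cc_def pairs_def by auto
  have ccs: "cc i j = cc j i" for i j by (auto simp: cc_def pairs_def)
  have cc_pairs: "cc i j = a i j" if "(i, j) \<in> pairs" for i j using that by (simp add: cc_def)
  \<comment> \<open>Mean-zero functions on the sites are the vectors of \<open>Std\<close>, so its
    \<open>psi\<close> is the gap of the random walk that the Aldous theorem takes as
    hypothesis.\<close>
  have "q * norm2_on {1..n} \<phi> \<le> walk_energy n cc \<phi> / 2" if \<phi>: "(\<Sum>i\<in>{1..n}. \<phi> i) = 0" for \<phi>
  proof -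
    define g where "g i = (if i \<in> {1..n} then \<phi> i else 0)" for i
    have gV: "g \<in> vecs Rstd" unfolding std_vecs using \<phi> by (simp add: g_def functions_on_def)
    have "norm2_on (pts Rstd) g = norm2_on {1..n} \<phi>" by (simp add: norm2_on_def std_pts g_def)
    moreover have "Re (inner_on (pts Rstd) (S.L g) g) = walk_energy n cc \<phi> / 2"
    proof -
      have d: "norm2_on (pts Rstd) (\<lambda>y. g y - act Rstd (prm (tr i j)) g y) = 2 * (cmod (\<phi> i - \<phi> j))\<^sup>2" if ij: "(i, j) \<in> pairs" for i j
      proof -
        have i: "i \<in> {1..n}" "j \<in> {1..n}" using ij by (auto simp: pairs_def)
        have "norm2_on (pts Rstd) (\<lambda>y. g y - act Rstd (prm (tr i j)) g y) = (\<Sum>y\<in>{1..n}. (cmod (g y - g (tr i j y)))\<^sup>2)"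
          by (simp add: norm2_on_def std_pts prm_def std_act inv_tr)
        also have "\<dots> = 2 * (cmod (g i - g j))\<^sup>2" by (rule sum_transpose_difference[OF i])
        finally show ?thesis using i by (simp add: g_def)
      qed
      have "(\<Sum>x\<in>base A n. c x * norm2_on (pts Rstd) (\<lambda>y. g y - act Rstd (bas x) g y)) = 0"
        by (simp add: std_bas norm2_on_def)
      moreover have "(\<Sum>(i, j)\<in>pairs. a i j * norm2_on (pts Rstd) (\<lambda>y. g y - act Rstd (prm (tr i j)) g y))
          = 2 * (\<Sum>(i, j)\<in>pairs. cc i j * (cmod (\<phi> i - \<phi> j))\<^sup>2)"
        unfolding sum_distrib_left by (intro sum.cong refl) (auto simp: d cc_pairs)
      moreover have "walk_energy n cc \<phi> = 2 * (\<Sum>(i, j)\<in>pairs. cc i j * (cmod (\<phi> i - \<phi> j))\<^sup>2)"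
        unfolding walk_energy_def
      proof (rule sum_pairs)
        show "cc i j * (cmod (\<phi> i - \<phi> j))\<^sup>2 = cc j i * (cmod (\<phi> j - \<phi> i))\<^sup>2" for i j
          by (simp only: ccs[of i j] norm_minus_commute)
      qed simp
      ultimately show ?thesis unfolding adm_form[OF std_unitary w gV] by simp
    qed
    ultimately show ?thesis using q(2)[of g] gV by (simp add: fixed_perp_all[OF std_fixed[OF n]])
  qed
  then have aldous: "(\<Sum>\<sigma>\<in>SG n. h \<sigma>) = 0 \<Longrightarrow> q * norm2_on (SG n) h \<le> process_energy n cc h / 4" for h
    by (rule aldous_spectral_gap[OF cc0 ccs])
  define h where "h \<sigma> = f (prm \<sigma>)" for \<sigma>
  have wt1: "wt \<theta>' b = 1" if "b \<in> base A n" "\<And>i. i \<in> {1..n} \<Longrightarrow> \<theta>' i = (\<lambda>x\<in>carrier A. 1)" for \<theta>' b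
    unfolding wt_def using base_in[OF that(1)] that(2) by (intro prod.neutral) auto
  \<comment> \<open>A trivial weight stays trivial when permuted, so \<open>f\<close> depends on the
    permutation alone. Sums over the group then become \<open>N\<close> times sums over
    \<open>SG n\<close>.\<close>
  have fh: "f (b, \<sigma>) = h \<sigma>" if "b \<in> base A n" "\<sigma> \<in> SG n" for b \<sigma>
  proof -
    have "f (b, \<sigma>) = f (bas b \<otimes>\<^bsub>W\<^esub> (bone, \<sigma>))" using that by (simp add: bas_def mult_W base_group_laws bone_in)
    also have "\<dots> = cnj (wt (\<theta> \<circ> inv' \<sigma>) b) * f (bone, \<sigma>)" by (rule cov_left[OF f(4) bone_in that(2,1)])
    also have "wt (\<theta> \<circ> inv' \<sigma>) b = 1"
    proof (rule wt1[OF that(1)])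
      fix i assume "i \<in> {1..n}"
      then have "inv' \<sigma> i \<in> {1..n}" using SG_in[OF SG_inv[OF that(2)], of i] by blast
      then show "(\<theta> \<circ> inv' \<sigma>) i = (\<lambda>x\<in>carrier A. 1)" using triv by simp
    qed
    finally show ?thesis by (simp add: h_def prm_def)
  qed
  define N where "N = card (base A n)"
  have N: "0 < N" unfolding N_def using finite_base bone_in card_gt_0_iff by blast
  have sumW: "(\<Sum>x\<in>carrier W. G x) = (\<Sum>b\<in>base A n. \<Sum>\<sigma>\<in>SG n. G (b, \<sigma>))" for G :: "_ \<Rightarrow> 'z :: comm_monoid_add"
    unfolding carrier_W by (simp add: sum.cartesian_product)
  have "0 = (\<Sum>b\<in>base A n. \<Sum>\<sigma>\<in>SG n. f (b, \<sigma>))" using f(3) sumW[of f] by simp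
  also have "\<dots> = of_nat N * (\<Sum>\<sigma>\<in>SG n. h \<sigma>)" by (simp add: fh N_def)
  finally have h0: "(\<Sum>\<sigma>\<in>SG n. h \<sigma>) = 0" using N by simp
  have nf: "norm2_on (pts Reg) f = real N * norm2_on (SG n) h"
    unfolding reg_norm2 sumW by (simp add: fh N_def norm2_on_def)
  have fR: "f \<in> vecs Reg" using f(1) by (simp add: reg_vecs)
  have db: "norm2_on (pts Reg) (\<lambda>y. f y - act Reg (bas x) f y) = 0" if x: "x \<in> base A n" for x
  proof -
    have "f (inv\<^bsub>W\<^esub> (bas x) \<otimes>\<^bsub>W\<^esub> (b, \<sigma>)) = f (b, \<sigma>)" if "b \<in> base A n" "\<sigma> \<in> SG n" for b \<sigma>
      unfolding inv_bas[OF x] using x that by (simp add: bas_def mult_W base_group_laws fh bmult_in binv_in)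
    then show ?thesis unfolding reg_displacement sumW by simp
  qed
  have dt: "norm2_on (pts Reg) (\<lambda>y. f y - act Reg (prm (tr i j)) f y) = real N * edge_energy n h i j" if ij: "(i, j) \<in> pairs" for i j
  proof -
    have t: "tr i j \<in> SG n" by (rule pairs_tr[OF ij])
    have "f (inv\<^bsub>W\<^esub> (prm (tr i j)) \<otimes>\<^bsub>W\<^esub> (b, \<sigma>)) = h (tr i j \<circ> \<sigma>)" if "b \<in> base A n" "\<sigma> \<in> SG n" for b \<sigma>
      unfolding inv_prm[OF t] inv_tr using t that by (simp add: prm_def mult_W base_group_laws permb_in fh SG_comp)
    then show ?thesis unfolding reg_displacement sumW by (simp add: fh N_def edge_energy_def)
  qed
  have "process_energy n cc h = 2 * (\<Sum>(i, j)\<in>pairs. cc i j * edge_energy n h i j)"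
    unfolding process_energy_def
  proof (rule sum_pairs)
    show "cc i j * edge_energy n h i j = cc j i * edge_energy n h j i" for i j by (simp only: ccs[of i j] edge_energy_commute)
  qed (simp add: edge_energy_refl)
  also have "(\<Sum>(i, j)\<in>pairs. cc i j * edge_energy n h i j) = (\<Sum>(i, j)\<in>pairs. a i j * edge_energy n h i j)"
    by (intro sum.cong refl) (auto simp: cc_pairs)
  finally have ip: "process_energy n cc h = 2 * (\<Sum>(i, j)\<in>pairs. a i j * edge_energy n h i j)" .
  have "r * norm2_on (pts Reg) f = (\<Sum>(i, j)\<in>pairs. a i j * norm2_on (pts Reg) (\<lambda>y. f y - act Reg (prm (tr i j)) f y)) / 2"
    unfolding r[symmetric] adm_form[OF reg_unitary w fR] by (simp add: db)
  also have "(\<Sum>(i, j)\<in>pairs. a i j * norm2_on (pts Reg) (\<lambda>y. f y - act Reg (prm (tr i j)) f y)) = real N * (\<Sum>(i, j)\<in>pairs. a i j * edge_energy n h i j)"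
    unfolding sum_distrib_left by (intro sum.cong refl) (auto simp: dt)
  finally have "r * (real N * norm2_on (SG n) h) = real N * (process_energy n cc h / 4)" by (simp add: nf ip)
  then have "real N * (r * norm2_on (SG n) h) = real N * (process_energy n cc h / 4)" by (simp only: mult.left_commute)
  then have "r * norm2_on (SG n) h = process_energy n cc h / 4" using N by simp
  then have le: "q * norm2_on (SG n) h \<le> r * norm2_on (SG n) h" using aldous[OF h0] by simp
  have "0 < norm2_on (pts Reg) f" using norm2_on_pos[OF finite_W f(1,2)] by (simp add: reg_pts)
  then have "0 < norm2_on (SG n) h" using N by (simp add: nf zero_less_mult_iff)
  then have "q \<le> r" using le by simp
  then show ?thesis using q(1) by simp
qed

text \<open>\<open>V_class\<close> rests on an arbitrary block decomposition, so its labelling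
  agrees with that of \<open>f\<close> only up to a permutation. Right translation by that
  permutation adjusts \<open>f\<close> without changing its energy.\<close>

lemma cov_perm:
  assumes f: "f \<in> functions_on (carrier W)" "f \<noteq> 0" "cov \<theta> f" and \<sigma>: "\<sigma> \<in> SG n" and w: "weights a c"
    and r: "Re (inner_on (pts Reg) (laplacian W (adm a c) Reg f) f) = r * norm2_on (pts Reg) f"
  shows "\<exists>f'\<in>functions_on (carrier W). f' \<noteq> 0 \<and> cov (\<theta> \<circ> \<sigma>) f' \<and>
    Re (inner_on (pts Reg) (laplacian W (adm a c) Reg f') f') = r * norm2_on (pts Reg) f'"
proof -
  interpret J: laplacian_rep W Reg "adm a c" by (rule laplacian_rep_adm[OF reg_unitary w])
  let ?k = "prm (inv' \<sigma>)"
  have k: "?k \<in> carrier W" by (intro prm_in SG_inv \<sigma>)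
  define f' where "f' x = (if x \<in> carrier W then f (x \<otimes>\<^bsub>W\<^esub> ?k) else 0)" for x
  have f'V: "f' \<in> functions_on (carrier W)" by (simp add: f'_def functions_on_def)
  have nf: "norm2_on (pts Reg) f' = norm2_on (pts Reg) f"
    unfolding reg_norm2 using sum_right_shift[OF k, of "\<lambda>x. (cmod (f x))\<^sup>2"] by (simp add: f'_def)
  have d: "norm2_on (pts Reg) (\<lambda>y. f' y - act Reg h f' y) = norm2_on (pts Reg) (\<lambda>y. f y - act Reg h f y)" if h: "h \<in> carrier W" for h
  proof -
    have "(\<Sum>g\<in>carrier W. (cmod (f' g - f' (inv\<^bsub>W\<^esub> h \<otimes>\<^bsub>W\<^esub> g)))\<^sup>2)
        = (\<Sum>g\<in>carrier W. (cmod (f (g \<otimes>\<^bsub>W\<^esub> ?k) - f (inv\<^bsub>W\<^esub> h \<otimes>\<^bsub>W\<^esub> (g \<otimes>\<^bsub>W\<^esub> ?k))))\<^sup>2)"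
      using h k by (intro sum.cong refl) (simp add: f'_def W.m_assoc)
    also have "\<dots> = (\<Sum>g\<in>carrier W. (cmod (f g - f (inv\<^bsub>W\<^esub> h \<otimes>\<^bsub>W\<^esub> g)))\<^sup>2)"
      by (rule sum_right_shift[OF k, of "\<lambda>g. (cmod (f g - f (inv\<^bsub>W\<^esub> h \<otimes>\<^bsub>W\<^esub> g)))\<^sup>2"])
    finally show ?thesis unfolding reg_displacement .
  qed
  have "Re (inner_on (pts Reg) (J.L f') f') = Re (inner_on (pts Reg) (J.L f) f)"
    using J.laplacian_form[of f'] J.laplacian_form[of f] f(1) f'V d by (simp add: reg_vecs)
  then have "Re (inner_on (pts Reg) (J.L f') f') = r * norm2_on (pts Reg) f'" using r nf by simp
  moreover have "f' \<noteq> 0"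
  proof
    assume "f' = 0"
    then have "norm2_on (pts Reg) f = 0" unfolding nf[symmetric] by (simp add: norm2_on_def)
    then show False using norm2_on_pos[OF finite_W f(1,2)] by (simp add: reg_pts)
  qed
  moreover have "cov (\<theta> \<circ> \<sigma>) f'"
    unfolding cov_def
  proof (intro ballI)
    fix x b assume x: "x \<in> carrier W" "b \<in> base A n"
    have b': "permb \<sigma> b \<in> base A n" by (rule permb_in[OF \<sigma> x(2)])
    have "bas b \<otimes>\<^bsub>W\<^esub> ?k = ?k \<otimes>\<^bsub>W\<^esub> bas (permb \<sigma> b)"
      unfolding prm_bas[OF SG_inv[OF \<sigma>] b'] using x \<sigma> by (simp add: permb_comp SG_inv SG_inv_comp base_group_laws)
    then have "x \<otimes>\<^bsub>W\<^esub> bas b \<otimes>\<^bsub>W\<^esub> ?k = x \<otimes>\<^bsub>W\<^esub> ?k \<otimes>\<^bsub>W\<^esub> bas (permb \<sigma> b)"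
      using x k bas_in[OF x(2)] bas_in[OF b'] by (simp add: W.m_assoc)
    moreover have "f (x \<otimes>\<^bsub>W\<^esub> ?k \<otimes>\<^bsub>W\<^esub> bas (permb \<sigma> b)) = cnj (wt \<theta> (permb \<sigma> b)) * f (x \<otimes>\<^bsub>W\<^esub> ?k)"
      by (rule covD[OF f(3) _ b']) (use x k in simp)
    ultimately show "f' (x \<otimes>\<^bsub>W\<^esub> bas b) = cnj (wt (\<theta> \<circ> \<sigma>) b) * f' x"
      using x bas_in[OF x(2)] by (simp add: f'_def wt_permb[OF \<sigma>])
  qed
  ultimately show ?thesis using f'V by blast
qed

lemma wt_cchar:
  assumes "b \<in> base A n"
  shows "wt (\<lambda>i. cchar (\<theta> i)) b = cnj (wt \<theta> b)"
  unfolding wt_def cnj_prod using base_in[OF assms] by (intro prod.cong refl) (simp add: cchar_def)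

text \<open>Left translations have real matrices, so conjugating \<open>f\<close> preserves every
  displacement. This is why one member of each duality orbit suffices.\<close>

lemma cov_cnj:
  assumes f: "f \<in> functions_on (carrier W)" "f \<noteq> 0" "cov \<theta> f" and w: "weights a c"
    and r: "Re (inner_on (pts Reg) (laplacian W (adm a c) Reg f) f) = r * norm2_on (pts Reg) f"
  shows "\<exists>f'\<in>functions_on (carrier W). f' \<noteq> 0 \<and> cov (\<lambda>i. cchar (\<theta> i)) f' \<and>
    Re (inner_on (pts Reg) (laplacian W (adm a c) Reg f') f') = r * norm2_on (pts Reg) f'"
proof -
  interpret J: laplacian_rep W Reg "adm a c" by (rule laplacian_rep_adm[OF reg_unitary w])
  define f' where "f' x = cnj (f x)" for x
  have f'V: "f' \<in> functions_on (carrier W)" using f(1) by (simp add: f'_def functions_on_def)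
  have nf: "norm2_on (pts Reg) f' = norm2_on (pts Reg) f" by (simp add: norm2_on_def f'_def)
  have d: "norm2_on (pts Reg) (\<lambda>y. f' y - act Reg h f' y) = norm2_on (pts Reg) (\<lambda>y. f y - act Reg h f y)" for h
    unfolding reg_displacement f'_def complex_cnj_diff[symmetric] complex_mod_cnj ..
  have "Re (inner_on (pts Reg) (J.L f') f') = Re (inner_on (pts Reg) (J.L f) f)"
    using J.laplacian_form[of f'] J.laplacian_form[of f] f(1) f'V d by (simp add: reg_vecs)
  then have "Re (inner_on (pts Reg) (J.L f') f') = r * norm2_on (pts Reg) f'" using r nf by simp
  moreover obtain p where "f p \<noteq> 0" using f(2) by (auto simp: fun_eq_iff)
  then have "f' p \<noteq> 0" by (simp add: f'_def)
  then have "f' \<noteq> 0" by (rule nonzero_funI)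
  moreover have "cov (\<lambda>i. cchar (\<theta> i)) f'"
    using f(3) by (simp add: cov_def f'_def wt_cchar)
  ultimately show ?thesis using f'V by blast
qed

lemma nontrivial_char:
  assumes k: "\<kappa> \<in> nontrivial_mult_vectors A n" and \<theta>: "\<And>c. c \<in> Ahat \<Longrightarrow> cnt \<theta> c = \<kappa> c"
  shows "\<exists>i\<in>{1..n}. \<theta> i \<noteq> (\<lambda>x\<in>carrier A. 1)"
proof (rule ccontr)
  assume "\<not> (\<exists>i\<in>{1..n}. \<theta> i \<noteq> (\<lambda>x\<in>carrier A. 1))"
  then have "{i \<in> {1..n}. \<theta> i = (\<lambda>x\<in>carrier A. 1)} = {1..n}" by blast
  then have "cnt \<theta> (\<lambda>x\<in>carrier A. 1) = n" by (simp add: cnt_def)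
  then show False using k \<theta>[OF one_in_Ahat] by (simp add: nontrivial_mult_vectors_def one_Ahat)
qed

lemma nontrivial_weight:
  assumes k: "\<kappa> \<in> nontrivial_mult_vectors A n" and \<theta>: "\<theta> \<in> chars" "\<And>c. c \<in> Ahat \<Longrightarrow> cnt \<theta> c = \<kappa> c"
  shows "fixed_space W (ind \<theta>) = {0}"
proof -
  obtain i where i: "i \<in> {1..n}" "\<theta> i \<noteq> (\<lambda>x\<in>carrier A. 1)" using nontrivial_char[OF k \<theta>(2)] by blast
  show ?thesis by (rule ind_fixed[OF \<theta>(1) i])
qed

lemma V_class_nontrivial:
  assumes k: "\<kappa> \<in> nontrivial_mult_vectors A n"
  obtains \<theta> where "\<theta> \<in> chars" "\<And>c. c \<in> Ahat \<Longrightarrow> cnt \<theta> c = \<kappa> c" "V_class A n \<kappa> = iso_class W (ind \<theta>)" "fixed_space W (ind \<theta>) = {0}"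
proof -
  have km: "\<kappa> \<in> mult_vectors A n" using k by (simp add: nontrivial_mult_vectors_def)
  obtain \<theta> where \<theta>: "\<theta> \<in> chars" "\<forall>c\<in>Ahat. cnt \<theta> c = \<kappa> c" "V_class A n \<kappa> = iso_class W (ind \<theta>)"
    using V_class_ind[OF km] by blast
  have c: "cnt \<theta> c = \<kappa> c" if "c \<in> Ahat" for c using \<theta>(2) that by (rule bspec)
  show ?thesis by (rule that[OF \<theta>(1) c \<theta>(3) nontrivial_weight[OF k \<theta>(1) c]])
qed

section \<open>Multiplicity vectors of labellings and the gap-determining property\<close>

definition kap :: "(nat \<Rightarrow> 'a \<Rightarrow> complex) \<Rightarrow> ('a \<Rightarrow> complex) \<Rightarrow> nat" where
  "kap \<theta> = (\<lambda>c\<in>Ahat. cnt \<theta> c)"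

lemma kap_in:
  assumes \<theta>: "\<theta> \<in> chars"
  shows "kap \<theta> \<in> mult_vectors A n"
proof -
  have "(\<Sum>c\<in>Ahat. cnt \<theta> c) = (\<Sum>c\<in>Ahat. \<Sum>i\<in>{i \<in> {1..n}. \<theta> i = c}. 1)" by (simp add: cnt_def)
  also have "\<dots> = (\<Sum>i\<in>{1..n}. 1)" by (rule sum.group) (use finite_Ahat chars_in[OF \<theta>] in auto)
  finally show ?thesis by (simp add: mult_vectors_def kap_def)
qed

lemma cnt_cchar:
  assumes \<theta>: "\<theta> \<in> chars" and c: "c \<in> Ahat"
  shows "cnt (\<lambda>i. cchar (\<theta> i)) c = cnt \<theta> (cchar c)"
proof -
  have "cchar (\<theta> i) = c \<longleftrightarrow> \<theta> i = cchar c" if "i \<in> {1..n}" for i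
    using cchar_cchar[OF chars_in[OF \<theta> that]] cchar_cchar[OF c] by auto
  then have "{i \<in> {1..n}. cchar (\<theta> i) = c} = {i \<in> {1..n}. \<theta> i = cchar c}" by blast
  then show ?thesis by (simp add: cnt_def)
qed

lemma dual_kap:
  assumes \<theta>: "\<theta> \<in> chars"
  shows "dual_vector A (kap \<theta>) = kap (\<lambda>i. cchar (\<theta> i))"
  unfolding dual_vector_def kap_def
  by (rule restrict_ext) (simp add: inv_Ahat cchar_in cnt_cchar[OF \<theta>])

lemma cchar_chars: "\<theta> \<in> chars \<Longrightarrow> (\<lambda>i. cchar (\<theta> i)) \<in> chars"
  by (auto simp: chars_def intro: cchar_in)

lemma psi_reg_le_adm:
  assumes R: "irreducible_rep W R" "fixed_space W R = {0}" and w: "weights a c"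
  shows "psi_reg W (adm a c) \<le> psi W (adm a c) R"
  by (rule psi_reg_le[OF group_W finite_W R]) (rule adm_sym[OF w])

theorem M_family_gap_determining:
  assumes n: "2 \<le> n" and T: "duality_transversal A n T"
  shows "gap_determining A n (M_family A n T)"
proof -
  have TN: "\<kappa> \<in> nontrivial_mult_vectors A n" if "\<kappa> \<in> T" for \<kappa> using T that unfolding duality_transversal_def by blast
  have member: "\<exists>R :: ('a wreath_elt, 'a wreath_elt \<times> unit) urep. irreducible_rep W R \<and> fixed_space W R = {0} \<and> V = iso_class W R"
    if "V \<in> V_class A n ` T" for V
  proof -
    obtain \<kappa> where "\<kappa> \<in> T" "V = V_class A n \<kappa>" using \<open>V \<in> V_class A n ` T\<close> by blast
    then show ?thesis using V_class_nontrivial[OF TN] ind_irreducible by metis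
  qed
  have std: "Std A n = iso_class W Rstd" by (simp add: Std_def)
  note std_irr = std_irreducible[OF n] and std_fix = std_fixed[OF n]
  have sub: "V \<in> Irr W - {iso_class W trivial_rep}" if V: "V \<in> M_family A n T" for V
  proof (cases "V = Std A n")
    case True
    then show ?thesis using iso_class_in_Irr[OF std_irr] nontrivial_class_iff[OF std_irr] std_fix by (simp add: std)
  next
    case False
    then have "V \<in> V_class A n ` T" using V by (simp add: M_family_def)
    then obtain R :: "('a wreath_elt, 'a wreath_elt \<times> unit) urep"
      where R: "irreducible_rep W R" "fixed_space W R = {0}" "V = iso_class W R" using member[of V] by blast
    then show ?thesis using iso_class_in_Irr[OF R(1)] nontrivial_class_iff[OF R(1)] by simp
  qed
  have low: "psi_reg W (adm a c) \<le> psi_class W (adm a c) V" if V: "V \<in> M_family A n T" and w: "weights a c" for V a c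
  proof (cases "V = Std A n")
    case True
    show ?thesis unfolding True std psi_class_iso_class[OF std_irr std_fix]
      by (rule psi_reg_le_adm[OF std_irr std_fix w])
  next
    case False
    then have "V \<in> V_class A n ` T" using V by (simp add: M_family_def)
    then obtain R :: "('a wreath_elt, 'a wreath_elt \<times> unit) urep"
      where R: "irreducible_rep W R" "fixed_space W R = {0}" "V = iso_class W R" using member[of V] by blast
    show ?thesis unfolding R(3) psi_class_iso_class[OF R(1,2)]
      by (rule psi_reg_le_adm[OF R(1,2) w])
  qed
  have att: "\<exists>V\<in>M_family A n T. psi_class W (adm a c) V \<le> psi_reg W (adm a c)" if w: "weights a c" for a c
  proof -
    obtain r \<theta> f where f: "psi_reg W (adm a c) = ereal r" "\<theta> \<in> chars" "f \<in> functions_on (carrier W)" "f \<noteq> 0"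
      "(\<Sum>x\<in>carrier W. f x) = 0" "cov \<theta> f"
      "Re (inner_on (pts Reg) (laplacian W (adm a c) Reg f) f) = r * norm2_on (pts Reg) f"
      by (rule gap_weight_function[OF n w])
    show ?thesis
    proof (cases "\<exists>i\<in>{1..n}. \<theta> i \<noteq> (\<lambda>x\<in>carrier A. 1)")
      case False
      then have triv: "\<theta> i = (\<lambda>x\<in>carrier A. 1)" if "i \<in> {1..n}" for i using that by blast
      have "psi_class W (adm a c) (Std A n) \<le> ereal r"
        unfolding std psi_class_iso_class[OF std_irr std_fix]
        by (rule trivial_weight_bound[OF n w triv f(3-7)])
      then show ?thesis using f(1) by (auto simp: M_family_def)
    next
      case True
      then obtain i where i: "i \<in> {1..n}" "\<theta> i \<noteq> (\<lambda>x\<in>carrier A. 1)" by blast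
      have key: "psi_class W (adm a c) (V_class A n (kap \<theta>')) \<le> ereal r"
        if t': "\<theta>' \<in> chars" "kap \<theta>' \<in> nontrivial_mult_vectors A n" "f' \<in> functions_on (carrier W)" "f' \<noteq> 0" "cov \<theta>' f'"
          "Re (inner_on (pts Reg) (laplacian W (adm a c) Reg f') f') = r * norm2_on (pts Reg) f'" for \<theta>' f'
      proof -
        obtain \<theta>1 where t1: "\<theta>1 \<in> chars" "\<And>c. c \<in> Ahat \<Longrightarrow> cnt \<theta>1 c = kap \<theta>' c" "V_class A n (kap \<theta>') = iso_class W (ind \<theta>1)"
          "fixed_space W (ind \<theta>1) = {0}" using V_class_nontrivial[OF t'(2)] by blast
        have "cnt \<theta>' c = cnt \<theta>1 c" if "c \<in> Ahat" for c using t1(2)[OF that] that by (simp add: kap_def)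
        then obtain \<sigma> where s: "\<sigma> \<in> SG n" "\<forall>i\<in>{1..n}. \<theta>1 i = \<theta>' (\<sigma> i)" using cnt_eq_perm[OF t'(1) t1(1)] by blast
        obtain f1 where f1: "f1 \<in> functions_on (carrier W)" "f1 \<noteq> 0" "cov (\<theta>' \<circ> \<sigma>) f1"
          "Re (inner_on (pts Reg) (laplacian W (adm a c) Reg f1) f1) = r * norm2_on (pts Reg) f1"
          using cov_perm[OF t'(3,4,5) s(1) w t'(6)] by blast
        have "wt \<theta>1 b = wt (\<theta>' \<circ> \<sigma>) b" for b using s(2) by (intro wt_cong) auto
        then have "cov \<theta>1 f1" using f1(3) by (simp add: cov_def)
        then have "psi W (adm a c) (ind \<theta>1) \<le> ereal r"
          by (rule weight_function_bound[OF t1(1,4) w f1(1,2)]) (simp add: f1(4))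
        then show ?thesis unfolding t1(3) psi_class_iso_class[OF ind_irreducible[OF t1(1)] t1(4)] .
      qed
      \<comment> \<open>Site \<open>i\<close> carries a non-trivial label, so the trivial one occurs
        at most \<open>n - 1\<close> times.\<close>
      have kN: "kap \<theta> \<in> nontrivial_mult_vectors A n"
      proof -
        have "{i \<in> {1..n}. \<theta> i = (\<lambda>x\<in>carrier A. 1)} \<subseteq> {1..n} - {i}" using i by blast
        then have "cnt \<theta> (\<lambda>x\<in>carrier A. 1) \<le> card ({1..n} - {i})" unfolding cnt_def by (intro card_mono) auto
        also have "\<dots> < n" using i(1) by (simp add: card_Diff_singleton)
        finally show ?thesis using kap_in[OF f(2)] one_in_Ahat by (simp add: nontrivial_mult_vectors_def one_Ahat kap_def)
      qed
      then have "\<exists>\<kappa>'. \<kappa>' \<in> T \<inter> {kap \<theta>, dual_vector A (kap \<theta>)}" using T unfolding duality_transversal_def by blast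
      then consider "kap \<theta> \<in> T" | "kap (\<lambda>i. cchar (\<theta> i)) \<in> T" by (auto simp: dual_kap[OF f(2)])
      then show ?thesis
      proof cases
        case 1
        have "psi_class W (adm a c) (V_class A n (kap \<theta>)) \<le> ereal r" by (rule key[OF f(2) kN f(3,4,6,7)])
        then show ?thesis using 1 f(1) by (auto simp: M_family_def)
      next
        case 2
        obtain f' where f': "f' \<in> functions_on (carrier W)" "f' \<noteq> 0" "cov (\<lambda>i. cchar (\<theta> i)) f'"
          "Re (inner_on (pts Reg) (laplacian W (adm a c) Reg f') f') = r * norm2_on (pts Reg) f'"
          using cov_cnj[OF f(3,4,6) w f(7)] by blast
        have "psi_class W (adm a c) (V_class A n (kap (\<lambda>i. cchar (\<theta> i)))) \<le> ereal r"
          by (rule key[OF cchar_chars[OF f(2)] TN[OF 2] f'])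
        then show ?thesis using 2 f(1) by (auto simp: M_family_def)
      qed
    qed
  qed
  show ?thesis
    unfolding gap_determining_def
  proof (intro conjI allI impI ballI)
    show "M_family A n T \<subseteq> Irr W - {iso_class W trivial_rep}" using sub by blast
    fix w assume "admissible A n w"
    then obtain a c where w: "weights a c" "w = adm a c" unfolding admissible_iff by blast
    show "psi_reg W w \<le> psi_class W w V" if "V \<in> M_family A n T" for V unfolding w(2) by (rule low[OF that w(1)])
    obtain V where "V \<in> M_family A n T" "psi_class W w V \<le> psi_reg W w" using att[OF w(1)] unfolding w(2) by blast
    moreover then have "psi_reg W w \<le> psi_class W w V" unfolding w(2) using low[OF _ w(1)] by blast
    ultimately show "\<exists>V\<in>M_family A n T. psi_reg W w = psi_class W w V" by (intro bexI[of _ V] antisym)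
  qed
qed

section \<open>Necessity and minimality\<close>

definition trivs :: "nat \<Rightarrow> 'a \<Rightarrow> complex" where
  "trivs i = (\<lambda>x\<in>carrier A. 1)"

lemma trivs_chars: "trivs \<in> chars"
  by (auto simp: chars_def trivs_def intro: one_in_Ahat)

lemma wt_trivs: "x \<in> base A n \<Longrightarrow> wt trivs x = 1"
  unfolding wt_def trivs_def using base_in by (intro prod.neutral) auto

section \<open>Cosine weights attached to a character\<close>

lemma sum_wt:
  assumes \<theta>: "\<theta> \<in> chars" and i: "i \<in> {1..n}" "\<theta> i \<noteq> (\<lambda>x\<in>carrier A. 1)"
  shows "(\<Sum>x\<in>base A n. wt \<theta> x) = 0"
proof -
  have "(\<Sum>x\<in>base A n. wt \<theta> x) = (\<Sum>x\<in>base A n. cnj (wt trivs x) * wt \<theta> x)" by (simp add: wt_trivs)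
  moreover have "\<not> (\<forall>i\<in>{1..n}. trivs i = \<theta> i)"
  proof
    assume "\<forall>i\<in>{1..n}. trivs i = \<theta> i"
    then have "trivs i = \<theta> i" using i(1) by (rule bspec)
    then show False using i(2) by (simp add: trivs_def)
  qed
  ultimately show ?thesis unfolding wt_orthogonal[OF trivs_chars \<theta>] by (simp only: if_False)
qed

text \<open>A product of two real parts is half the real part of
  \<open>cnj (wt \<theta> x) * wt \<eta> x\<close> plus half that of
  \<open>wt \<theta> x * wt \<eta> x\<close>. By orthogonality the sum is
  \<open>card (base A n)\<close>, reduced by half of it for each of \<open>\<theta>\<close> and its
  conjugate that agrees with \<open>\<eta>\<close>.\<close>

lemma weight_energy:
  assumes \<theta>: "\<theta> \<in> chars" "(\<Sum>x\<in>base A n. wt \<theta> x) = 0" and \<eta>: "\<eta> \<in> chars" "(\<Sum>x\<in>base A n. wt \<eta> x) = 0"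
  shows "(\<Sum>x\<in>base A n. (1 + Re (wt \<theta> x)) * (1 - Re (wt \<eta> x))) \<le> real (card (base A n))"
    and "(\<And>i. i \<in> {1..n} \<Longrightarrow> \<eta> i = \<theta> i) \<Longrightarrow> (\<Sum>x\<in>base A n. (1 + Re (wt \<theta> x)) * (1 - Re (wt \<eta> x))) < real (card (base A n))"
proof -
  let ?B = "base A n" and ?\<theta> = "\<lambda>i. cchar (\<theta> i)"
  have N: "0 < card ?B" using finite_base bone_in card_gt_0_iff by blast
  have "(1 + Re (wt \<theta> x)) * (1 - Re (wt \<eta> x)) = 1 + Re (wt \<theta> x) - Re (wt \<eta> x) - Re (cnj (wt \<theta> x) * wt \<eta> x) / 2
      - Re (cnj (wt ?\<theta> x) * wt \<eta> x) / 2" if "x \<in> ?B" for x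
    using that by (simp add: wt_cchar field_simps)
  then have "(\<Sum>x\<in>?B. (1 + Re (wt \<theta> x)) * (1 - Re (wt \<eta> x))) = (\<Sum>x\<in>?B. 1 + Re (wt \<theta> x) - Re (wt \<eta> x) - Re (cnj (wt \<theta> x) * wt \<eta> x) / 2
      - Re (cnj (wt ?\<theta> x) * wt \<eta> x) / 2)" by (rule sum.cong[OF refl])
  also have "\<dots> = real (card ?B) + Re (\<Sum>x\<in>?B. wt \<theta> x) - Re (\<Sum>x\<in>?B. wt \<eta> x) - Re (\<Sum>x\<in>?B. cnj (wt \<theta> x) * wt \<eta> x) / 2
      - Re (\<Sum>x\<in>?B. cnj (wt ?\<theta> x) * wt \<eta> x) / 2"
    unfolding Re_sum sum_subtractf sum.distrib sum_divide_distrib by simp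
  also have "\<dots> = real (card ?B) - Re (\<Sum>x\<in>?B. cnj (wt \<theta> x) * wt \<eta> x) / 2 - Re (\<Sum>x\<in>?B. cnj (wt ?\<theta> x) * wt \<eta> x) / 2"
    by (simp add: \<theta>(2) \<eta>(2))
  finally have eq: "(\<Sum>x\<in>?B. (1 + Re (wt \<theta> x)) * (1 - Re (wt \<eta> x)))
    = real (card ?B) - Re (\<Sum>x\<in>?B. cnj (wt \<theta> x) * wt \<eta> x) / 2 - Re (\<Sum>x\<in>?B. cnj (wt ?\<theta> x) * wt \<eta> x) / 2" .
  have ge: "0 \<le> Re (\<Sum>x\<in>?B. cnj (wt \<zeta> x) * wt \<eta> x)" if "\<zeta> \<in> chars" for \<zeta>
    unfolding wt_orthogonal[OF that \<eta>(1)] by simp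
  show "(\<Sum>x\<in>?B. (1 + Re (wt \<theta> x)) * (1 - Re (wt \<eta> x))) \<le> real (card ?B)"
    unfolding eq using ge[OF \<theta>(1)] ge[OF cchar_chars[OF \<theta>(1)]] by simp
  assume "\<And>i. i \<in> {1..n} \<Longrightarrow> \<eta> i = \<theta> i"
  then have "\<forall>i\<in>{1..n}. \<theta> i = \<eta> i" by auto
  then have "Re (\<Sum>x\<in>?B. cnj (wt \<theta> x) * wt \<eta> x) = real (card ?B)" unfolding wt_orthogonal[OF \<theta>(1) \<eta>(1)] by simp
  then show "(\<Sum>x\<in>?B. (1 + Re (wt \<theta> x)) * (1 - Re (wt \<eta> x))) < real (card ?B)"
    unfolding eq using N ge[OF cchar_chars[OF \<theta>(1)]] by simp
qed

lemma cosine_weights: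
  assumes \<theta>: "\<theta> \<in> chars" and M: "0 \<le> M"
  shows "weights (\<lambda>_ _. M) (\<lambda>x. 1 + Re (wt \<theta> x))"
proof -
  have "0 \<le> 1 + Re (wt \<theta> x)" if "x \<in> base A n" for x
    using abs_Re_le_cmod[of "wt \<theta> x"] wt_norm[OF \<theta> that] by linarith
  then show ?thesis unfolding weights_def using M by (simp add: wt_binv[OF \<theta>])
qed

text \<open>The test vector is the invariant vector of \<open>ind \<theta>\<close>. Transpositions
  do not move it, so the bound is uniform in \<open>M\<close>. On \<open>A^n\<close> its energy
  splits into those of the permuted labels \<open>\<theta>' g\<close>, each at most
  \<open>card (base A n)\<close>, and strictly less at the identity.\<close>

lemma cosine_psi_less:
  assumes \<theta>: "\<theta> \<in> chars" and i: "i \<in> {1..n}" "\<theta> i \<noteq> (\<lambda>x\<in>carrier A. 1)" and M: "0 \<le> M"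
  shows "psi W (adm (\<lambda>_ _. M) (\<lambda>x. 1 + Re (wt \<theta> x))) (ind \<theta>) < ereal (real (card (base A n)))"
proof -
  define a :: "nat \<Rightarrow> nat \<Rightarrow> real" where "a = (\<lambda>_ _. M)"
  define c where "c x = 1 + Re (wt \<theta> x)" for x
  have w: "weights a c" using cosine_weights[OF \<theta> M] by (simp add: a_def c_def[abs_def])
  interpret I: laplacian_rep W "ind \<theta>" "adm a c" by (rule laplacian_rep_adm[OF ind_unitary[OF \<theta>] w])
  define P where "P = (\<lambda>(g, u :: unit). if g \<in> carrier W then phase \<theta> g else 0)"
  have PV: "P \<in> vecs (ind \<theta>)"
    unfolding ind_vecs[OF \<theta>] using phase_right[OF \<theta>] stab_carrier by (auto simp: P_def functions_on_def)
  have P: "P (g, ()) = phase \<theta> g" if "g \<in> carrier W" for g using that by (simp add: P_def)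
  have nP: "norm2_on (pts (ind \<theta>)) P = real (card (carrier W))"
    unfolding ind_norm2 by (simp add: P phase_norm[OF \<theta>])
  define \<theta>' where "\<theta>' g = \<theta> \<circ> inv' (snd g)" for g :: "'a wreath_elt"
  have prm0: "norm2_on (pts (ind \<theta>)) (\<lambda>y. P y - act (ind \<theta>) (prm (tr k l)) P y) = 0" if kl: "(k, l) \<in> pairs" for k l
  proof -
    have "P (g, ()) - P (inv\<^bsub>W\<^esub> (prm (tr k l)) \<otimes>\<^bsub>W\<^esub> g, ()) = 0" if g: "g \<in> carrier W" for g
      unfolding inv_prm[OF pairs_tr[OF kl]] inv_tr
      using P[OF g] P[OF W.m_closed[OF pairs_prm[OF kl] g]] phase_prm[OF g pairs_tr[OF kl]] by simp
    then show ?thesis unfolding ind_displacement by simp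
  qed
  have bas: "norm2_on (pts (ind \<theta>)) (\<lambda>y. P y - act (ind \<theta>) (bas x) P y) = (\<Sum>g\<in>carrier W. 2 * (1 - Re (wt (\<theta>' g) x)))"
    if x: "x \<in> base A n" for x
    unfolding ind_displacement
  proof (rule sum.cong[OF refl])
    fix g assume g: "g \<in> carrier W"
    obtain b \<sigma> where gb: "g = (b, \<sigma>)" by (cases g)
    have b: "b \<in> base A n" "\<sigma> \<in> SG n" using g by (simp_all add: gb carrier_W)
    define z where "z = wt (\<theta>' g) x"
    have \<theta>'g: "\<theta>' g = \<theta> \<circ> inv' \<sigma>" by (simp add: \<theta>'_def gb)
    have c': "\<theta>' g \<in> chars" unfolding \<theta>'g by (rule chars_comp[OF \<theta> SG_inv[OF b(2)]])
    have "phase \<theta> (bas (binv x) \<otimes>\<^bsub>W\<^esub> (b, \<sigma>)) = cnj (wt (\<theta>' g) (binv x)) * phase \<theta> (b, \<sigma>)"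
      unfolding \<theta>'g by (rule phase_bas[OF \<theta> b binv_in[OF x]])
    then have "P (g, ()) - P (inv\<^bsub>W\<^esub> (bas x) \<otimes>\<^bsub>W\<^esub> g, ()) = (1 - z) * phase \<theta> g"
      unfolding inv_bas[OF x] P[OF g] P[OF W.m_closed[OF bas_in[OF binv_in[OF x]] g]]
      by (simp add: gb wt_binv[OF c'[unfolded gb] x] z_def algebra_simps)
    then have "(cmod (P (g, ()) - P (inv\<^bsub>W\<^esub> (bas x) \<otimes>\<^bsub>W\<^esub> g, ())))\<^sup>2 = (cmod (1 - z))\<^sup>2"
      by (simp add: norm_mult phase_norm[OF \<theta> g])
    also have "\<dots> = 1 - 2 * Re z + ((Re z)\<^sup>2 + (Im z)\<^sup>2)" unfolding cmod_power2 by (simp add: power2_eq_square algebra_simps)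
    also have "(Re z)\<^sup>2 + (Im z)\<^sup>2 = 1" unfolding cmod_power2[symmetric] z_def by (simp add: wt_norm[OF c' x])
    finally show "(cmod (P (g, ()) - P (inv\<^bsub>W\<^esub> (bas x) \<otimes>\<^bsub>W\<^esub> g, ())))\<^sup>2 = 2 * (1 - Re (wt (\<theta>' g) x))" by (simp add: z_def)
  qed
  define E where "E = Re (inner_on (pts (ind \<theta>)) (laplacian W (adm a c) (ind \<theta>) P) P)"
  have "(\<Sum>(k, l)\<in>pairs. a k l * norm2_on (pts (ind \<theta>)) (\<lambda>y. P y - act (ind \<theta>) (prm (tr k l)) P y)) = 0"
    by (rule sum.neutral) (auto simp: prm0)
  then have "E = (\<Sum>x\<in>base A n. c x * norm2_on (pts (ind \<theta>)) (\<lambda>y. P y - act (ind \<theta>) (bas x) P y)) / 2"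
    unfolding E_def adm_form[OF ind_unitary[OF \<theta>] w PV] by simp
  also have "\<dots> = (\<Sum>x\<in>base A n. \<Sum>g\<in>carrier W. c x * (1 - Re (wt (\<theta>' g) x)))"
  proof -
    have "c x * norm2_on (pts (ind \<theta>)) (\<lambda>y. P y - act (ind \<theta>) (bas x) P y) / 2 = (\<Sum>g\<in>carrier W. c x * (1 - Re (wt (\<theta>' g) x)))"
      if "x \<in> base A n" for x
      unfolding bas[OF that] sum_distrib_left sum_divide_distrib by (intro sum.cong refl) (simp add: field_simps)
    then show ?thesis unfolding sum_divide_distrib by (rule sum.cong[OF refl])
  qed
  also have "\<dots> = (\<Sum>g\<in>carrier W. \<Sum>x\<in>base A n. c x * (1 - Re (wt (\<theta>' g) x)))" by (rule sum.swap)
  also have "\<dots> < (\<Sum>g\<in>carrier W. real (card (base A n)))"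
  proof (rule sum_strict_mono_ex1[OF finite_W])
    have s0: "(\<Sum>x\<in>base A n. wt \<theta> x) = 0" by (rule sum_wt[OF \<theta> i])
    have ch: "\<theta>' g \<in> chars" and s1: "(\<Sum>x\<in>base A n. wt (\<theta>' g) x) = 0" if g: "g \<in> carrier W" for g
    proof -
      obtain b \<sigma> where gb: "g = (b, \<sigma>)" by (cases g)
      have b: "\<sigma> \<in> SG n" using g by (simp add: gb carrier_W)
      show c': "\<theta>' g \<in> chars" unfolding \<theta>'_def gb snd_conv by (rule chars_comp[OF \<theta> SG_inv[OF b]])
      have si: "\<sigma> i \<in> {1..n}" using SG_in[OF b, of i] i(1) by blast
      have "\<theta>' g (\<sigma> i) = \<theta> i" by (simp add: \<theta>'_def gb SG_inv_apply[OF b])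
      then show "(\<Sum>x\<in>base A n. wt (\<theta>' g) x) = 0" using sum_wt[OF c' si] i(2) by simp
    qed
    show "\<forall>g\<in>carrier W. (\<Sum>x\<in>base A n. c x * (1 - Re (wt (\<theta>' g) x))) \<le> real (card (base A n))"
      unfolding c_def using weight_energy(1)[OF \<theta> s0 ch s1] by blast
    have one: "\<one>\<^bsub>W\<^esub> \<in> carrier W" by simp
    have "\<theta>' \<one>\<^bsub>W\<^esub> k = \<theta> k" for k by (simp add: \<theta>'_def one_W)
    then have "(\<Sum>x\<in>base A n. c x * (1 - Re (wt (\<theta>' \<one>\<^bsub>W\<^esub>) x))) < real (card (base A n))"
      unfolding c_def by (intro weight_energy(2)[OF \<theta> s0 ch[OF one] s1[OF one]])
    then show "\<exists>g\<in>carrier W. (\<Sum>x\<in>base A n. c x * (1 - Re (wt (\<theta>' g) x))) < real (card (base A n))"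
      using one by blast
  qed
  finally have E: "E < real (card (carrier W)) * real (card (base A n))" by simp
  have cW: "0 < card (carrier W)" by (rule I.card_carrier_pos)
  have "P \<noteq> 0"
  proof
    assume "P = 0"
    then have "norm2_on (pts (ind \<theta>)) P = 0" by (simp add: norm2_on_def)
    then show False using nP cW by simp
  qed
  moreover have "P \<in> fixed_perp W (ind \<theta>)" using PV by (simp add: fixed_perp_all[OF ind_fixed[OF \<theta> i]])
  moreover have "Re (inner_on (pts (ind \<theta>)) (laplacian W (adm a c) (ind \<theta>) P) P) \<le> E / real (card (carrier W)) * norm2_on (pts (ind \<theta>)) P"
    unfolding E_def[symmetric] nP using cW by simp
  ultimately have "psi W (adm a c) (ind \<theta>) \<le> ereal (E / real (card (carrier W)))" by (intro I.psi_le_rayleigh)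
  also have "\<dots> < ereal (real (card (base A n)))" using E cW by (simp add: field_simps)
  finally show ?thesis unfolding a_def c_def .
qed

text \<open>The Fourier projection to weight \<open>\<theta>\<close> produces a vector of that
  weight unless it is zero.\<close>

lemma weight_projection:
  assumes R: "unitary_rep W R" and \<theta>: "\<theta> \<in> chars" and f: "f \<in> vecs R" and no: "\<not> has_weight R \<theta>"
  shows "(\<Sum>x\<in>base A n. cnj (wt \<theta> x) * act R (bas x) f p) = 0"
proof -
  interpret fin_rep W R by unfold_locales (use R finite_W in auto)
  define g where "g = (\<lambda>p. \<Sum>x\<in>base A n. cnj (wt \<theta> x) * act R (bas x) f p)"
  have bV: "act R (bas x) f \<in> vecs R" if "x \<in> base A n" for x by (rule act_in[OF bas_in[OF that] f])
  have gV: "g \<in> vecs R" unfolding g_def by (intro V_sum V_scale bV)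
  have "act R (bas y) g = (\<lambda>p. wt \<theta> y * g p)" if y: "y \<in> base A n" for y
  proof
    fix p
    define h where "h x = cnj (wt \<theta> x) * act R (bas x) f p" for x
    have "act R (bas y) g = (\<lambda>p. \<Sum>x\<in>base A n. act R (bas y) (\<lambda>q. cnj (wt \<theta> x) * act R (bas x) f q) p)"
      unfolding g_def by (rule clinear_on_sum[OF act_lin[OF bas_in[OF y]] sub_V]) (intro V_scale bV)
    then have "act R (bas y) g p = (\<Sum>x\<in>base A n. act R (bas y) (\<lambda>q. cnj (wt \<theta> x) * act R (bas x) f q) p)" by simp
    also have "\<dots> = (\<Sum>x\<in>base A n. wt \<theta> y * h (bmult y x))"
    proof (rule sum.cong[OF refl])
      fix x assume x: "x \<in> base A n"
      have z: "wt \<theta> y * cnj (wt \<theta> y) = 1" using wt_norm[OF \<theta> y] complex_norm_square[of "wt \<theta> y"] by simp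
      have "act R (bas y) (\<lambda>q. cnj (wt \<theta> x) * act R (bas x) f q) p = cnj (wt \<theta> x) * act R (bas y) (act R (bas x) f) p"
        by (simp only: clinear_on_scale[OF act_lin[OF bas_in[OF y]] bV[OF x]])
      also have "act R (bas y) (act R (bas x) f) = act R (bas (bmult y x)) f"
        unfolding bas_bas[OF x, symmetric] by (rule act_mult[OF bas_in[OF y] bas_in[OF x] f, symmetric])
      finally show "act R (bas y) (\<lambda>q. cnj (wt \<theta> x) * act R (bas x) f q) p = wt \<theta> y * h (bmult y x)"
        unfolding h_def wt_bmult[OF \<theta> y x] complex_cnj_mult mult.assoc[symmetric] z by simp
    qed
    also have "\<dots> = wt \<theta> y * (\<Sum>x\<in>base A n. h (bmult y x))" by (simp only: sum_distrib_left)
    also have "(\<Sum>x\<in>base A n. h (bmult y x)) = (\<Sum>x\<in>base A n. h x)" by (rule sum_bmult_shift[OF y])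
    finally show "act R (bas y) g p = wt \<theta> y * g p" by (simp only: g_def h_def)
  qed
  then have "g = 0" using no gV unfolding has_weight_def by blast
  then have "g p = 0" by simp
  then show ?thesis by (simp only: g_def)
qed

text \<open>The cosine weights have Fourier coefficients only at the three excluded weights, so they
  average the translates of \<open>f\<close> over \<open>A^n\<close> to zero. What is left of this
  part of the form is the squared norm times the total mass, at least
  \<open>card (base A n)\<close>.\<close>

lemma cosine_form_ge:
  assumes R: "unitary_rep W R" and \<theta>: "\<theta> \<in> chars" and M: "0 \<le> M" and f: "f \<in> vecs R"
    and no: "\<not> has_weight R \<theta>" "\<not> has_weight R (\<lambda>i. cchar (\<theta> i))" "\<not> has_weight R trivs"
  shows "real (card (base A n)) * norm2_on (pts R) f
    \<le> Re (inner_on (pts R) (laplacian W (adm (\<lambda>_ _. M) (\<lambda>x. 1 + Re (wt \<theta> x))) R f) f)"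
proof -
  interpret fin_rep W R by unfold_locales (use R finite_W in auto)
  define c where "c x = 1 + Re (wt \<theta> x)" for x
  have w: "weights (\<lambda>_ _. M) c" using cosine_weights[OF \<theta> M] by (simp add: c_def[abs_def])
  define N where "N = real (card (base A n))"
  have csum: "(\<Sum>x\<in>base A n. of_real (c x) * act R (bas x) f p) = 0" for p
  proof -
    have "of_real (c x) * act R (bas x) f p = cnj (wt trivs x) * act R (bas x) f p
        + (cnj (wt \<theta> x) * act R (bas x) f p) / 2 + (cnj (wt (\<lambda>i. cchar (\<theta> i)) x) * act R (bas x) f p) / 2" if "x \<in> base A n" for x
    proof -
      have "of_real (c x) = 1 + cnj (wt \<theta> x) / 2 + wt \<theta> x / 2" by (simp add: c_def complex_eq_iff)
      then show ?thesis using that by (simp add: wt_trivs wt_cchar algebra_simps)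
    qed
    then have "(\<Sum>x\<in>base A n. of_real (c x) * act R (bas x) f p) = (\<Sum>x\<in>base A n. cnj (wt trivs x) * act R (bas x) f p
        + (cnj (wt \<theta> x) * act R (bas x) f p) / 2 + (cnj (wt (\<lambda>i. cchar (\<theta> i)) x) * act R (bas x) f p) / 2)" by (rule sum.cong[OF refl])
    also have "\<dots> = 0"
      unfolding sum.distrib sum_divide_distrib[symmetric] weight_projection[OF R trivs_chars f no(3)]
        weight_projection[OF R \<theta> f no(1)] weight_projection[OF R cchar_chars[OF \<theta>] f no(2)] by simp
    finally show ?thesis .
  qed
  have "(\<Sum>x\<in>base A n. c x * Re (inner_on (pts R) f (act R (bas x) f))) = Re (inner_on (pts R) f (\<lambda>p. \<Sum>x\<in>base A n. of_real (c x) * act R (bas x) f p))"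
    unfolding inner_on_sum inner_on_simps by simp
  also have "\<dots> = 0" unfolding csum inner_on_simps by simp
  finally have c0: "(\<Sum>x\<in>base A n. c x * Re (inner_on (pts R) f (act R (bas x) f))) = 0" .
  have cN: "(\<Sum>x\<in>base A n. c x) = N + Re (\<Sum>x\<in>base A n. wt \<theta> x)" by (simp add: c_def sum.distrib N_def)
  have "0 \<le> Re (\<Sum>x\<in>base A n. cnj (wt trivs x) * wt \<theta> x)" unfolding wt_orthogonal[OF trivs_chars \<theta>] by simp
  then have "0 \<le> Re (\<Sum>x\<in>base A n. wt \<theta> x)" by (simp add: wt_trivs)
  then have cN': "N \<le> (\<Sum>x\<in>base A n. c x)" using cN by simp
  have "c x * norm2_on (pts R) (\<lambda>y. f y - act R (bas x) f y) = 2 * (c x * norm2_on (pts R) f) - 2 * (c x * Re (inner_on (pts R) f (act R (bas x) f)))"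
    if "x \<in> base A n" for x
    unfolding norm2_diff norm2_act[OF bas_in[OF that] f] by (simp add: algebra_simps)
  then have "(\<Sum>x\<in>base A n. c x * norm2_on (pts R) (\<lambda>y. f y - act R (bas x) f y))
      = (\<Sum>x\<in>base A n. 2 * (c x * norm2_on (pts R) f) - 2 * (c x * Re (inner_on (pts R) f (act R (bas x) f))))" by (rule sum.cong[OF refl])
  also have "\<dots> = 2 * ((\<Sum>x\<in>base A n. c x) * norm2_on (pts R) f)"
    unfolding sum_subtractf sum_distrib_left[symmetric] c0 sum_distrib_right by simp
  finally have bs: "(\<Sum>x\<in>base A n. c x * norm2_on (pts R) (\<lambda>y. f y - act R (bas x) f y)) = 2 * ((\<Sum>x\<in>base A n. c x) * norm2_on (pts R) f)" .
  have "0 \<le> (\<Sum>(i, j)\<in>pairs. M * norm2_on (pts R) (\<lambda>y. f y - act R (prm (tr i j)) f y))"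
    using M by (intro sum_nonneg) (auto simp: norm2_on_nonneg)
  then have "(\<Sum>x\<in>base A n. c x) * norm2_on (pts R) f \<le> Re (inner_on (pts R) (laplacian W (adm (\<lambda>_ _. M) c) R f) f)"
    unfolding adm_form[OF R w f] bs by simp
  moreover have "N * norm2_on (pts R) f \<le> (\<Sum>x\<in>base A n. c x) * norm2_on (pts R) f"
    by (rule mult_right_mono[OF cN' norm2_on_nonneg])
  ultimately show ?thesis unfolding N_def c_def by linarith
qed

text \<open>\<open>sum_over K f\<close> is \<open>K\<close>-invariant: either it is non-zero, or
  \<open>displacement_gap\<close> applies to \<open>f\<close>. The points are natural numbers, as in
  \<open>Irr\<close>.\<close>

lemma averaging_gap:
  assumes X: "X \<subseteq> carrier W" and K: "subgroup K W" "K \<subseteq> generate W X"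
  shows "\<exists>\<delta>>0. \<forall>(R :: ('a wreath_elt, nat) urep) f. unitary_rep W R \<longrightarrow> f \<in> vecs R \<longrightarrow>
    (\<exists>u\<in>vecs R. u \<noteq> 0 \<and> (\<forall>k\<in>K. act R k u = u)) \<or>
    \<delta> * norm2_on (pts R) f \<le> (\<Sum>x\<in>X. norm2_on (pts R) (\<lambda>y. f y - act R x f y))"
proof -
  have "K \<noteq> {}" using subgroup.one_closed[OF K(1)] by blast
  then obtain \<delta> where \<delta>: "0 < \<delta>" "\<forall>R :: ('a wreath_elt, nat) urep. unitary_rep W R \<longrightarrow>
      (\<forall>f\<in>vecs R. (\<forall>y. (\<Sum>k\<in>K. act R k f y) = 0) \<longrightarrow>
        \<delta> * norm2_on (pts R) f \<le> (\<Sum>x\<in>X. norm2_on (pts R) (\<lambda>y. f y - act R x f y)))"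
    using displacement_gap[OF group_W finite_W X K(2)] by blast
  show ?thesis
  proof (intro exI[of _ \<delta>] conjI allI impI \<delta>(1))
    fix R :: "('a wreath_elt, nat) urep" and f
    assume R: "unitary_rep W R" and f: "f \<in> vecs R"
    interpret fin_rep W R by unfold_locales (use R finite_W in auto)
    show "(\<exists>u\<in>vecs R. u \<noteq> 0 \<and> (\<forall>k\<in>K. act R k u = u)) \<or>
      \<delta> * norm2_on (pts R) f \<le> (\<Sum>x\<in>X. norm2_on (pts R) (\<lambda>y. f y - act R x f y))"
    proof (cases "\<forall>y. (\<Sum>k\<in>K. act R k f y) = 0")
      case True
      then show ?thesis using \<delta>(2) R f by simp
    next
      case False
      then obtain y where "sum_over K f y \<noteq> 0" unfolding sum_over_def by blast
      then have "sum_over K f \<noteq> 0" by (rule nonzero_funI)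
      moreover have "sum_over K f \<in> vecs R" by (rule sum_over_in[OF subgroup.subset[OF K(1)] f])
      moreover have "\<forall>k\<in>K. act R k (sum_over K f) = sum_over K f" using act_sum_over[OF K(1) f] by blast
      ultimately show ?thesis by blast
    qed
  qed
qed

text \<open>Used with \<open>m = n\<close> for the symmetric group and with \<open>m = n - 1\<close>
  for the stabilizer of \<open>n\<close>.\<close>

lemma prm_generate:
  assumes m: "m \<le> n" and \<pi>: "\<pi> permutes {1..m}"
    and X: "\<And>i j. 1 \<le> i \<Longrightarrow> i < j \<Longrightarrow> j \<le> m \<Longrightarrow> prm (tr i j) \<in> X"
  shows "prm \<pi> \<in> generate W X"
  using \<pi> finite_atLeastAtMost
proof (induction rule: permutes_induct)
  case id
  show ?case unfolding prm_def one_W[symmetric] by (rule generate.one)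
next
  case (swap a b p)
  have ab: "a \<in> {1..n}" "b \<in> {1..n}" using swap m by auto
  have "prm (tr a b) \<in> X"
  proof (cases "a < b")
    case True
    then show ?thesis using swap by (intro X) auto
  next
    case False
    then have "prm (tr b a) \<in> X" using swap by (intro X) auto
    then show ?thesis by (simp only: transpose_commute)
  qed
  then have "prm (tr a b) \<otimes>\<^bsub>W\<^esub> prm p \<in> generate W X" by (rule generate.eng[OF generate.incl swap.IH])
  then show ?case by (simp only: prm_prm[OF SG_tr[OF ab]])
qed

text \<open>The minimum over \<open>E\<close> is attained, so a strict upper bound for the gap is
  met by an eigenvector in some member of \<open>E\<close>. Both necessity proofs then identify this
  member.\<close>

lemma gap_witness:
  assumes E: "gap_determining A n E" and w: "weights a c" and less: "psi_reg W (adm a c) < ereal s"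
  obtains R :: "('a wreath_elt, nat) urep" and f where "irreducible_rep W R" "fixed_space W R = {0}" "iso_class W R \<in> E"
    "f \<in> vecs R" "f \<noteq> 0" "Re (inner_on (pts R) (laplacian W (adm a c) R f) f) < s * norm2_on (pts R) f"
proof -
  have "admissible A n (adm a c)" using w unfolding admissible_iff by blast
  then have "\<exists>V\<in>E. psi_reg W (adm a c) = psi_class W (adm a c) V" using E unfolding gap_determining_def by blast
  then obtain V where V: "V \<in> E" "psi_reg W (adm a c) = psi_class W (adm a c) V" ..
  have VI: "V \<in> Irr W" "V \<noteq> iso_class W trivial_rep" using E V(1) unfolding gap_determining_def by auto
  obtain R :: "('a wreath_elt, nat) urep" where R: "irreducible_rep W R" "V = iso_class W R"
    using VI(1) by (rule Irr_cases)
  have fx: "fixed_space W R = {0}" using VI(2) unfolding R(2) nontrivial_class_iff[OF R(1)] .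
  interpret laplacian_rep W R "adm a c" by (rule laplacian_rep_adm[OF unitary_of_irreducible[OF R(1)] w])
  have "vecs R \<noteq> fixed_space W R" using R(1) unfolding fx irreducible_rep_def by blast
  then obtain r f where r: "psi W (adm a c) R = ereal r" "f \<in> fixed_perp W R" "f \<noteq> 0" "L f = (\<lambda>x. of_real r * f x)"
    by (rule psi_attained)
  have f: "f \<in> vecs R" using r(2) by (simp add: fixed_perp_def)
  have "r < s" using less unfolding V(2) R(2) psi_class_iso_class[OF R(1) fx] r(1) by simp
  moreover have "Re (inner_on (pts R) (L f) f) = r * norm2_on (pts R) f"
    unfolding r(4) by (simp add: inner_on_simps inner_on_self)
  ultimately have "Re (inner_on (pts R) (L f) f) < s * norm2_on (pts R) f"
    using norm2_pos[OF f r(3)] by simp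
  then show ?thesis using that[OF R(1) fx _ f r(3)] V(1) unfolding R(2) by blast
qed

lemma kap_eq:
  assumes k: "\<kappa> \<in> nontrivial_mult_vectors A n" and c: "\<And>c. c \<in> Ahat \<Longrightarrow> cnt \<theta> c = \<kappa> c"
  shows "kap \<theta> = \<kappa>"
proof (rule extensionalityI[of _ Ahat])
  show "kap \<theta> \<in> extensional Ahat" by (simp add: kap_def)
  show "\<kappa> \<in> extensional Ahat" using k unfolding nontrivial_mult_vectors_def mult_vectors_def PiE_def by blast
  show "kap \<theta> c = \<kappa> c" if "c \<in> Ahat" for c using c[OF that] that by (simp add: kap_def)
qed

text \<open>Conjugation fixes the trivial character, so its multiplicity does not change.\<close>

lemma dual_nontrivial:
  assumes k: "\<kappa> \<in> nontrivial_mult_vectors A n"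
  shows "dual_vector A \<kappa> \<in> nontrivial_mult_vectors A n"
proof -
  obtain \<theta> where \<theta>: "\<theta> \<in> chars" "\<And>c. c \<in> Ahat \<Longrightarrow> cnt \<theta> c = \<kappa> c" "V_class A n \<kappa> = iso_class W (ind \<theta>)"
      "fixed_space W (ind \<theta>) = {0}" using V_class_nontrivial[OF k] by blast
  have kt: "kap \<theta> = \<kappa>" by (rule kap_eq[OF k]) (rule \<theta>(2))
  have d: "dual_vector A \<kappa> = kap (\<lambda>i. cchar (\<theta> i))"
    using dual_kap[OF \<theta>(1)] unfolding kt .
  have "cchar (\<lambda>x\<in>carrier A. 1) = (\<lambda>x\<in>carrier A. 1)" by (auto simp: cchar_def)
  then have "kap (\<lambda>i. cchar (\<theta> i)) (\<lambda>x\<in>carrier A. 1) = \<kappa> (\<lambda>x\<in>carrier A. 1)"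
    using cnt_cchar[OF \<theta>(1) one_in_Ahat] \<theta>(2)[OF one_in_Ahat] one_in_Ahat by (simp add: kap_def)
  then show ?thesis
    using k kap_in[OF cchar_chars[OF \<theta>(1)]] unfolding d nontrivial_mult_vectors_def one_Ahat by simp
qed

lemma ind_iso_class_cnt:
  assumes R: "irreducible_rep W R" and \<theta>: "\<theta> \<in> chars" "has_weight R \<theta>"
    and u: "u \<in> vecs R" "u \<noteq> 0" "\<And>\<pi>. \<pi> \<in> SG n \<Longrightarrow> act R (prm \<pi>) u = u"
    and k: "kap \<theta> \<in> nontrivial_mult_vectors A n"
  shows "iso_class W R = V_class A n (kap \<theta>)"
proof -
  obtain \<theta>1 where t1: "\<theta>1 \<in> chars" "\<And>c. c \<in> Ahat \<Longrightarrow> cnt \<theta>1 c = kap \<theta> c" "V_class A n (kap \<theta>) = iso_class W (ind \<theta>1)"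
      "fixed_space W (ind \<theta>1) = {0}" using V_class_nontrivial[OF k] by blast
  have "cnt \<theta> c = cnt \<theta>1 c" if "c \<in> Ahat" for c using t1(2)[OF that] that by (simp add: kap_def)
  then obtain \<sigma> where s: "\<sigma> \<in> SG n" "\<forall>i\<in>{1..n}. \<theta>1 i = \<theta> (\<sigma> i)" using cnt_eq_perm[OF \<theta>(1) t1(1)] by blast
  have "has_weight R (\<theta> \<circ> \<sigma>)" by (rule has_weight_comp[OF unitary_of_irreducible[OF R] \<theta>(1) s(1) \<theta>(2)])
  moreover have "wt (\<theta> \<circ> \<sigma>) b = wt \<theta>1 b" for b using s(2) by (intro wt_cong) auto
  ultimately have "has_weight R \<theta>1" by (simp add: has_weight_def)
  then have "rep_iso W R (ind \<theta>1)" by (rule spherical_iso[OF t1(1) R _ u])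
  then show ?thesis unfolding t1(3) by (rule iso_class_eq[OF R ind_irreducible[OF t1(1)]])
qed

text \<open>Otherwise \<open>R\<close> would be \<open>ind trivs\<close>, where the constant
  function is fixed.\<close>

lemma no_trivial_weight:
  assumes R: "irreducible_rep W R" "fixed_space W R = {0}"
    and u: "u \<in> vecs R" "u \<noteq> 0" "\<And>\<pi>. \<pi> \<in> SG n \<Longrightarrow> act R (prm \<pi>) u = u"
  shows "\<not> has_weight R trivs"
proof
  assume "has_weight R trivs"
  then have iso: "rep_iso W R (ind trivs)" by (rule spherical_iso[OF trivs_chars R(1) _ u])
  have un: "unitary_rep W (ind trivs)" by (rule ind_unitary[OF trivs_chars])
  have fx: "fixed_space W (ind trivs) = {0}"
    by (rule fixed_space_iso[OF iso unitary_of_irreducible[OF R(1)] un R(2)])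
  define P where "P = (\<lambda>(g, u :: unit). if g \<in> carrier W then 1 else 0 :: complex)"
  have ch: "ch trivs h = 1" if "h \<in> stab trivs" for h
  proof -
    have "fst h \<in> base A n" using stab_carrier[OF that] unfolding carrier_W by (rule mem_Times_iff[THEN iffD1, THEN conjunct1])
    then show ?thesis by (simp add: ch_def wt_trivs)
  qed
  have "P \<in> vecs (ind trivs)"
    unfolding ind_vecs[OF trivs_chars] using ch stab_carrier by (auto simp: P_def functions_on_def)
  moreover have "act (ind trivs) g P = P" if "g \<in> carrier W" for g
    using that by (auto simp: fun_eq_iff ind_act P_def)
  ultimately have "P \<in> fixed_space W (ind trivs)" by (simp add: fixed_space_def)
  then have "P = 0" unfolding fx by simp
  then have "P (\<one>\<^bsub>W\<^esub>, ()) = 0" by simp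
  then show False by (simp add: P_def)
qed

lemma prm_SG_subgroup: "subgroup (prm ` SG n) W"
proof (rule W.subgroupI)
  show "prm ` SG n \<subseteq> carrier W" using prm_in by blast
  show "prm ` SG n \<noteq> {}" using SG_id by blast
  show "inv\<^bsub>W\<^esub> a \<in> prm ` SG n" if "a \<in> prm ` SG n" for a using that SG_inv by (auto simp: inv_prm)
  show "a \<otimes>\<^bsub>W\<^esub> b \<in> prm ` SG n" if "a \<in> prm ` SG n" "b \<in> prm ` SG n" for a b using that SG_comp by (auto simp: prm_prm)
qed

lemma pairs_image_le:
  fixes D :: "'a wreath_elt \<Rightarrow> real"
  assumes "J \<subseteq> pairs" "\<And>x. 0 \<le> D x"
  shows "(\<Sum>x\<in>(\<lambda>(i, j). prm (tr i j)) ` J. D x) \<le> (\<Sum>(i, j)\<in>J. D (prm (tr i j)))"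
  using sum_image_le[of J D "\<lambda>(i, j). prm (tr i j)"] finite_subset[OF assms(1) finite_pairs] assms(2)
  by (simp add: case_prod_unfold)

theorem V_class_necessary:
  assumes E: "gap_determining A n E" and k: "\<kappa> \<in> nontrivial_mult_vectors A n"
  shows "V_class A n \<kappa> \<in> E \<or> V_class A n (dual_vector A \<kappa>) \<in> E"
proof -
  obtain \<theta> where \<theta>: "\<theta> \<in> chars" "\<And>c. c \<in> Ahat \<Longrightarrow> cnt \<theta> c = \<kappa> c" "V_class A n \<kappa> = iso_class W (ind \<theta>)"
      "fixed_space W (ind \<theta>) = {0}" using V_class_nontrivial[OF k] by blast
  obtain i where i: "i \<in> {1..n}" "\<theta> i \<noteq> (\<lambda>x\<in>carrier A. 1)" using nontrivial_char[OF k \<theta>(2)] by blast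
  let ?\<theta> = "\<lambda>i. cchar (\<theta> i)"
  have kap: "kap \<theta> = \<kappa>" by (rule kap_eq[OF k]) (rule \<theta>(2))
  have kap': "kap ?\<theta> = dual_vector A \<kappa>" using dual_kap[OF \<theta>(1)] unfolding kap by (rule sym)
  let ?X = "(\<lambda>(i, j). prm (tr i j)) ` pairs"
  have X: "?X \<subseteq> carrier W" using pairs_prm by auto
  have K: "prm ` SG n \<subseteq> generate W ?X"
  proof
    fix x assume "x \<in> prm ` SG n"
    then obtain \<pi> where p: "\<pi> \<in> SG n" "x = prm \<pi>" by blast
    have "prm (tr i j) \<in> ?X" if "1 \<le> i" "i < j" "j \<le> n" for i j
    proof -
      have "(i, j) \<in> pairs" using that by (simp add: pairs_def)
      then show ?thesis by (force simp: image_iff)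
    qed
    then show "x \<in> generate W ?X" unfolding p(2) by (rule prm_generate[OF le_refl SG_D[OF p(1)]])
  qed
  obtain \<delta> where \<delta>: "0 < \<delta>" "\<forall>(R :: ('a wreath_elt, nat) urep) f. unitary_rep W R \<longrightarrow> f \<in> vecs R \<longrightarrow>
    (\<exists>u\<in>vecs R. u \<noteq> 0 \<and> (\<forall>k\<in>prm ` SG n. act R k u = u)) \<or>
    \<delta> * norm2_on (pts R) f \<le> (\<Sum>x\<in>?X. norm2_on (pts R) (\<lambda>y. f y - act R x f y))"
    using averaging_gap[OF X prm_SG_subgroup K] by blast
  define N where "N = real (card (base A n))"
  \<comment> \<open>Without an invariant vector the transpositions alone give at least
    \<open>M * \<delta> / 2 = N\<close> times the squared norm; the half is that of
    \<open>adm_form\<close>.\<close>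
  define M where "M = 2 * N / \<delta>"
  have M: "0 \<le> M" using \<delta>(1) by (simp add: M_def N_def)
  define a :: "nat \<Rightarrow> nat \<Rightarrow> real" where "a = (\<lambda>_ _. M)"
  define c where "c = (\<lambda>x. 1 + Re (wt \<theta> x))"
  have w: "weights a c" unfolding a_def c_def by (rule cosine_weights[OF \<theta>(1) M])
  have "psi_reg W (adm a c) \<le> psi W (adm a c) (ind \<theta>)" by (rule psi_reg_le_adm[OF ind_irreducible[OF \<theta>(1)] \<theta>(4) w])
  also have "\<dots> < ereal N" unfolding a_def c_def N_def by (rule cosine_psi_less[OF \<theta>(1) i M])
  finally have less: "psi_reg W (adm a c) < ereal N" .
  obtain R :: "('a wreath_elt, nat) urep" and f where R: "irreducible_rep W R" "fixed_space W R = {0}" "iso_class W R \<in> E"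
    and f: "f \<in> vecs R" "f \<noteq> 0" "Re (inner_on (pts R) (laplacian W (adm a c) R f) f) < N * norm2_on (pts R) f"
    by (rule gap_witness[OF E w less])
  have un: "unitary_rep W R" by (rule unitary_of_irreducible[OF R(1)])
  define D where "D h = norm2_on (pts R) (\<lambda>y. f y - act R h f y)" for h
  have D0: "0 \<le> D h" for h by (simp add: D_def norm2_on_nonneg)
  have "\<not> \<delta> * norm2_on (pts R) f \<le> (\<Sum>x\<in>?X. D x)"
  proof
    assume "\<delta> * norm2_on (pts R) f \<le> (\<Sum>x\<in>?X. D x)"
    also have "\<dots> \<le> (\<Sum>(i, j)\<in>pairs. D (prm (tr i j)))" by (rule pairs_image_le[OF subset_refl D0])
    finally have "M * (\<delta> * norm2_on (pts R) f) \<le> M * (\<Sum>(i, j)\<in>pairs. D (prm (tr i j)))" using M by (rule mult_left_mono)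
    also have "M * (\<delta> * norm2_on (pts R) f) = 2 * (N * norm2_on (pts R) f)" using \<delta>(1) by (simp add: M_def)
    also have "M * (\<Sum>(i, j)\<in>pairs. D (prm (tr i j))) = (\<Sum>(i, j)\<in>pairs. a i j * D (prm (tr i j)))"
      unfolding a_def sum_distrib_left by (simp add: case_prod_unfold)
    finally have "2 * (N * norm2_on (pts R) f) \<le> (\<Sum>(i, j)\<in>pairs. a i j * D (prm (tr i j)))" .
    moreover have "0 \<le> (\<Sum>x\<in>base A n. c x * D (bas x))"
      using w D0 unfolding weights_def by (intro sum_nonneg mult_nonneg_nonneg) auto
    ultimately have "N * norm2_on (pts R) f \<le> ((\<Sum>(i, j)\<in>pairs. a i j * D (prm (tr i j))) + (\<Sum>x\<in>base A n. c x * D (bas x))) / 2" by simp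
    then show False using f(3) unfolding adm_form[OF un w f(1)] D_def by simp
  qed
  then have "\<exists>u\<in>vecs R. u \<noteq> 0 \<and> (\<forall>k\<in>prm ` SG n. act R k u = u)" using \<delta>(2)[rule_format, OF un f(1)] unfolding D_def by blast
  then obtain u where u: "u \<in> vecs R" "u \<noteq> 0" "\<And>\<pi>. \<pi> \<in> SG n \<Longrightarrow> act R (prm \<pi>) u = u" by blast
  \<comment> \<open>With neither weight, and without the trivial one because \<open>u\<close> is
    invariant, the energy of \<open>f\<close> would be at least \<open>N\<close> times its squared
    norm.\<close>
  have "has_weight R \<theta> \<or> has_weight R ?\<theta>"
  proof (rule ccontr)
    assume no: "\<not> (has_weight R \<theta> \<or> has_weight R ?\<theta>)"
    have "N * norm2_on (pts R) f \<le> Re (inner_on (pts R) (laplacian W (adm a c) R f) f)"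
      unfolding N_def a_def c_def
      by (rule cosine_form_ge[OF un \<theta>(1) M f(1) _ _ no_trivial_weight[OF R(1,2) u]]) (use no in simp_all)
    then show False using f(3) by simp
  qed
  then show ?thesis
  proof
    assume h: "has_weight R \<theta>"
    have "iso_class W R = V_class A n \<kappa>"
      using ind_iso_class_cnt[OF R(1) \<theta>(1) h u] k unfolding kap by blast
    then show ?thesis using R(3) by simp
  next
    assume h: "has_weight R ?\<theta>"
    have "iso_class W R = V_class A n (dual_vector A \<kappa>)"
      using ind_iso_class_cnt[OF R(1) cchar_chars[OF \<theta>(1)] h u] dual_nontrivial[OF k] unfolding kap' by blast
    then show ?thesis using R(3) by simp
  qed
qed

text \<open>Only the edges at \<open>n\<close>, of weight \<open>1\<close>, cost energy on the test
  vector, so the bound does not grow with the other weights. It is crude: energy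
  \<open>(n - 1) * n^2\<close> against a squared norm of at least \<open>1\<close>.\<close>

lemma std_psi_le:
  assumes n: "2 \<le> n" and w: "weights a c" and a: "\<And>i. 1 \<le> i \<Longrightarrow> i < n \<Longrightarrow> a i n = 1"
  obtains r where "psi W (adm a c) Rstd \<le> ereal r" "r \<le> real n ^ 3"
proof -
  interpret S: laplacian_rep W Rstd "adm a c" by (rule laplacian_rep_adm[OF std_unitary w])
  \<comment> \<open>On the sites, \<open>n\<close> times the unit vector at \<open>n\<close> minus
    the constant \<open>1\<close>; only transpositions involving \<open>n\<close> move it.\<close>
  define v :: "nat \<Rightarrow> complex" where "v i = (if i = n then of_nat n - 1 else if i \<in> {1..n} then - 1 else 0)" for i
  have vV: "v \<in> vecs Rstd"
  proof -
    have "(\<Sum>i\<in>{1..n}. v i) = v n + (\<Sum>i\<in>{1..n} - {n}. v i)" using n by (intro sum.remove) auto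
    also have "(\<Sum>i\<in>{1..n} - {n}. v i) = (\<Sum>i\<in>{1..n} - {n}. - 1)" by (intro sum.cong) (auto simp: v_def)
    also have "v n + \<dots> = 0" using n by (simp add: v_def card_Diff_singleton of_nat_diff)
    finally have "(\<Sum>i\<in>{1..n}. v i) = 0" .
    moreover have "v \<in> functions_on {1..n}" using n by (auto simp: functions_on_def v_def)
    ultimately show ?thesis by (simp add: std_vecs)
  qed
  have d: "norm2_on (pts Rstd) (\<lambda>y. v y - act Rstd (prm (tr i j)) v y) = (if j = n then 2 * (real n)\<^sup>2 else 0)"
    if ij: "(i, j) \<in> pairs" for i j
  proof -
    have i: "i \<in> {1..n}" "j \<in> {1..n}" "i < j" using ij by (auto simp: pairs_def)
    have "norm2_on (pts Rstd) (\<lambda>y. v y - act Rstd (prm (tr i j)) v y) = (\<Sum>y\<in>{1..n}. (cmod (v y - v (tr i j y)))\<^sup>2)"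
      by (simp add: norm2_on_def std_pts prm_def std_act inv_tr)
    also have "\<dots> = 2 * (cmod (v i - v j))\<^sup>2" by (rule sum_transpose_difference[OF i(1,2)])
    also have "\<dots> = (if j = n then 2 * (real n)\<^sup>2 else 0)" using i by (simp add: v_def)
    finally show ?thesis .
  qed
  have "(\<Sum>x\<in>base A n. c x * norm2_on (pts Rstd) (\<lambda>y. v y - act Rstd (bas x) v y)) = 0"
    by (simp add: std_bas norm2_on_def)
  then have "Re (inner_on (pts Rstd) (S.L v) v) = (\<Sum>(i, j)\<in>pairs. a i j * norm2_on (pts Rstd) (\<lambda>y. v y - act Rstd (prm (tr i j)) v y)) / 2"
    unfolding adm_form[OF std_unitary w vV] by simp
  also have "(\<Sum>(i, j)\<in>pairs. a i j * norm2_on (pts Rstd) (\<lambda>y. v y - act Rstd (prm (tr i j)) v y))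
      = (\<Sum>(i, j)\<in>pairs. if j = n then 2 * (real n)\<^sup>2 else 0)"
    by (intro sum.cong refl) (auto simp: d a pairs_def)
  also have "\<dots> = (\<Sum>p\<in>(\<lambda>i. (i, n)) ` {1..<n}. 2 * (real n)\<^sup>2)"
    unfolding case_prod_unfold by (rule sum.mono_neutral_cong_right[OF finite_pairs]) (auto simp: pairs_def)
  also have "\<dots> = real (n - 1) * (2 * (real n)\<^sup>2)" by (simp add: card_image inj_on_def)
  finally have form: "Re (inner_on (pts Rstd) (S.L v) v) = real (n - 1) * (real n)\<^sup>2" by simp
  have "(cmod (v n))\<^sup>2 \<le> (\<Sum>i\<in>{1..n}. (cmod (v i))\<^sup>2)" using n by (intro member_le_sum) auto
  moreover have "cmod (v n) = real (n - 1)"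
  proof -
    have "v n = of_nat (n - 1)" using n by (simp add: v_def of_nat_diff)
    then show ?thesis by (simp only: norm_of_nat)
  qed
  moreover have "1 \<le> (real (n - 1))\<^sup>2" using n by (intro one_le_power) simp
  ultimately have nv: "1 \<le> norm2_on (pts Rstd) v" unfolding norm2_on_def std_pts by simp
  have "real (n - 1) * (real n)\<^sup>2 \<le> real n * (real n)\<^sup>2" by (rule mult_right_mono) simp_all
  also have "\<dots> = real n ^ 3" by (simp add: power2_eq_square power3_eq_cube)
  finally have le: "Re (inner_on (pts Rstd) (S.L v) v) \<le> real n ^ 3 * 1" unfolding form by simp
  also have "\<dots> \<le> real n ^ 3 * norm2_on (pts Rstd) v" using nv by (rule mult_left_mono) simp
  finally have ray: "Re (inner_on (pts Rstd) (S.L v) v) \<le> real n ^ 3 * norm2_on (pts Rstd) v" .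
  have "v n \<noteq> 0"
  proof
    assume "v n = 0"
    then have "real (n - 1) = 0" using \<open>cmod (v n) = real (n - 1)\<close> by simp
    then show False using n by simp
  qed
  then have "v \<noteq> 0" by (rule nonzero_funI)
  moreover have "v \<in> fixed_perp W Rstd" using vV by (simp only: fixed_perp_all[OF std_fixed[OF n]])
  ultimately have "psi W (adm a c) Rstd \<le> ereal (real n ^ 3)" using ray by (intro S.psi_le_rayleigh)
  then show ?thesis using that[OF _ order_refl] by blast
qed

theorem Std_necessary:
  assumes n: "2 \<le> n" and E: "gap_determining A n E"
  shows "Std A n \<in> E"
proof -
  \<comment> \<open>Edges avoiding \<open>n\<close>; together with \<open>A^n\<close> they generate
    \<open>K\<close>, the elements whose permutation fixes \<open>n\<close>.\<close>
  define J where "J = {(i, j) \<in> pairs. j < n}"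
  let ?X1 = "(\<lambda>(i, j). prm (tr i j)) ` J"
  let ?X2 = "bas ` base A n"
  let ?X = "?X1 \<union> ?X2"
  define K where "K = {(g, \<pi>) \<in> carrier W. \<pi> n = n}"
  have JP: "J \<subseteq> pairs" by (auto simp: J_def)
  have finJ: "finite J" by (rule finite_subset[OF JP finite_pairs])
  have X: "?X \<subseteq> carrier W" using pairs_prm bas_in JP by auto
  have KI: "(g, \<pi>) \<in> K \<longleftrightarrow> g \<in> base A n \<and> \<pi> \<in> SG n \<and> \<pi> n = n" for g \<pi> by (auto simp: K_def carrier_W)
  have K: "subgroup K W"
  proof (rule W.subgroupI)
    show "K \<subseteq> carrier W" by (auto simp: K_def)
    have "(bone, id) \<in> K" by (simp add: KI bone_in SG_id)
    then show "K \<noteq> {}" by blast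
    show "inv\<^bsub>W\<^esub> x \<in> K" if "x \<in> K" for x
    proof -
      obtain g \<pi> where x: "x = (g, \<pi>)" by (cases x)
      have g: "g \<in> base A n" "\<pi> \<in> SG n" "\<pi> n = n" using that by (simp_all add: x KI)
      have "inv' \<pi> n = n" using SG_inv_apply(1)[OF g(2), of n] g(3) by simp
      then show ?thesis unfolding x inv_W[OF g(1,2)] KI using g by (simp add: binv_in permb_in SG_inv)
    qed
    show "x \<otimes>\<^bsub>W\<^esub> y \<in> K" if "x \<in> K" "y \<in> K" for x y
    proof -
      obtain g \<pi> where x: "x = (g, \<pi>)" by (cases x)
      obtain h \<sigma> where y: "y = (h, \<sigma>)" by (cases y)
      show ?thesis using that unfolding x y mult_W KI by (simp add: bmult_in permb_in SG_comp)
    qed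
  qed
  have gen: "K \<subseteq> generate W ?X"
  proof
    fix x assume xK: "x \<in> K"
    obtain g \<pi> where x: "x = (g, \<pi>)" by (cases x)
    have g: "g \<in> base A n" "\<pi> \<in> SG n" "\<pi> n = n" using xK by (simp_all add: x KI)
    have "\<pi> permutes {1..n - 1}"
    proof (rule permutes_superset[OF SG_D[OF g(2)]])
      fix i assume "i \<in> {1..n} - {1..n - 1}"
      then have "i = n" by auto
      then show "\<pi> i = i" using g(3) by simp
    qed
    moreover have "prm (tr i j) \<in> ?X" if "1 \<le> i" "i < j" "j \<le> n - 1" for i j
    proof -
      have "j < n" using that n by linarith
      then have "(i, j) \<in> J" using that by (simp add: J_def pairs_def)
      then show ?thesis by (force simp: image_iff)
    qed
    ultimately have "prm \<pi> \<in> generate W ?X" by (intro prm_generate[of "n - 1"]) simp_all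
    moreover have "bas g \<in> generate W ?X" using g(1) by (intro generate.incl) simp
    ultimately have "bas g \<otimes>\<^bsub>W\<^esub> prm \<pi> \<in> generate W ?X" by (intro generate.eng)
    then show "x \<in> generate W ?X" by (simp only: bas_prm[OF g(1,2)] x)
  qed
  obtain \<delta> where \<delta>: "0 < \<delta>" "\<forall>(R :: ('a wreath_elt, nat) urep) f. unitary_rep W R \<longrightarrow> f \<in> vecs R \<longrightarrow>
    (\<exists>u\<in>vecs R. u \<noteq> 0 \<and> (\<forall>k\<in>K. act R k u = u)) \<or>
    \<delta> * norm2_on (pts R) f \<le> (\<Sum>x\<in>?X. norm2_on (pts R) (\<lambda>y. f y - act R x f y))"
    using averaging_gap[OF X K gen] by blast
  \<comment> \<open>One above the bound of \<open>std_psi_le\<close>, so the gap is strictly below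
    \<open>s\<close>. \<open>M\<close> then gives a representation without
    \<open>K\<close>-invariant vectors energy at least \<open>s\<close>.\<close>
  define s where "s = real n ^ 3 + 1"
  define M where "M = 2 * s / \<delta>"
  have s0: "0 \<le> s" by (simp add: s_def)
  have M: "0 \<le> M" using \<delta>(1) s0 by (simp add: M_def)
  define a where "a i j = (if j < n then M else 1)" for i j :: nat
  define c where "c = (\<lambda>x :: nat \<Rightarrow> 'a. M)"
  have w: "weights a c" using M by (simp add: weights_def a_def c_def)
  have "psi_reg W (adm a c) \<le> psi W (adm a c) Rstd" by (rule psi_reg_le_adm[OF std_irreducible[OF n] std_fixed[OF n] w])
  also obtain r where "psi W (adm a c) Rstd \<le> ereal r" "r \<le> real n ^ 3"
    by (rule std_psi_le[OF n w]) (simp add: a_def)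
  then have "psi W (adm a c) Rstd < ereal s" by (simp add: s_def order.strict_trans1)
  finally have less: "psi_reg W (adm a c) < ereal s" .
  obtain R :: "('a wreath_elt, nat) urep" and f where R: "irreducible_rep W R" "fixed_space W R = {0}" "iso_class W R \<in> E"
    and f: "f \<in> vecs R" "f \<noteq> 0" "Re (inner_on (pts R) (laplacian W (adm a c) R f) f) < s * norm2_on (pts R) f"
    by (rule gap_witness[OF E w less])
  have un: "unitary_rep W R" by (rule unitary_of_irreducible[OF R(1)])
  define D where "D h = norm2_on (pts R) (\<lambda>y. f y - act R h f y)" for h
  have D0: "0 \<le> D h" for h by (simp add: D_def norm2_on_nonneg)
  have "\<not> \<delta> * norm2_on (pts R) f \<le> (\<Sum>x\<in>?X. D x)"
  proof
    assume "\<delta> * norm2_on (pts R) f \<le> (\<Sum>x\<in>?X. D x)"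
    also have "\<dots> \<le> (\<Sum>x\<in>?X1. D x) + (\<Sum>x\<in>?X2. D x)"
      using sum.union_inter[of ?X1 ?X2 D] sum_nonneg[of "?X1 \<inter> ?X2" D] finJ finite_base D0 by simp
    also have "\<dots> \<le> (\<Sum>(i, j)\<in>J. D (prm (tr i j))) + (\<Sum>x\<in>base A n. D (bas x))"
      using sum_image_le[of "base A n" D bas] finite_base D0 by (intro add_mono pairs_image_le[OF JP]) simp_all
    finally have "M * (\<delta> * norm2_on (pts R) f) \<le> M * ((\<Sum>(i, j)\<in>J. D (prm (tr i j))) + (\<Sum>x\<in>base A n. D (bas x)))"
      using M by (rule mult_left_mono)
    also have "M * (\<delta> * norm2_on (pts R) f) = 2 * (s * norm2_on (pts R) f)" using \<delta>(1) by (simp add: M_def)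
    also have "M * ((\<Sum>(i, j)\<in>J. D (prm (tr i j))) + (\<Sum>x\<in>base A n. D (bas x)))
        = (\<Sum>(i, j)\<in>J. a i j * D (prm (tr i j))) + (\<Sum>x\<in>base A n. c x * D (bas x))"
      unfolding c_def distrib_left sum_distrib_left by (intro arg_cong2[where f = "(+)"] sum.cong refl) (auto simp: a_def J_def)
    also have "\<dots> \<le> (\<Sum>(i, j)\<in>pairs. a i j * D (prm (tr i j))) + (\<Sum>x\<in>base A n. c x * D (bas x))"
      by (intro add_right_mono sum_mono2[OF finite_pairs JP]) (use M D0[of "prm (tr _ _)"] in \<open>auto simp: a_def\<close>)
    finally have "s * norm2_on (pts R) f \<le> ((\<Sum>(i, j)\<in>pairs. a i j * D (prm (tr i j))) + (\<Sum>x\<in>base A n. c x * D (bas x))) / 2" by simp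
    then show False using f(3) unfolding adm_form[OF un w f(1)] D_def by simp
  qed
  then have "\<exists>u\<in>vecs R. u \<noteq> 0 \<and> (\<forall>k\<in>K. act R k u = u)" using \<delta>(2)[rule_format, OF un f(1)] unfolding D_def by blast
  then obtain u where u: "u \<in> vecs R" "u \<noteq> 0" "\<forall>k\<in>K. act R k u = u" by blast
  have "rep_iso W R Rstd"
  proof (rule std_iso[OF n R(1,2) u(1,2)])
    show "act R (bas x) u = u" if "x \<in> base A n" for x
      by (rule bspec[OF u(3)]) (simp add: bas_def KI SG_id that)
    show "act R (prm \<pi>) u = u" if "\<pi> \<in> SG n" "\<pi> n = n" for \<pi>
      by (rule bspec[OF u(3)]) (simp add: prm_def KI bone_in that)
  qed
  then have "iso_class W R = Std A n" unfolding Std_def by (rule iso_class_eq[OF R(1) std_irreducible[OF n]])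
  then show ?thesis using R(3) by simp
qed

section \<open>Distinctness of the classes and minimality\<close>

lemma V_class_inj:
  assumes k: "\<kappa> \<in> nontrivial_mult_vectors A n" "\<kappa>' \<in> nontrivial_mult_vectors A n" and eq: "V_class A n \<kappa> = V_class A n \<kappa>'"
  shows "\<kappa> = \<kappa>'"
proof -
  obtain \<theta> where \<theta>: "\<theta> \<in> chars" "\<And>c. c \<in> Ahat \<Longrightarrow> cnt \<theta> c = \<kappa> c" "V_class A n \<kappa> = iso_class W (ind \<theta>)"
      "fixed_space W (ind \<theta>) = {0}" using V_class_nontrivial[OF k(1)] by blast
  obtain \<theta>' where \<theta>': "\<theta>' \<in> chars" "\<And>c. c \<in> Ahat \<Longrightarrow> cnt \<theta>' c = \<kappa>' c" "V_class A n \<kappa>' = iso_class W (ind \<theta>')"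
      "fixed_space W (ind \<theta>') = {0}" using V_class_nontrivial[OF k(2)] by blast
  have "rep_iso W (ind \<theta>) (ind \<theta>')"
    by (rule iso_class_eqD[OF ind_irreducible[OF \<theta>(1)] ind_irreducible[OF \<theta>'(1)] eq[unfolded \<theta>(3) \<theta>'(3)]])
  \<comment> \<open>A weight of \<open>ind \<theta>'\<close> is a permutation of
    \<open>\<theta>'\<close>, and counts do not see permutations.\<close>
  then have "has_weight (ind \<theta>') \<theta>" by (rule has_weight_iso[OF _ ind_unitary[OF \<theta>(1)] ind_has_weight[OF \<theta>(1)]])
  then obtain \<sigma> where s: "\<sigma> \<in> SG n" "\<forall>i\<in>{1..n}. \<theta> i = \<theta>' (\<sigma> i)" using ind_weight[OF \<theta>'(1) \<theta>(1)] by blast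
  have "cnt \<theta> c = cnt \<theta>' c" for c by (rule cnt_perm[OF s(1)]) (use s(2) in blast)
  then have "kap \<theta> = kap \<theta>'" by (simp only: kap_def)
  moreover have "kap \<theta> = \<kappa>" by (rule kap_eq[OF k(1)]) (rule \<theta>(2))
  moreover have "kap \<theta>' = \<kappa>'" by (rule kap_eq[OF k(2)]) (rule \<theta>'(2))
  ultimately show ?thesis by (simp only:)
qed

text \<open>\<open>A^n\<close> acts trivially on \<open>Std\<close>, but not on a vector of
  non-trivial weight.\<close>

lemma V_class_neq_Std:
  assumes n: "2 \<le> n" and k: "\<kappa> \<in> nontrivial_mult_vectors A n"
  shows "V_class A n \<kappa> \<noteq> Std A n"
proof
  assume eq: "V_class A n \<kappa> = Std A n"
  obtain \<theta> where \<theta>: "\<theta> \<in> chars" "\<And>c. c \<in> Ahat \<Longrightarrow> cnt \<theta> c = \<kappa> c" "V_class A n \<kappa> = iso_class W (ind \<theta>)"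
      "fixed_space W (ind \<theta>) = {0}" using V_class_nontrivial[OF k] by blast
  have "rep_iso W (ind \<theta>) Rstd"
    by (rule iso_class_eqD[OF ind_irreducible[OF \<theta>(1)] std_irreducible[OF n] eq[unfolded \<theta>(3) Std_def]])
  then have "has_weight Rstd \<theta>" by (rule has_weight_iso[OF _ ind_unitary[OF \<theta>(1)] ind_has_weight[OF \<theta>(1)]])
  then obtain f where f: "f \<noteq> 0" "\<forall>x\<in>base A n. act Rstd (bas x) f = (\<lambda>p. wt \<theta> x * f p)" unfolding has_weight_def by blast
  obtain p where p: "f p \<noteq> 0" using f(1) by (auto simp: fun_eq_iff)
  have wt1: "wt \<theta> x = wt trivs x" if x: "x \<in> base A n" for x
  proof -
    have "act Rstd (bas x) f = (\<lambda>p. wt \<theta> x * f p)" using f(2) x by (rule bspec)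
    then have "f p = wt \<theta> x * f p" unfolding std_bas by (rule fun_cong)
    then show ?thesis using p by (simp add: wt_trivs[OF x])
  qed
  obtain i where i: "i \<in> {1..n}" "\<theta> i \<noteq> (\<lambda>x\<in>carrier A. 1)" using nontrivial_char[OF k \<theta>(2)] by blast
  have "\<theta> i = trivs i" by (rule wt_eqD[OF \<theta>(1) trivs_chars wt1 i(1)])
  then show False using i(2) by (simp only: trivs_def)
qed

text \<open>A missing member must be some \<open>V_class A n \<kappa>\<close> with
  \<open>\<kappa>\<close> in \<open>T\<close>. Necessity then puts the class of the dual vector into
  \<open>E\<close>, so by injectivity the dual lies in \<open>T\<close> as well. Uniqueness in the
  transversal makes \<open>\<kappa>\<close> self-dual, and the class was not missing.\<close>

theorem M_family_minimal:
  assumes n: "2 \<le> n" and T: "duality_transversal A n T" and E: "E \<subset> M_family A n T" "gap_determining A n E"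
  shows False
proof -
  have TN: "\<kappa> \<in> nontrivial_mult_vectors A n" if "\<kappa> \<in> T" for \<kappa> using T that unfolding duality_transversal_def by blast
  obtain V where V: "V \<in> M_family A n T" "V \<notin> E" using E(1) by blast
  have "V \<noteq> Std A n" using Std_necessary[OF n E(2)] V(2) by blast
  then have "V \<in> V_class A n ` T" using V(1) by (simp add: M_family_def)
  then obtain \<kappa> where k: "\<kappa> \<in> T" "V = V_class A n \<kappa>" by blast
  let ?\<kappa> = "dual_vector A \<kappa>"
  have dn: "?\<kappa> \<in> nontrivial_mult_vectors A n" by (rule dual_nontrivial[OF TN[OF k(1)]])
  have "V_class A n ?\<kappa> \<in> E" using V_class_necessary[OF E(2) TN[OF k(1)]] V(2) k(2) by blast
  then have "V_class A n ?\<kappa> \<in> insert (Std A n) (V_class A n ` T)" using E(1) unfolding M_family_def by blast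
  then have "V_class A n ?\<kappa> \<in> V_class A n ` T" using V_class_neq_Std[OF n dn] by blast
  then obtain \<kappa>' where k': "\<kappa>' \<in> T" "V_class A n ?\<kappa> = V_class A n \<kappa>'" by blast
  have "?\<kappa> = \<kappa>'" by (rule V_class_inj[OF dn TN[OF k'(1)] k'(2)])
  then have "?\<kappa> \<in> T \<inter> {\<kappa>, ?\<kappa>}" "\<kappa> \<in> T \<inter> {\<kappa>, ?\<kappa>}" using k(1) k'(1) by auto
  moreover have "\<exists>!\<kappa>'. \<kappa>' \<in> T \<inter> {\<kappa>, ?\<kappa>}" using T TN[OF k(1)] unfolding duality_transversal_def by blast
  ultimately have "?\<kappa> = \<kappa>" by blast
  then show False using \<open>V_class A n ?\<kappa> \<in> E\<close> V(2) k(2) by simp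
qed

end

theorem theorem6p6:
  fixes A :: "('a, 'b) monoid_scheme" and n :: nat
  assumes "comm_group A" and "finite (carrier A)" and "n \<ge> 2"
  shows "(\<forall>T. duality_transversal A n T \<longrightarrow>
            gap_determining A n (M_family A n T) \<and> minimal_gap_determining A n (M_family A n T)) \<and>
         (\<forall>E. gap_determining A n E \<longrightarrow>
            Std A n \<in> E \<and>
            (\<forall>\<kappa>\<in>nontrivial_mult_vectors A n. V_class A n \<kappa> \<in> E \<or> V_class A n (dual_vector A \<kappa>) \<in> E))"
proof -
  interpret wr A n using assms(1,2) by (intro wr.intro wr_axioms.intro)
  have "gap_determining A n (M_family A n T) \<and> minimal_gap_determining A n (M_family A n T)"
    if T: "duality_transversal A n T" for T
    using M_family_gap_determining[OF assms(3) T] M_family_minimal[OF assms(3) T]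
    unfolding minimal_gap_determining_def by blast
  moreover have "Std A n \<in> E \<and> (\<forall>\<kappa>\<in>nontrivial_mult_vectors A n. V_class A n \<kappa> \<in> E \<or> V_class A n (dual_vector A \<kappa>) \<in> E)"
    if E: "gap_determining A n E" for E
    using Std_necessary[OF assms(3) E] V_class_necessary[OF E] by blast
  ultimately show ?thesis by blast
qed

end
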